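(* On most convex surfaces $S\in\mathcal{S}$, at most points $x\in S$, one has $\underline{K}(x)=\underline{G}(x)=0$ and $\overline{K}(x)=\overline{G}(x)=\infty$.
   Context: A convex surface is the boundary of a compact convex subset of $\mathbb{R}^3$ with interior points; $\mathcal{S}$ is the space of all convex surfaces with the Pompeiu–Hausdorff metric (a Baire space). Each convex surface is endowed with its intrinsic (induced length) metric, making it an Alexandrov surface with curvature bounded below by $0$. "Most" elements of a Baire space have a property if the exceptions form a first category set; for points of $S$ this refers to the topology of $S$. A geodesic triangle $\Delta$ consists of three points pairwise joined by shortest paths; $e_0(\Delta)$ is its excess (sum of angles minus $\pi$), $\sigma_0(\Delta)$ the area of the Euclidean triangle with the same side lengths, and $\mu(\Delta)$ the $2$-dimensional Hausdorff measure of the triangle (region it bounds). $E(x,\delta,a)$ is the set of geodesic triangles of diameter less than $\delta$ having $x$ in their interior and all angles at least $a$. Define $\underline{K}(x)=\lim_{\delta\to0}\inf_{\Delta\in E(x,\delta,0)}e_0(\Delta)/\sigma_0(\Delta)$, $\overline{K}(x)=\lim_{\delta\to0}\sup_{\Delta\in E(x,\delta,0)}e_0(\Delta)/\sigma_0(\Delta)$, $\underline{G}(x)=\lim_{a\to0}\lim_{\delta\to0}\inf_{\Delta\in E(x,\delta,a)}e_0(\Delta)/\mu(\Delta)$, $\overline{G}(x)=\lim_{a\to0}\lim_{\delta\to0}\sup_{\Delta\in E(x,\delta,a)}e_0(\Delta)/\mu(\Delta)$. *)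

theory Defs
  imports "HOL-Analysis.Analysis"
begin

definition nowhere_dense :: "'a topology \<Rightarrow> 'a set \<Rightarrow> bool" where
  "nowhere_dense X A \<longleftrightarrow> A \<subseteq> topspace X \<and> X interior_of (X closure_of A) = {}"

definition first_category :: "'a topology \<Rightarrow> 'a set \<Rightarrow> bool" where
  "first_category X A \<longleftrightarrow>
     (\<exists>F :: nat \<Rightarrow> 'a set. (\<forall>n. nowhere_dense X (F n)) \<and> A \<subseteq> (\<Union>n. F n))"

definition convex_surfaces :: "(real^3) set set" where
  "convex_surfaces = {frontier K | K. compact K \<and> convex K \<and> interior K \<noteq> {}}"

definition hausdist :: "(real^3) set \<Rightarrow> (real^3) set \<Rightarrow> real" where
  "hausdist A B = max (SUP a\<in>A. setdist {a} B) (SUP b\<in>B. setdist {b} A)"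

definition surface_space :: "(real^3) set topology" where
  "surface_space = topology (\<lambda>U. U \<subseteq> convex_surfaces \<and>
      (\<forall>A\<in>U. \<exists>e>0. \<forall>B\<in>convex_surfaces. hausdist A B < e \<longrightarrow> B \<in> U))"

definition curve_length :: "(real \<Rightarrow> 'a::metric_space) \<Rightarrow> ereal" where
  "curve_length g = (SUP ts \<in> {ts. sorted ts \<and> set ts \<subseteq> {0..1}}.
      ereal (\<Sum>i<length ts - 1. dist (g (ts ! i)) (g (ts ! Suc i))))"

definition idist :: "(real^3) set \<Rightarrow> real^3 \<Rightarrow> real^3 \<Rightarrow> real" where
  "idist S x y = real_of_ereal (INF g \<in> {g. path g \<and> path_image g \<subseteq> S \<and>
      pathstart g = x \<and> pathfinish g = y}. curve_length g)"

definition shortest_path :: "(real^3) set \<Rightarrow> (real \<Rightarrow> real^3) \<Rightarrow> real^3 \<Rightarrow> real^3 \<Rightarrow> bool" where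
  "shortest_path S g x y \<longleftrightarrow> path g \<and> path_image g \<subseteq> S \<and> pathstart g = x \<and> pathfinish g = y
      \<and> curve_length g = ereal (idist S x y)"

definition idiam :: "(real^3) set \<Rightarrow> (real^3) set \<Rightarrow> real" where
  "idiam S D = (SUP p\<in>D. SUP q\<in>D. idist S p q)"

definition cmp_angle :: "(real^3) set \<Rightarrow> real^3 \<Rightarrow> real^3 \<Rightarrow> real^3 \<Rightarrow> real" where
  "cmp_angle S p q1 q2 = arccos ((idist S p q1 ^ 2 + idist S p q2 ^ 2 - idist S q1 q2 ^ 2)
      / (2 * idist S p q1 * idist S p q2))"

definition path_angle :: "(real^3) set \<Rightarrow> (real \<Rightarrow> real^3) \<Rightarrow> (real \<Rightarrow> real^3) \<Rightarrow> real" where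
  "path_angle S g1 g2 = (let p = pathstart g1 in
     (INF \<epsilon>\<in>{0<..}. SUP q \<in> {(q1, q2). q1 \<in> path_image g1 \<and> q2 \<in> path_image g2 \<and>
          0 < idist S p q1 \<and> idist S p q1 < \<epsilon> \<and> 0 < idist S p q2 \<and> idist S p q2 < \<epsilon>}.
        cmp_angle S p (fst q) (snd q)))"

record gtri =
  va :: "real^3"
  vb :: "real^3"
  vc :: "real^3"
  sab :: "real \<Rightarrow> real^3"
  sbc :: "real \<Rightarrow> real^3"
  sca :: "real \<Rightarrow> real^3"
  reg :: "(real^3) set"

definition sides :: "gtri \<Rightarrow> (real^3) set" where
  "sides T = path_image (sab T) \<union> path_image (sbc T) \<union> path_image (sca T)"

definition geo_triangle :: "(real^3) set \<Rightarrow> gtri \<Rightarrow> bool" where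
  "geo_triangle S T \<longleftrightarrow>
     shortest_path S (sab T) (va T) (vb T) \<and> shortest_path S (sbc T) (vb T) (vc T) \<and>
     shortest_path S (sca T) (vc T) (va T) \<and> simple_path (sab T +++ sbc T +++ sca T) \<and>
     (\<exists>C\<in>components (S - sides T). reg T = closure C)"

definition ang_a :: "(real^3) set \<Rightarrow> gtri \<Rightarrow> real" where
  "ang_a S T = path_angle S (sab T) (reversepath (sca T))"
definition ang_b :: "(real^3) set \<Rightarrow> gtri \<Rightarrow> real" where
  "ang_b S T = path_angle S (reversepath (sab T)) (sbc T)"
definition ang_c :: "(real^3) set \<Rightarrow> gtri \<Rightarrow> real" where
  "ang_c S T = path_angle S (reversepath (sbc T)) (sca T)"

definition excess :: "(real^3) set \<Rightarrow> gtri \<Rightarrow> real" where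
  "excess S T = ang_a S T + ang_b S T + ang_c S T - pi"

definition eucl_tri_area :: "real \<Rightarrow> real \<Rightarrow> real \<Rightarrow> real" where
  "eucl_tri_area l1 l2 l3 = (SOME A. \<exists>p q r :: real^2. dist p q = l1 \<and> dist q r = l2 \<and>
      dist r p = l3 \<and> A = measure lborel (convex hull {p, q, r}))"

definition sigma0 :: "(real^3) set \<Rightarrow> gtri \<Rightarrow> real" where
  "sigma0 S T = eucl_tri_area (idist S (va T) (vb T)) (idist S (vb T) (vc T)) (idist S (vc T) (va T))"

section \<open>2-dimensional Hausdorff measure w.r.t. a metric d (normalised to agree with area)\<close>

definition ddiam :: "('a \<Rightarrow> 'a \<Rightarrow> real) \<Rightarrow> 'a set \<Rightarrow> ennreal" where
  "ddiam d U = (SUP p\<in>U. SUP q\<in>U. ennreal (d p q))"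

definition hausdorff2 :: "'a set \<Rightarrow> ('a \<Rightarrow> 'a \<Rightarrow> real) \<Rightarrow> 'a set \<Rightarrow> ennreal" where
  "hausdorff2 X d A = (SUP \<delta>\<in>{0<..}. INF U \<in> {U :: nat \<Rightarrow> 'a set. (\<forall>n. U n \<subseteq> X \<and> ddiam d (U n) \<le> ennreal \<delta>)
        \<and> A \<subseteq> (\<Union>n. U n)}. (\<Sum>n. ennreal (pi / 4) * ddiam d (U n) ^ 2))"

definition mu :: "(real^3) set \<Rightarrow> gtri \<Rightarrow> ennreal" where
  "mu S T = hausdorff2 S (idist S) (reg T)"

definition Etri :: "(real^3) set \<Rightarrow> real^3 \<Rightarrow> real \<Rightarrow> real \<Rightarrow> gtri set" where
  "Etri S x \<delta> a = {T. geo_triangle S T \<and> x \<in> reg T - sides T \<and> idiam S (reg T) < \<delta> \<and>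
      ang_a S T \<ge> a \<and> ang_b S T \<ge> a \<and> ang_c S T \<ge> a}"

definition ratioK :: "(real^3) set \<Rightarrow> gtri \<Rightarrow> ereal" where
  "ratioK S T = ereal (excess S T) / ereal (sigma0 S T)"

definition ratioG :: "(real^3) set \<Rightarrow> gtri \<Rightarrow> ereal" where
  "ratioG S T = ereal (excess S T) / enn2ereal (mu S T)"

definition K_low :: "(real^3) set \<Rightarrow> real^3 \<Rightarrow> ereal" where
  "K_low S x = Lim (at_right 0) (\<lambda>\<delta>. INF T\<in>Etri S x \<delta> 0. ratioK S T)"

definition K_up :: "(real^3) set \<Rightarrow> real^3 \<Rightarrow> ereal" where
  "K_up S x = Lim (at_right 0) (\<lambda>\<delta>. SUP T\<in>Etri S x \<delta> 0. ratioK S T)"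

definition G_low :: "(real^3) set \<Rightarrow> real^3 \<Rightarrow> ereal" where
  "G_low S x = Lim (at_right 0) (\<lambda>a. Lim (at_right 0) (\<lambda>\<delta>. INF T\<in>Etri S x \<delta> a. ratioG S T))"

definition G_up :: "(real^3) set \<Rightarrow> real^3 \<Rightarrow> ereal" where
  "G_up S x = Lim (at_right 0) (\<lambda>a. Lim (at_right 0) (\<lambda>\<delta>. SUP T\<in>Etri S x \<delta> a. ratioG S T))"

end

(*
  Call a property of a point of a convex surface forcible if, near any boundary point of any convex body, an
  arbitrarily small modification of the body makes the property hold on a nonempty open part of the boundary of
  every body close enough to the modified one.  Along a countable base of the ambient space, a forcible property
  holds, on most surfaces, off a nowhere dense set.  The body is modified by thickening it slightly and cutting it
  along one plane, or along three planes that meet in a blunt tip.  Bodies close to the flat cut carry geodesic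
  triangles around every point of an open set whose excess is negligible against their area; around the tip the
  excess stays bounded below although the triangles may be taken arbitrarily small.  Ratios are never negative,
  since the excess of a geodesic triangle is nonnegative.

  Nonnegative curvature enters through the variance inequality for a point and three others, proved for
  polytopes by Milka's argument and passed to the limit.  It yields the monotonicity of comparison angles, the bound on angles from
  below by comparison angles and, with a third direction, a bound from above.  Distances are controlled by the
  fact that the nearest-point projection onto a body does not increase lengths, so that shortest paths in the
  boundary are shortest in the complement of the interior as well.
*)
theory Submission
  imports Defs "HOL-Complex_Analysis.Complex_Analysis" "HOL-Real_Asymp.Real_Asymp"
begin

section \<open>Length of curves\<close>

text \<open>For fixed \<open>n\<close> the size \<open>s\<close> of the triangles is chosen before
  the closeness \<open>\<sigma>\<close> of the competing bodies, and nothing is claimed about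
  triangles as small as \<open>\<sigma>\<close>; hence a separate forcible property for each
  \<open>n\<close>, and errors that are small relative to \<open>s\<close>. The competing bodies are
  arbitrary, so their shortest paths are known only approximately. Lengths pin down a side: its
  length exceeds the distance of its ends by O(\<open>\<sigma>\<close>), so it stays within about
  sqrt(s \<open>\<sigma>\<close>) of a segment. Angles are limits at scale 0. Monotonicity bounds
  them from below by comparison angles at scale \<open>s\<close>; the upper bound needed for small
  excess comes from a path in the opposite direction and the equality case of the variance
  inequality. One triangle has to enclose all points of an open set; which component of the
  complement of its sides is the small one is decided by the winding number of the projected
  boundary. At the tip every angle is at least about 2 arcsin(\<open>sharp\<close>), and
  \<open>sharp\<close> > 1/2 depends only on the slope \<open>\<kappa>\<close>, which keeps the
  excess away from 0 however small \<open>s\<close> is.\<close>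

fun chain :: "'a::metric_space list \<Rightarrow> real" where
  "chain (x # y # zs) = dist x y + chain (y # zs)"
| "chain _ = 0"

lemma chain_nonneg: "chain xs \<ge> 0"
  by (induction xs rule: chain.induct) auto

lemma chain_eq_sum: "chain xs = (\<Sum>i<length xs - 1. dist (xs ! i) (xs ! Suc i))"
proof (induction xs rule: chain.induct)
  case (1 x y zs)
  have "(\<Sum>i<Suc (length zs). dist ((x # y # zs) ! i) ((x # y # zs) ! Suc i))
      = dist x y + (\<Sum>i<length zs. dist ((y # zs) ! i) ((y # zs) ! Suc i))"
    by (subst sum.lessThan_Suc_shift) simp
  then show ?case using 1 by simp
qed auto

lemma chain_append_ge: "chain xs + chain ys \<le> chain (xs @ ys)"
proof (induction xs rule: chain.induct)
  case ("2_2" v)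
  then show ?case by (cases ys) auto
qed auto

text \<open>Inserting \<open>m\<close> where the two lists meet uses the triangle inequality once.
  This refines a partition at a prescribed time.\<close>

lemma chain_append_le: "chain (xs @ ys) \<le> chain (xs @ [m]) + chain (m # ys)"
proof (induction xs rule: chain.induct)
  case "2_1"
  then show ?case by (cases ys) auto
next
  case ("2_2" v)
  show ?case
    by (cases ys) (auto intro: dist_triangle simp: chain_nonneg)
qed auto

lemma chain_snoc2: "chain (xs @ [x, y]) = chain (xs @ [x]) + dist x y"
  by (induction xs rule: chain.induct) auto

lemma chain_rev: "chain (rev xs) = chain xs"
proof (induction xs rule: chain.induct)
  case (1 x y zs)
  then show ?case using chain_snoc2[of "rev zs" y x] by (simp add: dist_commute)
qed auto

lemma chain_map_le:
  assumes "\<And>x y. x \<in> set xs \<Longrightarrow> y \<in> set xs \<Longrightarrow> dist (f x) (f y) \<le> M * dist x y"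
  shows "chain (map f xs) \<le> M * chain xs"
  using assms
proof (induction xs rule: chain.induct)
  case (1 x y zs)
  then have "chain (map f (y # zs)) \<le> M * chain (y # zs)" "dist (f x) (f y) \<le> M * dist x y" by auto
  then show ?case by (simp add: algebra_simps)
qed auto

lemma chain_sorted:
  fixes ts :: "real list"
  assumes "sorted ts" "set ts \<subseteq> {a..b}" "a \<le> b"
  shows "chain ts \<le> b - a"
  using assms
proof (induction ts arbitrary: a rule: chain.induct)
  case (1 x y zs)
  have "chain (y # zs) \<le> b - y" using 1 by (intro "1.IH") auto
  moreover have "dist x y = y - x" using 1 by (auto simp: dist_real_def)
  ultimately show ?case using 1 by auto
qed auto

text \<open>\<open>curve_length\<close> sees only \<open>{0..1}\<close>, whereas cutting a curve at
  a time requires the lengths of the pieces. As there, partitions are arbitrary sorted lists in the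
  interval, which may omit its ends.\<close>

definition vlen :: "(real \<Rightarrow> 'a::metric_space) \<Rightarrow> real \<Rightarrow> real \<Rightarrow> ereal" where
  "vlen g a b = (SUP ts \<in> {ts. sorted ts \<and> set ts \<subseteq> {a..b}}. ereal (chain (map g ts)))"

lemma curve_length_vlen: "curve_length g = vlen g 0 1"
  unfolding curve_length_def vlen_def
proof (rule SUP_cong)
  fix ts :: "real list"
  show "ereal (\<Sum>i<length ts - 1. dist (g (ts ! i)) (g (ts ! Suc i))) = ereal (chain (map g ts))"
    by (auto simp: chain_eq_sum intro!: sum.cong)
qed simp

lemma vlen_upper: "sorted ts \<Longrightarrow> set ts \<subseteq> {a..b} \<Longrightarrow> ereal (chain (map g ts)) \<le> vlen g a b"
  unfolding vlen_def by (rule SUP_upper) auto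

lemma vlen_least:
  "(\<And>ts. sorted ts \<Longrightarrow> set ts \<subseteq> {a..b} \<Longrightarrow> ereal (chain (map g ts)) \<le> c) \<Longrightarrow> vlen g a b \<le> c"
  unfolding vlen_def by (rule SUP_least) auto

lemma vlen_nonneg: "0 \<le> vlen g a b"
  using vlen_upper[of "[]" a b g] by (simp add: zero_ereal_def)

lemma dist_le_vlen: "a \<le> s \<Longrightarrow> s \<le> t \<Longrightarrow> t \<le> b \<Longrightarrow> ereal (dist (g s) (g t)) \<le> vlen g a b"
  using vlen_upper[of "[s, t]" a b g] by simp

lemma vlen_superadd:
  assumes "a \<le> b" "b \<le> c"
  shows "vlen g a b + vlen g b c \<le> vlen g a c"
proof -
  have *: "ereal (chain (map g xs)) + vlen g b c \<le> vlen g a c"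
    if xs: "sorted xs" "set xs \<subseteq> {a..b}" for xs
  proof -
    have "ereal (chain (map g xs)) + ereal (chain (map g ys)) \<le> vlen g a c"
      if ys: "sorted ys" "set ys \<subseteq> {b..c}" for ys
    proof -
      have "ereal (chain (map g xs)) + ereal (chain (map g ys)) \<le> ereal (chain (map g (xs @ ys)))"
        using chain_append_ge[of "map g xs" "map g ys"] by simp
      also have "\<dots> \<le> vlen g a c"
        using xs ys assms by (intro vlen_upper) (fastforce simp: sorted_append)+
      finally show ?thesis .
    qed
    then have "vlen g b c \<le> vlen g a c - ereal (chain (map g xs))"
      by (intro vlen_least) (auto simp: ereal_le_minus add.commute)
    then show ?thesis by (auto simp: ereal_le_minus add.commute)
  qed
  show ?thesis
  \<comment> \<open>Only finite terms can be moved across an \<open>ereal\<close> inequality; for an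
    infinite second piece the empty partition of the first piece already gives the claim.\<close>
  proof (cases "vlen g b c = \<infinity>")
    case True
    then show ?thesis using *[of "[]"] by simp
  next
    case False
    then have fin: "\<bar>vlen g b c\<bar> \<noteq> \<infinity>" using vlen_nonneg[of g b c] by auto
    then have "vlen g a b \<le> vlen g a c - vlen g b c"
      using * by (intro vlen_least) (auto simp: ereal_le_minus)
    then show ?thesis using fin by (auto simp: ereal_le_minus)
  qed
qed

lemma vlen_subadd:
  assumes "a \<le> b" "b \<le> c"
  shows "vlen g a c \<le> vlen g a b + vlen g b c"
proof (rule vlen_least)
  fix ts assume ts: "sorted ts" "set ts \<subseteq> {a..c}"
  \<comment> \<open>Sortedness turns filtering at \<open>b\<close> into cutting the list, so that
    \<open>b\<close> can be inserted at the cut.\<close>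
  define xs where "xs = filter (\<lambda>t. t \<le> b) ts"
  define ys where "ys = filter (\<lambda>t. \<not> t \<le> b) ts"
  have "ts = xs @ ys"
    unfolding xs_def ys_def using ts(1)
  proof (induction ts)
    case (Cons t ts)
    show ?case
    proof (cases "t \<le> b")
      case False
      then have "\<forall>u\<in>set ts. \<not> u \<le> b" using Cons.prems by auto
      then show ?thesis using False by (simp add: filter_id_conv filter_empty_conv)
    qed (use Cons in auto)
  qed auto
  then have "chain (map g ts) \<le> chain (map g (xs @ [b])) + chain (map g (b # ys))"
    using chain_append_le[of "map g xs" "map g ys" "g b"] by simp
  then have "ereal (chain (map g ts)) \<le> ereal (chain (map g (xs @ [b]))) + ereal (chain (map g (b # ys)))"
    by simp
  also have "\<dots> \<le> vlen g a b + vlen g b c"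
  proof (intro add_mono vlen_upper)
    show "sorted (xs @ [b])" "sorted (b # ys)"
      using ts by (auto simp: xs_def ys_def sorted_append intro: sorted_filter[where f="\<lambda>x. x", simplified])
    show "set (xs @ [b]) \<subseteq> {a..b}" "set (b # ys) \<subseteq> {b..c}"
      using ts assms by (auto simp: xs_def ys_def)
  qed
  finally show "ereal (chain (map g ts)) \<le> vlen g a b + vlen g b c" .
qed

lemma vlen_reparam_le:
  assumes "mono_on {a..b} \<phi>" "\<And>t. t \<in> {a..b} \<Longrightarrow> g t = h (\<phi> t)" "\<phi> ` {a..b} \<subseteq> {c..d}"
  shows "vlen g a b \<le> vlen h c d"
proof (rule vlen_least)
  fix ts assume ts: "sorted ts" "set ts \<subseteq> {a..b}"
  have "map g ts = map h (map \<phi> ts)" using ts assms(2) by auto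
  moreover have "sorted (map \<phi> ts)"
    using ts assms(1) by (induction ts) (auto simp: mono_on_def)
  moreover have "set (map \<phi> ts) \<subseteq> {c..d}" using ts assms(3) by auto
  ultimately show "ereal (chain (map g ts)) \<le> vlen h c d" by (metis vlen_upper)
qed

lemma vlen_reverse_le:
  assumes "antimono_on {a..b} \<phi>" "\<And>t. t \<in> {a..b} \<Longrightarrow> g t = h (\<phi> t)" "\<phi> ` {a..b} \<subseteq> {c..d}"
  shows "vlen g a b \<le> vlen h c d"
proof (rule vlen_least)
  fix ts assume ts: "sorted ts" "set ts \<subseteq> {a..b}"
  have "rev (map g ts) = map h (rev (map \<phi> ts))" using ts assms(2) by (auto simp: rev_map)
  then have "chain (map g ts) = chain (map h (rev (map \<phi> ts)))" by (metis chain_rev)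
  moreover have "sorted (rev (map \<phi> ts))"
    using ts assms(1) by (induction ts) (auto simp: monotone_on_def sorted_append)
  moreover have "set (rev (map \<phi> ts)) \<subseteq> {c..d}" using ts assms(3) by auto
  ultimately show "ereal (chain (map g ts)) \<le> vlen h c d" by (metis vlen_upper)
qed

lemma vlen_lipschitz_le:
  assumes "M \<ge> 0" "a \<le> b"
    and "\<And>s t. s \<in> {a..b} \<Longrightarrow> t \<in> {a..b} \<Longrightarrow> dist (g s) (g t) \<le> M * \<bar>s - t\<bar>"
  shows "vlen g a b \<le> ereal (M * (b - a))"
proof (rule vlen_least)
  fix ts assume ts: "sorted ts" "set ts \<subseteq> {a..b}"
  have "chain (map g ts) \<le> M * chain ts"
    using ts assms(3) by (intro chain_map_le) (auto simp: dist_real_def subset_iff)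
  also have "\<dots> \<le> M * (b - a)"
    using ts assms by (intro mult_left_mono chain_sorted) auto
  finally show "ereal (chain (map g ts)) \<le> ereal (M * (b - a))" by simp
qed

lemma vlen_image_le:
  assumes "\<And>x y. x \<in> A \<Longrightarrow> y \<in> A \<Longrightarrow> dist (f x) (f y) \<le> dist x y" "g ` {a..b} \<subseteq> A"
  shows "vlen (f \<circ> g) a b \<le> vlen g a b"
proof (rule vlen_least)
  fix ts assume ts: "sorted ts" "set ts \<subseteq> {a..b}"
  have "chain (map f (map g ts)) \<le> 1 * chain (map g ts)"
    using ts assms by (intro chain_map_le) (auto simp: subset_iff)
  then have "ereal (chain (map (f \<circ> g) ts)) \<le> ereal (chain (map g ts))" by simp
  also have "\<dots> \<le> vlen g a b" using ts by (rule vlen_upper)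
  finally show "ereal (chain (map (f \<circ> g) ts)) \<le> vlen g a b" .
qed

lemma curve_length_nonneg: "0 \<le> curve_length g"
  by (simp add: curve_length_vlen vlen_nonneg)

lemma curve_length_join:
  assumes "pathfinish g1 = pathstart g2"
  shows "curve_length (g1 +++ g2) \<le> curve_length g1 + curve_length g2"
proof -
  have "curve_length (g1 +++ g2) \<le> vlen (g1 +++ g2) 0 (1/2) + vlen (g1 +++ g2) (1/2) 1"
    unfolding curve_length_vlen by (rule vlen_subadd) auto
  also have "\<dots> \<le> vlen g1 0 1 + vlen g2 0 1"
  proof (rule add_mono)
    show "vlen (g1 +++ g2) 0 (1/2) \<le> vlen g1 0 1"
      by (rule vlen_reparam_le[where \<phi>="\<lambda>t. 2 * t"]) (auto simp: joinpaths_def mono_on_def)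
    show "vlen (g1 +++ g2) (1/2) 1 \<le> vlen g2 0 1"
    proof (rule vlen_reparam_le[where \<phi>="\<lambda>t. 2 * t - 1"])
      fix t :: real assume t: "t \<in> {1/2..1}"
      show "(g1 +++ g2) t = g2 (2 * t - 1)"
      proof (cases "t = 1/2")
        case True
        show ?thesis unfolding True using assms by (simp add: joinpaths_def pathfinish_def pathstart_def)
      qed (use t in \<open>auto simp: joinpaths_def\<close>)
    qed (auto simp: mono_on_def)
  qed
  finally show ?thesis by (simp add: curve_length_vlen)
qed

lemma curve_length_reverse: "curve_length (reversepath g) = curve_length g"
proof -
  have *: "curve_length (reversepath g) \<le> curve_length g" for g :: "real \<Rightarrow> 'a"
    unfolding curve_length_vlen
    by (rule vlen_reverse_le[where \<phi>="\<lambda>t. 1 - t"]) (auto simp: reversepath_def monotone_on_def)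
  from *[of g] *[of "reversepath g"] show ?thesis by simp
qed

lemma curve_length_subpath_le:
  assumes "0 \<le> s" "s \<le> t" "t \<le> 1"
  shows "curve_length (subpath s t g) \<le> vlen g s t"
  unfolding curve_length_vlen
proof (rule vlen_reparam_le[where \<phi>="\<lambda>u. (t - s) * u + s"])
  show "(\<lambda>u. (t - s) * u + s) ` {0..1} \<subseteq> {s..t}"
  proof clarify
    fix u :: real assume "u \<in> {0..1}"
    then have "0 \<le> (t - s) * u" "(t - s) * u \<le> (t - s) * 1"
      using assms by (simp, intro mult_left_mono) auto
    then show "(t - s) * u + s \<in> {s..t}" by auto
  qed
qed (use assms in \<open>auto simp: subpath_def mono_on_def mult_left_mono\<close>)

lemma curve_length_linepath: "curve_length (linepath x y) \<le> ereal (dist x (y::'a::real_normed_vector))"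
proof -
  have "vlen (linepath x y) 0 1 \<le> ereal (dist x y * (1 - 0))"
  proof (rule vlen_lipschitz_le)
    fix s t :: real
    have "linepath x y s - linepath x y t = (s - t) *\<^sub>R (y - x)"
      by (simp add: linepath_def algebra_simps)
    then show "dist (linepath x y s) (linepath x y t) \<le> dist x y * \<bar>s - t\<bar>"
      by (simp add: dist_norm norm_minus_commute mult.commute)
  qed auto
  then show ?thesis by (simp add: curve_length_vlen)
qed

section \<open>Length distance inside a set\<close>

text \<open>The value stays in \<open>ereal\<close> because \<open>idist\<close> turns an infinite
  infimum into 0; here the triangle inequality and monotonicity in the set hold without any
  connectedness. The sets that occur are surfaces, complements of open bodies, and parts of these
  cut off by half-spaces.\<close>

definition pdist :: "'a::metric_space set \<Rightarrow> 'a \<Rightarrow> 'a \<Rightarrow> ereal" where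
  "pdist A x y = (INF g \<in> {g. path g \<and> path_image g \<subseteq> A \<and> pathstart g = x \<and> pathfinish g = y}.
     curve_length g)"

lemma idist_pdist: "idist S x y = real_of_ereal (pdist S x y)"
  by (simp add: idist_def pdist_def)

lemma pdist_lower:
  "path g \<Longrightarrow> path_image g \<subseteq> A \<Longrightarrow> pathstart g = x \<Longrightarrow> pathfinish g = y \<Longrightarrow> pdist A x y \<le> curve_length g"
  unfolding pdist_def by (rule INF_lower) auto

lemma pdist_greatest:
  "(\<And>g. path g \<Longrightarrow> path_image g \<subseteq> A \<Longrightarrow> pathstart g = x \<Longrightarrow> pathfinish g = y \<Longrightarrow> c \<le> curve_length g)
    \<Longrightarrow> c \<le> pdist A x y"
  unfolding pdist_def by (rule INF_greatest) auto

lemma pdist_nonneg: "0 \<le> pdist A x y"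
  by (rule pdist_greatest) (rule curve_length_nonneg)

lemma pdist_ge_dist: "ereal (dist x y) \<le> pdist A x y"
proof (rule pdist_greatest)
  fix g assume "pathstart g = x" "pathfinish g = y"
  then show "ereal (dist x y) \<le> curve_length g"
    using dist_le_vlen[of 0 0 1 1 g] by (simp add: curve_length_vlen pathstart_def pathfinish_def)
qed

lemma pdist_triangle: "pdist A x z \<le> pdist A x y + pdist A y z"
proof -
  have *: "pdist A x z \<le> curve_length g + curve_length h"
    if "path g" "path_image g \<subseteq> A" "pathstart g = x" "pathfinish g = y"
       "path h" "path_image h \<subseteq> A" "pathstart h = y" "pathfinish h = z" for g h
  proof -
    have "pdist A x z \<le> curve_length (g +++ h)"
      using that by (intro pdist_lower) (auto simp: path_image_join)
    also have "\<dots> \<le> curve_length g + curve_length h" using that by (intro curve_length_join) simp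
    finally show ?thesis .
  qed
  show ?thesis
  proof (cases "pdist A x y = \<infinity> \<or> pdist A y z = \<infinity>")
    case True
    then show ?thesis using pdist_nonneg[of A x y] pdist_nonneg[of A y z] by auto
  next
    case False
    show ?thesis
    proof (rule ereal_le_epsilon)
      fix e :: ereal assume e: "0 < e"
      show "pdist A x z \<le> pdist A x y + pdist A y z + e"
      proof (cases e)
        case (real r)
        have fin: "\<bar>pdist A x y\<bar> \<noteq> \<infinity>" "\<bar>pdist A y z\<bar> \<noteq> \<infinity>"
          using False pdist_nonneg[of A x y] pdist_nonneg[of A y z] by auto
        have "pdist A x y < pdist A x y + ereal (r/2)" "pdist A y z < pdist A y z + ereal (r/2)"
          using fin e real by (auto simp: ereal_less_add)
        then obtain g h where g: "path g" "path_image g \<subseteq> A" "pathstart g = x" "pathfinish g = y"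
            "curve_length g < pdist A x y + ereal (r/2)"
          and h: "path h" "path_image h \<subseteq> A" "pathstart h = y" "pathfinish h = z"
            "curve_length h < pdist A y z + ereal (r/2)"
          by (auto simp: pdist_def INF_less_iff)
        have "pdist A x z \<le> curve_length g + curve_length h" using g h by (intro *)
        also have "\<dots> \<le> (pdist A x y + ereal (r/2)) + (pdist A y z + ereal (r/2))"
          using g h by (intro add_mono) auto
        also have "\<dots> = pdist A x y + pdist A y z + e"
          using fin real by (cases "pdist A x y"; cases "pdist A y z") auto
        finally show ?thesis .
      qed (use e in auto)
    qed
  qed
qed

lemma pdist_commute: "pdist A x y = pdist A y x"
proof -
  have *: "pdist A x y \<le> pdist A y x" for x y
  proof (rule pdist_greatest)
    fix g assume "path g" "path_image g \<subseteq> A" "pathstart g = y" "pathfinish g = x"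
    then show "pdist A x y \<le> curve_length g"
      using pdist_lower[of "reversepath g" A x y] by (simp add: curve_length_reverse)
  qed
  show ?thesis using *[of x y] *[of y x] by simp
qed

lemma pdist_segment:
  fixes x y :: "'a::real_normed_vector"
  assumes "closed_segment x y \<subseteq> A"
  shows "pdist A x y \<le> ereal (dist x y)"
proof -
  have "pdist A x y \<le> curve_length (linepath x y)" using assms by (intro pdist_lower) auto
  then show ?thesis using curve_length_linepath order_trans by blast
qed

lemma pdist_mono: "A \<subseteq> B \<Longrightarrow> pdist B x y \<le> pdist A x y"
  by (rule pdist_greatest) (auto intro!: pdist_lower)

text \<open>Composing a path with a nonexpanding map does not lengthen it. The maps used are
  nearest-point projections, both to bodies and to half-spaces.\<close>

lemma pdist_image_le:
  assumes lip: "\<And>x y. x \<in> A \<Longrightarrow> y \<in> A \<Longrightarrow> dist (f x) (f y) \<le> dist x y" and "f ` A \<subseteq> B"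
  shows "pdist B (f x) (f y) \<le> pdist A x y"
proof (rule pdist_greatest)
  fix g assume g: "path g" "path_image g \<subseteq> A" "pathstart g = x" "pathfinish g = y"
  have "1-lipschitz_on A f" using lip by (intro lipschitz_onI) auto
  then have cont: "continuous_on A f" by (rule lipschitz_on_continuous_on)
  have "pdist B (f x) (f y) \<le> curve_length (f \<circ> g)"
  proof (rule pdist_lower)
    show "path (f \<circ> g)" using g cont continuous_on_subset path_continuous_image by blast
    show "path_image (f \<circ> g) \<subseteq> B" using g assms(2) by (auto simp: path_image_compose)
  qed (use g in \<open>auto simp: pathstart_compose pathfinish_compose\<close>)
  also have "\<dots> \<le> curve_length g"
    unfolding curve_length_vlen using g lip
    by (intro vlen_image_le[where A=A]) (auto simp: path_image_def)
  finally show "pdist B (f x) (f y) \<le> curve_length g" .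
qed

lemma curve_length_ge_pdist:
  fixes g :: "real \<Rightarrow> 'a::real_normed_vector"
  assumes g: "path g" "path_image g \<subseteq> A" and st: "0 \<le> s" "s \<le> t" "t \<le> 1"
  shows "pdist A (g s) (g t) \<le> vlen g s t"
proof -
  have "pdist A (g s) (g t) \<le> curve_length (subpath s t g)"
    using g st path_image_subpath_subset[of s t g] by (intro pdist_lower) auto
  then show ?thesis using curve_length_subpath_le[OF st] order_trans by blast
qed

lemma curve_length_ge_pdist2:
  fixes g :: "real \<Rightarrow> 'a::real_normed_vector"
  assumes "path g" "path_image g \<subseteq> A" "t \<in> {0..1}"
  shows "pdist A (pathstart g) (g t) + pdist A (g t) (pathfinish g) \<le> curve_length g"
proof -
  have "pdist A (g 0) (g t) + pdist A (g t) (g 1) \<le> vlen g 0 t + vlen g t 1"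
    using assms by (intro add_mono curve_length_ge_pdist) auto
  also have "\<dots> \<le> curve_length g"
    unfolding curve_length_vlen using assms by (intro vlen_superadd) auto
  finally show ?thesis by (simp add: pathstart_def pathfinish_def)
qed

text \<open>By the intermediate value theorem every path from \<open>z\<close> to \<open>q\<close>
  meets the hyperplane, and its length splits at the crossing point.\<close>

lemma pdist_crossing:
  fixes n :: "'a::real_inner"
  assumes "b \<le> n \<bullet> z" "n \<bullet> q \<le> b"
    and "\<And>m. m \<in> A \<Longrightarrow> n \<bullet> m = b \<Longrightarrow> c \<le> pdist A z m + pdist A m q"
  shows "c \<le> pdist A z q"
proof (rule pdist_greatest)
  fix g assume g: "path g" "path_image g \<subseteq> A" "pathstart g = z" "pathfinish g = q"
  have "continuous_on {0..1} (\<lambda>t. n \<bullet> g t)" using g(1) by (auto simp: path_def intro: continuous_intros)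
  then obtain t where t: "0 \<le> t" "t \<le> 1" "n \<bullet> g t = b"
    using IVT2'[of "\<lambda>t. n \<bullet> g t" 1 b 0] assms g by (auto simp: pathstart_def pathfinish_def)
  then have "c \<le> pdist A z (g t) + pdist A (g t) q"
    using g by (intro assms(3)) (auto simp: path_image_def)
  also have "\<dots> \<le> curve_length g" using curve_length_ge_pdist2[of g A t] g t by auto
  finally show "c \<le> curve_length g" .
qed

section \<open>The intrinsic metric of a convex surface\<close>

lemma segment_halfspace_ge:
  fixes n :: "'a::real_inner"
  assumes "b \<le> n \<bullet> x" "b \<le> n \<bullet> y" "z \<in> closed_segment x y"
  shows "b \<le> n \<bullet> z"
proof -
  have "convex {z. n \<bullet> z \<ge> b}" by (rule convex_halfspace_ge)
  then have "closed_segment x y \<subseteq> {z. n \<bullet> z \<ge> b}" using assms by (intro closed_segment_subset) auto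
  then show ?thesis using assms by auto
qed

lemma segment_hyperplane:
  fixes n :: "'a::real_inner"
  assumes "n \<bullet> x = b" "n \<bullet> y = b" "z \<in> closed_segment x y"
  shows "n \<bullet> z = b"
  using segment_halfspace_ge[of b n x y z] segment_halfspace_ge[of "-b" "-n" x y z] assms by auto

locale convex_body =
  fixes K :: "(real^3) set"
  assumes compact_K: "compact K" and convex_K: "convex K" and interior_K: "interior K \<noteq> {}"
begin

abbreviation S where "S \<equiv> frontier K"
abbreviation d where "d \<equiv> idist S"
abbreviation W where "W \<equiv> - interior K"

lemma closed_K: "closed K" using compact_K by (rule compact_imp_closed)

lemma K_nonempty: "K \<noteq> {}" using interior_K interior_subset by auto

lemma S_eq: "S = K - interior K"
  using closed_K by (simp add: frontier_def)

lemma S_subset_W: "S \<subseteq> W" and S_subset_K: "S \<subseteq> K"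
  by (auto simp: S_eq)

lemma compact_S: "compact S" using compact_K by (rule compact_frontier)

lemma closed_S: "closed S" by (rule frontier_closed)

lemma interior_mix:
  assumes "a \<in> interior K" "b \<in> K" "0 < u" "u \<le> 1"
  shows "u *\<^sub>R a + (1 - u) *\<^sub>R b \<in> interior K"
  using mem_interior_convex_shrink[OF convex_K assms(1,2,3,4)] by (simp add: algebra_simps)

section \<open>Nearest-point projection and supporting planes\<close>

lemma closest_point_frontier:
  assumes "y \<in> W" shows "closest_point K y \<in> S"
proof -
  have "closest_point K y \<in> rel_frontier K"
    using assms closed_K K_nonempty interior_K
    by (intro closest_point_in_rel_frontier)
       (auto simp: affine_hull_nonempty_interior rel_interior_nonempty_interior)
  then show ?thesis using interior_K by (simp add: rel_frontier_nonempty_interior)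
qed

lemma closest_point_nonexp: "dist (closest_point K x) (closest_point K y) \<le> dist x y"
  using closest_point_lipschitz[OF convex_K closed_K K_nonempty] .

lemma pdist_closest_point: "pdist S (closest_point K x) (closest_point K y) \<le> pdist W x y"
  using closest_point_nonexp closest_point_frontier by (intro pdist_image_le) auto

lemma closest_point_S: "x \<in> S \<Longrightarrow> closest_point K x = x"
  using S_subset_K by (auto intro: closest_point_self)

lemma pdist_S_W: "x \<in> S \<Longrightarrow> y \<in> S \<Longrightarrow> pdist S x y = pdist W x y"
  using pdist_closest_point[of x y] pdist_mono[OF S_subset_W, of x y]
  by (simp add: closest_point_S)

text \<open>An interior point could be moved a little in direction \<open>n\<close>, against the
  support inequality. The explicit detours used for polytopes run in such outer half-spaces, where
  segments cannot enter the interior.\<close>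

lemma support_in_W:
  assumes K: "\<And>y. y \<in> K \<Longrightarrow> n \<bullet> y \<le> b" and n: "n \<noteq> 0" and z: "b \<le> n \<bullet> z"
  shows "z \<in> W"
proof
  assume "z \<in> interior K"
  then obtain e where e: "e > 0" "ball z e \<subseteq> K" by (meson mem_interior)
  let ?y = "z + (e / (2 * norm n)) *\<^sub>R n"
  have "norm (?y - z) < e" using e n by simp
  then have "?y \<in> K" using e by (auto simp: dist_norm norm_minus_commute mem_ball subset_iff)
  then have "n \<bullet> ?y \<le> b" by (rule K)
  moreover have "n \<bullet> ?y = n \<bullet> z + e * norm n / 2"
    using n by (simp add: inner_add_right dot_square_norm power2_eq_square field_simps)
  moreover have "0 < e * norm n / 2" using e n by simp
  ultimately show False using z by linarith
qed

lemma support_segment_W: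
  assumes K: "\<And>y. y \<in> K \<Longrightarrow> n \<bullet> y \<le> b" and n: "n \<noteq> 0" and z: "b \<le> n \<bullet> x" "b \<le> n \<bullet> y"
  shows "closed_segment x y \<subseteq> W"
proof
  fix w assume "w \<in> closed_segment x y"
  then have "b \<le> n \<bullet> w" by (rule segment_halfspace_ge[OF z])
  then show "w \<in> W" using K n by (rule support_in_W[rotated 2])
qed

lemma S_support:
  assumes "x \<in> S"
  obtains n where "norm n = 1" "\<And>y. y \<in> K \<Longrightarrow> n \<bullet> y \<le> n \<bullet> x"
proof -
  have "x \<in> rel_frontier K" using assms interior_K by (simp add: rel_frontier_nonempty_interior)
  then have "x \<notin> rel_interior K" by (simp add: rel_frontier_def)
  moreover have "x \<in> K" using S_subset_K assms by (rule subsetD)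
  ultimately have *: "x \<in> K" "x \<notin> rel_interior K" by simp_all
  from supporting_hyperplane_rel_boundary[OF convex_K *]
  obtain a where a: "\<And>y. y \<in> K \<Longrightarrow> a \<bullet> x \<le> a \<bullet> y" and "a \<noteq> 0"
    by metis
  show thesis
  proof (rule that[of "- sgn a"])
    show "norm (- sgn a) = 1" using \<open>a \<noteq> 0\<close> by (simp add: norm_sgn)
    fix y assume "y \<in> K"
    then show "- sgn a \<bullet> y \<le> - sgn a \<bullet> x"
      using mult_left_mono[OF a(1)[of y], of "inverse (norm a)"] by (simp add: sgn_div_norm)
  qed
qed

section \<open>Lipschitz comparison of intrinsic and Euclidean distance\<close>

lemma outer_ray:
  assumes c: "c \<in> interior K" and x: "x \<in> S" and M: "M \<ge> 1"
  shows "c + M *\<^sub>R (x - c) \<in> W"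
proof
  assume "c + M *\<^sub>R (x - c) \<in> interior K"
  then have "(1/M) *\<^sub>R (c + M *\<^sub>R (x - c)) + (1 - 1/M) *\<^sub>R c \<in> interior K"
    using c M interior_subset by (intro interior_mix) auto
  also have "(1/M) *\<^sub>R (c + M *\<^sub>R (x - c)) + (1 - 1/M) *\<^sub>R c = x"
    using M by (simp add: algebra_simps)
  finally show False using x by (simp add: S_eq)
qed

lemma outer_ray_pdist:
  assumes c: "c \<in> interior K" and x: "x \<in> S" and M: "M \<ge> 1"
    and R: "norm (x - c) \<le> R"
  shows "pdist W x (c + M *\<^sub>R (x - c)) \<le> ereal ((M - 1) * R)"
proof -
  have "pdist W x (c + M *\<^sub>R (x - c)) \<le> ereal (dist x (c + M *\<^sub>R (x - c)))"
  proof (intro pdist_segment subsetI)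
    fix z assume "z \<in> closed_segment x (c + M *\<^sub>R (x - c))"
    then obtain u where u: "0 \<le> u" "u \<le> 1" "z = (1 - u) *\<^sub>R x + u *\<^sub>R (c + M *\<^sub>R (x - c))"
      by (auto simp: in_segment)
    have "z = c + (1 + u * (M - 1)) *\<^sub>R (x - c)" unfolding u(3) by (simp add: algebra_simps)
    then show "z \<in> W" using outer_ray[OF c x, of "1 + u * (M - 1)"] u M by simp
  qed
  also have "x - (c + M *\<^sub>R (x - c)) = (1 - M) *\<^sub>R (x - c)" by (simp add: algebra_simps)
  then have "dist x (c + M *\<^sub>R (x - c)) = (M - 1) * norm (x - c)"
    using M by (simp add: dist_norm)
  also have "\<dots> \<le> (M - 1) * R" using M R by (intro mult_left_mono) auto
  finally show ?thesis by simp
qed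

text \<open>Detour: radially away from \<open>c\<close> by the factor \<open>M\<close>, along a
  straight segment, and radially back. With \<open>M = 1 + dist x y / \<rho>\<close> each radial
  piece costs at most \<open>R * dist x y / \<rho>\<close>.\<close>

lemma pdist_near:
  assumes ball: "cball c \<rho> \<subseteq> interior K" "0 < \<rho>" and R: "K \<subseteq> cball c R"
    and x: "x \<in> S" and y: "y \<in> S" and near: "dist x y \<le> \<rho>"
  shows "pdist S x y \<le> ereal ((2 * R / \<rho> + 2) * dist x y)"
proof (cases "x = y")
  case True
  have "pdist S x x \<le> ereal (dist x x)" using x by (intro pdist_segment) simp
  then show ?thesis unfolding True[symmetric] by simp
next
  case False
  define \<delta> where "\<delta> = dist x y"
  have \<delta>: "0 < \<delta>" "\<delta> \<le> \<rho>" using False near by (auto simp: \<delta>_def)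
  define M where "M = 1 + \<delta> / \<rho>"
  have M: "M > 1" "M \<le> 2" using \<delta> ball by (auto simp: M_def)
  have c: "c \<in> interior K" using ball by auto
  let ?x = "c + M *\<^sub>R (x - c)" and ?y = "c + M *\<^sub>R (y - c)"
  have Rx: "norm (x - c) \<le> R" "norm (y - c) \<le> R"
    using R x y S_subset_K by (auto simp: dist_norm norm_minus_commute subset_iff)
  \<comment> \<open>On the half of the segment next to \<open>x\<close> the dilated point is not
    interior: otherwise \<open>x\<close> would be a convex combination of an interior point and of
    \<open>b\<close>. The bound \<open>u \<le> 1/2\<close> is what keeps \<open>b\<close> in the
    inner ball; the other half is covered by exchanging \<open>x\<close> and
    \<open>y\<close>.\<close>
  have key: "c + M *\<^sub>R ((1 - u) *\<^sub>R x + u *\<^sub>R y - c) \<in> W"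
    if u: "0 \<le> u" "u \<le> 1/2" and xy: "x \<in> S" "norm (x - y) = \<delta>" for x y u
  proof
    assume *: "c + M *\<^sub>R ((1 - u) *\<^sub>R x + u *\<^sub>R y - c) \<in> interior K" (is "?w \<in> _")
    define b where "b = c + (M / (M - 1)) *\<^sub>R (u *\<^sub>R (x - y))"
    have MM: "M / (M - 1) = (\<rho> + \<delta>) / \<delta>" using \<delta> ball by (simp add: M_def field_simps)
    have "norm (b - c) = (\<rho> + \<delta>) / \<delta> * u * \<delta>" using \<delta> ball u xy by (simp add: b_def MM)
    also have "(\<rho> + \<delta>) / \<delta> * u * \<delta> = (\<rho> + \<delta>) * u" using \<delta> by simp
    also have "\<dots> \<le> (\<rho> + \<rho>) * (1/2)" using \<delta> u by (intro mult_mono) auto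
    finally have "norm (b - c) \<le> \<rho>" by simp
    then have "b \<in> cball c \<rho>" by (simp add: dist_norm norm_minus_commute)
    then have "b \<in> K" using ball(1) interior_subset[of K] by (meson subsetD)
    then have "(1/M) *\<^sub>R ?w + (1 - 1/M) *\<^sub>R b \<in> interior K" using * M by (intro interior_mix) auto
    also have "(1/M) *\<^sub>R ?w + (1 - 1/M) *\<^sub>R b = x"
    proof -
      have "(1 - 1/M) * (M / (M - 1) * u) = u" using M by (simp add: field_simps)
      then have "(1 - 1/M) *\<^sub>R b = (1 - 1/M) *\<^sub>R c + u *\<^sub>R (x - y)"
        unfolding b_def scaleR_add_right scaleR_scaleR by simp
      moreover have "(1/M) *\<^sub>R ?w = (1/M) *\<^sub>R c + ((1 - u) *\<^sub>R x + u *\<^sub>R y - c)"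
      proof -
        have "1/M * M = 1" using M by simp
        then show ?thesis by (simp only: scaleR_add_right scaleR_scaleR scaleR_one)
      qed
      ultimately have "(1/M) *\<^sub>R ?w + (1 - 1/M) *\<^sub>R b
          = (1/M) *\<^sub>R c + ((1 - u) *\<^sub>R x + u *\<^sub>R y - c) + ((1 - 1/M) *\<^sub>R c + u *\<^sub>R (x - y))"
        by simp
      also have "\<dots> = x" by (simp only: scaleR_diff_left scaleR_diff_right scaleR_one) simp
      finally show ?thesis .
    qed
    finally show False using xy by (simp add: S_eq)
  qed
  have "pdist W ?x ?y \<le> ereal (dist ?x ?y)"
  proof (intro pdist_segment subsetI)
    fix z assume "z \<in> closed_segment ?x ?y"
    then obtain u where u: "0 \<le> u" "u \<le> 1" "z = (1 - u) *\<^sub>R ?x + u *\<^sub>R ?y"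
      by (auto simp: in_segment)
    have z: "z = c + M *\<^sub>R ((1 - u) *\<^sub>R x + u *\<^sub>R y - c)" unfolding u(3) by (simp add: algebra_simps)
    show "z \<in> W"
    proof (cases "u \<le> 1/2")
      case True
      then show ?thesis unfolding z using u x by (intro key) (auto simp: \<delta>_def dist_norm)
    next
      case False
      have "c + M *\<^sub>R ((1 - (1 - u)) *\<^sub>R y + (1 - u) *\<^sub>R x - c) \<in> W"
        using False u y by (intro key) (auto simp: \<delta>_def dist_norm norm_minus_commute)
      then show ?thesis unfolding z by (simp add: add.commute)
    qed
  qed
  also have "dist ?x ?y = M * \<delta>"
  proof -
    have "?x - ?y = M *\<^sub>R (x - y)" by (simp add: algebra_simps)
    then show ?thesis using M by (simp add: dist_norm \<delta>_def)
  qed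
  finally have mid: "pdist W ?x ?y \<le> ereal (M * \<delta>)" .
  have o1: "pdist W x ?x \<le> ereal ((M - 1) * R)"
    using M Rx by (intro outer_ray_pdist[OF c x]) auto
  have o2: "pdist W ?y y \<le> ereal ((M - 1) * R)"
    using outer_ray_pdist[OF c y, of M R] M Rx pdist_commute[of W ?y y] by simp
  have "pdist W x y \<le> pdist W x ?x + (pdist W ?x ?y + pdist W ?y y)"
    by (rule order_trans[OF pdist_triangle add_left_mono[OF pdist_triangle]])
  also have "\<dots> \<le> ereal ((M - 1) * R) + (ereal (M * \<delta>) + ereal ((M - 1) * R))"
    by (intro add_mono o1 o2 mid)
  also have "\<dots> = ereal (2 * (\<delta> / \<rho>) * R + M * \<delta>)" by (simp add: M_def)
  also have "\<dots> \<le> ereal (2 * (\<delta> / \<rho>) * R + 2 * \<delta>)" using M \<delta> by simp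
  finally show ?thesis using pdist_S_W[OF x y] by (simp add: \<delta>_def algebra_simps)
qed

lemma norm_perp_ge:
  assumes "x \<bullet> z = 0" "\<rho> \<le> norm x" "\<rho> \<le> norm (z::real^3)" "0 \<le> \<rho>" "v \<in> closed_segment x z"
  shows "\<rho> / 2 \<le> norm v"
proof -
  obtain u where u: "0 \<le> u" "u \<le> 1" "v = (1 - u) *\<^sub>R x + u *\<^sub>R z"
    using assms by (auto simp: in_segment)
  have "(norm v)\<^sup>2 = (1-u)\<^sup>2 * (norm x)\<^sup>2 + u\<^sup>2 * (norm z)\<^sup>2"
    unfolding u(3) power2_norm_eq_inner using assms(1)
    by (simp add: inner_add_left inner_add_right inner_commute power2_eq_square)
  also have "\<dots> \<ge> (1-u)\<^sup>2 * \<rho>\<^sup>2 + u\<^sup>2 * \<rho>\<^sup>2"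
    using assms by (intro add_mono mult_left_mono power_mono) auto
  also have "(1-u)\<^sup>2 * \<rho>\<^sup>2 + u\<^sup>2 * \<rho>\<^sup>2 = ((1-u)\<^sup>2 + u\<^sup>2) * \<rho>\<^sup>2" by (simp add: algebra_simps)
  also have "(1-u)\<^sup>2 + u\<^sup>2 = 1/4 + (1/4 + (2*u - 1)\<^sup>2/2)" by (simp add: power2_eq_square field_simps)
  finally have "(\<rho>/2)\<^sup>2 + (1/4 + (2*u - 1)\<^sup>2/2) * \<rho>\<^sup>2 \<le> (norm v)\<^sup>2"
    by (simp add: algebra_simps power2_eq_square)
  moreover have "0 \<le> (1/4 + (2*u - 1)\<^sup>2/2) * \<rho>\<^sup>2" by simp
  ultimately have "(\<rho>/2)\<^sup>2 \<le> (norm v)\<^sup>2" by linarith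
  then show ?thesis by (rule power2_le_imp_le) simp
qed

text \<open>Two points may be opposite with respect to \<open>c\<close>, and then the segment
  between their dilations meets the body. Both are therefore joined to the same point
  \<open>c + M *\<^sub>R z\<close> with \<open>z\<close> orthogonal to both directions, which exists
  in dimension three. Since \<open>M * \<rho> = 3 * R\<close>, these segments keep distance at least
  3R/2 from \<open>c\<close> and so miss the body.\<close>

lemma pdist_far:
  assumes ball: "cball c \<rho> \<subseteq> interior K" "0 < \<rho>" and R: "K \<subseteq> cball c R" "0 < R"
  shows "\<exists>D. \<forall>x\<in>S. \<forall>y\<in>S. pdist S x y \<le> ereal D"
proof -
  define M where "M = 3 * R / \<rho>"
  have "pdist S x y \<le> ereal (2 * ((M - 1) * R + 2 * M * R))" if x: "x \<in> S" and y: "y \<in> S" for x y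
  proof -
  have c: "c \<in> interior K" using ball by auto
  have "\<rho> \<le> R"
  proof -
    obtain u :: "real^3" where u: "norm u = 1" using norm_axis_1 by blast
    then have "c + \<rho> *\<^sub>R u \<in> cball c \<rho>" using ball by (simp add: dist_norm)
    then have "c + \<rho> *\<^sub>R u \<in> cball c R" using ball R interior_subset by blast
    then show ?thesis using u ball by (simp add: dist_norm)
  qed
  then have M: "M \<ge> 1" "M \<ge> 0" "M * \<rho> = 3 * R" using ball R by (auto simp: M_def field_simps)
  have "dim {x - c, y - c} \<le> 2"
    using dim_le_card'[of "{x - c, y - c}"] by (simp add: card_insert_if split: if_splits)
  then obtain z0 where z0: "z0 \<noteq> 0" "\<And>y'. y' \<in> span {x - c, y - c} \<Longrightarrow> orthogonal z0 y'"
    using orthogonal_to_subspace_exists[of "{x - c, y - c}"] by auto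
  define z where "z = (\<rho> / norm z0) *\<^sub>R z0"
  have z: "norm z = \<rho>" "(x - c) \<bullet> z = 0" "(y - c) \<bullet> z = 0"
    using z0 ball z0(2)[of "x - c"] z0(2)[of "y - c"]
    by (auto simp: z_def orthogonal_def inner_commute span_base)
  have half: "pdist W w (c + M *\<^sub>R z) \<le> ereal ((M - 1) * R + 2 * M * R)"
    if w: "w \<in> S" "(w - c) \<bullet> z = 0" for w
  proof -
    have wR: "norm (w - c) \<le> R" "w \<notin> ball c \<rho>"
      using w R ball S_subset_K S_subset_W
      by (force simp: dist_norm norm_minus_commute subset_iff)+
    then have wr: "\<rho> \<le> norm (w - c)" by (auto simp: dist_norm norm_minus_commute)
    have "pdist W (c + M *\<^sub>R (w - c)) (c + M *\<^sub>R z) \<le> ereal (dist (c + M *\<^sub>R (w - c)) (c + M *\<^sub>R z))"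
    proof (intro pdist_segment subsetI)
      fix v assume "v \<in> closed_segment (c + M *\<^sub>R (w - c)) (c + M *\<^sub>R z)"
      then have "v - c \<in> closed_segment (M *\<^sub>R (w - c)) (M *\<^sub>R z)"
        using closed_segment_translation_eq[of c "v - c" "M *\<^sub>R (w - c)" "M *\<^sub>R z"] by simp
      then have "M * \<rho> / 2 \<le> norm (v - c)"
        using M(2) w z ball mult_left_mono[OF wr M(2)]
        by (intro norm_perp_ge[of "M *\<^sub>R (w - c)" "M *\<^sub>R z"]) auto
      then have "norm (v - c) > R" using M R by auto
      then show "v \<in> W" using R interior_subset by (fastforce simp: dist_norm norm_minus_commute)
    qed
    also have "\<dots> \<le> ereal (2 * M * R)"
    proof -
      have "(c + M *\<^sub>R (w - c)) - (c + M *\<^sub>R z) = M *\<^sub>R (w - c - z)" by (simp add: algebra_simps)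
      then have "dist (c + M *\<^sub>R (w - c)) (c + M *\<^sub>R z) = M * norm (w - c - z)"
        using M by (simp add: dist_norm)
      also have "\<dots> \<le> M * (R + R)"
        using norm_triangle_ineq4[of "w - c" z] M wR z \<open>\<rho> \<le> R\<close> by (intro mult_left_mono) auto
      finally show ?thesis by simp
    qed
    finally have 1: "pdist W (c + M *\<^sub>R (w - c)) (c + M *\<^sub>R z) \<le> ereal (2 * M * R)" .
    have 2: "pdist W w (c + M *\<^sub>R (w - c)) \<le> ereal ((M - 1) * R)"
      using wR by (intro outer_ray_pdist[OF c w(1) M(1)]) auto
    show ?thesis
      using add_mono[OF 2 1] pdist_triangle[of W w "c + M *\<^sub>R z" "c + M *\<^sub>R (w - c)"] by simp
  qed
  have "pdist W x y \<le> pdist W x (c + M *\<^sub>R z) + pdist W (c + M *\<^sub>R z) y" by (rule pdist_triangle)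
  also have "\<dots> \<le> ereal ((M - 1) * R + 2 * M * R) + ereal ((M - 1) * R + 2 * M * R)"
    using half[OF x z(2)] half[OF y z(3)] by (intro add_mono) (auto simp: pdist_commute)
  finally show ?thesis using pdist_S_W[OF x y] by (simp add: mult.commute)
  qed
  then show ?thesis by blast
qed

lemma pdist_lipschitz: "\<exists>C>0. \<forall>x\<in>S. \<forall>y\<in>S. pdist S x y \<le> ereal (C * dist x y)"
proof -
  obtain c where "c \<in> interior K" using interior_K by auto
  then obtain e where c: "e > 0" "cball c e \<subseteq> interior K"
    using mem_interior_cball[of c "interior K"] by auto
  obtain R where R: "R > 0" "K \<subseteq> ball c R"
    using bounded_subset_ballD[OF compact_imp_bounded[OF compact_K], of c] by blast
  then have R: "R > 0" "K \<subseteq> cball c R" using ball_subset_cball[of c R] by auto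
  obtain D where D: "\<forall>x\<in>S. \<forall>y\<in>S. pdist S x y \<le> ereal D"
    using pdist_far[OF c(2,1) R(2,1)] by blast
  define C where "C = max (2 * R / e + 2) (D / e)"
  have "0 < 2 * R / e + 2" using R(1) c(1) by (intro add_nonneg_pos divide_nonneg_pos) auto
  then have C: "C > 0" unfolding C_def by linarith
  show ?thesis
  proof (intro exI[of _ C] conjI ballI)
    fix x y assume xy: "x \<in> S" "y \<in> S"
    show "pdist S x y \<le> ereal (C * dist x y)"
    proof (cases "dist x y \<le> e")
      case True
      have "(2 * R / e + 2) * dist x y \<le> C * dist x y" by (intro mult_right_mono) (auto simp: C_def)
      then show ?thesis using pdist_near[OF c(2,1) R(2) xy True] by (meson ereal_less_eq(3) order_trans)
    next
      case False
      have "0 \<le> D" using D[rule_format, OF xy] pdist_nonneg[of S x y] order_trans[of 0 "pdist S x y" "ereal D"] by simp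
      have "D = D / e * e" using c by simp
      moreover have "D / e * e \<le> D / e * dist x y"
        using c False \<open>0 \<le> D\<close> by (intro mult_left_mono divide_nonneg_pos) auto
      moreover have "D / e * dist x y \<le> C * dist x y" by (intro mult_right_mono) (auto simp: C_def)
      ultimately have "D \<le> C * dist x y" by linarith
      then show ?thesis using D[rule_format, OF xy] by (meson ereal_less_eq(3) order_trans)
    qed
  qed (rule C)
qed

text \<open>The Lipschitz bound makes \<open>pdist\<close> finite on the surface, so nothing is lost
  in passing to the real-valued \<open>idist\<close>, and the metric laws are inherited.\<close>

lemma ereal_d: "x \<in> S \<Longrightarrow> y \<in> S \<Longrightarrow> ereal (d x y) = pdist S x y"
proof -
  assume xy: "x \<in> S" "y \<in> S"
  obtain C where "\<forall>x\<in>S. \<forall>y\<in>S. pdist S x y \<le> ereal (C * dist x y)"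
    using pdist_lipschitz by blast
  then have "pdist S x y \<le> ereal (C * dist x y)" using xy by auto
  then have "\<bar>pdist S x y\<bar> \<noteq> \<infinity>" using pdist_nonneg[of S x y] by auto
  then show ?thesis by (simp add: idist_pdist ereal_real')
qed

lemma d_ge_dist: "x \<in> S \<Longrightarrow> y \<in> S \<Longrightarrow> dist x y \<le> d x y"
  using pdist_ge_dist[of x y S] by (simp flip: ereal_d)

lemma d_nonneg: "x \<in> S \<Longrightarrow> y \<in> S \<Longrightarrow> 0 \<le> d x y"
  using order_trans[OF zero_le_dist d_ge_dist] .

lemma d_commute: "d x y = d y x"
  by (simp add: idist_pdist pdist_commute)

lemma d_triangle: "x \<in> S \<Longrightarrow> y \<in> S \<Longrightarrow> z \<in> S \<Longrightarrow> d x z \<le> d x y + d y z"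
  using pdist_triangle[of S x z y] by (simp flip: ereal_d)

lemma d_le_pdist_W: "x \<in> S \<Longrightarrow> y \<in> S \<Longrightarrow> pdist W x y \<le> ereal c \<Longrightarrow> d x y \<le> c"
  by (simp flip: ereal_d pdist_S_W)

lemma d_refl: "x \<in> S \<Longrightarrow> d x x = 0"
  using pdist_segment[of x x S] d_nonneg[of x x] by (simp flip: ereal_d)

lemma d_eq_0: "x \<in> S \<Longrightarrow> y \<in> S \<Longrightarrow> d x y = 0 \<longleftrightarrow> x = y"
  using d_ge_dist[of x y] d_refl[of x] by auto

lemma d_pos: "x \<in> S \<Longrightarrow> y \<in> S \<Longrightarrow> x \<noteq> y \<Longrightarrow> 0 < d x y"
  using d_nonneg[of x y] d_eq_0[of x y] by simp

lemma d_lipschitz: "\<exists>C>0. \<forall>x\<in>S. \<forall>y\<in>S. d x y \<le> C * dist x y"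
  using pdist_lipschitz by (simp flip: ereal_d)

lemma d_abs_diff: "x \<in> S \<Longrightarrow> y \<in> S \<Longrightarrow> z \<in> S \<Longrightarrow> \<bar>d x y - d x z\<bar> \<le> d y z"
  using d_triangle[of x y z] d_triangle[of x z y] by (simp add: d_commute)

lemma continuous_d:
  assumes "x \<in> S" shows "continuous_on S (d x)"
proof -
  obtain C where C: "C > 0" "\<forall>x\<in>S. \<forall>y\<in>S. d x y \<le> C * dist x y"
    using d_lipschitz by blast
  have "C-lipschitz_on S (d x)"
  proof (rule lipschitz_onI)
    fix y z assume yz: "y \<in> S" "z \<in> S"
    then show "dist (d x y) (d x z) \<le> C * dist y z"
      using d_abs_diff[OF assms yz] C(2)[rule_format, OF yz] by (simp add: dist_real_def)
  qed (use C in auto)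
  then show ?thesis by (rule lipschitz_on_continuous_on)
qed

lemma tendsto_d:
  assumes "(f \<longlongrightarrow> x) F" "(g \<longlongrightarrow> y) F" "x \<in> S" "y \<in> S"
    and "\<And>t. f t \<in> S" "\<And>t. g t \<in> S"
  shows "((\<lambda>t. d (f t) (g t)) \<longlongrightarrow> d x y) F"
proof -
  obtain C where C: "C > 0" "\<forall>x\<in>S. \<forall>y\<in>S. d x y \<le> C * dist x y"
    using d_lipschitz by blast
  have lim: "((\<lambda>t. C * dist (f t) x + C * dist (g t) y) \<longlongrightarrow> C * 0 + C * 0) F"
    by (intro tendsto_intros iffD1[OF tendsto_dist_iff] assms(1,2))
  have "dist (d (f t) (g t)) (d x y) \<le> C * dist (f t) x + C * dist (g t) y" for t
  proof -
    have *: "f t \<in> S" "g t \<in> S" by (fact assms)+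
    note C(2)[rule_format, OF *(1) assms(3)] C(2)[rule_format, OF *(2) assms(4)]
      d_abs_diff[OF *(2,1) assms(3)] d_abs_diff[OF assms(3) *(2) assms(4)]
    moreover have "d (g t) (f t) = d (f t) (g t)" "d (g t) x = d x (g t)" by (rule d_commute)+
    ultimately show ?thesis unfolding dist_real_def by linarith
  qed
  then have "\<forall>\<^sub>F t in F. norm (dist (d (f t) (g t)) (d x y)) \<le> C * dist (f t) x + C * dist (g t) y"
    by simp
  from Lim_null_comparison[OF this] lim
  show ?thesis unfolding tendsto_dist_iff[of "\<lambda>t. d (f t) (g t)"] by simp
qed

lemma d_segment: "closed_segment x y \<subseteq> S \<Longrightarrow> d x y = dist x y"
proof -
  assume *: "closed_segment x y \<subseteq> S"
  then have "x \<in> S" "y \<in> S" by auto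
  then show ?thesis using pdist_segment[OF *] d_ge_dist[of x y] by (simp flip: ereal_d)
qed

end

section \<open>Shortest paths\<close>

context convex_body
begin

text \<open>Almost minimal paths contain a point at distance \<open>r\<close> from \<open>x\<close>
  by continuity; a limit of such points exists by compactness, and the slack 1 / (n + 1) vanishes in
  it.\<close>

lemma between_point:
  assumes x: "x \<in> S" and y: "y \<in> S" and r: "0 \<le> r" "r \<le> d x y"
  shows "\<exists>m\<in>S. d x m = r \<and> d m y = d x y - r"
proof -
  have "\<exists>m. m \<in> S \<and> d x m = r \<and> d m y \<le> d x y - r + 1 / Suc n" for n
  proof -
    have "pdist S x y < ereal (d x y + 1 / Suc n)"
      using ereal_d[OF x y] by (metis ereal_less(2) ereal_less_eq(3) add_increasing less_add_same_cancel1 less_ereal.simps(1) of_nat_0_less_iff zero_less_Suc zero_less_divide_1_iff)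
    then obtain g where g: "path g" "path_image g \<subseteq> S" "pathstart g = x" "pathfinish g = y"
        "curve_length g < ereal (d x y + 1 / Suc n)"
      unfolding pdist_def INF_less_iff by blast
    have gS: "g t \<in> S" if "t \<in> {0..1}" for t using g(2) that unfolding path_image_def by blast
    have "continuous_on {0..1} (\<lambda>t. d x (g t))"
      by (rule continuous_on_compose2[OF continuous_d[OF x]]) (use g(1) gS in \<open>auto simp: path_def\<close>)
    moreover have "d x (g 0) \<le> r" "r \<le> d x (g 1)"
      using g(3,4) r d_refl[OF x] by (simp_all add: pathstart_def pathfinish_def)
    ultimately obtain t where t: "0 \<le> t" "t \<le> 1" "d x (g t) = r"
      using IVT'[of "\<lambda>t. d x (g t)" 0 r 1] by auto
    have "g t \<in> S" using gS t by simp
    have "pdist S x (g t) + pdist S (g t) y \<le> curve_length g"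
      using curve_length_ge_pdist2[OF g(1,2), of t] t g(3,4) by simp
    then have "ereal (d x (g t) + d (g t) y) \<le> curve_length g"
      using ereal_d[OF x \<open>g t \<in> S\<close>] ereal_d[OF \<open>g t \<in> S\<close> y] by (metis plus_ereal.simps(1))
    then have "ereal (d x (g t) + d (g t) y) < ereal (d x y + 1 / Suc n)" using g(5) by (rule le_less_trans)
    then have "d x (g t) + d (g t) y < d x y + 1 / Suc n" by simp
    then show ?thesis using t \<open>g t \<in> S\<close> by (intro exI[of _ "g t"]) linarith
  qed
  then obtain m where m: "\<And>n. m n \<in> S" "\<And>n. d x (m n) = r" "\<And>n. d (m n) y \<le> d x y - r + 1 / Suc n"
    by metis
  obtain l s where l: "l \<in> S" "strict_mono s" "(m \<circ> s) \<longlonglongrightarrow> l"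
    using compact_S m(1) unfolding compact_def by meson
  have ms: "(m \<circ> s) n \<in> S" for n using m by simp
  have "(\<lambda>n. d x ((m \<circ> s) n)) \<longlonglongrightarrow> d x l" by (rule tendsto_d[OF tendsto_const l(3) x l(1) x ms])
  then have 1: "d x l = r" using m(2) LIMSEQ_unique[OF _ tendsto_const, of r "d x l"] by simp
  have "(\<lambda>n. d ((m \<circ> s) n) y) \<longlonglongrightarrow> d l y" by (rule tendsto_d[OF l(3) tendsto_const l(1) y ms y])
  moreover have "(\<lambda>n. d x y - r + 1 / Suc (s n)) \<longlonglongrightarrow> d x y - r + 0"
    using LIMSEQ_subseq_LIMSEQ[OF LIMSEQ_inverse_real_of_nat l(2)]
    by (intro tendsto_intros) (simp add: comp_def inverse_eq_divide)
  ultimately have "d l y \<le> d x y - r + 0"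
    by (rule LIMSEQ_le) (use m(3) in auto)
  moreover have "d x y \<le> d x l + d l y" by (rule d_triangle[OF x l(1) y])
  ultimately show ?thesis using 1 l(1) by (intro bexI[of _ l]) auto
qed

text \<open>A shortest path as an isometric embedding of an interval, that is, parametrized by
  intrinsic arc length. A path in the sense of \<open>shortest_path\<close> may run at any speed and
  even stand still.\<close>

definition geod :: "(real \<Rightarrow> real^3) \<Rightarrow> real \<Rightarrow> bool" where
  "geod \<gamma> l \<longleftrightarrow> 0 \<le> l \<and> (\<forall>s\<in>{0..l}. \<gamma> s \<in> S) \<and> (\<forall>s\<in>{0..l}. \<forall>t\<in>{0..l}. d (\<gamma> s) (\<gamma> t) = \<bar>s - t\<bar>)"

lemma geod_S: "geod \<gamma> l \<Longrightarrow> 0 \<le> s \<Longrightarrow> s \<le> l \<Longrightarrow> \<gamma> s \<in> S"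
  and geod_d: "geod \<gamma> l \<Longrightarrow> 0 \<le> s \<Longrightarrow> s \<le> l \<Longrightarrow> 0 \<le> t \<Longrightarrow> t \<le> l \<Longrightarrow> d (\<gamma> s) (\<gamma> t) = \<bar>s - t\<bar>"
  and geod_nonneg: "geod \<gamma> l \<Longrightarrow> 0 \<le> l"
  by (auto simp: geod_def)

lemma geod_dist: "geod \<gamma> l \<Longrightarrow> 0 \<le> s \<Longrightarrow> s \<le> l \<Longrightarrow> 0 \<le> t \<Longrightarrow> t \<le> l \<Longrightarrow> dist (\<gamma> s) (\<gamma> t) \<le> \<bar>s - t\<bar>"
  using d_ge_dist[of "\<gamma> s" "\<gamma> t"] by (simp add: geod_S geod_d)

lemma geod_length: "geod \<gamma> l \<Longrightarrow> d (\<gamma> 0) (\<gamma> l) = l"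
  by (simp add: geod_d geod_nonneg)

lemma geod_reverse: "geod \<gamma> l \<Longrightarrow> geod (\<lambda>t. \<gamma> (l - t)) l"
  by (auto simp: geod_def)

lemma geod_restrict: "geod \<gamma> l \<Longrightarrow> 0 \<le> a \<Longrightarrow> a \<le> l \<Longrightarrow> geod \<gamma> a"
  by (auto simp: geod_def)

lemma continuous_geod: "geod \<gamma> l \<Longrightarrow> continuous_on {0..l} \<gamma>"
  by (rule lipschitz_on_continuous_on[of 1], rule lipschitz_onI) (auto simp: geod_dist dist_real_def)

text \<open>A maximal isometric relation containing both endpoints is total by the finite intersection
  property; this replaces the usual dyadic construction.\<close>
lemma geodesic_exists:
  assumes x: "x \<in> S" and y: "y \<in> S"
  shows "\<exists>\<gamma>. geod \<gamma> (d x y) \<and> \<gamma> 0 = x \<and> \<gamma> (d x y) = y"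
proof -
  define L where "L = d x y"
  have L: "0 \<le> L" by (simp add: L_def d_nonneg x y)
  define A where "A = {R :: (real \<times> (real^3)) set. R \<subseteq> {0..L} \<times> S \<and> (0, x) \<in> R \<and> (L, y) \<in> R \<and>
      (\<forall>a\<in>R. \<forall>b\<in>R. d (snd a) (snd b) = \<bar>fst a - fst b\<bar>)}"
  have "{(0, x), (L, y)} \<in> A"
    using x y L by (simp add: A_def d_refl L_def[symmetric] d_commute[of y x])
  then have "A \<noteq> {}" by blast
  moreover have "\<Union>C \<in> A" if "C \<noteq> {}" "subset.chain A C" for C
  proof -
    have CA: "C \<subseteq> A" and lin: "\<And>X Y. X \<in> C \<Longrightarrow> Y \<in> C \<Longrightarrow> X \<subseteq> Y \<or> Y \<subseteq> X"
      using that(2) by (auto simp: subset.chain_def)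
    have "d (snd a) (snd b) = \<bar>fst a - fst b\<bar>" if ab: "a \<in> \<Union>C" "b \<in> \<Union>C" for a b
    proof -
      obtain X Y where XY: "X \<in> C" "Y \<in> C" "a \<in> X" "b \<in> Y" using ab by blast
      with lin[OF XY(1,2)] obtain Z where "Z \<in> C" "a \<in> Z" "b \<in> Z" by blast
      then show ?thesis using CA by (auto simp: A_def)
    qed
    moreover have "\<Union>C \<subseteq> {0..L} \<times> S" using CA by (auto simp: A_def)
    moreover have "(0, x) \<in> \<Union>C" "(L, y) \<in> \<Union>C" using CA that(1) by (auto simp: A_def)
    ultimately show ?thesis by (simp add: A_def)
  qed
  ultimately obtain M where M: "M \<in> A" and maxM: "\<forall>X\<in>A. M \<subseteq> X \<longrightarrow> X = M"
    using subset_Zorn_nonempty[of A] by blast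
  have Msub: "M \<subseteq> {0..L} \<times> S" and Mx: "(0, x) \<in> M" and My: "(L, y) \<in> M"
    using M by (auto simp: A_def)
  have Md: "d p q = \<bar>s - t\<bar>" if "(s, p) \<in> M" "(t, q) \<in> M" for s t p q
  proof -
    have "d (snd (s, p)) (snd (t, q)) = \<bar>fst (s, p) - fst (t, q)\<bar>"
      using M that unfolding A_def by blast
    then show ?thesis by simp
  qed
  have total: "\<exists>p. (t, p) \<in> M" if t: "0 \<le> t" "t \<le> L" for t
  proof -
    define F where "F = (\<lambda>(s, q). S \<inter> d q -` {..\<bar>t - s\<bar>}) ` M"
    have "S \<inter> \<Inter>F \<noteq> {}"
    proof (rule compact_imp_fip[OF compact_S])
      fix T assume "T \<in> F"
      then obtain s q where "(s, q) \<in> M" "T = S \<inter> d q -` {..\<bar>t - s\<bar>}" by (auto simp: F_def)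
      moreover from this have "q \<in> S" using Msub by blast
      ultimately show "closed T"
        using continuous_closed_preimage[OF continuous_d closed_S closed_atMost] by blast
    next
      fix F' assume "finite F'" "F' \<subseteq> F"
      then obtain Q where Q: "finite Q" "Q \<subseteq> M" "F' = (\<lambda>(s, q). S \<inter> d q -` {..\<bar>t - s\<bar>}) ` Q"
        unfolding F_def by (meson finite_subset_image)
      \<comment> \<open>Of finitely many constraints only the last one before \<open>t\<close> and
        the first one after \<open>t\<close> matter: a point between these two at the right
        distances satisfies the others by the triangle inequality. The endpoints are inserted so
        that both exist.\<close>
      define Q1 where "Q1 = {a \<in> insert (0, x) Q. fst a \<le> t}"
      define Q2 where "Q2 = {a \<in> insert (L, y) Q. fst a \<ge> t}"
      have fin: "finite Q1" "finite Q2" "Q1 \<noteq> {}" "Q2 \<noteq> {}" using Q(1) t by (auto simp: Q1_def Q2_def)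
      obtain a where a: "a \<in> Q1" "\<And>a'. a' \<in> Q1 \<Longrightarrow> fst a' \<le> fst a"
        using Max_in[of "fst ` Q1"] Max_ge[of "fst ` Q1"] fin by (metis (no_types, lifting) finite_imageI image_iff image_is_empty)
      obtain b where b: "b \<in> Q2" "\<And>a'. a' \<in> Q2 \<Longrightarrow> fst b \<le> fst a'"
        using Min_in[of "fst ` Q2"] Min_le[of "fst ` Q2"] fin by (metis (no_types, lifting) finite_imageI image_iff image_is_empty)
      have abM: "(fst a, snd a) \<in> M" "(fst b, snd b) \<in> M" "fst a \<le> t" "t \<le> fst b"
        using a(1) b(1) Q(2) Mx My by (auto simp: Q1_def Q2_def)
      then have abS: "snd a \<in> S" "snd b \<in> S" using Msub by blast+
      have dab: "d (snd a) (snd b) = fst b - fst a" using Md[OF abM(1,2)] abM by simp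
      then obtain p where p: "p \<in> S" "d (snd a) p = t - fst a" "d p (snd b) = fst b - t"
        using between_point[OF abS, of "t - fst a"] abM by auto
      have "d q p \<le> \<bar>t - s\<bar>" if sq: "(s, q) \<in> Q" for s q
      proof -
        have sqM: "(s, q) \<in> M" and "q \<in> S" using sq Q(2) Msub by auto
        show ?thesis
        proof (cases "s \<le> t")
          case True
          then have "s \<le> fst a" using a(2)[of "(s, q)"] sq by (simp add: Q1_def)
          then show ?thesis
            using d_triangle[OF \<open>q \<in> S\<close> abS(1) p(1)] Md[OF sqM abM(1)] p(2) by simp
        next
          case False
          then have "fst b \<le> s" using b(2)[of "(s, q)"] sq by (simp add: Q2_def)
          then show ?thesis
            using d_triangle[OF \<open>q \<in> S\<close> abS(2) p(1)] Md[OF sqM abM(2)] p(3) d_commute[of "snd b" p] abM by simp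
        qed
      qed
      then have "p \<in> S \<inter> \<Inter>F'" using p(1) Q(3) by auto
      then show "S \<inter> \<Inter>F' \<noteq> {}" by blast
    qed
    then obtain p where p: "p \<in> S" "\<And>s q. (s, q) \<in> M \<Longrightarrow> d q p \<le> \<bar>t - s\<bar>" by (auto simp: F_def)
    \<comment> \<open>The opposite inequality follows from the constraints at the two ends, which
      leave no slack.\<close>
    have eq: "d q p = \<bar>t - s\<bar>" if sq: "(s, q) \<in> M" for s q
    proof -
      have "q \<in> S" "0 \<le> s" "s \<le> L" using sq Msub by auto
      have "d q p \<ge> \<bar>t - s\<bar>"
      proof (cases "s \<le> t")
        case True
        have "d q y = L - s" using Md[OF sq My] \<open>s \<le> L\<close> by simp
        moreover have "d y p \<le> L - t" using p(2)[OF My] t by simp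
        moreover have "d q y \<le> d q p + d p y" by (rule d_triangle[OF \<open>q \<in> S\<close> p(1) y])
        ultimately show ?thesis using True d_commute[of p y] by simp
      next
        case False
        have "d q x = s" using Md[OF sq Mx] \<open>0 \<le> s\<close> by simp
        moreover have "d x p \<le> t" using p(2)[OF Mx] t by simp
        moreover have "d q x \<le> d q p + d p x" by (rule d_triangle[OF \<open>q \<in> S\<close> p(1) x])
        ultimately show ?thesis using False d_commute[of p x] by simp
      qed
      then show ?thesis using p(2)[OF sq] by simp
    qed
    have "d (snd a) (snd b) = \<bar>fst a - fst b\<bar>" if "a \<in> insert (t, p) M" "b \<in> insert (t, p) M" for a b
    proof -
      have "d p (snd b) = \<bar>t - fst b\<bar>" if "b \<in> M" for b
        using eq[of "fst b" "snd b"] that d_commute[of p "snd b"] by simp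
      moreover have "d (snd a) p = \<bar>fst a - t\<bar>" if "a \<in> M" for a
        using eq[of "fst a" "snd a"] that by (simp add: abs_minus_commute)
      moreover have "d (snd a) (snd b) = \<bar>fst a - fst b\<bar>" if "a \<in> M" "b \<in> M" for a b
        using Md[of "fst a" "snd a" "fst b" "snd b"] that by simp
      ultimately show ?thesis using that d_refl[OF p(1)] by (elim insertE) simp_all
    qed
    then have "insert (t, p) M \<in> A" using Msub Mx My p(1) t by (simp add: A_def)
    then show ?thesis using maxM by blast
  qed
  define \<gamma> where "\<gamma> t = (SOME p. (t, p) \<in> M)" for t
  have \<gamma>: "(t, \<gamma> t) \<in> M" if "0 \<le> t" "t \<le> L" for t
    unfolding \<gamma>_def using total[OF that] by (rule someI_ex)
  have S: "\<gamma> t \<in> S" if "0 \<le> t" "t \<le> L" for t using \<gamma>[OF that] Msub by blast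
  have "geod \<gamma> L"
    unfolding geod_def using L S Md[OF \<gamma> \<gamma>] by simp
  moreover have "d (\<gamma> 0) x = 0" "d (\<gamma> L) y = 0" using Md[OF \<gamma> Mx, of 0] Md[OF \<gamma> My, of L] L by simp_all
  then have "\<gamma> 0 = x" "\<gamma> L = y" using d_eq_0 S L x y by simp_all
  ultimately show ?thesis unfolding L_def by blast
qed

lemma geod_shortest_path:
  assumes "geod \<gamma> l"
  shows "shortest_path S (\<lambda>t. \<gamma> (l * t)) (\<gamma> 0) (\<gamma> l)"
proof -
  have l: "0 \<le> l" using assms by (rule geod_nonneg)
  have mem: "0 \<le> l * t" "l * t \<le> l" if "t \<in> {0..1}" for t
    using that l mult_left_mono[of t 1 l] by auto
  have path: "path (\<lambda>t. \<gamma> (l * t))"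
    unfolding path_def
    by (rule continuous_on_compose2[OF continuous_geod[OF assms]]) (use mem in \<open>auto intro!: continuous_intros\<close>)
  have image: "path_image (\<lambda>t. \<gamma> (l * t)) \<subseteq> S"
    using mem geod_S[OF assms] by (auto simp: path_image_def)
  have "curve_length (\<lambda>t. \<gamma> (l * t)) \<le> ereal (l * (1 - 0))"
    unfolding curve_length_vlen
  proof (rule vlen_lipschitz_le[OF l])
    fix s t :: real assume "s \<in> {0..1}" "t \<in> {0..1}"
    then have "dist (\<gamma> (l * s)) (\<gamma> (l * t)) \<le> \<bar>l * s - l * t\<bar>"
      by (intro geod_dist[OF assms] mem)
    also have "\<dots> = l * \<bar>s - t\<bar>" using l by (simp add: abs_mult flip: right_diff_distrib)
    finally show "dist (\<gamma> (l * s)) (\<gamma> (l * t)) \<le> l * \<bar>s - t\<bar>" .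
  qed simp
  moreover have "ereal l \<le> curve_length (\<lambda>t. \<gamma> (l * t))"
  proof -
    have "ereal (d (\<gamma> 0) (\<gamma> l)) = pdist S (\<gamma> 0) (\<gamma> l)" using l by (intro ereal_d geod_S[OF assms]) auto
    also have "\<dots> \<le> curve_length (\<lambda>t. \<gamma> (l * t))"
      using path image by (intro pdist_lower) (auto simp: pathstart_def pathfinish_def)
    finally show ?thesis by (simp add: geod_length[OF assms])
  qed
  ultimately have "curve_length (\<lambda>t. \<gamma> (l * t)) = ereal l" by simp
  then show ?thesis
    using path image by (simp add: shortest_path_def pathstart_def pathfinish_def geod_length[OF assms])
qed

text \<open>Equality of length and distance leaves no slack in any triangle inequality along the
  path, so the distance \<open>\<phi>\<close> from \<open>x\<close> is a monotone arc-length
  parameter. A right inverse of \<open>\<phi>\<close> can be chosen arbitrarily, because times with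
  equal \<open>\<phi>\<close> belong to the same point.\<close>

lemma shortest_path_geod:
  assumes "shortest_path S g x y"
  shows "x \<in> S" "y \<in> S"
    and "\<exists>\<gamma>. geod \<gamma> (d x y) \<and> \<gamma> 0 = x \<and> \<gamma> (d x y) = y \<and> \<gamma> ` {0..d x y} = path_image g"
proof -
  have g: "path g" "path_image g \<subseteq> S" "pathstart g = x" "pathfinish g = y"
      "curve_length g = ereal (d x y)"
    using assms by (auto simp: shortest_path_def)
  have gS: "g t \<in> S" if "0 \<le> t" "t \<le> 1" for t using g(2) that by (auto simp: path_image_def)
  have g01: "g 0 = x" "g 1 = y" using g(3,4) by (simp_all add: pathstart_def pathfinish_def)
  then show x: "x \<in> S" and y: "y \<in> S" using gS[of 0] gS[of 1] by simp_all
  define \<phi> where "\<phi> t = d x (g t)" for t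
  have le: "\<phi> t = \<phi> s + d (g s) (g t) \<and> \<phi> t \<le> d x y" if st: "0 \<le> s" "s \<le> t" "t \<le> 1" for s t
  proof -
    have S: "g s \<in> S" "g t \<in> S" using gS st by auto
    have "pdist S (g 0) (g s) + (pdist S (g s) (g t) + pdist S (g t) (g 1)) \<le> vlen g 0 s + (vlen g s t + vlen g t 1)"
      using st by (intro add_mono curve_length_ge_pdist[OF g(1,2)]) auto
    also have "\<dots> \<le> vlen g 0 s + vlen g s 1" using st by (intro add_left_mono vlen_superadd) auto
    also have "\<dots> \<le> vlen g 0 1" using st by (intro vlen_superadd) auto
    also have "\<dots> = ereal (d x y)" using g(5) by (simp add: curve_length_vlen)
    finally have "ereal (d x (g s) + (d (g s) (g t) + d (g t) y)) \<le> ereal (d x y)"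
      using S x y by (simp add: g01 flip: ereal_d)
    then have "d x (g s) + (d (g s) (g t) + d (g t) y) \<le> d x y" by simp
    moreover have "d x y \<le> d x (g t) + d (g t) y" by (rule d_triangle[OF x S(2) y])
    moreover have "d x (g t) \<le> d x (g s) + d (g s) (g t)" by (rule d_triangle[OF x S])
    moreover have "0 \<le> d (g t) y" by (rule d_nonneg[OF S(2) y])
    ultimately show ?thesis unfolding \<phi>_def by linarith
  qed
  have iso: "d (g s) (g t) = \<bar>\<phi> s - \<phi> t\<bar>" if st: "0 \<le> s" "s \<le> 1" "0 \<le> t" "t \<le> 1" for s t
  proof (cases "s \<le> t")
    case True
    then show ?thesis using le[of s t] st d_nonneg[OF gS gS, of s t] by simp
  next
    case False
    then show ?thesis using le[of t s] st d_nonneg[OF gS gS, of t s] d_commute[of "g s" "g t"] by simp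
  qed
  have \<phi>01: "\<phi> 0 = 0" "\<phi> 1 = d x y" by (simp_all add: \<phi>_def g01 d_refl x)
  have "continuous_on {0..1} \<phi>"
    unfolding \<phi>_def
    by (rule continuous_on_compose2[OF continuous_d[OF x]]) (use g(1) gS in \<open>auto simp: path_def\<close>)
  then have ex: "\<exists>t. 0 \<le> t \<and> t \<le> 1 \<and> \<phi> t = r" if "0 \<le> r" "r \<le> d x y" for r
    using IVT'[of \<phi> 0 r 1] that \<phi>01 by auto
  define \<tau> where "\<tau> r = (SOME t. 0 \<le> t \<and> t \<le> 1 \<and> \<phi> t = r)" for r
  have \<tau>: "0 \<le> \<tau> r \<and> \<tau> r \<le> 1 \<and> \<phi> (\<tau> r) = r" if "0 \<le> r" "r \<le> d x y" for r
    unfolding \<tau>_def using ex[OF that] by (rule someI_ex)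
  have geod: "geod (g \<circ> \<tau>) (d x y)"
    unfolding geod_def using \<tau> iso gS d_nonneg[OF x y] by simp
  have gt: "(g \<circ> \<tau>) (\<phi> t) = g t" "0 \<le> \<phi> t" "\<phi> t \<le> d x y" if t: "0 \<le> t" "t \<le> 1" for t
  proof -
    show b: "0 \<le> \<phi> t" "\<phi> t \<le> d x y" using le[of t t] t d_nonneg[OF x gS] by (simp_all add: \<phi>_def)
    have "d (g (\<tau> (\<phi> t))) (g t) = 0" using iso[of "\<tau> (\<phi> t)" t] \<tau>[OF b] t by simp
    then show "(g \<circ> \<tau>) (\<phi> t) = g t" using d_eq_0[OF gS gS, of "\<tau> (\<phi> t)" t] \<tau>[OF b] t by simp
  qed
  have "(g \<circ> \<tau>) ` {0..d x y} = path_image g"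
  proof (intro equalityI subsetI)
    fix z assume "z \<in> (g \<circ> \<tau>) ` {0..d x y}"
    then show "z \<in> path_image g" using \<tau> by (auto simp: path_image_def)
  next
    fix z assume "z \<in> path_image g"
    then obtain t where "0 \<le> t" "t \<le> 1" "z = g t" by (auto simp: path_image_def)
    then show "z \<in> (g \<circ> \<tau>) ` {0..d x y}" using gt[of t] by (intro image_eqI[of _ _ "\<phi> t"]) auto
  qed
  then show "\<exists>\<gamma>. geod \<gamma> (d x y) \<and> \<gamma> 0 = x \<and> \<gamma> (d x y) = y \<and> \<gamma> ` {0..d x y} = path_image g"
    using geod gt(1)[of 0] gt(1)[of 1] by (intro exI[of _ "g \<circ> \<tau>"]) (simp add: \<phi>01 g01)
qed

end

section \<open>Convex polytopes\<close>

lemma stewart: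
  fixes x y m :: "'a::real_inner"
  shows "(norm (m - ((1 - \<theta>) *\<^sub>R x + \<theta> *\<^sub>R y)))\<^sup>2
    = (1 - \<theta>) * (dist x m)\<^sup>2 + \<theta> * (dist m y)\<^sup>2 - \<theta> * (1 - \<theta>) * (dist x y)\<^sup>2"
  unfolding dist_norm power2_norm_eq_inner
  by (simp add: inner_simps inner_commute algebra_simps)

text \<open>Stewart's identity turns the two distance bounds into a squared distance that is at most
  0.\<close>

lemma between_collinear:
  fixes x y m :: "'a::real_inner"
  assumes "dist x m \<le> \<tau>" "dist m y \<le> e - \<tau>" "dist x y = e" "0 \<le> \<tau>" "\<tau> \<le> e" "0 < e"
  shows "m = x + (\<tau> / e) *\<^sub>R (y - x)"
proof -
  define \<theta> where "\<theta> = \<tau> / e"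
  have \<theta>: "0 \<le> \<theta>" "\<theta> \<le> 1" "\<tau> = \<theta> * e" "e - \<tau> = (1 - \<theta>) * e"
    using assms(4-6) by (auto simp: \<theta>_def field_simps)
  have "(dist x m)\<^sup>2 \<le> (\<theta> * e)\<^sup>2" "(dist m y)\<^sup>2 \<le> ((1 - \<theta>) * e)\<^sup>2"
    using assms(1,2) \<theta> by (auto intro: power_mono)
  then have "(1 - \<theta>) * (dist x m)\<^sup>2 + \<theta> * (dist m y)\<^sup>2 \<le> (1 - \<theta>) * (\<theta> * e)\<^sup>2 + \<theta> * ((1 - \<theta>) * e)\<^sup>2"
    using \<theta> by (intro add_mono mult_left_mono) auto
  also have "\<dots> = \<theta> * (1 - \<theta>) * e\<^sup>2" by (simp add: power2_eq_square algebra_simps)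
  finally have "(norm (m - ((1 - \<theta>) *\<^sub>R x + \<theta> *\<^sub>R y)))\<^sup>2 \<le> 0" unfolding stewart assms(3) by simp
  then have "m = (1 - \<theta>) *\<^sub>R x + \<theta> *\<^sub>R y" by simp
  then show ?thesis by (simp add: \<theta>_def algebra_simps)
qed

text \<open>Vanishing of a first variation: a nonzero linear term would dominate the quadratic one
  for a small \<open>\<delta>\<close> of suitable sign.\<close>

lemma linear_part_zero:
  fixes a B :: real
  assumes "\<And>\<delta>. 0 \<le> \<delta> * a + \<delta>\<^sup>2 * B"
  shows "a = 0"
proof (rule ccontr)
  assume "a \<noteq> 0"
  define C where "C = \<bar>B\<bar> + 1"
  have C: "C > 0" "B \<le> C" by (auto simp: C_def)
  have "0 \<le> (- a / (2 * C)) * a + (- a / (2 * C))\<^sup>2 * B" by (rule assms)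
  also have "\<dots> \<le> (- a / (2 * C)) * a + (- a / (2 * C))\<^sup>2 * C" using C by (intro add_left_mono mult_left_mono) auto
  also have "\<dots> = - (a\<^sup>2 / (4 * C))" using C by (simp add: power2_eq_square field_simps)
  finally show False using C \<open>a \<noteq> 0\<close> by (simp add: field_simps)
qed

text \<open>First-order expansion of the norm with explicit quadratic error. Square roots are
  avoided by 2 A n \<le> A^2 + n^2 for the norm n.\<close>

lemma norm_unit_add_le:
  fixes u v :: "'a::real_inner"
  assumes A: "0 < A" and u: "norm u = 1"
  shows "norm (A *\<^sub>R u + \<delta> *\<^sub>R v) \<le> A + \<delta> * (v \<bullet> u) + \<delta>\<^sup>2 * (v \<bullet> v) / (2 * A)"
proof -
  let ?n = "norm (A *\<^sub>R u + \<delta> *\<^sub>R v)"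
  have "0 \<le> (A - ?n)\<^sup>2" by simp
  then have "?n * (2 * A) \<le> A\<^sup>2 + ?n\<^sup>2" by (simp add: power2_eq_square algebra_simps)
  also have "?n\<^sup>2 = A\<^sup>2 + 2 * A * \<delta> * (v \<bullet> u) + \<delta>\<^sup>2 * (v \<bullet> v)"
  proof -
    have "u \<bullet> u = 1" using u by (simp add: dot_square_norm)
    then show ?thesis unfolding power2_norm_eq_inner inner_add_left inner_add_right
      by (simp add: inner_commute[of u v] power2_eq_square)
  qed
  finally have "?n \<le> (A\<^sup>2 + (A\<^sup>2 + 2 * A * \<delta> * (v \<bullet> u) + \<delta>\<^sup>2 * (v \<bullet> v))) / (2 * A)"
    using A by (simp add: pos_le_divide_eq)
  also have "\<dots> = A + \<delta> * (v \<bullet> u) + \<delta>\<^sup>2 * (v \<bullet> v) / (2 * A)"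
    using A by (simp add: add_divide_distrib power2_eq_square)
  finally show ?thesis .
qed

lemma norm_unit_diff_le:
  fixes u v :: "'a::real_inner"
  assumes "0 < A" "norm u = 1"
  shows "norm (A *\<^sub>R u - \<delta> *\<^sub>R v) \<le> A - \<delta> * (v \<bullet> u) + \<delta>\<^sup>2 * (v \<bullet> v) / (2 * A)"
  using norm_unit_add_le[OF assms, of "- \<delta>" v] by simp

text \<open>The supremum of the initial segments on which \<open>Q\<close> holds is reached by
  \<open>lim\<close> and passed by \<open>step\<close>. This follows a shortest path through its
  kinks without first showing that they are finitely many.\<close>

lemma real_induction:
  fixes Q :: "real \<Rightarrow> bool"
  assumes ab: "a \<le> b" and base: "Q a"
    and step: "\<And>s. a \<le> s \<Longrightarrow> s < b \<Longrightarrow> Q s \<Longrightarrow> \<exists>e>0. \<forall>s'. s < s' \<and> s' < s + e \<longrightarrow> Q s'"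
    and lim: "\<And>s. a < s \<Longrightarrow> s \<le> b \<Longrightarrow> (\<And>s'. a \<le> s' \<Longrightarrow> s' < s \<Longrightarrow> Q s') \<Longrightarrow> Q s"
  shows "Q b"
proof -
  define A where "A = {s. a \<le> s \<and> s \<le> b \<and> (\<forall>s'. a \<le> s' \<and> s' \<le> s \<longrightarrow> Q s')}"
  define c where "c = Sup A"
  have aA: "a \<in> A" using ab base by (auto simp: A_def dest: order_antisym)
  have bdd: "bdd_above A" by (auto simp: A_def intro: bdd_aboveI)
  have c: "a \<le> c" unfolding c_def by (rule cSup_upper[OF aA bdd])
  have cb: "c \<le> b" unfolding c_def
  proof (rule cSup_least)
    show "A \<noteq> {}" using aA by blast
  qed (simp add: A_def)
  have below: "Q s'" if ay: "a \<le> s'" and sc: "s' < c" for s'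
  proof -
    have "A \<noteq> {}" using aA by blast
    then obtain s where "s \<in> A" "s' < s" using less_cSupD[OF _ sc[unfolded c_def]] by blast
    then show ?thesis using ay by (simp add: A_def)
  qed
  have Qc: "Q c"
  proof (cases "a = c")
    case False
    then have "a < c" using c by simp
    then show ?thesis using cb below by (rule lim)
  qed (use base in simp)
  show ?thesis
  proof (cases "c = b")
    case False
    then have "c < b" using cb by simp
    from step[OF c this Qc] obtain e where e: "e > 0" "\<forall>s'. c < s' \<and> s' < c + e \<longrightarrow> Q s'" by blast
    define s where "s = min b (c + e / 2)"
    have s: "c < s" "s \<le> b" "s < c + e" using \<open>c < b\<close> e(1) by (auto simp: s_def)
    have "Q s'" if "a \<le> s'" "s' \<le> s" for s'
    proof (cases s' c rule: linorder_cases)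
      case less
      with that(1) show ?thesis by (rule below)
    next
      case greater
      then show ?thesis using e(2) that(2) s(3) by simp
    qed (use Qc in simp)
    then have "s \<in> A" using s c unfolding A_def by simp
    then have "s \<le> c" unfolding c_def by (rule cSup_upper[OF _ bdd])
    then show ?thesis using s by simp
  qed (use Qc in simp)
qed

text \<open>At every interior point \<open>h\<close> lies locally below a line touching it, as a
  concave function does, and \<open>c0\<close> bounds its initial slope. From a counterexample a
  linear and a quadratic penalty are subtracted; the result has an interior minimum, where its
  second difference is negative by the support condition.\<close>

lemma upper_support_bound:
  fixes h :: "real \<Rightarrow> real"
  assumes l: "0 < l" and cont: "continuous_on {0..l} h"
    and zero: "\<exists>e>0. e \<le> l \<and> (\<forall>\<tau>\<in>{0..e}. h \<tau> \<le> h 0 + c0 * \<tau>)"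
    and support: "\<And>t. 0 < t \<Longrightarrow> t < l \<Longrightarrow>
      \<exists>c. \<exists>e>0. e \<le> t \<and> t + e \<le> l \<and> (\<forall>\<tau>\<in>{0..e}. h (t + \<tau>) \<le> h t + c * \<tau> \<and> h (t - \<tau>) \<le> h t - c * \<tau>)"
  shows "h l \<le> h 0 + c0 * l"
proof (rule ccontr)
  assume "\<not> h l \<le> h 0 + c0 * l"
  define k where "k = h l - h 0 - c0 * l"
  have k: "k > 0" using \<open>\<not> _\<close> by (simp add: k_def)
  \<comment> \<open>At \<open>l\<close> the two penalties consume k/2 and k/4, so \<open>m l\<close>
    stays positive.\<close>
  define \<beta> where "\<beta> = k / (2 * l)"
  define \<eta> where "\<eta> = k / (4 * l\<^sup>2)"
  have pos: "\<beta> > 0" "\<eta> > 0" using k l by (auto simp: \<beta>_def \<eta>_def)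
  define m where "m t = h t - h 0 - c0 * t - \<beta> * t - \<eta> * t\<^sup>2" for t
  have "\<beta> * l = k / 2" "\<eta> * l\<^sup>2 = k / 4" using l by (auto simp: \<beta>_def \<eta>_def)
  then have ml: "m l > 0" using k by (simp add: m_def k_def)
  have m0: "m 0 = 0" by (simp add: m_def)
  obtain e where e: "e > 0" "e \<le> l" "\<forall>\<tau>\<in>{0..e}. h \<tau> \<le> h 0 + c0 * \<tau>" using zero by blast
  have "h e \<le> h 0 + c0 * e" using e by simp
  moreover have "0 < \<beta> * e" "0 < \<eta> * e\<^sup>2" using pos e by auto
  ultimately have me: "m e < 0" unfolding m_def by linarith
  have "continuous_on {0..l} m" unfolding m_def by (intro continuous_intros cont)
  then obtain t where t: "t \<in> {0..l}" "\<forall>s\<in>{0..l}. m t \<le> m s"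
    using continuous_attains_inf[of "{0..l}" m] l by auto
  have "m t \<le> m e" using t(2) e(1,2) by simp
  then have "m t < 0" using me by simp
  then have t0: "0 < t" "t < l" using t(1) m0 ml by (cases "t = 0"; cases "t = l"; force)+
  obtain c e where e: "e > 0" "e \<le> t" "t + e \<le> l"
    "\<forall>\<tau>\<in>{0..e}. h (t + \<tau>) \<le> h t + c * \<tau> \<and> h (t - \<tau>) \<le> h t - c * \<tau>"
    using support[OF t0] by blast
  have "h (t + e) \<le> h t + c * e" "h (t - e) \<le> h t - c * e" using e by auto
  then have "h (t + e) + h (t - e) \<le> 2 * h t" by linarith
  moreover have "m (t + e) + m (t - e) - 2 * m t = h (t + e) + h (t - e) - 2 * h t - 2 * (\<eta> * e\<^sup>2)"
    unfolding m_def by (simp add: power2_eq_square algebra_simps)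
  moreover have "0 < \<eta> * e\<^sup>2" using pos e by auto
  moreover have "m t \<le> m (t + e)" "m t \<le> m (t - e)" using t e t0 by auto
  ultimately show False by linarith
qed

text \<open>The coefficients solve the Gram system of two vectors, whose determinant is 1 -
  g^2.\<close>

lemma gram_projection:
  fixes n1 n2 z :: "'a::real_inner"
  assumes "norm n1 = 1" "norm n2 = 1" "\<bar>n1 \<bullet> n2\<bar> < 1"
  shows "\<exists>a b. n1 \<bullet> (z - a *\<^sub>R n1 - b *\<^sub>R n2) = 0 \<and> n2 \<bullet> (z - a *\<^sub>R n1 - b *\<^sub>R n2) = 0"
proof -
  define g where "g = n1 \<bullet> n2"
  define D where "D = 1 - g\<^sup>2"
  have D: "D > 0" using assms(3) by (simp add: D_def g_def abs_square_less_1)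
  have nn: "n1 \<bullet> n1 = 1" "n2 \<bullet> n2 = 1" using assms(1,2) by (simp_all add: dot_square_norm)
  define p q where "p = n1 \<bullet> z" and "q = n2 \<bullet> z"
  have "p - (p - g * q) / D - (q - g * p) / D * g = 0" "q - (p - g * q) / D * g - (q - g * p) / D = 0"
    using D by (simp_all add: field_simps) (simp_all add: D_def power2_eq_square algebra_simps)
  then show ?thesis
    by (intro exI[of _ "(p - g * q) / D"] exI[of _ "(q - g * p) / D"])
       (simp add: inner_diff_right nn inner_commute[of n2 n1] flip: g_def p_def q_def)
qed

lemma unit_inner_less_1:
  fixes n m :: "'a::real_inner"
  assumes "norm n = 1" "norm m = 1" "n \<noteq> m"
  shows "n \<bullet> m < 1"
proof -
  have "0 < (norm (n - m))\<^sup>2" using assms(3) by simp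
  also have "(norm (n - m))\<^sup>2 = 2 - 2 * (n \<bullet> m)"
    using assms(1,2) unfolding power2_norm_eq_inner norm_eq_1
    by (simp add: inner_diff inner_commute)
  finally show ?thesis by simp
qed

section \<open>Polytopes given by finitely many unit normals\<close>

locale polytope_body = convex_body +
  fixes H :: "((real^3) \<times> real) set"
  assumes finite_H: "finite H" and unit_H: "(n, b) \<in> H \<Longrightarrow> norm n = 1"
    and K_eq: "K = {y. \<forall>(n, b)\<in>H. n \<bullet> y \<le> b}"
begin

text \<open>The constraints that are active at \<open>x\<close>. As \<open>H\<close> may contain
  redundant half-spaces, the plane of an active normal can meet the body in less than a facet; it
  still supports the body.\<close>

definition act :: "real^3 \<Rightarrow> real^3 \<Rightarrow> bool" where
  "act x n \<longleftrightarrow> (n, n \<bullet> x) \<in> H"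

lemma act_le: "act x n \<Longrightarrow> y \<in> K \<Longrightarrow> n \<bullet> y \<le> n \<bullet> x"
  using K_eq by (auto simp: act_def)

lemma act_norm: "act x n \<Longrightarrow> norm n = 1"
  unfolding act_def by (rule unit_H)

lemma act_nonzero: "act x n \<Longrightarrow> n \<noteq> 0"
  using act_norm by force

lemma act_W: "act x n \<Longrightarrow> n \<bullet> x \<le> n \<bullet> z \<Longrightarrow> z \<in> W"
  by (rule support_in_W[OF act_le act_nonzero])

lemma act_segment_W: "act x n \<Longrightarrow> n \<bullet> x \<le> n \<bullet> y \<Longrightarrow> n \<bullet> x \<le> n \<bullet> z \<Longrightarrow> closed_segment y z \<subseteq> W"
  by (rule support_segment_W[OF act_le act_nonzero])

lemma act_pdist: "act x n \<Longrightarrow> n \<bullet> x \<le> n \<bullet> y \<Longrightarrow> n \<bullet> x \<le> n \<bullet> z \<Longrightarrow> pdist W y z \<le> ereal (dist y z)"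
  by (rule pdist_segment[OF act_segment_W])

lemma act_S: "x \<in> K \<Longrightarrow> act x n \<Longrightarrow> x \<in> S"
  using act_W[of x n x] by (simp add: S_eq)

lemma interior_act: "act x n \<Longrightarrow> y \<in> interior K \<Longrightarrow> n \<bullet> y < n \<bullet> x"
  using act_W[of x n y] by force

lemma S_act:
  assumes "x \<in> S" shows "\<exists>n. act x n"
proof (rule ccontr)
  assume *: "\<not> ?thesis"
  define U where "U = (\<Inter>h\<in>H. {y. fst h \<bullet> y < snd h})"
  have "open U" unfolding U_def using finite_H by (intro open_INT) (auto intro: open_halfspace_lt)
  moreover have "U \<subseteq> K" unfolding U_def K_eq by force
  moreover have "x \<in> U"
    unfolding U_def
  proof
    fix h assume h: "h \<in> H"
    have "x \<in> K" using assms S_subset_K by blast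
    then have "fst h \<bullet> x \<le> snd h" using h K_eq by force
    moreover have "fst h \<bullet> x \<noteq> snd h" using * h unfolding act_def by (metis prod.collapse)
    ultimately show "x \<in> {y. fst h \<bullet> y < snd h}" by simp
  qed
  ultimately have "x \<in> interior K" by (meson interior_maximal subsetD)
  then show False using assms by (simp add: S_eq)
qed

text \<open>One of the finitely many planes contains the path at times accumulating at
  \<open>t\<close> from the right, hence also at \<open>t\<close>. The segment in that plane from
  the path at \<open>t\<close> to one of these later points lies in the surface, so its length is
  the intrinsic distance, and \<open>between_collinear\<close> forces the path to follow it.\<close>

lemma local_right:
  assumes g: "geod \<gamma> l" and t: "0 \<le> t" "t < l"
  shows "\<exists>e>0. \<exists>u n. t + e \<le> l \<and> norm u = 1 \<and> act (\<gamma> t) n \<and> n \<bullet> u = 0 \<and>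
      (\<forall>\<tau>\<in>{0..e}. \<gamma> (t + \<tau>) = \<gamma> t + \<tau> *\<^sub>R u)"
proof -
  define T where "T k = t + (l - t) / Suc k" for k :: nat
  have T: "t < T k" "T k \<le> l" for k
  proof -
    have "(l - t) / Suc k \<le> (l - t) / 1" using t by (intro divide_left_mono) auto
    then show "t < T k" "T k \<le> l" using t by (auto simp: T_def)
  qed
  have TS: "\<gamma> (T k) \<in> S" for k using T[of k] t by (intro geod_S[OF g]) auto
  have "\<exists>n. act (\<gamma> (T k)) n" for k using S_act[OF TS] .
  then obtain N where N: "\<And>k. act (\<gamma> (T k)) (N k)" by metis
  \<comment> \<open>Pairs of normal and offset are put into the pigeonholes, so that infinitely many
    times share a plane and not merely a normal.\<close>
  define f where "f k = (N k, N k \<bullet> \<gamma> (T k))" for k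
  have "range f \<subseteq> H" using N by (auto simp: f_def act_def)
  then obtain k0 where inf: "infinite {k. f k = f k0}"
    using pigeonhole_infinite[of UNIV f] finite_subset[OF _ finite_H] by auto
  define n b where "n = N k0" and "b = n \<bullet> \<gamma> (T k0)"
  have nb: "(n, b) \<in> H" using N[of k0] by (simp add: act_def n_def b_def)
  have nn: "norm n = 1" using nb by (rule unit_H)
  have "n \<bullet> \<gamma> t = b"
  proof (rule ccontr)
    assume "n \<bullet> \<gamma> t \<noteq> b"
    define \<delta> where "\<delta> = \<bar>n \<bullet> \<gamma> t - b\<bar>"
    have "\<delta> > 0" using \<open>n \<bullet> \<gamma> t \<noteq> b\<close> by (simp add: \<delta>_def)
    obtain j :: nat where j: "(l - t) / \<delta> < j" using reals_Archimedean2 by blast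
    obtain k where k: "k > j" "f k = f k0" using inf unfolding infinite_nat_iff_unbounded by blast
    then have "N k = N k0" and *: "N k \<bullet> \<gamma> (T k) = N k0 \<bullet> \<gamma> (T k0)" by (auto simp: f_def)
    from * have "n \<bullet> \<gamma> (T k) = b" unfolding \<open>N k = N k0\<close> n_def b_def .
    then have "\<delta> = \<bar>n \<bullet> (\<gamma> t - \<gamma> (T k))\<bar>" by (simp add: \<delta>_def inner_diff_right)
    also have "\<dots> \<le> norm n * norm (\<gamma> t - \<gamma> (T k))" by (rule Cauchy_Schwarz_ineq2)
    also have "\<dots> \<le> T k - t"
      using geod_dist[OF g, of t "T k"] T[of k] t nn by (simp add: dist_norm)
    also have "\<dots> = (l - t) / Suc k" by (simp add: T_def)
    finally have "\<delta> * Suc k \<le> l - t" by (simp add: pos_le_divide_eq)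
    moreover have "l - t < \<delta> * j" using j \<open>\<delta> > 0\<close> by (simp add: pos_divide_less_eq mult.commute)
    moreover have "\<delta> * j \<le> \<delta> * Suc k" using k(1) \<open>\<delta> > 0\<close> by (intro mult_left_mono) auto
    ultimately show False by linarith
  qed
  then have act: "act (\<gamma> t) n" using nb by (simp add: act_def)
  define e where "e = T k0 - t"
  have e: "e > 0" "t + e = T k0" "t + e \<le> l" using T[of k0] by (auto simp: e_def)
  define y where "y = \<gamma> (t + e)"
  have xy: "\<gamma> t \<in> S" "y \<in> S" using t e by (auto simp: y_def intro: geod_S[OF g])
  have ny: "n \<bullet> y = b" using e(2) by (simp add: y_def b_def)
  have "closed_segment (\<gamma> t) y \<subseteq> S"
  proof
    fix z assume z: "z \<in> closed_segment (\<gamma> t) y"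
    have "z \<in> K" using closed_segment_subset[OF _ _ convex_K] xy S_subset_K z by blast
    moreover have "n \<bullet> z = n \<bullet> \<gamma> t" using segment_hyperplane[OF _ _ z] \<open>n \<bullet> \<gamma> t = b\<close> ny by simp
    then have "act z n" using act by (simp add: act_def)
    ultimately show "z \<in> S" by (rule act_S)
  qed
  then have "dist (\<gamma> t) y = d (\<gamma> t) y" by (simp add: d_segment)
  also have "\<dots> = e" using geod_d[OF g, of t "t + e"] t e by (simp add: y_def)
  finally have dist: "dist (\<gamma> t) y = e" .
  define u where "u = (1 / e) *\<^sub>R (y - \<gamma> t)"
  have "\<gamma> (t + \<tau>) = \<gamma> t + \<tau> *\<^sub>R u" if "\<tau> \<in> {0..e}" for \<tau>
  proof -
    have "\<gamma> (t + \<tau>) = \<gamma> t + (\<tau> / e) *\<^sub>R (y - \<gamma> t)"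
      using geod_dist[OF g, of t "t + \<tau>"] geod_dist[OF g, of "t + \<tau>" "t + e"] that t e dist
      by (intro between_collinear) (auto simp: y_def)
    then show ?thesis by (simp add: u_def)
  qed
  moreover have "norm u = 1" using dist e by (simp add: u_def dist_norm norm_minus_commute)
  moreover have "n \<bullet> u = 0" using ny \<open>n \<bullet> \<gamma> t = b\<close> by (simp add: u_def inner_diff_right)
  ultimately show ?thesis using e act by blast
qed

lemma local_left:
  assumes g: "geod \<gamma> l" and t: "0 < t" "t \<le> l"
  shows "\<exists>e>0. \<exists>u n. e \<le> t \<and> norm u = 1 \<and> act (\<gamma> t) n \<and> n \<bullet> u = 0 \<and>
      (\<forall>\<tau>\<in>{0..e}. \<gamma> (t - \<tau>) = \<gamma> t - \<tau> *\<^sub>R u)"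
proof -
  obtain e u n where *: "e > 0" "l - t + e \<le> l" "norm u = 1" "act (\<gamma> (l - (l - t))) n" "n \<bullet> u = 0"
    "\<And>\<tau>. \<tau> \<in> {0..e} \<Longrightarrow> \<gamma> (l - (l - t + \<tau>)) = \<gamma> (l - (l - t)) + \<tau> *\<^sub>R u"
    using local_right[OF geod_reverse[OF g], of "l - t"] t by auto
  have "\<gamma> (t - \<tau>) = \<gamma> t - \<tau> *\<^sub>R (- u)" if "\<tau> \<in> {0..e}" for \<tau> using *(6)[OF that] by (simp add: algebra_simps)
  then show ?thesis using * by (intro exI[of _ e] conjI exI[of _ "- u"] exI[of _ n] ballI) auto
qed

end

text \<open>A point where a shortest path arrives with direction \<open>u1\<close> inside the facet plane with normal
  \<open>n1\<close> and leaves with direction \<open>u2\<close> inside the facet plane with normal \<open>n2\<close>.\<close>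
locale kink = polytope_body +
  fixes x u1 u2 n1 n2 :: "real^3" and e :: real
  assumes xK: "x \<in> K" and act1: "act x n1" and act2: "act x n2"
    and norm_u1: "norm u1 = 1" and norm_u2: "norm u2 = 1"
    and perp1: "n1 \<bullet> u1 = 0" and perp2: "n2 \<bullet> u2 = 0"
    and e_pos: "0 < e" and in1: "x - e *\<^sub>R u1 \<in> K" and in2: "x + e *\<^sub>R u2 \<in> K"
    and shortest: "ereal (2 * e) \<le> pdist W (x - e *\<^sub>R u1) (x + e *\<^sub>R u2)"
begin

lemma reversed: "kink K H x (- u2) (- u1) n2 n1 e"
  using xK act1 act2 norm_u1 norm_u2 perp1 perp2 e_pos in1 in2 shortest
  by unfold_locales (simp_all add: pdist_commute)

lemma act_dir:
  assumes "act x n" shows "0 \<le> n \<bullet> u1" "n \<bullet> u2 \<le> 0"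
  using act_le[OF assms in1] act_le[OF assms in2] e_pos
  by (simp_all add: inner_diff_right inner_add_right zero_le_mult_iff mult_le_0_iff)

lemma unit_squares: "u1 \<bullet> u1 = 1" "u2 \<bullet> u2 = 1" "n1 \<bullet> n1 = 1" "n2 \<bullet> n2 = 1"
  using norm_u1 norm_u2 act_norm[OF act1] act_norm[OF act2] by (simp_all add: dot_square_norm)

text \<open>Pushing the apex along a vector contained in both facet planes does not shorten the path.\<close>
lemma first_variation:
  assumes v: "n1 \<bullet> v = 0" "n2 \<bullet> v = 0"
  shows "v \<bullet> u1 = v \<bullet> u2"
proof -
  have "0 \<le> \<delta> * (v \<bullet> u1 - v \<bullet> u2) + \<delta>\<^sup>2 * ((v \<bullet> v) / e)" for \<delta>
  proof -
    have "ereal (2 * e) \<le> pdist W (x - e *\<^sub>R u1) (x + \<delta> *\<^sub>R v) + pdist W (x + \<delta> *\<^sub>R v) (x + e *\<^sub>R u2)"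
      by (rule order_trans[OF shortest pdist_triangle])
    also have "\<dots> \<le> ereal (dist (x - e *\<^sub>R u1) (x + \<delta> *\<^sub>R v)) + ereal (dist (x + \<delta> *\<^sub>R v) (x + e *\<^sub>R u2))"
      using v perp1 perp2
      by (intro add_mono act_pdist[OF act1] act_pdist[OF act2]) (simp_all add: inner_add_right inner_diff_right)
    finally have le: "2 * e \<le> dist (x - e *\<^sub>R u1) (x + \<delta> *\<^sub>R v) + dist (x + \<delta> *\<^sub>R v) (x + e *\<^sub>R u2)"
      by simp
    have "dist (x - e *\<^sub>R u1) (x + \<delta> *\<^sub>R v) = norm (e *\<^sub>R u1 + \<delta> *\<^sub>R v)"
      by (subst dist_commute) (simp add: dist_norm algebra_simps)
    moreover have "dist (x + \<delta> *\<^sub>R v) (x + e *\<^sub>R u2) = norm (e *\<^sub>R u2 - \<delta> *\<^sub>R v)"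
      by (subst dist_commute) (simp add: dist_norm algebra_simps)
    ultimately have "2 * e \<le> norm (e *\<^sub>R u1 + \<delta> *\<^sub>R v) + norm (e *\<^sub>R u2 - \<delta> *\<^sub>R v)" using le by simp
    also have "\<dots> \<le> (e + \<delta> * (v \<bullet> u1) + \<delta>\<^sup>2 * (v \<bullet> v) / (2 * e)) + (e - \<delta> * (v \<bullet> u2) + \<delta>\<^sup>2 * (v \<bullet> v) / (2 * e))"
      by (intro add_mono norm_unit_add_le norm_unit_diff_le e_pos norm_u1 norm_u2)
    also have "\<dots> = 2 * e + (\<delta> * (v \<bullet> u1 - v \<bullet> u2) + \<delta>\<^sup>2 * ((v \<bullet> v) / e))"
      by (simp add: algebra_simps)
    finally show ?thesis by simp
  qed
  from linear_part_zero[OF this] show ?thesis by simp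
qed

lemma normals_not_opposite: "n1 \<noteq> - n2"
proof
  assume *: "n1 = - n2"
  obtain w where "w \<in> interior K" using interior_K by auto
  from interior_act[OF act1 this] interior_act[OF act2 this] show False unfolding * by simp
qed

lemma inner_normals: "- 1 < n1 \<bullet> n2"
proof -
  have "norm (- n2) = 1" using act_norm[OF act2] by simp
  from unit_inner_less_1[OF act_norm[OF act1] this normals_not_opposite]
  show ?thesis unfolding inner_minus_right by linarith
qed

text \<open>This is straightness after unfolding the two planes. The first variation forces
  \<open>u1 - u2\<close> into the span of the normals; equal lengths of \<open>u1\<close> and
  \<open>u2\<close> make its coefficients equal up to sign; the signs are fixed because -
  \<open>u1\<close> and \<open>u2\<close> point into the body.\<close>

lemma turn: "\<exists>\<alpha>\<ge>0. u1 - u2 = \<alpha> *\<^sub>R (n1 + n2)"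
proof (cases "n1 = n2")
  case True
  have "n1 \<bullet> (u1 - u2) = 0" "n2 \<bullet> (u1 - u2) = 0" using perp1 perp2 True by (simp_all add: inner_diff_right)
  from first_variation[OF this] have "(u1 - u2) \<bullet> (u1 - u2) = 0" by (simp add: inner_diff_right)
  then show ?thesis by (intro exI[of _ 0]) simp
next
  case False
  define g where "g = n1 \<bullet> n2"
  have g: "\<bar>g\<bar> < 1"
    using unit_inner_less_1[OF act_norm[OF act1] act_norm[OF act2] False] inner_normals by (simp add: g_def)
  obtain a b where ab: "n1 \<bullet> (u1 - u2 - a *\<^sub>R n1 - b *\<^sub>R n2) = 0" "n2 \<bullet> (u1 - u2 - a *\<^sub>R n1 - b *\<^sub>R n2) = 0"
    using gram_projection[OF act_norm[OF act1] act_norm[OF act2] g[unfolded g_def], of "u1 - u2"] by blast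
  define v where "v = u1 - u2 - a *\<^sub>R n1 - b *\<^sub>R n2"
  have "v \<bullet> u1 = v \<bullet> u2" using ab by (intro first_variation) (simp_all add: v_def)
  moreover have "v \<bullet> v = v \<bullet> (u1 - u2 - a *\<^sub>R n1 - b *\<^sub>R n2)" by (simp only: v_def)
  then have "v \<bullet> v = v \<bullet> u1 - v \<bullet> u2 - a * (n1 \<bullet> v) - b * (n2 \<bullet> v)"
    by (simp add: inner_diff_right inner_commute)
  ultimately have "v \<bullet> v = 0" using ab by (simp flip: v_def)
  then have "v = 0" by simp
  then have eq: "u1 - u2 = a *\<^sub>R n1 + b *\<^sub>R n2" by (simp add: v_def algebra_simps)
  define p q where "p = n1 \<bullet> (u1 - u2)" and "q = n2 \<bullet> (u1 - u2)"
  have pq: "p = a + b * g" "q = a * g + b"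
    unfolding p_def q_def eq by (simp_all add: inner_add_right unit_squares g_def inner_commute)
  have pq': "p = - (n1 \<bullet> u2)" "q = n2 \<bullet> u1" by (simp_all add: p_def q_def inner_diff_right perp1 perp2)
  then have "0 \<le> p" "0 \<le> q" using act_dir[OF act1] act_dir[OF act2] by simp_all
  have "(u1 - u2) \<bullet> (u1 + u2) = 0" by (simp add: inner_simps unit_squares inner_commute)
  then have "- a * p + b * q = 0"
    unfolding eq by (simp add: inner_simps perp1 perp2 pq')
  then have "a\<^sup>2 = b\<^sup>2" unfolding pq by (simp add: power2_eq_square algebra_simps)
  then have "a = b \<or> a = - b" by (simp add: power2_eq_iff)
  then have "a = b"
  proof
    assume "a = - b"
    then have "p = - (b * (1 - g))" "q = b * (1 - g)" using pq by (simp_all add: algebra_simps)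
    then have "b * (1 - g) = 0" using \<open>0 \<le> p\<close> \<open>0 \<le> q\<close> by linarith
    moreover have "1 - g \<noteq> 0" using g by linarith
    ultimately have "b = 0" by simp
    then show ?thesis using \<open>a = - b\<close> by simp
  qed simp
  then have "p = a * (1 + g)" using pq by (simp add: algebra_simps)
  moreover have "0 < 1 + g" using g by linarith
  ultimately have "0 \<le> a" using mult_neg_pos[of a "1 + g"] \<open>0 \<le> p\<close> by linarith
  then show ?thesis using eq \<open>a = b\<close> by (intro exI[of _ a]) (simp add: scaleR_add_right)
qed

text \<open>If the path really turns and \<open>n\<close> were not orthogonal to the common edge direction, a detour around
  the apex on the outer side of that third facet would be shorter.\<close>
lemma cut_corner:
  assumes ne: "u1 \<noteq> u2" and n: "act x n" and v: "n1 \<bullet> v = 0" "n2 \<bullet> v = 0"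
  shows "n \<bullet> v = 0"
proof -
  have shorter: False if pos: "n \<bullet> v > 0" and v: "n1 \<bullet> v = 0" "n2 \<bullet> v = 0" for v
  proof -
    define k where "k = n \<bullet> v"
    have k: "k > 0" using pos by (simp add: k_def)
    have nn: "norm n = 1" using n by (rule act_norm)
    have nu: "\<bar>n \<bullet> u1\<bar> \<le> 1" "\<bar>n \<bullet> u2\<bar> \<le> 1"
      using Cauchy_Schwarz_ineq2[of n u1] Cauchy_Schwarz_ineq2[of n u2] by (simp_all add: nn norm_u1 norm_u2)
    define c where "c = v \<bullet> u1"
    have c: "v \<bullet> u1 = c" "v \<bullet> u2 = c" using first_variation[OF v] by (simp_all add: c_def)
    define s where "s = norm (u1 + u2)"
    have "s\<^sup>2 < 2\<^sup>2"
    proof -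
      have "s\<^sup>2 = 4 - (norm (u1 - u2))\<^sup>2"
        by (simp add: s_def power2_norm_eq_inner inner_simps unit_squares inner_commute)
      moreover have "0 < (norm (u1 - u2))\<^sup>2" using ne by simp
      ultimately show ?thesis by simp
    qed
    then have s: "s < 2" by (rule power_less_imp_less_base) simp
    have bound: "k * (2 - s) \<le> \<delta> * (2 * (v \<bullet> v) / e)" if \<delta>: "\<delta> > 0" "\<delta> * k \<le> e / 2" for \<delta>
    proof -
      define A where "A = e - \<delta> * k"
      have A: "A > 0" "A \<ge> e / 2" using \<delta> e_pos by (auto simp: A_def)
      \<comment> \<open>The detour runs in the plane of \<open>n1\<close> to \<open>?y\<close>, on
        the outer side of \<open>n\<close> to \<open>?z\<close>, and in the plane of
        \<open>n2\<close> to the end. The multiple \<open>k = n \<bullet> v\<close> is large enough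
        to bring both points to the outer side, since \<open>n\<close> has product at most 1 in
        absolute value with \<open>u1\<close> and \<open>u2\<close>. The gain is of first order in
        \<open>\<delta>\<close>, the loss of second order.\<close>
      let ?y = "x + \<delta> *\<^sub>R (v - k *\<^sub>R u1)" and ?z = "x + \<delta> *\<^sub>R (v + k *\<^sub>R u2)"
      have ny: "n \<bullet> x \<le> n \<bullet> ?y" "n \<bullet> x \<le> n \<bullet> ?z"
      proof -
        have "k * (n \<bullet> u1) \<le> k * 1" by (rule mult_left_mono) (use nu k in linarith)+
        moreover have "k * (- (n \<bullet> u2)) \<le> k * 1" by (rule mult_left_mono) (use nu k in linarith)+
        ultimately have "0 \<le> n \<bullet> (v - k *\<^sub>R u1)" "0 \<le> n \<bullet> (v + k *\<^sub>R u2)"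
          by (simp_all add: inner_simps flip: k_def)
        then have "0 \<le> \<delta> * (n \<bullet> (v - k *\<^sub>R u1))" "0 \<le> \<delta> * (n \<bullet> (v + k *\<^sub>R u2))" using \<delta> by simp_all
        then show "n \<bullet> x \<le> n \<bullet> ?y" "n \<bullet> x \<le> n \<bullet> ?z" by (simp_all only: inner_add_right inner_scaleR_right)
      qed
      have "ereal (2 * e) \<le> pdist W (x - e *\<^sub>R u1) ?y + (pdist W ?y ?z + pdist W ?z (x + e *\<^sub>R u2))"
        by (rule order_trans[OF shortest order_trans[OF pdist_triangle add_left_mono[OF pdist_triangle]]])
      also have "\<dots> \<le> ereal (dist (x - e *\<^sub>R u1) ?y) + (ereal (dist ?y ?z) + ereal (dist ?z (x + e *\<^sub>R u2)))"
        using v perp1 perp2 ny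
        by (intro add_mono act_pdist[OF act1] act_pdist[OF act2] act_pdist[OF n])
           (simp_all add: inner_add_right inner_diff_right)
      finally have le: "2 * e \<le> dist (x - e *\<^sub>R u1) ?y + (dist ?y ?z + dist ?z (x + e *\<^sub>R u2))" by simp
      have d1: "dist (x - e *\<^sub>R u1) ?y = norm (A *\<^sub>R u1 + \<delta> *\<^sub>R v)"
        by (subst dist_commute) (simp add: dist_norm A_def algebra_simps)
      have d3: "dist ?z (x + e *\<^sub>R u2) = norm (A *\<^sub>R u2 - \<delta> *\<^sub>R v)"
        by (subst dist_commute) (simp add: dist_norm A_def algebra_simps)
      have "?z - ?y = (\<delta> * k) *\<^sub>R (u1 + u2)" by (simp add: algebra_simps)
      then have d2: "dist ?y ?z = \<delta> * k * s"
        using \<delta> k by (subst dist_commute) (simp add: dist_norm s_def)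
      have "2 * e \<le> \<delta> * k * s + (norm (A *\<^sub>R u1 + \<delta> *\<^sub>R v) + norm (A *\<^sub>R u2 - \<delta> *\<^sub>R v))"
        using le unfolding d1 d2 d3 by simp
      also have "\<dots> \<le> \<delta> * k * s + ((A + \<delta> * (v \<bullet> u1) + \<delta>\<^sup>2 * (v \<bullet> v) / (2 * A)) + (A - \<delta> * (v \<bullet> u2) + \<delta>\<^sup>2 * (v \<bullet> v) / (2 * A)))"
        by (intro add_left_mono add_mono norm_unit_add_le norm_unit_diff_le A(1) norm_u1 norm_u2)
      also have "\<dots> = \<delta> * k * s + 2 * A + \<delta>\<^sup>2 * (v \<bullet> v) / A" by (simp add: c)
      also have "\<dots> \<le> \<delta> * k * s + 2 * A + \<delta>\<^sup>2 * (v \<bullet> v) / (e / 2)"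
        by (intro add_left_mono divide_left_mono mult_nonneg_nonneg mult_pos_pos)
           (use A e_pos in simp_all)
      finally have "\<delta> * (k * (2 - s)) \<le> \<delta> * (\<delta> * (2 * (v \<bullet> v) / e))"
        by (simp add: A_def algebra_simps power2_eq_square)
      then show ?thesis using \<delta>(1) by (rule mult_left_le_imp_le)
    qed
    define V where "V = 2 * (v \<bullet> v) / e"
    define C where "C = V + 1"
    have "V \<ge> 0" using e_pos by (simp add: V_def)
    then have V: "V \<ge> 0" "C > 0" "V \<le> C" by (simp_all add: C_def)
    \<comment> \<open>The first bound leaves at least half of \<open>e\<close> in \<open>A\<close>;
      the second keeps the quadratic loss below half of the linear gain.\<close>
    define \<delta> where "\<delta> = min (e / (2 * k)) (k * (2 - s) / (2 * C))"
    have "\<delta> > 0" using e_pos k s V by (simp add: \<delta>_def)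
    moreover have "\<delta> * k \<le> e / (2 * k) * k" using k by (intro mult_right_mono) (simp_all add: \<delta>_def)
    then have "\<delta> * k \<le> e / 2" using k by simp
    ultimately have "k * (2 - s) \<le> \<delta> * V" unfolding V_def by (rule bound)
    also have "\<dots> \<le> k * (2 - s) / (2 * C) * C"
      using V \<open>\<delta> > 0\<close> k s by (intro mult_mono) (simp_all add: \<delta>_def)
    also have "\<dots> = k * (2 - s) / 2" using V by simp
    finally have "k * (2 - s) \<le> 0" by simp
    moreover have "0 < k * (2 - s)" using k s by (intro mult_pos_pos) auto
    ultimately show False by linarith
  qed
  from shorter[of v] have "\<not> 0 < n \<bullet> v" using v by blast
  moreover have "n1 \<bullet> - v = 0" "n2 \<bullet> - v = 0" using v by simp_all
  with shorter[of "- v"] have "\<not> 0 < n \<bullet> (- v)" by blast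
  ultimately show ?thesis by simp
qed

text \<open>Milka's argument: project the path onto the half-space of \<open>n1\<close>; when it first meets the plane of
  \<open>n2\<close>, the point \<open>x + r u2\<close> is at least as close to the meeting point as \<open>x + r u1\<close>.\<close>
lemma milka:
  assumes r: "0 \<le> r" and q: "q \<in> W" "n1 \<bullet> q \<le> n1 \<bullet> x" "n2 \<bullet> q \<le> n2 \<bullet> x"
  shows "pdist W (x + r *\<^sub>R u2) q \<le> pdist W (x + r *\<^sub>R u1) q"
proof -
  obtain \<alpha> where \<alpha>: "\<alpha> \<ge> 0" "u1 - u2 = \<alpha> *\<^sub>R (n1 + n2)" using turn by blast
  define C where "C = {y. n1 \<bullet> y \<le> n1 \<bullet> x}"
  have C: "convex C" "closed C" "C \<noteq> {}"
    by (auto simp: C_def convex_halfspace_le closed_halfspace_le intro: exI[of _ x])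
  have n1: "n1 \<noteq> 0" using act1 by (rule act_nonzero)
  have intC: "interior C = {y. n1 \<bullet> y < n1 \<bullet> x}" unfolding C_def using n1 by (rule interior_halfspace_le)
  have "x - n1 \<in> interior C" unfolding intC using n1 by (simp add: inner_diff_right)
  then have intC_ne: "interior C \<noteq> {}" by blast
  define f where "f = closest_point C"
  have f_fix: "f y = y" if "y \<in> C" for y unfolding f_def by (rule closest_point_self[OF that])
  have f_out: "n1 \<bullet> f y = n1 \<bullet> x" if "y \<notin> C" for y
  proof -
    have "f y \<in> C" unfolding f_def by (rule closest_point_in_set[OF C(2,3)])
    moreover have "f y \<notin> interior C"
      using closest_point_in_rel_interior[OF C(2,3), of y] that interior_subset[of C]
      by (auto simp: f_def affine_hull_nonempty_interior[OF intC_ne] rel_interior_nonempty_interior[OF intC_ne])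
    ultimately show ?thesis unfolding intC by (simp add: C_def)
  qed
  \<comment> \<open>Projection to the half-space of \<open>n1\<close> maps \<open>W\<close> into
    \<open>W\<close>: points outside the half-space land on its boundary plane, which misses the
    interior of the body.\<close>
  define A where "A = W \<inter> C"
  have fA: "f ` W \<subseteq> A"
  proof (rule image_subsetI)
    fix y assume y: "y \<in> W"
    have "f y \<in> C" unfolding f_def by (rule closest_point_in_set[OF C(2,3)])
    moreover have "f y \<in> W"
    proof (cases "y \<in> C")
      case False
      then show ?thesis using f_out[OF False] by (intro act_W[OF act1]) simp
    qed (use y f_fix in simp)
    ultimately show "f y \<in> A" by (simp add: A_def)
  qed
  let ?z1 = "x + r *\<^sub>R u1" and ?z2 = "x + r *\<^sub>R u2"
  have fz: "f ?z1 = ?z1" "f q = q" using q perp1 by (intro f_fix; simp add: C_def inner_add_right)+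
  have "pdist W ?z2 q \<le> pdist A ?z1 q"
  proof (rule pdist_crossing[where n=n2 and b="n2 \<bullet> x"])
    show "n2 \<bullet> x \<le> n2 \<bullet> ?z1" using act_dir(1)[OF act2] r by (simp add: inner_add_right)
    show "n2 \<bullet> q \<le> n2 \<bullet> x" by fact
    fix m assume m: "m \<in> A" "n2 \<bullet> m = n2 \<bullet> x"
    \<comment> \<open>By \<open>turn\<close>, \<open>u1 - u2\<close> is a nonnegative multiple of
      \<open>n1 + n2\<close>, and \<open>m\<close> lies on the inner side of the first plane and on
      the second.\<close>
    have "dist ?z2 m \<le> dist ?z1 m"
    proof -
      have "n1 \<bullet> (m - x) \<le> 0" "n2 \<bullet> (m - x) = 0" using m by (simp_all add: A_def C_def inner_diff_right)
      then have "(u1 - u2) \<bullet> (m - x) \<le> 0"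
        using \<alpha> by (simp add: inner_add_left mult_nonneg_nonpos)
      then have "r * ((u1 - u2) \<bullet> (m - x)) \<le> 0" using r by (simp add: mult_nonneg_nonpos)
      moreover have "(dist ?z1 m)\<^sup>2 - (dist ?z2 m)\<^sup>2 = - 2 * (r * ((u1 - u2) \<bullet> (m - x)))"
      proof -
        have "(dist (x + r *\<^sub>R u) m)\<^sup>2 = (norm (m - x))\<^sup>2 - 2 * r * (u \<bullet> (m - x)) + r\<^sup>2 * (u \<bullet> u)" for u
        proof -
          have "(norm (r *\<^sub>R u - w))\<^sup>2 = (norm w)\<^sup>2 - 2 * r * (u \<bullet> w) + r\<^sup>2 * (u \<bullet> u)" for w
            unfolding power2_norm_eq_inner
            by (simp add: inner_diff_left inner_diff_right inner_commute[of w u] power2_eq_square algebra_simps)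
          moreover have "x + r *\<^sub>R u - m = r *\<^sub>R u - (m - x)" by simp
          ultimately show ?thesis unfolding dist_norm by (simp only:)
        qed
        then show ?thesis by (simp add: unit_squares inner_diff_left algebra_simps)
      qed
      ultimately have "(dist ?z2 m)\<^sup>2 \<le> (dist ?z1 m)\<^sup>2" by linarith
      then show ?thesis by (rule power2_le_imp_le) simp
    qed
    have "pdist W ?z2 q \<le> pdist W ?z2 m + pdist W m q" by (rule pdist_triangle)
    also have "\<dots> \<le> ereal (dist ?z2 m) + pdist A m q"
      using m perp2 by (intro add_mono act_pdist[OF act2] pdist_mono) (auto simp: A_def inner_add_right)
    also have "\<dots> \<le> ereal (dist ?z1 m) + pdist A m q"
      using \<open>dist ?z2 m \<le> dist ?z1 m\<close> by (intro add_right_mono) simp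
    also have "\<dots> \<le> pdist A ?z1 m + pdist A m q" by (intro add_right_mono pdist_ge_dist)
    finally show "pdist W ?z2 q \<le> pdist A ?z1 m + pdist A m q" .
  qed
  also have "\<dots> = pdist A (f ?z1) (f q)" by (simp add: fz)
  also have "\<dots> \<le> pdist W ?z1 q"
    using closest_point_lipschitz[OF C] fA by (intro pdist_image_le) (auto simp: f_def)
  finally show ?thesis .
qed

lemma milka_reversed:
  assumes "0 \<le> r" "q \<in> W" "n1 \<bullet> q \<le> n1 \<bullet> x" "n2 \<bullet> q \<le> n2 \<bullet> x"
  shows "pdist W (x - r *\<^sub>R u1) q \<le> pdist W (x - r *\<^sub>R u2) q"
  using kink.milka[OF reversed, of r q] assms by simp

text \<open>A path that really turns does so inside an edge: \<open>cut_corner\<close> removes the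
  part of \<open>n\<close> orthogonal to \<open>n1\<close> and \<open>n2\<close>, and pairing with
  \<open>u1\<close> and \<open>u2\<close> shows the signs of the coefficients.\<close>

lemma turn_normal:
  assumes ne: "u1 \<noteq> u2" and n: "act x n"
  shows "\<exists>a\<ge>0. \<exists>b\<ge>0. n = a *\<^sub>R n1 + b *\<^sub>R n2"
proof -
  obtain \<alpha> where \<alpha>: "\<alpha> \<ge> 0" "u1 - u2 = \<alpha> *\<^sub>R (n1 + n2)" using turn by blast
  have "\<alpha> > 0" using \<alpha> ne by (cases "\<alpha> = 0") auto
  have n12: "n1 \<noteq> n2"
  proof
    assume "n1 = n2"
    then have "n1 \<bullet> (u1 - u2) = 0" using perp1 perp2 by (simp add: inner_diff_right)
    then have "\<alpha> * (n1 \<bullet> n1 + n1 \<bullet> n2) = 0" unfolding \<alpha>(2) by (simp add: inner_add_right)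
    moreover have "n1 \<bullet> n2 = 1" using unit_squares(4) \<open>n1 = n2\<close> by simp
    ultimately show False using \<open>\<alpha> > 0\<close> by (simp add: unit_squares(3))
  qed
  define g where "g = n1 \<bullet> n2"
  have g: "\<bar>g\<bar> < 1"
    using unit_inner_less_1[OF act_norm[OF act1] act_norm[OF act2] n12] inner_normals by (simp add: g_def)
  obtain a b where ab: "n1 \<bullet> (n - a *\<^sub>R n1 - b *\<^sub>R n2) = 0" "n2 \<bullet> (n - a *\<^sub>R n1 - b *\<^sub>R n2) = 0"
    using gram_projection[OF act_norm[OF act1] act_norm[OF act2] g[unfolded g_def], of n] by blast
  define v where "v = n - a *\<^sub>R n1 - b *\<^sub>R n2"
  have "n \<bullet> v = 0" using ab by (intro cut_corner[OF ne n]) (simp_all add: v_def)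
  moreover have "v \<bullet> v = (n - a *\<^sub>R n1 - b *\<^sub>R n2) \<bullet> v" by (simp only: v_def)
  then have "v \<bullet> v = n \<bullet> v - a * (n1 \<bullet> v) - b * (n2 \<bullet> v)" by (simp add: inner_diff_left)
  ultimately have "v \<bullet> v = 0" using ab by (simp flip: v_def)
  then have "v = 0" by simp
  then have eq: "n = a *\<^sub>R n1 + b *\<^sub>R n2" by (simp add: v_def algebra_simps)
  have "n2 \<bullet> (u1 - u2) = \<alpha> * (1 + g)" "n1 \<bullet> (u1 - u2) = \<alpha> * (1 + g)"
    unfolding \<alpha>(2) by (simp_all add: inner_add_right unit_squares g_def inner_commute algebra_simps)
  moreover have "0 < \<alpha> * (1 + g)" using \<open>\<alpha> > 0\<close> g by (intro mult_pos_pos) auto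
  ultimately have pos: "n2 \<bullet> u1 > 0" "n1 \<bullet> u2 < 0" by (simp_all add: inner_diff_right perp1 perp2)
  have "n \<bullet> u1 = b * (n2 \<bullet> u1)" "n \<bullet> u2 = a * (n1 \<bullet> u2)"
    unfolding eq by (simp_all add: inner_add_left perp1 perp2)
  then have "0 \<le> b * (n2 \<bullet> u1)" "a * (n1 \<bullet> u2) \<le> 0" using act_dir[OF n] by simp_all
  then have "0 \<le> b" "0 \<le> a" using mult_neg_pos[OF _ pos(1), of b] mult_neg_neg[OF _ pos(2), of a] by force+
  then show ?thesis by (intro exI[of _ a] exI[of _ b] conjI eq)
qed

end

text \<open>The Lang-Schroeder-Sturm inequality for three points, with unnormalized weights. For
  vectors seen from \<open>p\<close> the difference of the two sides is the squared norm of their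
  weighted sum. It is a closed condition on six distances, which is why it can be passed to
  limits.\<close>

definition variance_ineq :: "('a \<Rightarrow> 'a \<Rightarrow> real) \<Rightarrow> 'a \<Rightarrow> 'a \<Rightarrow> 'a \<Rightarrow> 'a \<Rightarrow> bool" where
  "variance_ineq d p x y z \<longleftrightarrow> (\<forall>a b c. 0 \<le> a \<longrightarrow> 0 \<le> b \<longrightarrow> 0 \<le> c \<longrightarrow>
     a * b * (d x y)\<^sup>2 + a * c * (d x z)\<^sup>2 + b * c * (d y z)\<^sup>2
       \<le> (a + b + c) * (a * (d p x)\<^sup>2 + b * (d p y)\<^sup>2 + c * (d p z)\<^sup>2))"

text \<open>It is enough to represent the points by vectors that keep the distances from
  \<open>p\<close> and do not shrink the others.\<close>

lemma variance_ineq_vectors: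
  fixes u v w :: "'b::real_inner"
  assumes "norm u = d p x" "norm v = d p y" "norm w = d p z"
    and "0 \<le> d x y" "0 \<le> d x z" "0 \<le> d y z"
    and "d x y \<le> norm (u - v)" "d x z \<le> norm (u - w)" "d y z \<le> norm (v - w)"
  shows "variance_ineq d p x y z"
  unfolding variance_ineq_def
proof (intro allI impI)
  fix a b c :: real assume abc: "0 \<le> a" "0 \<le> b" "0 \<le> c"
  have "a * b * (d x y)\<^sup>2 + a * c * (d x z)\<^sup>2 + b * c * (d y z)\<^sup>2
      \<le> a * b * (norm (u - v))\<^sup>2 + a * c * (norm (u - w))\<^sup>2 + b * c * (norm (v - w))\<^sup>2"
    using assms(4-) abc by (intro add_mono mult_left_mono power_mono mult_nonneg_nonneg) auto
  also have "\<dots> = (a + b + c) * (a * (norm u)\<^sup>2 + b * (norm v)\<^sup>2 + c * (norm w)\<^sup>2)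
      - (norm (a *\<^sub>R u + b *\<^sub>R v + c *\<^sub>R w))\<^sup>2"
    unfolding power2_norm_eq_inner
    by (simp add: inner_simps inner_commute[of v u] inner_commute[of w u] inner_commute[of w v] algebra_simps)
  also have "\<dots> \<le> (a + b + c) * (a * (d p x)\<^sup>2 + b * (d p y)\<^sup>2 + c * (d p z)\<^sup>2)"
    unfolding assms(1-3) by simp
  finally show "a * b * (d x y)\<^sup>2 + a * c * (d x z)\<^sup>2 + b * c * (d y z)\<^sup>2
      \<le> (a + b + c) * (a * (d p x)\<^sup>2 + b * (d p y)\<^sup>2 + c * (d p z)\<^sup>2)" .
qed

lemma variance_ineq_limit:
  assumes lim: "(\<lambda>n. D n (p' n) (x' n)) \<longlonglongrightarrow> d p x" "(\<lambda>n. D n (p' n) (y' n)) \<longlonglongrightarrow> d p y" "(\<lambda>n. D n (p' n) (z' n)) \<longlonglongrightarrow> d p z"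
    "(\<lambda>n. D n (x' n) (y' n)) \<longlonglongrightarrow> d x y" "(\<lambda>n. D n (x' n) (z' n)) \<longlonglongrightarrow> d x z" "(\<lambda>n. D n (y' n) (z' n)) \<longlonglongrightarrow> d y z"
    and var: "\<And>n::nat. variance_ineq (D n) (p' n) (x' n) (y' n) (z' n)"
  shows "variance_ineq d p x y z"
  unfolding variance_ineq_def
proof (intro allI impI)
  fix a b c :: real assume abc: "0 \<le> a" "0 \<le> b" "0 \<le> c"
  have l: "(\<lambda>n. a * b * (D n (x' n) (y' n))\<^sup>2 + a * c * (D n (x' n) (z' n))\<^sup>2 + b * c * (D n (y' n) (z' n))\<^sup>2)
      \<longlonglongrightarrow> a * b * (d x y)\<^sup>2 + a * c * (d x z)\<^sup>2 + b * c * (d y z)\<^sup>2"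
    by (intro tendsto_intros lim)
  have r: "(\<lambda>n. (a + b + c) * (a * (D n (p' n) (x' n))\<^sup>2 + b * (D n (p' n) (y' n))\<^sup>2 + c * (D n (p' n) (z' n))\<^sup>2))
      \<longlonglongrightarrow> (a + b + c) * (a * (d p x)\<^sup>2 + b * (d p y)\<^sup>2 + c * (d p z)\<^sup>2)"
    by (intro tendsto_intros lim)
  show "a * b * (d x y)\<^sup>2 + a * c * (d x z)\<^sup>2 + b * c * (d y z)\<^sup>2
      \<le> (a + b + c) * (a * (d p x)\<^sup>2 + b * (d p y)\<^sup>2 + c * (d p z)\<^sup>2)"
  proof (rule LIMSEQ_le[OF l r], intro exI[of _ 0] allI impI)
    fix n :: nat
    show "a * b * (D n (x' n) (y' n))\<^sup>2 + a * c * (D n (x' n) (z' n))\<^sup>2 + b * c * (D n (y' n) (z' n))\<^sup>2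
      \<le> (a + b + c) * (a * (D n (p' n) (x' n))\<^sup>2 + b * (D n (p' n) (y' n))\<^sup>2 + c * (D n (p' n) (z' n))\<^sup>2)"
      using var[of n] abc unfolding variance_ineq_def by blast
  qed
qed

section \<open>Directions of shortest paths and comparison with tangent vectors\<close>

context polytope_body
begin

definition rdir :: "(real \<Rightarrow> real^3) \<Rightarrow> real \<Rightarrow> real \<Rightarrow> real^3 \<Rightarrow> bool" where
  "rdir \<gamma> l s u \<longleftrightarrow> (\<exists>e>0. s + e \<le> l \<and> (\<forall>\<tau>\<in>{0..e}. \<gamma> (s + \<tau>) = \<gamma> s + \<tau> *\<^sub>R u))"

lemma rdir_unique:
  assumes "rdir \<gamma> l s u" "rdir \<gamma> l s v" shows "u = v"
proof -
  obtain e where e: "e > 0" "\<forall>\<tau>\<in>{0..e}. \<gamma> (s + \<tau>) = \<gamma> s + \<tau> *\<^sub>R u"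
    using assms(1) unfolding rdir_def by blast
  obtain e' where e': "e' > 0" "\<forall>\<tau>\<in>{0..e'}. \<gamma> (s + \<tau>) = \<gamma> s + \<tau> *\<^sub>R v"
    using assms(2) unfolding rdir_def by blast
  define \<tau> where "\<tau> = min e e'"
  have \<tau>: "\<tau> > 0" "\<tau> \<le> e" "\<tau> \<le> e'" using e(1) e'(1) by (simp_all add: \<tau>_def)
  have "\<gamma> s + \<tau> *\<^sub>R u = \<gamma> s + \<tau> *\<^sub>R v" using e(2)[rule_format, of \<tau>] e'(2)[rule_format, of \<tau>] \<tau> by simp
  then show ?thesis using \<tau>(1) by simp
qed

lemma kink_geod:
  assumes g: "geod \<gamma> l"
    and left: "e1 > 0" "e1 \<le> t" "norm u1 = 1" "act (\<gamma> t) n1" "n1 \<bullet> u1 = 0"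
      "\<forall>\<tau>\<in>{0..e1}. \<gamma> (t - \<tau>) = \<gamma> t - \<tau> *\<^sub>R u1"
    and right: "e2 > 0" "t + e2 \<le> l" "norm u2 = 1" "act (\<gamma> t) n2" "n2 \<bullet> u2 = 0"
      "\<forall>\<tau>\<in>{0..e2}. \<gamma> (t + \<tau>) = \<gamma> t + \<tau> *\<^sub>R u2"
  shows "kink K H (\<gamma> t) u1 u2 n1 n2 (min e1 e2)"
proof -
  define e where "e = min e1 e2"
  have e: "0 < e" "e \<le> e1" "e \<le> e2" using left(1) right(1) by (simp_all add: e_def)
  have eq: "\<gamma> (t - e) = \<gamma> t - e *\<^sub>R u1" "\<gamma> (t + e) = \<gamma> t + e *\<^sub>R u2"
    using left(6) right(6) e by simp_all
  have S: "\<gamma> t \<in> S" "\<gamma> (t - e) \<in> S" "\<gamma> (t + e) \<in> S"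
    using left(2) right(2) e by (auto intro!: geod_S[OF g])
  have "d (\<gamma> (t - e)) (\<gamma> (t + e)) = 2 * e"
    using geod_d[OF g, of "t - e" "t + e"] left(2) right(2) e by simp
  then have sh: "ereal (2 * e) \<le> pdist W (\<gamma> t - e *\<^sub>R u1) (\<gamma> t + e *\<^sub>R u2)"
    using ereal_d[OF S(2,3)] pdist_S_W[OF S(2,3)] unfolding eq by simp
  have inK: "\<gamma> t \<in> K" "\<gamma> t - e *\<^sub>R u1 \<in> K" "\<gamma> t + e *\<^sub>R u2 \<in> K"
    using S S_subset_K unfolding eq by blast+
  show ?thesis
    unfolding e_def[symmetric]
    by unfold_locales (fact inK left right e sh)+
qed

text \<open>The tangent ray of a shortest path, cut off at the remaining length, approaches every point of the
  surface as the foot point moves along the path.\<close>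
lemma milka_chain:
  assumes g: "geod \<alpha> l" and l: "0 < l" and w: "rdir \<alpha> l 0 w" and q: "q \<in> S"
  shows "pdist W (\<alpha> l) q \<le> pdist W (\<alpha> 0 + l *\<^sub>R w) q"
proof -
  define D where "D = pdist W (\<alpha> 0 + l *\<^sub>R w) q"
  \<comment> \<open>At intermediate times the claim is made for every right direction and reduced to
    one by uniqueness; at time \<open>l\<close> the ray has shrunk to the endpoint.\<close>
  define Q where "Q s \<longleftrightarrow> (s < l \<longrightarrow> (\<forall>u. rdir \<alpha> l s u \<longrightarrow> pdist W (\<alpha> s + (l - s) *\<^sub>R u) q \<le> D)) \<and>
      (s = l \<longrightarrow> pdist W (\<alpha> l) q \<le> D)" for s
  have qW: "q \<in> W" "q \<in> K" using q S_subset_W S_subset_K by blast+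
  have "Q l"
  proof (rule real_induction[where a=0])
    show "0 \<le> l" using l by simp
    have "pdist W (\<alpha> 0 + l *\<^sub>R u) q \<le> D" if "rdir \<alpha> l 0 u" for u
      using rdir_unique[OF w that] by (simp add: D_def)
    then show "Q 0" using l by (simp add: Q_def)
  next
    fix s assume s: "0 \<le> s" "s < l" "Q s"
    obtain e u n where e: "e > 0" "s + e \<le> l" "\<forall>\<tau>\<in>{0..e}. \<alpha> (s + \<tau>) = \<alpha> s + \<tau> *\<^sub>R u"
      using local_right[OF g s(1,2)] by blast
    then have "rdir \<alpha> l s u" unfolding rdir_def by blast
    then have D: "pdist W (\<alpha> s + (l - s) *\<^sub>R u) q \<le> D" using s by (simp add: Q_def)
    have "Q s'" if s': "s < s'" "s' < s + e" for s'
    proof -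
      have as: "\<alpha> s' = \<alpha> s + (s' - s) *\<^sub>R u" using e(3)[rule_format, of "s' - s"] s' by simp
      have "\<alpha> (s' + \<tau>) = \<alpha> s' + \<tau> *\<^sub>R u" if "\<tau> \<in> {0..s + e - s'}" for \<tau>
        using e(3)[rule_format, of "s' - s + \<tau>"] that s' unfolding as
        by (simp add: algebra_simps)
      then have "rdir \<alpha> l s' u" unfolding rdir_def using s' e(2) by (intro exI[of _ "s + e - s'"]) auto
      moreover have "\<alpha> s' + (l - s') *\<^sub>R u = \<alpha> s + (l - s) *\<^sub>R u" unfolding as by (simp add: algebra_simps)
      ultimately have "pdist W (\<alpha> s' + (l - s') *\<^sub>R u') q \<le> D" if "rdir \<alpha> l s' u'" for u'
        using rdir_unique[OF that] D by metis
      moreover have "s' \<noteq> l" using s' e(2) by simp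
      ultimately show ?thesis by (simp add: Q_def)
    qed
    then show "\<exists>e>0. \<forall>s'. s < s' \<and> s' < s + e \<longrightarrow> Q s'" using e(1) by blast
  next
    fix s assume s: "0 < s" "s \<le> l" and Q: "\<And>s'. 0 \<le> s' \<Longrightarrow> s' < s \<Longrightarrow> Q s'"
    obtain e1 u1 n1 where left: "e1 > 0" "e1 \<le> s" "norm u1 = 1" "act (\<alpha> s) n1" "n1 \<bullet> u1 = 0"
      "\<forall>\<tau>\<in>{0..e1}. \<alpha> (s - \<tau>) = \<alpha> s - \<tau> *\<^sub>R u1"
      using local_left[OF g s] by blast
    define s' where "s' = s - e1"
    have as: "\<alpha> s' = \<alpha> s - e1 *\<^sub>R u1" using left(1,6) by (simp add: s'_def)
    have "\<alpha> (s' + \<tau>) = \<alpha> s' + \<tau> *\<^sub>R u1" if "\<tau> \<in> {0..e1}" for \<tau>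
      using left(6)[rule_format, of "e1 - \<tau>"] that unfolding as by (simp add: s'_def algebra_simps)
    then have "rdir \<alpha> l s' u1" unfolding rdir_def using left(1) s by (intro exI[of _ e1]) (simp add: s'_def)
    moreover have "Q s'" using left(1,2) by (intro Q) (simp_all add: s'_def)
    moreover have "s' < l" using left(1) s by (simp add: s'_def)
    ultimately have "pdist W (\<alpha> s' + (l - s') *\<^sub>R u1) q \<le> D" by (simp add: Q_def)
    also have "\<alpha> s' + (l - s') *\<^sub>R u1 = \<alpha> s + (l - s) *\<^sub>R u1"
      unfolding as by (simp add: s'_def algebra_simps)
    finally have D: "pdist W (\<alpha> s + (l - s) *\<^sub>R u1) q \<le> D" .
    show "Q s"
    proof (cases "s = l")
      case True
      then show ?thesis using D by (simp add: Q_def)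
    next
      case False
      then have sl: "0 \<le> s" "s < l" using s by simp_all
      obtain e2 u2 n2 where right: "e2 > 0" "s + e2 \<le> l" "norm u2 = 1" "act (\<alpha> s) n2" "n2 \<bullet> u2 = 0"
        "\<forall>\<tau>\<in>{0..e2}. \<alpha> (s + \<tau>) = \<alpha> s + \<tau> *\<^sub>R u2"
        using local_right[OF g sl] by blast
      \<comment> \<open>Only at such a point can the ray change its direction; along a straight
        piece of the path its end stays fixed.\<close>
      interpret k: kink K H "\<alpha> s" u1 u2 n1 n2 "min e1 e2" by (rule kink_geod[OF g left right])
      have "pdist W (\<alpha> s + (l - s) *\<^sub>R u2) q \<le> pdist W (\<alpha> s + (l - s) *\<^sub>R u1) q"
        using sl qW act_le[OF left(4) qW(2)] act_le[OF right(4) qW(2)] by (intro k.milka) simp_all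
      also note D
      finally have *: "pdist W (\<alpha> s + (l - s) *\<^sub>R u2) q \<le> D" .
      have "rdir \<alpha> l s u2" unfolding rdir_def using right by blast
      then have "pdist W (\<alpha> s + (l - s) *\<^sub>R u) q \<le> D" if "rdir \<alpha> l s u" for u
        using rdir_unique[OF that] * by metis
      then show ?thesis using False by (simp add: Q_def)
    qed
  qed
  then show ?thesis by (simp add: Q_def D_def)
qed

lemma norm_sub_sq:
  fixes u w :: "real^3"
  assumes "norm u = 1" "norm w = 1"
  shows "(norm (r *\<^sub>R w - \<tau> *\<^sub>R u))\<^sup>2 = r\<^sup>2 + \<tau>\<^sup>2 - 2 * \<tau> * (r * (w \<bullet> u))"
proof -
  have "u \<bullet> u = 1" "w \<bullet> w = 1" using assms by (simp_all add: norm_eq_1)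
  then show ?thesis unfolding power2_norm_eq_inner
    by (simp add: inner_simps inner_commute[of u w] power2_eq_square algebra_simps)
qed

lemma d_sq_le:
  assumes "x \<in> S" "y \<in> S" "pdist W x y \<le> ereal (norm v)" "(norm v)\<^sup>2 = c"
  shows "(d x y)\<^sup>2 \<le> c"
proof -
  have "d x y \<le> norm v" using assms by (intro d_le_pdist_W) auto
  then have "(d x y)\<^sup>2 \<le> (norm v)\<^sup>2" by (rule power_mono) (rule d_nonneg[OF assms(1,2)])
  then show ?thesis using assms(4) by simp
qed

text \<open>The same \<open>c\<close> serves both sides, so d(p, .)^2 - t^2 has a supporting line
  from above at \<open>t\<close>: nonnegative curvature in differential form. By
  \<open>milka_chain\<close> the point \<open>p\<close> may be replaced by the end \<open>z\<close>
  of the tangent ray of a shortest path towards \<open>p\<close>, which leaves planar computations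
  at the kink.\<close>

lemma geod_support:
  assumes g: "geod \<gamma> l" and t: "0 < t" "t < l" and p: "p \<in> S"
  shows "\<exists>c. \<exists>e>0. e \<le> t \<and> t + e \<le> l \<and> (\<forall>\<tau>\<in>{0..e}.
      (d p (\<gamma> (t + \<tau>)))\<^sup>2 \<le> (d p (\<gamma> t))\<^sup>2 + \<tau>\<^sup>2 - 2 * \<tau> * c \<and>
      (d p (\<gamma> (t - \<tau>)))\<^sup>2 \<le> (d p (\<gamma> t))\<^sup>2 + \<tau>\<^sup>2 + 2 * \<tau> * c)"
proof -
  define x where "x = \<gamma> t"
  have xS: "x \<in> S" using t by (auto simp: x_def intro!: geod_S[OF g])
  have tl: "0 \<le> t" "t \<le> l" using t by simp_all
  obtain e1 u1 n1 where left: "e1 > 0" "e1 \<le> t" "norm u1 = 1" "act (\<gamma> t) n1" "n1 \<bullet> u1 = 0"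
    "\<forall>\<tau>\<in>{0..e1}. \<gamma> (t - \<tau>) = \<gamma> t - \<tau> *\<^sub>R u1"
    using local_left[OF g t(1) tl(2)] by blast
  obtain e2 u2 n2 where right: "e2 > 0" "t + e2 \<le> l" "norm u2 = 1" "act (\<gamma> t) n2" "n2 \<bullet> u2 = 0"
    "\<forall>\<tau>\<in>{0..e2}. \<gamma> (t + \<tau>) = \<gamma> t + \<tau> *\<^sub>R u2"
    using local_right[OF g tl(1) t(2)] by blast
  interpret k: kink K H x u1 u2 n1 n2 "min e1 e2" unfolding x_def by (rule kink_geod[OF g left right])
  define e where "e = min e1 e2"
  have e: "0 < e" "e \<le> t" "t + e \<le> l" using left right by (auto simp: e_def)
  have eqs: "\<gamma> (t - \<tau>) = x - \<tau> *\<^sub>R u1" "\<gamma> (t + \<tau>) = x + \<tau> *\<^sub>R u2" if "\<tau> \<in> {0..e}" for \<tau>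
    using left(6) right(6) that by (simp_all add: e_def x_def)
  have inS: "x - \<tau> *\<^sub>R u1 \<in> S" "x + \<tau> *\<^sub>R u2 \<in> S" if "\<tau> \<in> {0..e}" for \<tau>
    using that e geod_S[OF g, of "t - \<tau>"] geod_S[OF g, of "t + \<tau>"] unfolding eqs[OF that] by auto
  show ?thesis
  proof (cases "p = x")
    case True
    have "d p (\<gamma> (t + \<tau>)) = \<tau>" "d p (\<gamma> (t - \<tau>)) = \<tau>" if "\<tau> \<in> {0..e}" for \<tau>
      unfolding True x_def using geod_d[OF g, of t "t + \<tau>"] geod_d[OF g, of t "t - \<tau>"] that e tl by auto
    then show ?thesis using e by (intro exI[of _ 0] exI[of _ e]) auto
  next
    case False
    define r where "r = d x p"
    have r: "0 < r" unfolding r_def using d_pos[OF xS p] False by simp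
    obtain \<alpha> where \<alpha>: "geod \<alpha> r" "\<alpha> 0 = x" "\<alpha> r = p" using geodesic_exists[OF xS p] by (auto simp: r_def)
    obtain e' w n where w: "e' > 0" "0 + e' \<le> r" "norm w = 1" "act (\<alpha> 0) n" "n \<bullet> w = 0"
      "\<forall>\<tau>\<in>{0..e'}. \<alpha> (0 + \<tau>) = \<alpha> 0 + \<tau> *\<^sub>R w"
      using local_right[OF \<alpha>(1) order_refl r] by blast
    have n: "act x n" using w(4) by (simp add: \<alpha>)
    have rdir: "rdir \<alpha> r 0 w" unfolding rdir_def using w by blast
    define z where "z = x + r *\<^sub>R w"
    have chain: "pdist W p q \<le> pdist W z q" if "q \<in> S" for q
      using milka_chain[OF \<alpha>(1) r rdir that] by (simp add: \<alpha> z_def)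
    have "x + e' *\<^sub>R w \<in> K"
      using geod_S[OF \<alpha>(1), of e'] w(1,2) w(6)[rule_format, of e'] S_subset_K by (auto simp: \<alpha>)
    then have wdir: "m \<bullet> w \<le> 0" if "act x m" for m
      using act_le[OF that, of "x + e' *\<^sub>R w"] w(1) by (simp add: inner_add_right mult_le_0_iff)
    have zW: "z \<in> W" using act_W[OF n, of z] w(5) by (simp add: z_def inner_add_right)
    have zle: "m \<bullet> z \<le> m \<bullet> x" if "act x m" for m
      using wdir[OF that] r by (simp add: z_def inner_add_right mult_nonneg_nonpos)
    have conclude: ?thesis if u: "norm u = 1"
      and plus: "\<And>\<tau>. 0 \<le> \<tau> \<Longrightarrow> pdist W z (x + \<tau> *\<^sub>R u2) \<le> ereal (norm (r *\<^sub>R w - \<tau> *\<^sub>R u))"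
      and minus: "\<And>\<tau>. 0 \<le> \<tau> \<Longrightarrow> pdist W z (x - \<tau> *\<^sub>R u1) \<le> ereal (norm (r *\<^sub>R w - (- \<tau>) *\<^sub>R u))" for u
    proof -
      have "(d p (\<gamma> (t + \<tau>)))\<^sup>2 \<le> (d p (\<gamma> t))\<^sup>2 + \<tau>\<^sup>2 - 2 * \<tau> * (r * (w \<bullet> u)) \<and>
          (d p (\<gamma> (t - \<tau>)))\<^sup>2 \<le> (d p (\<gamma> t))\<^sup>2 + \<tau>\<^sup>2 + 2 * \<tau> * (r * (w \<bullet> u))" if \<tau>: "\<tau> \<in> {0..e}" for \<tau>
      proof -
        have dr: "d p (\<gamma> t) = r" by (simp add: r_def x_def d_commute)
        have "(d p (x + \<tau> *\<^sub>R u2))\<^sup>2 \<le> r\<^sup>2 + \<tau>\<^sup>2 - 2 * \<tau> * (r * (w \<bullet> u))"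
          using \<tau> by (intro d_sq_le[OF p inS(2)[OF \<tau>] order_trans[OF chain[OF inS(2)[OF \<tau>]] plus] norm_sub_sq[OF u w(3)]]) simp
        moreover have "(d p (x - \<tau> *\<^sub>R u1))\<^sup>2 \<le> r\<^sup>2 + (- \<tau>)\<^sup>2 - 2 * (- \<tau>) * (r * (w \<bullet> u))"
          using \<tau> by (intro d_sq_le[OF p inS(1)[OF \<tau>] order_trans[OF chain[OF inS(1)[OF \<tau>]] minus] norm_sub_sq[OF u w(3)]]) simp
        ultimately show ?thesis unfolding eqs[OF \<tau>] dr by simp
      qed
      then show ?thesis using e by (intro exI[of _ "r * (w \<bullet> u)"] exI[of _ e]) auto
    qed
    have plane: "pdist W z (x + \<tau> *\<^sub>R u) \<le> ereal (norm (r *\<^sub>R w - \<tau> *\<^sub>R u))"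
      if "act x m" "m \<bullet> w = 0" "m \<bullet> u = 0" for m u \<tau>
    proof -
      have "pdist W z (x + \<tau> *\<^sub>R u) \<le> ereal (dist z (x + \<tau> *\<^sub>R u))"
        using that by (intro act_pdist[OF that(1)]) (simp_all add: z_def inner_add_right)
      then show ?thesis by (simp add: z_def dist_norm)
    qed
    show ?thesis
    proof (cases "u1 = u2")
      case True
      have nu: "n \<bullet> u1 = 0" using k.act_dir[OF n] unfolding True by simp
      show ?thesis
      proof (rule conclude[OF k.norm_u1])
        fix \<tau> :: real
        show "pdist W z (x + \<tau> *\<^sub>R u2) \<le> ereal (norm (r *\<^sub>R w - \<tau> *\<^sub>R u1))"
          using plane[OF n w(5) nu, of \<tau>] by (simp add: True)
        show "pdist W z (x - \<tau> *\<^sub>R u1) \<le> ereal (norm (r *\<^sub>R w - (- \<tau>) *\<^sub>R u1))"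
          using plane[OF n w(5) nu, of "- \<tau>"] by simp
      qed
    next
      case False
      \<comment> \<open>\<open>n\<close> is a nonnegative combination of \<open>n1\<close> and
        \<open>n2\<close>, with both of which \<open>w\<close> has nonpositive product;
        orthogonality of \<open>w\<close> to \<open>n\<close> therefore puts \<open>w\<close> into
        one of the two planes. The side of the kink in that plane is compared directly, the other
        side through Milka's inequality or its reverse.\<close>
      obtain a b where ab: "0 \<le> a" "0 \<le> b" "n = a *\<^sub>R n1 + b *\<^sub>R n2" using k.turn_normal[OF False n] by blast
      have "a * (n1 \<bullet> w) + b * (n2 \<bullet> w) = 0" using w(5) unfolding ab(3) by (simp add: inner_add_left)
      moreover have "a * (n1 \<bullet> w) \<le> 0" "b * (n2 \<bullet> w) \<le> 0"
        using ab wdir[OF k.act1] wdir[OF k.act2] by (simp_all add: mult_nonneg_nonpos)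
      ultimately have "a * (n1 \<bullet> w) = 0" "b * (n2 \<bullet> w) = 0" by linarith+
      moreover have "a \<noteq> 0 \<or> b \<noteq> 0" using act_nonzero[OF n] ab(3) by auto
      ultimately consider "n1 \<bullet> w = 0" | "n2 \<bullet> w = 0" by auto
      then show ?thesis
      proof cases
        case 1
        show ?thesis
        proof (rule conclude[OF k.norm_u1])
          fix \<tau> :: real assume \<tau>: "0 \<le> \<tau>"
          have "pdist W (x + \<tau> *\<^sub>R u2) z \<le> pdist W (x + \<tau> *\<^sub>R u1) z"
            by (rule k.milka[OF \<tau> zW zle[OF k.act1] zle[OF k.act2]])
          also have "\<dots> \<le> ereal (norm (r *\<^sub>R w - \<tau> *\<^sub>R u1))"
            using plane[OF k.act1 1 k.perp1, of \<tau>] by (simp add: pdist_commute)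
          finally show "pdist W z (x + \<tau> *\<^sub>R u2) \<le> ereal (norm (r *\<^sub>R w - \<tau> *\<^sub>R u1))"
            by (simp add: pdist_commute)
          show "pdist W z (x - \<tau> *\<^sub>R u1) \<le> ereal (norm (r *\<^sub>R w - (- \<tau>) *\<^sub>R u1))"
            using plane[OF k.act1 1 k.perp1, of "- \<tau>"] by simp
        qed
      next
        case 2
        show ?thesis
        proof (rule conclude[OF k.norm_u2])
          fix \<tau> :: real assume \<tau>: "0 \<le> \<tau>"
          have "pdist W (x - \<tau> *\<^sub>R u1) z \<le> pdist W (x - \<tau> *\<^sub>R u2) z"
            by (rule k.milka_reversed[OF \<tau> zW zle[OF k.act1] zle[OF k.act2]])
          also have "\<dots> \<le> ereal (norm (r *\<^sub>R w - (- \<tau>) *\<^sub>R u2))"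
            using plane[OF k.act2 2 k.perp2, of "- \<tau>"] by (simp add: pdist_commute)
          finally show "pdist W z (x - \<tau> *\<^sub>R u1) \<le> ereal (norm (r *\<^sub>R w - (- \<tau>) *\<^sub>R u2))"
            by (simp add: pdist_commute)
          show "pdist W z (x + \<tau> *\<^sub>R u2) \<le> ereal (norm (r *\<^sub>R w - \<tau> *\<^sub>R u2))"
            using plane[OF k.act2 2 k.perp2, of \<tau>] by simp
        qed
      qed
    qed
  qed
qed

text \<open>With a single active normal all initial directions at \<open>p\<close> lie in one plane.
  Distances from \<open>p\<close> are kept by construction of \<open>L\<close>. The rest is hinge
  comparison: \<open>geod_support\<close> is integrated along a shortest path by
  \<open>upper_support_bound\<close>, with the initial slope supplied by
  \<open>milka_chain\<close>.\<close>

lemma log_map: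
  assumes p: "p \<in> S" and single: "\<forall>m m'. act p m \<longrightarrow> act p m' \<longrightarrow> m = m'"
  shows "\<exists>L :: real^3 \<Rightarrow> real^3. (\<forall>x\<in>S. norm (L x) = d p x) \<and> (\<forall>x\<in>S. \<forall>y\<in>S. d x y \<le> norm (L x - L y))"
proof -
  obtain n where n: "act p n" using S_act[OF p] by blast
  have "\<exists>v. norm v = d p x \<and> (x \<noteq> p \<longrightarrow> (\<exists>\<gamma> w. geod \<gamma> (d p x) \<and> \<gamma> 0 = p \<and> \<gamma> (d p x) = x \<and>
      rdir \<gamma> (d p x) 0 w \<and> norm w = 1 \<and> n \<bullet> w = 0 \<and> v = d p x *\<^sub>R w))" if x: "x \<in> S" for x
  proof (cases "x = p")
    case True
    then show ?thesis using d_refl[OF p] by (intro exI[of _ 0]) simp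
  next
    case False
    then have pos: "0 < d p x" using d_pos[OF p x] by simp
    obtain \<gamma> where \<gamma>: "geod \<gamma> (d p x)" "\<gamma> 0 = p" "\<gamma> (d p x) = x" using geodesic_exists[OF p x] by blast
    obtain e w m where w: "e > 0" "0 + e \<le> d p x" "norm w = 1" "act (\<gamma> 0) m" "m \<bullet> w = 0"
      "\<forall>\<tau>\<in>{0..e}. \<gamma> (0 + \<tau>) = \<gamma> 0 + \<tau> *\<^sub>R w"
      using local_right[OF \<gamma>(1) order_refl pos] by blast
    have "act p m" using w(4) \<gamma>(2) by simp
    then have "m = n" using single n by blast
    moreover have "rdir \<gamma> (d p x) 0 w" unfolding rdir_def using w by blast
    moreover have "norm (d p x *\<^sub>R w) = d p x" using w(3) pos by simp
    ultimately show ?thesis using \<gamma> w(3,5) by blast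
  qed
  then obtain L where L: "\<And>x. x \<in> S \<Longrightarrow> norm (L x) = d p x"
    "\<And>x. x \<in> S \<Longrightarrow> x \<noteq> p \<Longrightarrow> \<exists>\<gamma> w. geod \<gamma> (d p x) \<and> \<gamma> 0 = p \<and> \<gamma> (d p x) = x \<and>
      rdir \<gamma> (d p x) 0 w \<and> norm w = 1 \<and> n \<bullet> w = 0 \<and> L x = d p x *\<^sub>R w"
    by metis
  have L0: "L p = 0" using L(1)[OF p] d_refl[OF p] by simp
  have "d x y \<le> norm (L x - L y)" if x: "x \<in> S" and y: "y \<in> S" for x y
  proof (cases "x = p \<or> y = p")
    case True
    then show ?thesis using L(1)[OF x] L(1)[OF y] L0 d_commute[of x p] by auto
  next
    case False
    define l r where "l = d p x" and "r = d p y"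
    have lr: "0 < l" "0 < r" unfolding l_def r_def using d_pos[OF p x] d_pos[OF p y] False by auto
    obtain \<gamma> w where \<gamma>: "geod \<gamma> l" "\<gamma> 0 = p" "\<gamma> l = x" "rdir \<gamma> l 0 w" "norm w = 1" "n \<bullet> w = 0" "L x = l *\<^sub>R w"
      using L(2)[OF x] False by (auto simp: l_def)
    obtain \<beta> v where \<beta>: "geod \<beta> r" "\<beta> 0 = p" "\<beta> r = y" "rdir \<beta> r 0 v" "norm v = 1" "n \<bullet> v = 0" "L y = r *\<^sub>R v"
      using L(2)[OF y] False by (auto simp: r_def)
    obtain e where "e > 0" "0 + e \<le> l" "\<forall>\<tau>\<in>{0..e}. \<gamma> (0 + \<tau>) = \<gamma> 0 + \<tau> *\<^sub>R w"
      using \<gamma>(4) unfolding rdir_def by blast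
    then have e: "e > 0" "e \<le> l" "\<And>\<tau>. \<tau> \<in> {0..e} \<Longrightarrow> \<gamma> \<tau> = p + \<tau> *\<^sub>R w"
      using \<gamma>(2) by simp_all
    define h where "h t = (d y (\<gamma> t))\<^sup>2 - t\<^sup>2" for t
    have "h l \<le> h 0 + (- 2 * (r * (v \<bullet> w))) * l"
    proof (rule upper_support_bound[OF lr(1)])
      have "continuous_on {0..l} (\<lambda>t. d y (\<gamma> t))"
        by (rule continuous_on_compose2[OF continuous_d[OF y] continuous_geod[OF \<gamma>(1)]])
           (auto intro: geod_S[OF \<gamma>(1)])
      then show "continuous_on {0..l} h" unfolding h_def by (intro continuous_intros)
    next
      have "h \<tau> \<le> h 0 + (- 2 * (r * (v \<bullet> w))) * \<tau>" if \<tau>: "\<tau> \<in> {0..e}" for \<tau>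
      proof -
        have q: "p + \<tau> *\<^sub>R w \<in> S" using geod_S[OF \<gamma>(1), of \<tau>] \<tau> e by auto
        have "pdist W y (p + \<tau> *\<^sub>R w) \<le> pdist W (p + r *\<^sub>R v) (p + \<tau> *\<^sub>R w)"
          using milka_chain[OF \<beta>(1) lr(2) \<beta>(4) q] by (simp add: \<beta>)
        also have "\<dots> \<le> ereal (dist (p + r *\<^sub>R v) (p + \<tau> *\<^sub>R w))"
          using \<gamma>(6) \<beta>(6) by (intro act_pdist[OF n]) (simp_all add: inner_add_right)
        finally have "pdist W y (p + \<tau> *\<^sub>R w) \<le> ereal (norm (r *\<^sub>R v - \<tau> *\<^sub>R w))" by (simp add: dist_norm)
        then have "(d y (p + \<tau> *\<^sub>R w))\<^sup>2 \<le> r\<^sup>2 + \<tau>\<^sup>2 - 2 * \<tau> * (r * (v \<bullet> w))"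
          by (rule d_sq_le[OF y q _ norm_sub_sq[OF \<gamma>(5) \<beta>(5)]])
        moreover have "d y p = r" by (simp add: r_def d_commute)
        ultimately show ?thesis using e(3)[OF \<tau>] by (simp add: h_def \<gamma>(2) algebra_simps)
      qed
      then show "\<exists>e>0. e \<le> l \<and> (\<forall>\<tau>\<in>{0..e}. h \<tau> \<le> h 0 + (- 2 * (r * (v \<bullet> w))) * \<tau>)" using e by blast
    next
      fix t assume t: "0 < t" "t < l"
      obtain c e where c: "e > 0" "e \<le> t" "t + e \<le> l"
        "\<And>\<tau>. \<tau> \<in> {0..e} \<Longrightarrow> (d y (\<gamma> (t + \<tau>)))\<^sup>2 \<le> (d y (\<gamma> t))\<^sup>2 + \<tau>\<^sup>2 - 2 * \<tau> * c \<and>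
            (d y (\<gamma> (t - \<tau>)))\<^sup>2 \<le> (d y (\<gamma> t))\<^sup>2 + \<tau>\<^sup>2 + 2 * \<tau> * c"
        using geod_support[OF \<gamma>(1) t y] by blast
      have "h (t + \<tau>) \<le> h t + (- 2 * c - 2 * t) * \<tau> \<and> h (t - \<tau>) \<le> h t - (- 2 * c - 2 * t) * \<tau>"
        if "\<tau> \<in> {0..e}" for \<tau>
        using c(4)[OF that] by (simp add: h_def power2_eq_square algebra_simps)
      then show "\<exists>c. \<exists>e>0. e \<le> t \<and> t + e \<le> l \<and> (\<forall>\<tau>\<in>{0..e}. h (t + \<tau>) \<le> h t + c * \<tau> \<and> h (t - \<tau>) \<le> h t - c * \<tau>)"
        using c(1-3) by blast
    qed
    then have "(d y x)\<^sup>2 \<le> r\<^sup>2 + l\<^sup>2 - 2 * l * (r * (v \<bullet> w))"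
      using d_commute[of y p] by (simp add: h_def \<gamma> r_def algebra_simps)
    also have "\<dots> = (norm (L y - L x))\<^sup>2"
      unfolding \<gamma>(7) \<beta>(7) norm_sub_sq[OF \<gamma>(5) \<beta>(5)] ..
    finally have "d y x \<le> norm (L y - L x)" by (rule power2_le_imp_le) simp
    then show ?thesis by (simp add: d_commute[of y x] norm_minus_commute)
  qed
  then show ?thesis using L(1) by blast
qed

text \<open>Among the planes through \<open>p\<close> one nearest to an interior point
  \<open>y\<close> is chosen, and \<open>p\<close> is moved within it towards the foot of
  \<open>y\<close>. Every other active plane is left strictly, because distinct unit normals have
  product below 1.\<close>

lemma single_normal_dense:
  assumes p: "p \<in> S" and r: "0 < r"
  shows "\<exists>q\<in>S. dist q p < r \<and> (\<forall>m m'. act q m \<longrightarrow> act q m' \<longrightarrow> m = m')"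
proof -
  obtain y where y: "y \<in> interior K" using interior_K by auto
  define N where "N = {m. act p m}"
  have "N \<subseteq> fst ` H" by (force simp: N_def act_def)
  then have fin: "finite N" using finite_H finite_subset by blast
  have ne: "N \<noteq> {}" using S_act[OF p] by (auto simp: N_def)
  define lam where "lam m = m \<bullet> p - m \<bullet> y" for m
  have lam: "0 < lam m" if "m \<in> N" for m using interior_act[OF _ y, of p m] that by (simp add: lam_def N_def)
  obtain i where i: "i \<in> N" "\<forall>m\<in>N. lam i \<le> lam m"
    using arg_min_if_finite[OF fin ne, of lam] by (metis linorder_not_le)
  define v where "v = (y - p) + lam i *\<^sub>R i"
  have ii: "i \<bullet> i = 1" using act_norm[of p i] i(1) by (simp add: N_def norm_eq_1)
  have iv: "i \<bullet> v = 0" by (simp add: v_def inner_add_right inner_diff_right ii lam_def)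
  have mv: "m \<bullet> v < 0" if m: "m \<in> N" "m \<noteq> i" for m
  proof -
    have "norm m = 1" "norm i = 1" using act_norm m(1) i(1) unfolding N_def by blast+
    then have "m \<bullet> i < 1" using m(2) by (rule unit_inner_less_1)
    then have "lam i * (m \<bullet> i) < lam i * 1" using lam[OF i(1)] by (intro mult_strict_left_mono)
    moreover have "m \<bullet> v = - lam m + lam i * (m \<bullet> i)" by (simp add: v_def inner_add_right inner_diff_right lam_def)
    ultimately show ?thesis using i(2) m(1) by force
  qed
  have pK: "p \<in> K" using p S_subset_K by blast
  have strict: "\<forall>\<^sub>F e in at_right 0. n \<bullet> (p + e *\<^sub>R v) < b" if nb: "(n, b) \<in> H" "n \<bullet> p < b" for n b
  proof -
    have "((\<lambda>e. n \<bullet> (p + e *\<^sub>R v)) \<longlongrightarrow> n \<bullet> (p + 0 *\<^sub>R v)) (at_right 0)" by (intro tendsto_intros)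
    then show ?thesis using nb(2) by (intro order_tendstoD(2)) auto
  qed
  have "\<forall>\<^sub>F e in at_right 0. \<forall>h\<in>H. fst h \<bullet> p < snd h \<longrightarrow> fst h \<bullet> (p + e *\<^sub>R v) < snd h"
    using strict by (intro eventually_ball_finite[OF finite_H] ballI) (auto simp: eventually_mono)
  moreover have "((\<lambda>e. dist (p + e *\<^sub>R v) p) \<longlongrightarrow> dist (p + 0 *\<^sub>R v) p) (at_right 0)" by (intro tendsto_intros)
  then have "\<forall>\<^sub>F e in at_right 0. dist (p + e *\<^sub>R v) p < r" using r by (intro order_tendstoD(2)) auto
  moreover have "\<forall>\<^sub>F e in at_right (0::real). 0 < e" by (rule eventually_at_right_less)
  ultimately have "\<forall>\<^sub>F e in at_right 0. (\<forall>h\<in>H. fst h \<bullet> p < snd h \<longrightarrow> fst h \<bullet> (p + e *\<^sub>R v) < snd h) \<and>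
      dist (p + e *\<^sub>R v) p < r \<and> 0 < e" by eventually_elim simp
  then obtain e where e: "\<forall>h\<in>H. fst h \<bullet> p < snd h \<longrightarrow> fst h \<bullet> (p + e *\<^sub>R v) < snd h"
      "dist (p + e *\<^sub>R v) p < r" "0 < e"
    using eventually_happens'[OF trivial_limit_at_right_real] by blast
  define q where "q = p + e *\<^sub>R v"
  have act_q: "m = i" if m: "act q m" for m
  proof (rule ccontr)
    assume "m \<noteq> i"
    have mH: "(m, m \<bullet> q) \<in> H" using m by (simp add: act_def)
    have "m \<bullet> p \<le> m \<bullet> q" using act_le[OF m pK] .
    show False
    proof (cases "m \<bullet> p = m \<bullet> q")
      case True
      then have "m \<in> N" using mH by (simp add: N_def act_def)
      then have "e * (m \<bullet> v) < 0" using mv \<open>m \<noteq> i\<close> e(3) by (simp add: mult_pos_neg)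
      moreover have "m \<bullet> q = m \<bullet> p + e * (m \<bullet> v)" by (simp add: q_def inner_add_right)
      ultimately show False using True by linarith
    next
      case False
      then have "m \<bullet> p < m \<bullet> q" using \<open>m \<bullet> p \<le> m \<bullet> q\<close> by simp
      then show False using bspec[OF e(1) mH] by (simp add: q_def)
    qed
  qed
  have "n \<bullet> q \<le> b" if nb: "(n, b) \<in> H" for n b
  proof (cases "n \<bullet> p < b")
    case True
    then show ?thesis using bspec[OF e(1) nb] by (simp add: q_def)
  next
    case False
    moreover have "n \<bullet> p \<le> b" using pK nb unfolding K_eq by auto
    ultimately have eq: "n \<bullet> p = b" by simp
    then have "n \<in> N" using nb by (simp add: N_def act_def)
    then have "n \<bullet> v \<le> 0" using mv[of n] iv by (cases "n = i") auto
    then have "e * (n \<bullet> v) \<le> 0" using e(3) by (simp add: mult_nonneg_nonpos)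
    then show ?thesis using eq by (simp add: q_def inner_add_right)
  qed
  then have qK: "q \<in> K" unfolding K_eq by auto
  have "act q i"
    using i(1) iv by (simp add: N_def act_def q_def inner_add_right)
  then have "q \<in> S" by (rule act_S[OF qK])
  then show ?thesis using e(2) act_q by (intro bexI[of _ q]) (auto simp: q_def)
qed

lemma variance_polytope:
  assumes p: "p \<in> S" and xyz: "x \<in> S" "y \<in> S" "z \<in> S"
  shows "variance_ineq d p x y z"
proof -
  have "\<exists>q. q \<in> S \<and> dist q p < 1 / Suc n \<and> (\<forall>m m'. act q m \<longrightarrow> act q m' \<longrightarrow> m = m')" for n
    using single_normal_dense[OF p, of "1 / Suc n"] by auto
  then obtain q where q: "\<And>n. q n \<in> S" "\<And>n. dist (q n) p < 1 / Suc n"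
      "\<And>n. \<forall>m m'. act (q n) m \<longrightarrow> act (q n) m' \<longrightarrow> m = m'"
    by metis
  have lim: "q \<longlonglongrightarrow> p"
  proof (rule iffD2[OF tendsto_dist_iff], rule Lim_null_comparison)
    show "\<forall>\<^sub>F n in sequentially. norm (dist (q n) p) \<le> 1 / Suc n"
      using q(2) by (intro always_eventually allI) (simp add: less_imp_le)
    show "(\<lambda>n. 1 / real (Suc n)) \<longlonglongrightarrow> 0"
      using LIMSEQ_inverse_real_of_nat by (simp add: inverse_eq_divide)
  qed
  have var: "variance_ineq d (q n) x y z" for n
  proof -
    obtain L :: "real^3 \<Rightarrow> real^3" where L: "\<forall>x\<in>S. norm (L x) = d (q n) x" "\<forall>x\<in>S. \<forall>y\<in>S. d x y \<le> norm (L x - L y)"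
      using log_map[OF q(1) q(3)] by blast
    show ?thesis
      by (rule variance_ineq_vectors[of "L x" _ _ _ "L y" _ "L z"]) (use L xyz d_nonneg in simp_all)
  qed
  show ?thesis
  proof (rule variance_ineq_limit[where D="\<lambda>_. d" and p'=q and x'="\<lambda>_. x" and y'="\<lambda>_. y" and z'="\<lambda>_. z"])
    show "(\<lambda>n. d (q n) x) \<longlonglongrightarrow> d p x" "(\<lambda>n. d (q n) y) \<longlonglongrightarrow> d p y" "(\<lambda>n. d (q n) z) \<longlonglongrightarrow> d p z"
      using xyz q(1) p by (auto intro!: tendsto_d[OF lim tendsto_const])
  qed (use var in auto)
qed

end

section \<open>Nonnegative curvature of convex surfaces\<close>

lemma pdist_image_scale:
  assumes lip: "\<And>x y. x \<in> A \<Longrightarrow> y \<in> A \<Longrightarrow> dist (f x) (f y) \<le> M * dist x y" and fA: "f ` A \<subseteq> B" and M: "0 < M"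
  shows "ereal (1 / M) * pdist B (f x) (f y) \<le> pdist A x y"
proof (rule pdist_greatest)
  fix g assume g: "path g" "path_image g \<subseteq> A" "pathstart g = x" "pathfinish g = y"
  have "M-lipschitz_on A f" using lip M by (intro lipschitz_onI) auto
  then have cont: "continuous_on A f" by (rule lipschitz_on_continuous_on)
  have "pdist B (f x) (f y) \<le> curve_length (f \<circ> g)"
  proof (rule pdist_lower)
    show "path (f \<circ> g)" by (rule path_continuous_image[OF g(1) continuous_on_subset[OF cont g(2)]])
    show "path_image (f \<circ> g) \<subseteq> B" using g(2) fA unfolding path_image_compose by blast
  qed (use g in \<open>simp_all add: pathstart_compose pathfinish_compose\<close>)
  also have "\<dots> \<le> ereal M * curve_length g"
    unfolding curve_length_vlen
  proof (rule vlen_least)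
    fix ts :: "real list" assume ts: "sorted ts" "set ts \<subseteq> {0..1}"
    have "chain (map f (map g ts)) \<le> M * chain (map g ts)"
    proof (rule chain_map_le)
      fix u v assume "u \<in> set (map g ts)" "v \<in> set (map g ts)"
      then have "u \<in> A" "v \<in> A" using ts(2) g(2) by (auto simp: path_image_def)
      then show "dist (f u) (f v) \<le> M * dist u v" by (rule lip)
    qed
    then have "ereal (chain (map (f \<circ> g) ts)) \<le> ereal M * ereal (chain (map g ts))" by simp
    also have "\<dots> \<le> ereal M * vlen g 0 1"
      using M by (intro ereal_mult_left_mono vlen_upper ts) auto
    finally show "ereal (chain (map (f \<circ> g) ts)) \<le> ereal M * vlen g 0 1" .
  qed
  finally have "ereal (1 / M) * pdist B (f x) (f y) \<le> ereal (1 / M) * (ereal M * curve_length g)"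
    using M by (intro ereal_mult_left_mono) auto
  also have "\<dots> = curve_length g" using M by (simp add: mult.assoc[symmetric] one_ereal_def[symmetric])
  finally show "ereal (1 / M) * pdist B (f x) (f y) \<le> curve_length g" .
qed

section \<open>Approximation of a convex body by inner polytopes\<close>

lemma polytope_polytope_body:
  assumes P: "polytope Q" and int: "interior Q \<noteq> {}"
  shows "\<exists>H. polytope_body Q H"
proof -
  obtain F where F: "finite F" "Q = \<Inter>F" "\<forall>h\<in>F. \<exists>a b. a \<noteq> 0 \<and> h = {x. a \<bullet> x \<le> b}"
    using polytope_imp_polyhedron[OF P] unfolding polyhedron_def by blast
  then obtain a b where ab: "\<And>h. h \<in> F \<Longrightarrow> a h \<noteq> 0" "\<And>h. h \<in> F \<Longrightarrow> h = {x. a h \<bullet> x \<le> b h}"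
    by metis
  define H where "H = (\<lambda>h. ((1 / norm (a h)) *\<^sub>R a h, b h / norm (a h))) ` F"
  have "polytope_body Q H"
  proof
    show "compact Q" "convex Q" by (rule polytope_imp_compact[OF P], rule polytope_imp_convex[OF P])
    show "interior Q \<noteq> {}" by fact
    show "finite H" using F(1) by (simp add: H_def)
    show "norm n = 1" if "(n, c) \<in> H" for n c using that ab(1) by (auto simp: H_def)
    have "y \<in> h \<longleftrightarrow> (1 / norm (a h)) *\<^sub>R a h \<bullet> y \<le> b h / norm (a h)" if "h \<in> F" for h y
    proof -
      have "y \<in> h \<longleftrightarrow> a h \<bullet> y \<le> b h" using ab(2)[OF that] by blast
      then show ?thesis using ab(1)[OF that] by (simp add: divide_le_cancel)
    qed
    then show "Q = {y. \<forall>(n, c)\<in>H. n \<bullet> y \<le> c}" unfolding F(2) H_def by auto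
  qed
  then show ?thesis by blast
qed

context convex_body
begin

text \<open>Finitely many boxes inside the interior cover the contracted body by compactness; the
  convex hull of their vertices is the polytope.\<close>

lemma inner_polytope:
  assumes c: "c \<in> interior K" and t: "0 < t" "t < 1"
  shows "\<exists>Q. polytope Q \<and> Q \<subseteq> interior K \<and> (\<lambda>x. c + t *\<^sub>R (x - c)) ` K \<subseteq> Q"
proof -
  define Kt where "Kt = (\<lambda>x. c + t *\<^sub>R (x - c)) ` K"
  have "compact Kt" unfolding Kt_def by (intro compact_continuous_image compact_K continuous_intros)
  have sub: "Kt \<subseteq> interior K"
  proof
    fix y assume "y \<in> Kt"
    then obtain x where x: "x \<in> K" "y = c + t *\<^sub>R (x - c)" by (auto simp: Kt_def)
    have "(1 - t) *\<^sub>R c + (1 - (1 - t)) *\<^sub>R x \<in> interior K" using t x by (intro interior_mix c) auto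
    then show "y \<in> interior K" unfolding x(2) by (simp add: algebra_simps)
  qed
  have "\<exists>a b. y \<in> box a b \<and> cbox a b \<subseteq> interior K" if "y \<in> Kt" for y
  proof -
    have "y \<in> interior K" using sub that by blast
    from open_contains_cbox[OF open_interior this] show ?thesis by metis
  qed
  then obtain a b where ab: "\<And>y. y \<in> Kt \<Longrightarrow> y \<in> box (a y) (b y)" "\<And>y. y \<in> Kt \<Longrightarrow> cbox (a y) (b y) \<subseteq> interior K"
    by metis
  have "Kt \<subseteq> (\<Union>y\<in>Kt. box (a y) (b y))" using ab(1) by blast
  from compactE_image[OF \<open>compact Kt\<close> open_box this]
  obtain Y where Y: "Y \<subseteq> Kt" "finite Y" "Kt \<subseteq> (\<Union>y\<in>Y. box (a y) (b y))" .
  have "\<exists>V. finite V \<and> cbox (a y) (b y) = convex hull V" for y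
    using polytope_interval[of "a y" "b y"] by (simp add: polytope_def)
  then obtain V where V: "\<And>y. finite (V y)" "\<And>y. cbox (a y) (b y) = convex hull V y" by metis
  define Q where "Q = convex hull (\<Union>y\<in>Y. V y)"
  have "polytope Q" unfolding Q_def using Y(2) V(1) by (intro polytope_convex_hull finite_UN_I)
  moreover have "Q \<subseteq> interior K"
    unfolding Q_def
  proof (rule hull_minimal)
    show "(\<Union>y\<in>Y. V y) \<subseteq> interior K"
    proof clarify
      fix x y assume "y \<in> Y" "x \<in> V y"
      then have "x \<in> cbox (a y) (b y)" unfolding V(2) by (simp add: hull_inc)
      then show "x \<in> interior K" using ab(2)[of y] \<open>y \<in> Y\<close> Y(1) by blast
    qed
    show "convex (interior K)" using convex_K by (rule convex_interior)
  qed
  moreover have "Kt \<subseteq> Q"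
  proof
    fix x assume "x \<in> Kt"
    then obtain y where y: "y \<in> Y" "x \<in> box (a y) (b y)" using Y(3) by blast
    then have "x \<in> convex hull V y" using box_subset_cbox V(2) by blast
    also have "convex hull V y \<subseteq> Q" unfolding Q_def using y(1) by (intro hull_mono) blast
    finally show "x \<in> Q" .
  qed
  ultimately show ?thesis unfolding Kt_def by blast
qed

theorem variance:
  assumes pts: "p \<in> S" "x \<in> S" "y \<in> S" "z \<in> S"
  shows "variance_ineq d p x y z"
proof -
  obtain c where c: "c \<in> interior K" using interior_K by auto
  define t where "t n = 1 - 1 / (real n + 2)" for n :: nat
  have t: "0 < t n" "t n < 1" for n by (auto simp: t_def field_simps)
  have "(\<lambda>n. 1 - 1 / (real n + 2)) \<longlonglongrightarrow> 1" by real_asymp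
  then have t_lim: "t \<longlonglongrightarrow> 1" by (simp add: t_def[abs_def])
  obtain Q where Q: "\<And>n. polytope (Q n)" "\<And>n. Q n \<subseteq> interior K" "\<And>n. (\<lambda>x. c + t n *\<^sub>R (x - c)) ` K \<subseteq> Q n"
    using inner_polytope[OF c t] by metis
  have open_img: "open ((\<lambda>x. c + t n *\<^sub>R (x - c)) ` interior K)" for n
  proof -
    have "(\<lambda>x. c + t n *\<^sub>R (x - c)) ` interior K = (\<lambda>x. (c - t n *\<^sub>R c) + x) ` ((\<lambda>x. t n *\<^sub>R x) ` interior K)"
      unfolding image_image by (simp add: algebra_simps)
    then show ?thesis using open_translation[OF open_scaling[OF _ open_interior], of "t n" "c - t n *\<^sub>R c" K] t[of n] by simp
  qed
  have img_int: "(\<lambda>x. c + t n *\<^sub>R (x - c)) ` interior K \<subseteq> interior (Q n)" for n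
    using Q(3)[of n] interior_subset[of K] by (intro interior_maximal open_img) blast
  then have "interior (Q n) \<noteq> {}" for n using c by blast
  then have "\<exists>H. polytope_body (Q n) H" for n by (rule polytope_polytope_body[OF Q(1)])
  then obtain H where H: "\<And>n. polytope_body (Q n) (H n)" by metis
  have body: "convex_body (Q n)" for n using H polytope_body.axioms(1) by blast
  \<comment> \<open>The surface lies outside the interior of \<open>Q n\<close>, so this projection
    does not increase intrinsic distances.\<close>
  define q where "q n u = closest_point (Q n) u" for n u
  \<comment> \<open>The way back: dilation by 1 / \<open>t n\<close> carries the frontier of
    \<open>Q n\<close> outside the interior of \<open>K\<close>, from where it can be projected to
    \<open>K\<close>. This costs the factor \<open>t n\<close>, which tends to 1.\<close>
  define E where "E n z = c + (1 / t n) *\<^sub>R (z - c)" for n and z :: "real^3"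
  have SW: "S \<subseteq> - interior (Q n)" for n using Q(2)[of n] interior_subset[of "Q n"] by (auto simp: S_eq)
  have q_front: "q n u \<in> frontier (Q n)" if "u \<in> S" for n u
    unfolding q_def using convex_body.closest_point_frontier[OF body] SW that by blast
  have le: "idist (frontier (Q n)) (q n u) (q n v) \<le> d u v" if uv: "u \<in> S" "v \<in> S" for n u v
  proof -
    have "ereal (idist (frontier (Q n)) (q n u) (q n v)) = pdist (frontier (Q n)) (q n u) (q n v)"
      by (rule convex_body.ereal_d[OF body q_front[OF uv(1)] q_front[OF uv(2)]])
    also have "\<dots> \<le> pdist (- interior (Q n)) u v"
      unfolding q_def by (rule convex_body.pdist_closest_point[OF body])
    also have "\<dots> \<le> pdist S u v" by (rule pdist_mono[OF SW])
    also have "\<dots> = ereal (d u v)" by (rule ereal_d[OF uv, symmetric])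
    finally show ?thesis by simp
  qed
  have EW: "E n ` frontier (Q n) \<subseteq> W" for n
  proof clarify
    fix z assume z: "z \<in> frontier (Q n)" "E n z \<in> interior K"
    have "c + t n *\<^sub>R (E n z - c) \<in> interior (Q n)" using z(2) img_int[of n] by blast
    moreover have "c + t n *\<^sub>R (E n z - c) = z" using t[of n] by (simp add: E_def)
    ultimately show False using z(1) by (simp add: frontier_def)
  qed
  define r where "r n u = closest_point K (E n (q n u))" for n u
  have r_S: "r n u \<in> S" if "u \<in> S" for n u
    unfolding r_def using EW q_front[OF that] by (intro closest_point_frontier) blast
  have ge: "t n * d (r n u) (r n v) \<le> idist (frontier (Q n)) (q n u) (q n v)" if uv: "u \<in> S" "v \<in> S" for n u v
  proof -
    let ?F = "frontier (Q n)"
    have "ereal (1 / (1 / t n)) * pdist W (E n (q n u)) (E n (q n v)) \<le> pdist ?F (q n u) (q n v)"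
    proof (rule pdist_image_scale)
      fix a b
      have "E n a - E n b = (1 / t n) *\<^sub>R (a - b)" by (simp add: E_def algebra_simps)
      then show "dist (E n a) (E n b) \<le> 1 / t n * dist a b" using t[of n] by (simp add: dist_norm)
    qed (use EW t in auto)
    also have "\<dots> = ereal (idist ?F (q n u) (q n v))"
      by (rule convex_body.ereal_d[OF body q_front[OF uv(1)] q_front[OF uv(2)], symmetric])
    finally have 1: "ereal (t n) * pdist W (E n (q n u)) (E n (q n v)) \<le> ereal (idist ?F (q n u) (q n v))" by simp
    have "ereal (t n * d (r n u) (r n v)) = ereal (t n) * pdist S (r n u) (r n v)"
      using ereal_d[OF r_S r_S, OF uv] by (simp flip: times_ereal.simps(1))
    also have "\<dots> \<le> ereal (t n) * pdist W (E n (q n u)) (E n (q n v))"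
      unfolding r_def using t[of n] by (intro ereal_mult_left_mono pdist_closest_point) auto
    also note 1
    finally show ?thesis by simp
  qed
  have r_lim: "(\<lambda>n. r n u) \<longlonglongrightarrow> u" if u: "u \<in> S" for u
  proof -
    have b1: "dist (r n u) u \<le> (1 - t n) * norm (u - c) + (1 / t n - 1) * (norm (u - c) + norm (u - c))" for n
    proof -
      have uK: "u \<in> K" using u S_subset_K by blast
      have cl: "closed (Q n)" using polytope_imp_closed[OF Q(1)] .
      have "dist u (q n u) \<le> dist u (c + t n *\<^sub>R (u - c))"
        unfolding q_def using Q(3)[of n] uK by (intro closest_point_le cl) blast
      also have "u - (c + t n *\<^sub>R (u - c)) = (1 - t n) *\<^sub>R (u - c)" by (simp add: algebra_simps)
      then have "dist u (c + t n *\<^sub>R (u - c)) = (1 - t n) * norm (u - c)" using t[of n] by (simp add: dist_norm)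
      finally have d1: "dist u (q n u) \<le> (1 - t n) * norm (u - c)" .
      also have "\<dots> \<le> 1 * norm (u - c)" using t[of n] by (intro mult_right_mono) auto
      finally have "norm (q n u - c) \<le> norm (u - c) + norm (u - c)"
        using dist_triangle[of "q n u" c u] by (simp add: dist_norm dist_commute norm_minus_commute)
      moreover have "E n (q n u) - q n u = (1 / t n - 1) *\<^sub>R (q n u - c)" by (simp add: E_def algebra_simps)
      moreover have tt: "0 \<le> 1 / t n - 1" using t[of n] by simp
      ultimately have d2: "dist (E n (q n u)) (q n u) \<le> (1 / t n - 1) * (norm (u - c) + norm (u - c))"
        by (simp add: dist_norm mult_left_mono)
      have "dist (r n u) u \<le> dist (E n (q n u)) u"
        using closest_point_nonexp[of "E n (q n u)" u] closest_point_S[OF u] by (simp add: r_def)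
      also have "\<dots> \<le> dist (E n (q n u)) (q n u) + dist (q n u) u" by (rule dist_triangle)
      finally show ?thesis using d1 d2 by (simp add: dist_commute)
    qed
    have "(\<lambda>n. (1 - t n) * norm (u - c) + (1 / t n - 1) * (norm (u - c) + norm (u - c)))
        \<longlonglongrightarrow> (1 - 1) * norm (u - c) + (1 / 1 - 1) * (norm (u - c) + norm (u - c))"
      by (intro tendsto_intros t_lim) simp
    then have "(\<lambda>n. (1 - t n) * norm (u - c) + (1 / t n - 1) * (norm (u - c) + norm (u - c))) \<longlonglongrightarrow> 0" by simp
    moreover have "\<forall>\<^sub>F n in sequentially. norm (dist (r n u) u)
        \<le> (1 - t n) * norm (u - c) + (1 / t n - 1) * (norm (u - c) + norm (u - c))"
      using b1 by (intro always_eventually allI) simp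
    ultimately have "(\<lambda>n. dist (r n u) u) \<longlonglongrightarrow> 0" by (rule Lim_null_comparison[rotated])
    then show ?thesis by (rule iffD2[OF tendsto_dist_iff])
  qed
  have lim: "(\<lambda>n. idist (frontier (Q n)) (q n u) (q n v)) \<longlonglongrightarrow> d u v" if uv: "u \<in> S" "v \<in> S" for u v
  proof (rule tendsto_sandwich)
    show "\<forall>\<^sub>F n in sequentially. t n * d (r n u) (r n v) \<le> idist (frontier (Q n)) (q n u) (q n v)"
      using ge[OF uv] by (intro always_eventually allI)
    show "\<forall>\<^sub>F n in sequentially. idist (frontier (Q n)) (q n u) (q n v) \<le> d u v"
      using le[OF uv] by (intro always_eventually allI)
    have "(\<lambda>n. d (r n u) (r n v)) \<longlonglongrightarrow> d u v"
      by (rule tendsto_d[OF r_lim[OF uv(1)] r_lim[OF uv(2)] uv r_S[OF uv(1)] r_S[OF uv(2)]])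
    from tendsto_mult[OF t_lim this] show "(\<lambda>n. t n * d (r n u) (r n v)) \<longlonglongrightarrow> d u v" by simp
  qed simp
  show ?thesis
  proof (rule variance_ineq_limit[where D="\<lambda>n. idist (frontier (Q n))" and p'="\<lambda>n. q n p"
        and x'="\<lambda>n. q n x" and y'="\<lambda>n. q n y" and z'="\<lambda>n. q n z"])
    show "variance_ineq (idist (frontier (Q n))) (q n p) (q n x) (q n y) (q n z)" for n
      by (rule polytope_body.variance_polytope[OF H]) (use q_front pts in auto)
  qed (use lim pts in auto)
qed

text \<open>At the intermediate point \<open>z\<close> the weights \<open>t\<close> for
  \<open>a\<close> and \<open>s\<close> for \<open>b\<close> make the variance inequality an
  equality at order 0 in the weight \<open>\<epsilon>\<close> of \<open>c\<close>. After division by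
  \<open>\<epsilon>\<close> the limit is Stewart's identity, as an inequality.\<close>

lemma point_on_side:
  assumes pts: "z \<in> S" "a \<in> S" "b \<in> S" "c \<in> S" and ab: "d a b = s + t" "d z a = s" "d z b = t"
  shows "t * (d a c)\<^sup>2 + s * (d b c)\<^sup>2 \<le> (s + t) * (s * t + (d z c)\<^sup>2)"
proof (rule field_le_epsilon)
  fix e :: real assume e: "0 < e"
  have st: "0 \<le> s" "0 \<le> t" using ab d_nonneg pts by metis+
  define Z where "Z = (d z c)\<^sup>2"
  define \<epsilon> where "\<epsilon> = e / (Z + 1)"
  have Z: "0 \<le> Z" by (simp add: Z_def)
  have \<epsilon>: "0 < \<epsilon>" using e Z by (simp add: \<epsilon>_def add_nonneg_pos)
  have "\<epsilon> * Z \<le> \<epsilon> * (Z + 1)" using \<epsilon> by (intro mult_left_mono) auto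
  also have "\<epsilon> * (Z + 1) = e" using Z by (simp add: \<epsilon>_def)
  finally have \<epsilon>Z: "\<epsilon> * Z \<le> e" .
  have "t * s * (d a b)\<^sup>2 + t * \<epsilon> * (d a c)\<^sup>2 + s * \<epsilon> * (d b c)\<^sup>2
      \<le> (t + s + \<epsilon>) * (t * (d z a)\<^sup>2 + s * (d z b)\<^sup>2 + \<epsilon> * (d z c)\<^sup>2)"
    using variance[OF pts] st \<epsilon> unfolding variance_ineq_def by simp
  then have "\<epsilon> * (t * (d a c)\<^sup>2 + s * (d b c)\<^sup>2) \<le> \<epsilon> * ((s + t) * (s * t + Z) + \<epsilon> * Z)"
    unfolding ab Z_def by (simp add: power2_eq_square algebra_simps)
  then have "t * (d a c)\<^sup>2 + s * (d b c)\<^sup>2 \<le> (s + t) * (s * t + Z) + \<epsilon> * Z"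
    using \<epsilon> by (rule mult_left_le_imp_le)
  then show "t * (d a c)\<^sup>2 + s * (d b c)\<^sup>2 \<le> (s + t) * (s * t + (d z c)\<^sup>2) + e"
    using \<epsilon>Z by (simp add: Z_def)
qed

text \<open>\<open>b\<close> and \<open>c\<close> end two continuations, of equal length
  \<open>r\<close>, of a path from \<open>a\<close> through \<open>z\<close>. Using \<open>c\<close>
  as the third point in \<open>point_on_side\<close> leaves no distance between the ends.\<close>

lemma nonbranching:
  assumes pts: "a \<in> S" "z \<in> S" "b \<in> S" "c \<in> S" and m: "0 < m" "d z a = m"
    and b: "d a b = m + r" "d z b = r" and c: "d a c = m + r" "d z c = r"
  shows "b = c"
proof -
  have "r * (m + r)\<^sup>2 + m * (d b c)\<^sup>2 \<le> (m + r) * (m * r + r\<^sup>2)"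
    using point_on_side[OF pts(2,1,3,4) b(1) m(2) b(2)] by (simp add: c)
  also have "\<dots> = r * (m + r)\<^sup>2" by (simp add: power2_eq_square algebra_simps)
  finally have "m * (d b c)\<^sup>2 \<le> 0" by simp
  then have "(d b c)\<^sup>2 \<le> 0" using m(1) by (simp add: mult_le_0_iff)
  then show ?thesis using d_eq_0 pts by simp
qed

section \<open>Comparison angles and their monotonicity\<close>

definition ccos :: "real^3 \<Rightarrow> real^3 \<Rightarrow> real^3 \<Rightarrow> real" where
  "ccos p q1 q2 = ((d p q1)\<^sup>2 + (d p q2)\<^sup>2 - (d q1 q2)\<^sup>2) / (2 * d p q1 * d p q2)"

lemma cmp_angle_ccos: "cmp_angle S p q1 q2 = arccos (ccos p q1 q2)"
  by (simp add: cmp_angle_def ccos_def)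

lemma ccos_commute: "ccos p q1 q2 = ccos p q2 q1"
  by (simp add: ccos_def d_commute[of q1 q2] mult.commute mult.left_commute add.commute)

lemma ccos_bounds:
  assumes "p \<in> S" "x \<in> S" "y \<in> S" "p \<noteq> x" "p \<noteq> y"
  shows "- 1 \<le> ccos p x y" "ccos p x y \<le> 1"
proof -
  define a b c where "a = d p x" and "b = d p y" and "c = d x y"
  have ab: "0 < a" "0 < b" unfolding a_def b_def using assms by (auto intro: d_pos)
  have c: "0 \<le> c" "c \<le> a + b" "a \<le> c + b" "b \<le> c + a"
    unfolding a_def b_def c_def
    using d_nonneg d_triangle[of x p y] d_triangle[of p y x] d_triangle[of p x y] d_commute assms by (metis add.commute)+
  have "c\<^sup>2 \<le> (a + b)\<^sup>2" using c by (intro power_mono)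
  then have "- 1 * (2 * a * b) \<le> a\<^sup>2 + b\<^sup>2 - c\<^sup>2" by (simp add: power2_eq_square algebra_simps)
  then show "- 1 \<le> ccos p x y"
    unfolding ccos_def a_def[symmetric] b_def[symmetric] c_def[symmetric] using ab by (subst pos_le_divide_eq) auto
  have "\<bar>a - b\<bar>\<^sup>2 \<le> c\<^sup>2" using c by (intro power_mono) auto
  then have "a\<^sup>2 + b\<^sup>2 - c\<^sup>2 \<le> 1 * (2 * a * b)" by (simp add: power2_eq_square algebra_simps)
  then show "ccos p x y \<le> 1"
    unfolding ccos_def a_def[symmetric] b_def[symmetric] c_def[symmetric] using ab by (subst pos_divide_le_eq) auto
qed

text \<open>This is \<open>point_on_side\<close> rearranged: drawing in one end of a path does not
  decrease the comparison angle at its origin.\<close>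

lemma ccos_mono1:
  assumes g: "geod \<gamma> l" and y: "y \<in> S" "y \<noteq> \<gamma> 0" and s: "0 < s" "s \<le> l"
  shows "ccos (\<gamma> 0) (\<gamma> s) y \<le> ccos (\<gamma> 0) (\<gamma> l) y"
proof -
  have S: "\<gamma> 0 \<in> S" "\<gamma> s \<in> S" "\<gamma> l \<in> S" using s by (auto intro: geod_S[OF g])
  define a where "a = d (\<gamma> 0) y"
  have a: "0 < a" unfolding a_def using d_pos S y by metis
  have d: "d (\<gamma> 0) (\<gamma> s) = s" "d (\<gamma> 0) (\<gamma> l) = l" "d (\<gamma> s) (\<gamma> 0) = s" "d (\<gamma> s) (\<gamma> l) = l - s"
    using geod_d[OF g, of 0 s] geod_d[OF g, of 0 l] geod_d[OF g, of s 0] geod_d[OF g, of s l] s by auto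
  have "(l - s) * a\<^sup>2 + s * (d (\<gamma> l) y)\<^sup>2 \<le> (s + (l - s)) * (s * (l - s) + (d (\<gamma> s) y)\<^sup>2)"
    unfolding a_def using d by (intro point_on_side[OF S(2,1,3) y(1)]) auto
  then have "l * (s\<^sup>2 + a\<^sup>2 - (d (\<gamma> s) y)\<^sup>2) \<le> s * (l\<^sup>2 + a\<^sup>2 - (d (\<gamma> l) y)\<^sup>2)"
    by (simp add: power2_eq_square algebra_simps)
  then have "(s\<^sup>2 + a\<^sup>2 - (d (\<gamma> s) y)\<^sup>2) / (2 * s * a) \<le> (l\<^sup>2 + a\<^sup>2 - (d (\<gamma> l) y)\<^sup>2) / (2 * l * a)"
    using s a by (simp add: divide_simps) (simp add: mult.commute mult.left_commute)
  then show ?thesis unfolding ccos_def d a_def .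
qed

lemma geod_neq: "geod \<gamma> l \<Longrightarrow> 0 < s \<Longrightarrow> s \<le> l \<Longrightarrow> \<gamma> s \<noteq> \<gamma> 0"
  using geod_d[of \<gamma> l 0 s] d_refl[OF geod_S[of \<gamma> l 0]] by force

lemma ccos_mono:
  assumes g: "geod \<gamma> l" and h: "geod \<beta> r" and p: "\<gamma> 0 = \<beta> 0"
    and s: "0 < s" "s \<le> s'" "s' \<le> l" and t: "0 < t" "t \<le> t'" "t' \<le> r"
  shows "ccos (\<gamma> 0) (\<gamma> s) (\<beta> t) \<le> ccos (\<gamma> 0) (\<gamma> s') (\<beta> t')"
proof -
  have "ccos (\<gamma> 0) (\<gamma> s) (\<beta> t) \<le> ccos (\<gamma> 0) (\<gamma> s') (\<beta> t)"
    using geod_S[OF h, of t] geod_neq[OF h, of t] s t p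
    by (intro ccos_mono1[OF geod_restrict[OF g]]) auto
  also have "\<dots> = ccos (\<beta> 0) (\<beta> t) (\<gamma> s')" by (simp add: p ccos_commute)
  also have "\<dots> \<le> ccos (\<beta> 0) (\<beta> t') (\<gamma> s')"
    using geod_S[OF g, of s'] geod_neq[OF g, of s'] s t p
    by (intro ccos_mono1[OF geod_restrict[OF h]]) auto
  also have "\<dots> = ccos (\<gamma> 0) (\<gamma> s') (\<beta> t')" by (simp add: p ccos_commute)
  finally show ?thesis .
qed

end

section \<open>Angles and excess\<close>

text \<open>The angles of a Euclidean triangle. By Heron's product \<open>A * B + C\<close> is
  nonnegative, hence equal to the product of two sines, and the cosine of the sum of two angles
  becomes that of pi minus the third.\<close>

lemma arccos_sum_ge_pi:
  fixes a b c :: real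
  assumes pos: "0 < a" "0 < b" "0 < c" and tri: "a \<le> b + c" "b \<le> a + c" "c \<le> a + b"
  shows "pi \<le> arccos ((b\<^sup>2 + c\<^sup>2 - a\<^sup>2) / (2 * b * c)) + arccos ((a\<^sup>2 + c\<^sup>2 - b\<^sup>2) / (2 * a * c))
    + arccos ((a\<^sup>2 + b\<^sup>2 - c\<^sup>2) / (2 * a * b))"
proof -
  define A where "A = (b\<^sup>2 + c\<^sup>2 - a\<^sup>2) / (2 * b * c)"
  define B where "B = (a\<^sup>2 + c\<^sup>2 - b\<^sup>2) / (2 * a * c)"
  define C where "C = (a\<^sup>2 + b\<^sup>2 - c\<^sup>2) / (2 * a * b)"
  have bound: "- 1 \<le> (x\<^sup>2 + y\<^sup>2 - z\<^sup>2) / (2 * x * y) \<and> (x\<^sup>2 + y\<^sup>2 - z\<^sup>2) / (2 * x * y) \<le> 1"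
    if "0 < x" "0 < y" "0 < z" "x \<le> y + z" "y \<le> x + z" "z \<le> x + y" for x y z :: real
  proof -
    have "z\<^sup>2 \<le> (x + y)\<^sup>2" using that by (intro power_mono) auto
    then have "- 1 * (2 * x * y) \<le> x\<^sup>2 + y\<^sup>2 - z\<^sup>2" by (simp add: power2_eq_square algebra_simps)
    moreover have "\<bar>x - y\<bar>\<^sup>2 \<le> z\<^sup>2" using that by (intro power_mono) auto
    then have "x\<^sup>2 + y\<^sup>2 - z\<^sup>2 \<le> 1 * (2 * x * y)" by (simp add: power2_eq_square algebra_simps)
    moreover have "0 < 2 * x * y" using that by simp
    ultimately show ?thesis by (simp only: pos_le_divide_eq pos_divide_le_eq)
  qed
  have A: "- 1 \<le> A" "A \<le> 1" using bound[of b c a] pos tri by (simp_all add: A_def add.commute)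
  have B: "- 1 \<le> B" "B \<le> 1" using bound[of a c b] pos tri by (simp_all add: B_def add.commute)
  have C: "- 1 \<le> C" "C \<le> 1" using bound[of a b c] pos tri by (simp_all add: C_def add.commute)
  have A2: "2 * b * c * A = b\<^sup>2 + c\<^sup>2 - a\<^sup>2" using pos by (simp add: A_def)
  have B2: "2 * a * c * B = a\<^sup>2 + c\<^sup>2 - b\<^sup>2" using pos by (simp add: B_def)
  have C2: "2 * a * b * C = a\<^sup>2 + b\<^sup>2 - c\<^sup>2" using pos by (simp add: C_def)
  have heron: "4 * a * b * c\<^sup>2 * (A * B + C) = (a + b + c) * (b + c - a) * (a + c - b) * (a + b - c)"
  proof -
    have "4 * a * b * c\<^sup>2 * (A * B + C) = (2 * b * c * A) * (2 * a * c * B) + 2 * c\<^sup>2 * (2 * a * b * C)"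
      by (simp add: power2_eq_square algebra_simps)
    then show ?thesis unfolding A2 B2 C2 by (simp add: power2_eq_square algebra_simps)
  qed
  have ABC: "0 \<le> A * B + C"
  proof -
    have "0 \<le> (a + b + c) * (b + c - a) * (a + c - b) * (a + b - c)"
      using pos tri by (intro mult_nonneg_nonneg) auto
    then have "0 \<le> (4 * a * b * c\<^sup>2) * (A * B + C)" using heron by simp
    moreover have "0 < 4 * a * b * c\<^sup>2" using pos by simp
    ultimately show ?thesis by (simp add: zero_le_mult_iff)
  qed
  have "(1 - A\<^sup>2) * (1 - B\<^sup>2) = (A * B + C)\<^sup>2"
  proof -
    have "4 * a\<^sup>2 * b\<^sup>2 * c\<^sup>2 * (1 - A\<^sup>2 - B\<^sup>2 - C\<^sup>2 - 2 * A * B * C)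
        = 4 * a\<^sup>2 * b\<^sup>2 * c\<^sup>2 - a\<^sup>2 * (2 * b * c * A)\<^sup>2 - b\<^sup>2 * (2 * a * c * B)\<^sup>2 - c\<^sup>2 * (2 * a * b * C)\<^sup>2
          - (2 * b * c * A) * (2 * a * c * B) * (2 * a * b * C)"
      by (simp add: power2_eq_square algebra_simps)
    also have "\<dots> = 0" unfolding A2 B2 C2 by (simp add: power2_eq_square algebra_simps)
    finally have "1 - A\<^sup>2 - B\<^sup>2 - C\<^sup>2 - 2 * A * B * C = 0" using pos by simp
    then show ?thesis by (simp add: power2_eq_square algebra_simps)
  qed
  then have "sqrt (1 - A\<^sup>2) * sqrt (1 - B\<^sup>2) = A * B + C" using ABC by (simp flip: real_sqrt_mult)
  then have "cos (arccos A + arccos B) = - C"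
    using A B by (simp add: cos_add sin_arccos)
  also have "\<dots> = cos (pi - arccos C)" using C by (simp add: cos_diff)
  finally have eq: "cos (arccos A + arccos B) = cos (pi - arccos C)" .
  have r: "0 \<le> arccos A" "0 \<le> arccos B" "0 \<le> arccos C" "arccos C \<le> pi"
    using A B C by (auto intro: arccos_lbound arccos_ubound)
  have "pi \<le> arccos A + arccos B + arccos C"
  proof (cases "arccos A + arccos B \<le> pi")
    case True
    then have "arccos A + arccos B = pi - arccos C"
      using cos_inj_pi[of "arccos A + arccos B" "pi - arccos C"] eq r by simp
    then show ?thesis by simp
  qed (use r in linarith)
  then show ?thesis by (simp add: A_def B_def C_def)
qed

section \<open>Angles between shortest paths\<close>

context convex_body
begin

lemma shortest_path_reversepath:
  assumes "shortest_path S g x y" shows "shortest_path S (reversepath g) y x"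
  using assms unfolding shortest_path_def by (simp add: curve_length_reverse d_commute)

text \<open>The angle is an infimum over the size of suprema of comparison angles. By monotonicity a
  comparison angle is dominated by those at smaller parameters, so each one bounds the angle from
  below. For the upper bound an arbitrary pair of parameters is compared with the equal pair formed
  by the smaller one, so control along equal parameters is enough.\<close>

lemma path_angle_bounds:
  assumes g: "geod \<gamma> l" "0 < l" "\<gamma> 0 = p" "\<gamma> ` {0..l} = path_image g1"
    and h: "geod \<beta> r" "0 < r" "\<beta> 0 = p" "\<beta> ` {0..r} = path_image g2" and start: "pathstart g1 = p"
  shows path_angle_ge: "0 < s \<Longrightarrow> s \<le> l \<Longrightarrow> 0 < t \<Longrightarrow> t \<le> r \<Longrightarrow> arccos (ccos p (\<gamma> s) (\<beta> t)) \<le> path_angle S g1 g2"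
    and path_angle_le: "0 < u0 \<Longrightarrow> u0 \<le> l \<Longrightarrow> u0 \<le> r \<Longrightarrow> - 1 \<le> k \<Longrightarrow> (\<And>u. 0 < u \<Longrightarrow> u \<le> u0 \<Longrightarrow> k \<le> ccos p (\<gamma> u) (\<beta> u))
      \<Longrightarrow> path_angle S g1 g2 \<le> arccos k"
proof -
  define A where "A e = {(q1, q2). q1 \<in> path_image g1 \<and> q2 \<in> path_image g2 \<and>
      0 < d p q1 \<and> d p q1 < e \<and> 0 < d p q2 \<and> d p q2 < e}" for e
  define F where "F e = (SUP q\<in>A e. cmp_angle S p (fst q) (snd q))" for e
  have angle: "path_angle S g1 g2 = (INF e\<in>{0<..}. F e)"
    unfolding path_angle_def Let_def start F_def A_def ..
  have pS: "p \<in> S" using geod_S[OF g(1), of 0] g(2,3) by simp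
  have dg: "d p (\<gamma> s) = s" if "0 \<le> s" "s \<le> l" for s using geod_d[OF g(1), of 0 s] that g(3) by simp
  have dh: "d p (\<beta> t) = t" if "0 \<le> t" "t \<le> r" for t using geod_d[OF h(1), of 0 t] that h(3) by simp
  have A_elem: "\<exists>s t. q = (\<gamma> s, \<beta> t) \<and> 0 < s \<and> s \<le> l \<and> s < e \<and> 0 < t \<and> t \<le> r \<and> t < e" if "q \<in> A e" for q e
  proof -
    obtain q1 q2 where q0: "q = (q1, q2)" by (cases q)
    have q: "q1 \<in> path_image g1" "q2 \<in> path_image g2" "0 < d p q1" "d p q1 < e" "0 < d p q2" "d p q2 < e"
      using that by (simp_all add: A_def q0)
    then have "q1 \<in> \<gamma> ` {0..l}" "q2 \<in> \<beta> ` {0..r}" using g(4) h(4) by simp_all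
    then obtain s t where "q1 = \<gamma> s" "s \<in> {0..l}" "q2 = \<beta> t" "t \<in> {0..r}" by blast
    then show ?thesis using q q0 dg[of s] dh[of t] by auto
  qed
  have A_mem: "(\<gamma> s, \<beta> t) \<in> A e" if "0 < s" "s \<le> l" "s < e" "0 < t" "t \<le> r" "t < e" for s t e
    using that dg[of s] dh[of t] unfolding A_def g(4)[symmetric] h(4)[symmetric] by auto
  have neq: "\<gamma> s \<noteq> p" "\<gamma> s \<in> S" if "0 < s" "s \<le> l" for s
    using geod_neq[OF g(1) that] geod_S[OF g(1), of s] that g(3) by auto
  have neq': "\<beta> s \<noteq> p" "\<beta> s \<in> S" if "0 < s" "s \<le> r" for s
    using geod_neq[OF h(1) that] geod_S[OF h(1), of s] that h(3) by auto
  have cb: "- 1 \<le> ccos p (\<gamma> s) (\<beta> t)" "ccos p (\<gamma> s) (\<beta> t) \<le> 1" if "0 < s" "s \<le> l" "0 < t" "t \<le> r" for s t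
    using ccos_bounds[OF pS neq(2) neq'(2)] neq(1) neq'(1) that by (metis, metis)
  have bdd: "bdd_above ((\<lambda>q. cmp_angle S p (fst q) (snd q)) ` A e)" for e
  proof (rule bdd_aboveI2[where M=pi])
    fix q assume "q \<in> A e"
    then obtain s t where "q = (\<gamma> s, \<beta> t)" "0 < s" "s \<le> l" "0 < t" "t \<le> r" using A_elem by blast
    then show "cmp_angle S p (fst q) (snd q) \<le> pi"
      unfolding cmp_angle_ccos using cb[of s t] by (simp add: arccos_ubound)
  qed
  have ge: "arccos (ccos p (\<gamma> s) (\<beta> t)) \<le> F e" if e: "0 < e" and st: "0 < s" "s \<le> l" "0 < t" "t \<le> r" for s t e
  proof -
    define s' t' where "s' = min s (e / 2)" and "t' = min t (e / 2)"
    have s': "0 < s'" "s' \<le> s" "s' < e" "0 < t'" "t' \<le> t" "t' < e"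
      using e st by (auto simp: s'_def t'_def)
    have "ccos (\<gamma> 0) (\<gamma> s') (\<beta> t') \<le> ccos (\<gamma> 0) (\<gamma> s) (\<beta> t)"
      using s' st by (intro ccos_mono[OF g(1) h(1)]) (simp_all add: g(3) h(3))
    then have "arccos (ccos p (\<gamma> s) (\<beta> t)) \<le> arccos (ccos p (\<gamma> s') (\<beta> t'))"
      using cb(1)[of s' t'] cb(2)[of s t] s' st by (intro arccos_le_arccos) (simp_all add: g(3))
    also have "\<dots> = cmp_angle S p (fst (\<gamma> s', \<beta> t')) (snd (\<gamma> s', \<beta> t'))" by (simp add: cmp_angle_ccos)
    also have "\<dots> \<le> F e"
      unfolding F_def using s' st by (intro cSUP_upper bdd A_mem) auto
    finally show ?thesis .
  qed
  have F0: "0 \<le> F e" if "0 < e" for e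
  proof -
    have "0 \<le> arccos (ccos p (\<gamma> l) (\<beta> r))" using cb[of l r] g(2) h(2) by (simp add: arccos_lbound)
    also have "\<dots> \<le> F e" using g(2) h(2) by (intro ge[OF that]) auto
    finally show ?thesis .
  qed
  show "arccos (ccos p (\<gamma> s) (\<beta> t)) \<le> path_angle S g1 g2" if "0 < s" "s \<le> l" "0 < t" "t \<le> r"
    unfolding angle
  proof (rule cINF_greatest)
    show "{0::real<..} \<noteq> {}" by (meson greaterThan_non_empty)
  qed (use ge that in simp)
  show "path_angle S g1 g2 \<le> arccos k"
    if u: "0 < u0" "u0 \<le> l" "u0 \<le> r" and k: "- 1 \<le> k" and le: "\<And>u. 0 < u \<Longrightarrow> u \<le> u0 \<Longrightarrow> k \<le> ccos p (\<gamma> u) (\<beta> u)"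
  proof -
    have "path_angle S g1 g2 \<le> F u0"
      unfolding angle using u F0 by (intro cINF_lower bdd_belowI2[where m=0]) auto
    also have "\<dots> \<le> arccos k"
      unfolding F_def
    proof (rule cSUP_least)
      have "(\<gamma> (u0 / 2), \<beta> (u0 / 2)) \<in> A u0" using u by (intro A_mem) auto
      then show "A u0 \<noteq> {}" by blast
      fix q assume "q \<in> A u0"
      then obtain s t where q: "q = (\<gamma> s, \<beta> t)" and st: "0 < s" "s \<le> l" "s < u0" "0 < t" "t \<le> r" "t < u0"
        using A_elem by blast
      define v where "v = min s t"
      have v: "0 < v" "v \<le> s" "v \<le> t" "v \<le> u0" using st by (auto simp: v_def)
      have "k \<le> ccos p (\<gamma> v) (\<beta> v)" using v by (intro le)
      also have "\<dots> = ccos (\<gamma> 0) (\<gamma> v) (\<beta> v)" by (simp add: g(3))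
      also have "\<dots> \<le> ccos (\<gamma> 0) (\<gamma> s) (\<beta> t)"
        using v st by (intro ccos_mono[OF g(1) h(1)]) (simp_all add: g(3) h(3))
      finally show "cmp_angle S p (fst q) (snd q) \<le> arccos k"
        unfolding q cmp_angle_ccos using k cb(2)[of s t] st by (intro arccos_le_arccos) (simp_all add: g(3))
    qed
    finally show ?thesis .
  qed
qed

lemma shortest_path_angle_ge:
  assumes g: "shortest_path S g1 p x" "p \<noteq> x" and h: "shortest_path S g2 p y" "p \<noteq> y"
  shows "arccos (ccos p x y) \<le> path_angle S g1 g2"
proof -
  have S: "p \<in> S" "x \<in> S" "y \<in> S"
    using shortest_path_geod(1,2)[OF g(1)] shortest_path_geod(1,2)[OF h(1)] by auto
  obtain \<gamma> where \<gamma>: "geod \<gamma> (d p x)" "\<gamma> 0 = p" "\<gamma> (d p x) = x" "\<gamma> ` {0..d p x} = path_image g1"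
    using shortest_path_geod(3)[OF g(1)] by blast
  obtain \<beta> where \<beta>: "geod \<beta> (d p y)" "\<beta> 0 = p" "\<beta> (d p y) = y" "\<beta> ` {0..d p y} = path_image g2"
    using shortest_path_geod(3)[OF h(1)] by blast
  have start: "pathstart g1 = p" using g(1) by (simp add: shortest_path_def)
  have pos: "0 < d p x" "0 < d p y" using d_pos[OF S(1,2) g(2)] d_pos[OF S(1,3) h(2)] by auto
  show ?thesis
    using path_angle_ge[OF \<gamma>(1) pos(1) \<gamma>(2,4) \<beta>(1) pos(2) \<beta>(2,4) start, of "d p x" "d p y"] pos
    by (simp add: \<gamma>(3) \<beta>(3))
qed

text \<open>The nested join passes through its vertices at the parameters 0, 1/2 and 3/4.\<close>

lemma simple_triangle_distinct:
  assumes "simple_path (g1 +++ g2 +++ g3)" "pathstart g1 = a" "pathfinish g1 = b"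
    "pathstart g2 = b" "pathfinish g2 = c" "pathstart g3 = c" "pathfinish g3 = a"
  shows "a \<noteq> b" "b \<noteq> c" "c \<noteq> a"
proof -
  let ?g = "g1 +++ g2 +++ g3"
  have v: "?g 0 = a" "?g (1/2) = b" "?g (3/4) = c"
    using assms(2-) by (auto simp: joinpaths_def pathstart_def pathfinish_def)
  have inj: "s = t \<or> s = 0 \<and> t = 1 \<or> s = 1 \<and> t = 0"
    if "s \<in> {0..1}" "t \<in> {0..1}" "?g s = ?g t" for s t
    using assms(1) that unfolding simple_path_def loop_free_def by blast
  show "a \<noteq> b" using inj[of 0 "1/2"] v by auto
  show "b \<noteq> c" using inj[of "1/2" "3/4"] v by auto
  show "c \<noteq> a" using inj[of "3/4" 0] v by auto
qed

lemma geo_triangle_distinct: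
  assumes "geo_triangle S T"
  shows "va T \<noteq> vb T" "vb T \<noteq> vc T" "vc T \<noteq> va T"
    and "va T \<in> S" "vb T \<in> S" "vc T \<in> S"
proof -
  have T: "shortest_path S (sab T) (va T) (vb T)" "shortest_path S (sbc T) (vb T) (vc T)"
    "shortest_path S (sca T) (vc T) (va T)" "simple_path (sab T +++ sbc T +++ sca T)"
    using assms by (auto simp: geo_triangle_def)
  show "va T \<noteq> vb T" "vb T \<noteq> vc T" "vc T \<noteq> va T"
    using simple_triangle_distinct[OF T(4)] T(1-3) unfolding shortest_path_def by blast+
  show "va T \<in> S" "vb T \<in> S" "vc T \<in> S"
    using shortest_path_geod(1)[OF T(1)] shortest_path_geod(1)[OF T(2)] shortest_path_geod(1)[OF T(3)] .
qed

lemma geo_triangle_angles_ge: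
  assumes "geo_triangle S T"
  shows "arccos (ccos (va T) (vb T) (vc T)) \<le> ang_a S T"
    and "arccos (ccos (vb T) (va T) (vc T)) \<le> ang_b S T"
    and "arccos (ccos (vc T) (vb T) (va T)) \<le> ang_c S T"
proof -
  have T: "shortest_path S (sab T) (va T) (vb T)" "shortest_path S (sbc T) (vb T) (vc T)"
    "shortest_path S (sca T) (vc T) (va T)"
    using assms by (auto simp: geo_triangle_def)
  note ne = geo_triangle_distinct(1-3)[OF assms]
  show "arccos (ccos (va T) (vb T) (vc T)) \<le> ang_a S T"
    unfolding ang_a_def using T shortest_path_reversepath ne by (intro shortest_path_angle_ge) auto
  show "arccos (ccos (vb T) (va T) (vc T)) \<le> ang_b S T"
    unfolding ang_b_def using T shortest_path_reversepath ne by (intro shortest_path_angle_ge) auto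
  show "arccos (ccos (vc T) (vb T) (va T)) \<le> ang_c S T"
    unfolding ang_c_def using T shortest_path_reversepath ne by (intro shortest_path_angle_ge) auto
qed

theorem excess_nonneg:
  assumes "geo_triangle S T" shows "0 \<le> excess S T"
proof -
  note ne = geo_triangle_distinct[OF assms]
  define a b c where "a = d (vb T) (vc T)" and "b = d (va T) (vc T)" and "c = d (va T) (vb T)"
  have pos: "0 < a" "0 < b" "0 < c" unfolding a_def b_def c_def using ne by (auto intro!: d_pos)
  have tri: "a \<le> b + c" "b \<le> a + c" "c \<le> a + b"
    using d_triangle[of "vb T" "va T" "vc T"] d_triangle[of "va T" "vb T" "vc T"] d_triangle[of "va T" "vc T" "vb T"] ne
    unfolding a_def b_def c_def by (simp_all add: d_commute[of "vb T" "va T"] d_commute[of "vc T" "vb T"])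
  have e1: "ccos (va T) (vb T) (vc T) = (b\<^sup>2 + c\<^sup>2 - a\<^sup>2) / (2 * b * c)"
    by (simp add: ccos_def a_def b_def c_def mult.commute mult.left_commute add.commute)
  have e2: "ccos (vb T) (va T) (vc T) = (a\<^sup>2 + c\<^sup>2 - b\<^sup>2) / (2 * a * c)"
    unfolding ccos_def a_def b_def c_def d_commute[of "vb T" "va T"]
    by (simp add: mult.commute mult.left_commute add.commute)
  have e3: "ccos (vc T) (vb T) (va T) = (a\<^sup>2 + b\<^sup>2 - c\<^sup>2) / (2 * a * b)"
    unfolding ccos_def a_def b_def c_def d_commute[of "vb T" "va T"] d_commute[of "vc T" "vb T"] d_commute[of "vc T" "va T"] ..
  show ?thesis
    using geo_triangle_angles_ge[OF assms, unfolded e1 e2 e3] arccos_sum_ge_pi[OF pos tri]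
    unfolding excess_def by linarith
qed

text \<open>The variance inequality for three points at equal small distances bounds an angle from above by means of
  comparison angles with a third, opposite direction.\<close>
lemma shortest_path_angle_le:
  assumes g: "shortest_path S g1 p x" "p \<noteq> x" and h: "shortest_path S g2 p y" "p \<noteq> y"
    and z: "z \<in> S" "z \<noteq> p" and k: "- 1 \<le> k" "k \<le> - 5 / 2 - sqrt 3 * (ccos p x z + ccos p y z)"
  shows "path_angle S g1 g2 \<le> arccos k"
proof -
  have S: "p \<in> S" "x \<in> S" "y \<in> S"
    using shortest_path_geod(1,2)[OF g(1)] shortest_path_geod(1,2)[OF h(1)] by auto
  obtain \<gamma> where \<gamma>: "geod \<gamma> (d p x)" "\<gamma> 0 = p" "\<gamma> (d p x) = x" "\<gamma> ` {0..d p x} = path_image g1"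
    using shortest_path_geod(3)[OF g(1)] by blast
  obtain \<beta> where \<beta>: "geod \<beta> (d p y)" "\<beta> 0 = p" "\<beta> (d p y) = y" "\<beta> ` {0..d p y} = path_image g2"
    using shortest_path_geod(3)[OF h(1)] by blast
  obtain \<alpha> where \<alpha>: "geod \<alpha> (d p z)" "\<alpha> 0 = p" "\<alpha> (d p z) = z"
    using geodesic_exists[OF S(1) z(1)] by blast
  have start: "pathstart g1 = p" using g(1) by (simp add: shortest_path_def)
  have pos: "0 < d p x" "0 < d p y" "0 < d p z"
    using d_pos[OF S(1,2) g(2)] d_pos[OF S(1,3) h(2)] d_pos[OF S(1) z(1)] z(2) by auto
  define u0 where "u0 = min (d p x) (min (d p y) (d p z))"
  have u0: "0 < u0" "u0 \<le> d p x" "u0 \<le> d p y" "u0 \<le> d p z" using pos by (auto simp: u0_def)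
  show ?thesis
  proof (rule path_angle_le[OF \<gamma>(1) pos(1) \<gamma>(2,4) \<beta>(1) pos(2) \<beta>(2,4) start u0(1-3) k(1)])
    fix u assume u: "0 < u" "u \<le> u0"
    have uS: "\<gamma> u \<in> S" "\<beta> u \<in> S" "\<alpha> u \<in> S"
      using u u0 by (auto intro: geod_S[OF \<gamma>(1)] geod_S[OF \<beta>(1)] geod_S[OF \<alpha>(1)])
    have du: "d p (\<gamma> u) = u" "d p (\<beta> u) = u" "d p (\<alpha> u) = u"
      using geod_d[OF \<gamma>(1), of 0 u] geod_d[OF \<beta>(1), of 0 u] geod_d[OF \<alpha>(1), of 0 u] u u0
      by (simp_all add: \<gamma>(2) \<beta>(2) \<alpha>(2))
    have c: "(d v w)\<^sup>2 = 2 * u\<^sup>2 - 2 * u\<^sup>2 * ccos p v w" if "d p v = u" "d p w = u" for v w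
      unfolding ccos_def that using u(1) by (simp add: power2_eq_square)
    have "ccos (\<gamma> 0) (\<gamma> u) (\<alpha> u) \<le> ccos (\<gamma> 0) (\<gamma> (d p x)) (\<alpha> (d p z))"
      using u u0 by (intro ccos_mono[OF \<gamma>(1) \<alpha>(1)]) (simp_all add: \<gamma>(2) \<alpha>(2))
    then have c1: "ccos p (\<gamma> u) (\<alpha> u) \<le> ccos p x z" by (simp add: \<gamma> \<alpha>)
    have "ccos (\<beta> 0) (\<beta> u) (\<alpha> u) \<le> ccos (\<beta> 0) (\<beta> (d p y)) (\<alpha> (d p z))"
      using u u0 by (intro ccos_mono[OF \<beta>(1) \<alpha>(1)]) (simp_all add: \<beta>(2) \<alpha>(2))
    then have c2: "ccos p (\<beta> u) (\<alpha> u) \<le> ccos p y z" by (simp add: \<beta> \<alpha>)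
    \<comment> \<open>The weight of the third direction. For two unit vectors at 60 degrees, sqrt 3
      times the opposite bisector balances their sum; the variance inequality is then an equality,
      so the bound is exact for a flat equilateral triangle.\<close>
    define s :: real where "s = sqrt 3"
    have s: "0 \<le> s" "s * s = 3" by (simp_all add: s_def)
    define X Y Z where "X = ccos p (\<gamma> u) (\<beta> u)" and "Y = ccos p (\<gamma> u) (\<alpha> u)" and "Z = ccos p (\<beta> u) (\<alpha> u)"
    have "1 * 1 * (d (\<gamma> u) (\<beta> u))\<^sup>2 + 1 * s * (d (\<gamma> u) (\<alpha> u))\<^sup>2 + 1 * s * (d (\<beta> u) (\<alpha> u))\<^sup>2
        \<le> (1 + 1 + s) * (1 * (d p (\<gamma> u))\<^sup>2 + 1 * (d p (\<beta> u))\<^sup>2 + s * (d p (\<alpha> u))\<^sup>2)"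
      using s(1) by (intro variance[OF S(1) uS, unfolded variance_ineq_def, rule_format]) simp_all
    then have "2 * u\<^sup>2 * ((1 - X) + s * (1 - Y) + s * (1 - Z)) \<le> 2 * u\<^sup>2 * ((2 + s) * (2 + s) / 2)"
      unfolding c[OF du(1,2)] c[OF du(1,3)] c[OF du(2,3)] du X_def Y_def Z_def by (simp add: algebra_simps)
    then have "(1 - X) + s * (1 - Y) + s * (1 - Z) \<le> (2 + s) * (2 + s) / 2" using u(1) by simp
    also have "\<dots> = 7 / 2 + 2 * s" using s(2) by (simp add: algebra_simps)
    finally have "- 5 / 2 - s * (Y + Z) \<le> X" by (simp add: algebra_simps)
    moreover have "s * (Y + Z) \<le> s * (ccos p x z + ccos p y z)"
      using c1 c2 s(1) by (intro mult_left_mono) (simp_all add: Y_def Z_def)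
    ultimately show "k \<le> ccos p (\<gamma> u) (\<beta> u)" using k(2) unfolding s_def X_def by linarith
  qed
qed

end

section \<open>Surfaces close to a trihedral tip or to a plane\<close>

definition dir :: "nat \<Rightarrow> complex" where
  "dir k = (if k = 0 then 1 else if k = 1 then Complex (- 1 / 2) (sqrt 3 / 2) else Complex (- 1 / 2) (- sqrt 3 / 2))"

lemma less_3_cases: "k < 3 \<longleftrightarrow> k = 0 \<or> k = 1 \<or> k = (2::nat)"
  by auto

lemma inner_dir: "j < 3 \<Longrightarrow> k < 3 \<Longrightarrow> dir j \<bullet> dir k = (if j = k then 1 else - 1 / 2)"
  unfolding less_3_cases by (auto simp: dir_def inner_complex_def)

lemma norm_dir [simp]: "norm (dir k) = 1"
  by (auto simp: dir_def cmod_def power2_eq_square)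

lemma dir_sum: "dir 0 + dir 1 + dir 2 = 0"
  by (auto simp: dir_def complex_eq_iff)

lemma inner_dir_sum: "dir 0 \<bullet> w + dir 1 \<bullet> w + dir 2 \<bullet> w = 0"
  using dir_sum by (metis inner_add_left inner_zero_left)

lemma inner_dir_bound: "\<bar>dir k \<bullet> w\<bar> \<le> norm w"
  using Cauchy_Schwarz_ineq2[of "dir k" w] by simp

lemma other_index: "j < 3 \<Longrightarrow> k < 3 \<Longrightarrow> \<exists>l<3. l \<noteq> j \<and> l \<noteq> (k::nat)"
  by presburger

lemma dist_dir: "j < 3 \<Longrightarrow> k < 3 \<Longrightarrow> j \<noteq> k \<Longrightarrow> norm (dir j - dir k) = sqrt 3"
proof -
  assume jk: "j < 3" "k < 3" "j \<noteq> k"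
  have "(norm (dir j - dir k))\<^sup>2 = 3"
    unfolding power2_norm_eq_inner using jk by (simp add: inner_diff_left inner_diff_right inner_dir)
  then show ?thesis by (simp add: real_sqrt_unique)
qed

text \<open>Height of a trihedral tip with apex over 0 and facets of slope \<open>\<kappa>\<close>;
  for \<open>\<kappa> = 0\<close> it is the horizontal plane, so flat cuts and tips are treated
  together.\<close>

definition roof :: "real \<Rightarrow> complex \<Rightarrow> real" where
  "roof \<kappa> w = min (- \<kappa> * (dir 0 \<bullet> w)) (min (- \<kappa> * (dir 1 \<bullet> w)) (- \<kappa> * (dir 2 \<bullet> w)))"

lemma roof_le: "k < 3 \<Longrightarrow> roof \<kappa> w \<le> - \<kappa> * (dir k \<bullet> w)"
  unfolding less_3_cases roof_def by auto

lemma roof_eq: "\<exists>k<3. roof \<kappa> w = - \<kappa> * (dir k \<bullet> w)"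
proof -
  have "roof \<kappa> w = - \<kappa> * (dir 0 \<bullet> w) \<or> roof \<kappa> w = - \<kappa> * (dir 1 \<bullet> w) \<or> roof \<kappa> w = - \<kappa> * (dir 2 \<bullet> w)"
    unfolding roof_def by linarith
  then show ?thesis unfolding less_3_cases by blast
qed

lemma abs_roof_le:
  assumes "0 \<le> \<kappa>" "\<kappa> \<le> 1" shows "\<bar>roof \<kappa> w\<bar> \<le> norm w"
proof -
  obtain k where k: "roof \<kappa> w = - \<kappa> * (dir k \<bullet> w)" using roof_eq by blast
  have "\<bar>roof \<kappa> w\<bar> = \<kappa> * \<bar>dir k \<bullet> w\<bar>" unfolding k using assms by (simp add: abs_mult)
  also have "\<dots> \<le> 1 * norm w" using assms inner_dir_bound by (intro mult_mono) auto
  finally show ?thesis by simp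
qed

lemma roof_le_0: "roof \<kappa> w \<le> 0"
proof -
  have "3 * roof \<kappa> w \<le> - \<kappa> * (dir 0 \<bullet> w + dir 1 \<bullet> w + dir 2 \<bullet> w)"
    using roof_le[of 0 \<kappa> w] roof_le[of 1 \<kappa> w] roof_le[of 2 \<kappa> w] by (simp add: algebra_simps)
  then show ?thesis unfolding inner_dir_sum by simp
qed

text \<open>Over the ray of - \<open>dir j\<close> the two facets other than \<open>j\<close> attain
  the minimum together: these rays are the edges. The vertices of the triangle are placed over them,
  so that each side of the model triangle lies in one facet.\<close>

lemma roof_vertex:
  assumes "j < 3" "0 \<le> \<kappa>" "0 \<le> s"
  shows "roof \<kappa> (- s *\<^sub>R dir j) = - \<kappa> * s / 2"
    and "k < 3 \<Longrightarrow> k \<noteq> j \<Longrightarrow> roof \<kappa> (- s *\<^sub>R dir j) = - \<kappa> * (dir k \<bullet> (- s *\<^sub>R dir j))"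
proof -
  have v: "- \<kappa> * (dir k \<bullet> (- s *\<^sub>R dir j)) = (if k = j then \<kappa> * s else - \<kappa> * s / 2)" if "k < 3" for k
    using that assms(1) by (simp add: inner_dir)
  have "0 \<le> \<kappa> * s" using assms by simp
  then show *: "roof \<kappa> (- s *\<^sub>R dir j) = - \<kappa> * s / 2"
    unfolding roof_def using v[of 0] v[of 1] v[of 2] assms(1) unfolding less_3_cases by (auto simp: min_def)
  show "roof \<kappa> (- s *\<^sub>R dir j) = - \<kappa> * (dir k \<bullet> (- s *\<^sub>R dir j))" if "k < 3" "k \<noteq> j"
    unfolding * v[OF that(1)] using that by simp
qed

section \<open>Orthonormal coordinates around the apex\<close>

locale frame =
  fixes v e1 e2 \<nu> :: "real^3"
  assumes unit: "e1 \<bullet> e1 = 1" "e2 \<bullet> e2 = 1" "\<nu> \<bullet> \<nu> = 1"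
    and orth: "e1 \<bullet> e2 = 0" "e1 \<bullet> \<nu> = 0" "e2 \<bullet> \<nu> = 0"
begin

definition proj :: "real^3 \<Rightarrow> complex" where "proj y = Complex ((y - v) \<bullet> e1) ((y - v) \<bullet> e2)"
definition height :: "real^3 \<Rightarrow> real" where "height y = (y - v) \<bullet> \<nu>"
definition pt :: "complex \<Rightarrow> real \<Rightarrow> real^3" where "pt w h = v + Re w *\<^sub>R e1 + Im w *\<^sub>R e2 + h *\<^sub>R \<nu>"
definition nrm :: "real \<Rightarrow> nat \<Rightarrow> real^3" where "nrm \<kappa> k = \<nu> + \<kappa> *\<^sub>R (Re (dir k) *\<^sub>R e1 + Im (dir k) *\<^sub>R e2)"

lemma proj_pt [simp]: "proj (pt w h) = w" and height_pt [simp]: "height (pt w h) = h"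
  using unit orth
  by (simp_all add: proj_def height_def pt_def inner_add_left inner_add_right complex_eq_iff inner_commute)

lemma basis_expand: "y = (y \<bullet> e1) *\<^sub>R e1 + (y \<bullet> e2) *\<^sub>R e2 + (y \<bullet> \<nu>) *\<^sub>R \<nu>"
proof -
  define B where "B = {e1, e2, \<nu>}"
  have neq: "e1 \<noteq> e2" "e1 \<noteq> \<nu>" "e2 \<noteq> \<nu>" using unit orth by auto
  have "pairwise orthogonal B"
    using orth by (auto simp: B_def pairwise_def orthogonal_def inner_commute)
  moreover have "0 \<notin> B" using unit by (auto simp: B_def)
  ultimately have ind: "independent B" by (rule pairwise_orthogonal_independent)
  have "card B = 3" using neq by (simp add: B_def)
  then have "span B = UNIV"
    using card_ge_dim_independent[of B UNIV] ind by (simp add: dim_UNIV) blast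
  define z where "z = y - ((y \<bullet> e1) *\<^sub>R e1 + (y \<bullet> e2) *\<^sub>R e2 + (y \<bullet> \<nu>) *\<^sub>R \<nu>)"
  have "z \<bullet> e1 = 0" "z \<bullet> e2 = 0" "z \<bullet> \<nu> = 0"
    using unit orth by (simp_all add: z_def inner_diff_right inner_add_right inner_commute)
  then have "\<And>b. b \<in> B \<Longrightarrow> orthogonal z b" by (auto simp: B_def orthogonal_def)
  then have "orthogonal z z" using \<open>span B = UNIV\<close> orthogonal_to_span[of z B z] by simp
  then show ?thesis by (simp add: z_def orthogonal_self)
qed

lemma pt_proj [simp]: "pt (proj y) (height y) = y"
  using basis_expand[of "y - v"] by (simp add: pt_def proj_def height_def algebra_simps)

lemma dist_pt: "(dist (pt w h) (pt w' h'))\<^sup>2 = (norm (w - w'))\<^sup>2 + (h - h')\<^sup>2"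
proof -
  have "pt w h - pt w' h' = (Re w - Re w') *\<^sub>R e1 + (Im w - Im w') *\<^sub>R e2 + (h - h') *\<^sub>R \<nu>"
    by (simp add: pt_def algebra_simps)
  then have "(dist (pt w h) (pt w' h'))\<^sup>2 = (Re w - Re w')\<^sup>2 + (Im w - Im w')\<^sup>2 + (h - h')\<^sup>2"
    unfolding dist_norm power2_norm_eq_inner using unit orth
    by (simp add: inner_add_left inner_add_right inner_commute power2_eq_square)
  then show ?thesis by (simp add: cmod_power2)
qed

lemma dist_split: "(dist x y)\<^sup>2 = (norm (proj x - proj y))\<^sup>2 + (height x - height y)\<^sup>2"
  using dist_pt[of "proj x" "height x" "proj y" "height y"] by simp

lemma proj_dist_le: "norm (proj x - proj y) \<le> dist x y"
  by (rule power2_le_imp_le) (use dist_split[of x y] in auto)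

lemma height_dist_le: "\<bar>height x - height y\<bar> \<le> dist x y"
  by (rule power2_le_imp_le) (use dist_split[of x y] in \<open>auto\<close>)

lemma dist_same_height: "dist (pt w h) (pt w' h) = norm (w - w')"
  using dist_pt[of w h w' h] by (simp add: power2_eq_iff_nonneg)

lemma dist_same_proj: "dist (pt w h) (pt w h') = \<bar>h - h'\<bar>"
  by (rule power2_eq_imp_eq) (use dist_pt[of w h w h'] in auto)

lemma nrm_inner: "nrm \<kappa> k \<bullet> (y - v) = height y + \<kappa> * (dir k \<bullet> proj y)"
  by (simp add: nrm_def height_def proj_def inner_complex_def inner_add_left inner_commute algebra_simps)

lemma nrm_inner': "nrm \<kappa> k \<bullet> y = height y + \<kappa> * (dir k \<bullet> proj y) + nrm \<kappa> k \<bullet> v"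
  using nrm_inner[of \<kappa> k y] by (simp add: inner_diff_right)

lemma nrm_nonzero: "nrm \<kappa> k \<noteq> 0"
proof
  assume "nrm \<kappa> k = 0"
  then have "nrm \<kappa> k \<bullet> \<nu> = 0" by simp
  then show False using unit orth by (simp add: nrm_def inner_add_right inner_commute)
qed

lemma pt_add: "pt w h + t *\<^sub>R \<nu> = pt w (h + t)"
  by (simp add: pt_def algebra_simps)

lemma pt_combine: "(1 - t) *\<^sub>R pt w h + t *\<^sub>R pt w' h' = pt ((1 - t) *\<^sub>R w + t *\<^sub>R w') ((1 - t) * h + t * h')"
  by (simp add: pt_def algebra_simps)

lemma continuous_proj: "continuous_on A proj"
  unfolding proj_def by (intro continuous_intros)

lemma continuous_height: "continuous_on A height"
  unfolding height_def by (intro continuous_intros)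

end

text \<open>A body close to the cut one over a disc of radius \<open>\<rho>\<close>:
  \<open>below\<close> keeps it under the raised planes, \<open>near\<close> brings it up to the
  roof, and the ball in \<open>deep\<close> makes the upper part of its surface a graph. The later
  estimates use the competing body only through these data.\<close>

locale near_tip = convex_body + frame +
  fixes \<kappa> \<rho> \<sigma> :: real
  assumes \<kappa>: "0 \<le> \<kappa>" "\<kappa> \<le> 1" and \<rho>: "0 < \<rho>" and \<sigma>: "0 < \<sigma>"
    and below: "\<And>y k. y \<in> K \<Longrightarrow> k < 3 \<Longrightarrow> height y + \<kappa> * (dir k \<bullet> proj y) \<le> \<sigma>"
    and near: "\<And>w. norm w \<le> \<rho> \<Longrightarrow> \<exists>z\<in>K. dist (pt w (roof \<kappa> w)) z \<le> \<sigma>"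
    and deep: "cball (pt 0 (- 2 * \<rho>)) (\<rho> / 2) \<subseteq> K"
begin

lemma height_le: assumes "y \<in> K" shows "height y \<le> roof \<kappa> (proj y) + \<sigma>" "height y \<le> \<sigma>"
proof -
  obtain k where k: "k < 3" "roof \<kappa> (proj y) = - \<kappa> * (dir k \<bullet> proj y)" using roof_eq by blast
  show "height y \<le> roof \<kappa> (proj y) + \<sigma>" using below[OF assms k(1)] k(2) by simp
  then show "height y \<le> \<sigma>" using roof_le_0[of \<kappa> "proj y"] by simp
qed

lemma facet_segment_W:
  assumes "k < 3" "\<sigma> \<le> height x + \<kappa> * (dir k \<bullet> proj x)" "\<sigma> \<le> height y + \<kappa> * (dir k \<bullet> proj y)"
  shows "closed_segment x y \<subseteq> W"
proof (rule support_segment_W[where n="nrm \<kappa> k" and b="\<sigma> + nrm \<kappa> k \<bullet> v"])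
  show "nrm \<kappa> k \<bullet> y \<le> \<sigma> + nrm \<kappa> k \<bullet> v" if "y \<in> K" for y
    using below[OF that assms(1)] unfolding nrm_inner'[of \<kappa> k y] by simp
qed (use assms nrm_nonzero in \<open>simp_all add: nrm_inner'[of \<kappa> k x] nrm_inner'[of \<kappa> k y]\<close>)

lemma high_segment_W:
  assumes "\<sigma> \<le> height x" "\<sigma> \<le> height y"
  shows "closed_segment x y \<subseteq> W"
proof (rule support_segment_W[where n=\<nu> and b="\<sigma> + v \<bullet> \<nu>"])
  show "\<nu> \<bullet> y \<le> \<sigma> + v \<bullet> \<nu>" if "y \<in> K" for y
    using height_le(2)[OF that] by (simp add: height_def inner_diff_right inner_commute)
qed (use assms unit in \<open>auto simp: height_def inner_diff_right inner_commute\<close>)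

text \<open>The roof raised by \<open>\<sigma>\<close> lies outside the interior and can be
  projected to the surface; segments in one raised facet then bound intrinsic distances from above
  by Euclidean ones.\<close>

definition lift :: "complex \<Rightarrow> real^3" where
  "lift w = closest_point K (pt w (roof \<kappa> w + \<sigma>))"

lemma lift_S: "lift w \<in> S"
proof -
  obtain k where k: "k < 3" "roof \<kappa> w = - \<kappa> * (dir k \<bullet> w)" using roof_eq by blast
  have "closed_segment (pt w (roof \<kappa> w + \<sigma>)) (pt w (roof \<kappa> w + \<sigma>)) \<subseteq> W"
    by (rule facet_segment_W[OF k(1)]) (simp_all add: k(2))
  then show ?thesis unfolding lift_def by (intro closest_point_frontier) simp
qed

lemma lift_near: assumes "norm w \<le> \<rho>" shows "dist (lift w) (pt w (roof \<kappa> w)) \<le> 3 * \<sigma>"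
proof -
  let ?y = "pt w (roof \<kappa> w)" and ?z = "pt w (roof \<kappa> w + \<sigma>)"
  obtain z where z: "z \<in> K" "dist ?y z \<le> \<sigma>" using near[OF assms] by blast
  have yz: "dist ?z ?y = \<sigma>" using \<sigma> by (simp add: dist_same_proj)
  have "dist ?z (lift w) \<le> dist ?z z" unfolding lift_def by (rule closest_point_le[OF closed_K z(1)])
  also have "\<dots> \<le> dist ?z ?y + dist ?y z" by (rule dist_triangle)
  finally have "dist ?z (lift w) \<le> 2 * \<sigma>" using z yz by simp
  then show ?thesis using dist_triangle[of "lift w" ?y ?z] yz by (simp add: dist_commute)
qed

lemma d_lift_le:
  assumes "k < 3" "roof \<kappa> w = - \<kappa> * (dir k \<bullet> w)" "roof \<kappa> w' = - \<kappa> * (dir k \<bullet> w')"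
  shows "d (lift w) (lift w') \<le> dist (pt w (roof \<kappa> w)) (pt w' (roof \<kappa> w'))"
proof -
  let ?z = "pt w (roof \<kappa> w + \<sigma>)" and ?z' = "pt w' (roof \<kappa> w' + \<sigma>)"
  have le: "pdist W ?z ?z' \<le> ereal (dist ?z ?z')"
    by (intro pdist_segment facet_segment_W[OF assms(1)]) (simp_all add: assms(2,3))
  have eq: "dist ?z ?z' = dist (pt w (roof \<kappa> w)) (pt w' (roof \<kappa> w'))"
    unfolding pt_add[symmetric] by simp
  have "ereal (d (lift w) (lift w')) \<le> pdist W ?z ?z'"
    unfolding ereal_d[OF lift_S lift_S] unfolding lift_def by (rule pdist_closest_point)
  from order_trans[OF this le] show ?thesis unfolding eq by simp
qed

lemma d_lift_ge:
  assumes "norm w \<le> \<rho>" "norm w' \<le> \<rho>"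
  shows "dist (pt w (roof \<kappa> w)) (pt w' (roof \<kappa> w')) - 6 * \<sigma> \<le> d (lift w) (lift w')"
proof -
  have "dist (pt w (roof \<kappa> w)) (pt w' (roof \<kappa> w')) \<le> dist (lift w) (lift w') + 6 * \<sigma>"
    using lift_near[OF assms(1)] lift_near[OF assms(2)]
      dist_triangle[of "pt w (roof \<kappa> w)" "pt w' (roof \<kappa> w')" "lift w"]
      dist_triangle[of "lift w" "pt w' (roof \<kappa> w')" "lift w'"] by (simp add: dist_commute)
  then show ?thesis using d_ge_dist[OF lift_S lift_S, of w w'] by simp
qed

lemma deep_interior: "norm w < \<rho> / 2 \<Longrightarrow> pt w (- 2 * \<rho>) \<in> interior K"
proof -
  assume w: "norm w < \<rho> / 2"
  have "pt w (- 2 * \<rho>) \<in> ball (pt 0 (- 2 * \<rho>)) (\<rho> / 2)" using w by (simp add: dist_same_height)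
  moreover have "ball (pt 0 (- 2 * \<rho>)) (\<rho> / 2) \<subseteq> interior K"
    using deep ball_subset_cball by (intro interior_maximal) auto
  ultimately show ?thesis by blast
qed

text \<open>A point below the roof by more than \<open>8 \<sigma>\<close> lies on a segment from a point of the body near the roof to the
  deep ball, hence in the interior.\<close>
lemma sheet:
  assumes y: "y \<in> S" and p: "norm (proj y) \<le> \<rho> / 8" and h: "- 2 * \<rho> < height y"
  shows "roof \<kappa> (proj y) - 8 * \<sigma> \<le> height y"
proof (rule ccontr)
  assume not: "\<not> ?thesis"
  let ?w = "proj y"
  define r where "r = roof \<kappa> ?w"
  define t where "t = r - height y"
  have t: "8 * \<sigma> < t" "0 < t" using not \<sigma> by (simp_all add: t_def r_def)
  have r: "r \<le> \<rho> / 8" "- (\<rho> / 8) \<le> r" using abs_roof_le[OF \<kappa>, of ?w] p by (simp_all add: r_def)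
  obtain z where z: "z \<in> K" "dist (pt ?w r) z \<le> \<sigma>" using near[of ?w] p \<rho> by (auto simp: r_def)
  \<comment> \<open>The line from \<open>z\<close> through \<open>y\<close> is followed down to the
    level of the deep ball. As \<open>y\<close> is more than 8 \<open>\<sigma>\<close> below the
    roof, the error \<open>\<sigma>\<close> of \<open>z\<close> grows to less than 9/32
    \<open>\<rho>\<close>; together with the horizontal offset \<open>\<rho> / 8\<close> the end is
    within \<open>\<rho> / 2\<close> of the centre.\<close>
  define lam where "lam = (2 * \<rho> + height y) / t"
  have lam: "0 < lam" using h t by (simp add: lam_def)
  define u where "u = y + lam *\<^sub>R (y - z)"
  have lam_le: "lam * \<sigma> < 9 / 32 * \<rho>"
  proof -
    have "2 * \<rho> + height y < 2 * \<rho> + \<rho> / 8" using t(2) r by (simp add: t_def)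
    then have "lam < (2 * \<rho> + \<rho> / 8) / t" unfolding lam_def using t by (intro divide_strict_right_mono)
    also have "\<dots> \<le> (2 * \<rho> + \<rho> / 8) / (8 * \<sigma>)" using t \<sigma> \<rho> by (intro divide_left_mono) auto
    finally have "lam * \<sigma> < (2 * \<rho> + \<rho> / 8) / (8 * \<sigma>) * \<sigma>" using \<sigma> by (intro mult_strict_right_mono)
    also have "\<dots> = (17 / 64) * \<rho>" using \<sigma> by simp
    finally show ?thesis using \<rho> by simp
  qed
  have yz: "y = pt ?w (r - t)" by (simp add: t_def)
  define u' where "u' = pt ?w (- 2 * \<rho>)"
  have u': "u' = y + lam *\<^sub>R (y - pt ?w r)"
  proof -
    have "y - pt ?w r = (- t) *\<^sub>R \<nu>" by (subst yz) (simp add: pt_def algebra_simps)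
    then have "y + lam *\<^sub>R (y - pt ?w r) = pt ?w (height y) + (- (lam * t)) *\<^sub>R \<nu>" by simp
    also have "\<dots> = pt ?w (height y - lam * t)" unfolding pt_add by simp
    also have "lam * t = 2 * \<rho> + height y" using t by (simp add: lam_def)
    finally show ?thesis by (simp add: u'_def)
  qed
  have "dist u u' \<le> lam * \<sigma>"
  proof -
    have "u - u' = lam *\<^sub>R (pt ?w r - z)" unfolding u_def u' by (simp add: algebra_simps)
    then have "dist u u' = lam * dist (pt ?w r) z" using lam by (simp add: dist_norm)
    then show ?thesis using z(2) lam by (simp add: mult_left_mono)
  qed
  moreover have "dist u' (pt 0 (- 2 * \<rho>)) \<le> \<rho> / 8" using p by (simp add: u'_def dist_same_height)
  ultimately have "dist u (pt 0 (- 2 * \<rho>)) < \<rho> / 2"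
    using dist_triangle[of u "pt 0 (- 2 * \<rho>)" u'] lam_le \<rho> by simp
  then have "u \<in> ball (pt 0 (- 2 * \<rho>)) (\<rho> / 2)" by (simp add: dist_commute)
  moreover have "ball (pt 0 (- 2 * \<rho>)) (\<rho> / 2) \<subseteq> interior K"
    using deep ball_subset_cball by (intro interior_maximal) auto
  ultimately have "u \<in> interior K" by blast
  then have "(1 / (1 + lam)) *\<^sub>R u + (1 - 1 / (1 + lam)) *\<^sub>R z \<in> interior K"
    using lam z(1) by (intro interior_mix) auto
  moreover have "(1 / (1 + lam)) *\<^sub>R u + (1 - 1 / (1 + lam)) *\<^sub>R z = y"
  proof -
    have "1 - 1 / (1 + lam) = (1 / (1 + lam)) * lam" using lam by (simp add: field_simps)
    then have "(1 / (1 + lam)) *\<^sub>R u + (1 - 1 / (1 + lam)) *\<^sub>R z = (1 / (1 + lam)) *\<^sub>R (u + lam *\<^sub>R z)"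
      by (simp add: scaleR_add_right)
    also have "u + lam *\<^sub>R z = (1 + lam) *\<^sub>R y" by (simp add: u_def algebra_simps)
    finally show ?thesis using lam by simp
  qed
  ultimately show False using y by (simp add: S_eq)
qed

text \<open>Of two points on one vertical line, the lower one would lie between the upper one and an
  interior point at depth 2 \<open>\<rho>\<close>, hence in the interior.\<close>

lemma proj_inj:
  assumes y: "y \<in> S" "y' \<in> S" and p: "proj y = proj y'" "norm (proj y) < \<rho> / 2"
    and h: "- 2 * \<rho> < height y" "- 2 * \<rho> < height y'"
  shows "y = y'"
proof -
  have key: False if y: "y \<in> S" "y' \<in> S" "proj y = proj y'" "norm (proj y) < \<rho> / 2" "- 2 * \<rho> < height y"
    "height y < height y'" for y y'
  proof -
    define t where "t = (height y' - height y) / (height y' + 2 * \<rho>)"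
    have pos: "height y' + 2 * \<rho> > 0" using y by simp
    have t: "0 < t" "t \<le> 1" using y pos by (simp_all add: t_def)
    have "t *\<^sub>R pt (proj y) (- 2 * \<rho>) + (1 - t) *\<^sub>R y' \<in> interior K"
      using deep_interior[OF y(4)] y(2) S_subset_K t by (intro interior_mix) auto
    moreover have "t *\<^sub>R pt (proj y) (- 2 * \<rho>) + (1 - t) *\<^sub>R y' = y"
    proof -
      have "(1 - t) *\<^sub>R pt (proj y) (height y') + t *\<^sub>R pt (proj y) (- 2 * \<rho>)
          = pt (proj y) ((1 - t) * height y' + t * (- 2 * \<rho>))"
        unfolding pt_combine by (simp add: algebra_simps)
      also have "(1 - t) * height y' + t * (- 2 * \<rho>) = height y' - t * (height y' + 2 * \<rho>)"
        by (simp add: algebra_simps)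
      also have "t * (height y' + 2 * \<rho>) = height y' - height y" using pos by (simp add: t_def)
      finally show ?thesis using y(3) pt_proj[of y] pt_proj[of y'] by (simp add: add.commute)
    qed
    ultimately show False using y(1) by (simp add: S_eq)
  qed
  have "\<not> height y < height y'" using key[of y y'] assms by blast
  moreover have "\<not> height y' < height y" using key[of y' y] assms by auto
  ultimately have "height y = height y'" by simp
  then show ?thesis using p(1) by (metis pt_proj)
qed

lemma sheet_exists:
  assumes w: "norm w \<le> \<rho> / 8"
  shows "\<exists>y\<in>S. proj y = w \<and> - 2 * \<rho> < height y"
proof -
  let ?a = "pt w (- 2 * \<rho>)" and ?b = "pt w (2 * \<sigma>)"
  have a: "?a \<in> interior K" using w \<rho> by (intro deep_interior) simp
  have b: "?b \<notin> K" using height_le(2)[of ?b] \<sigma> by auto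
  have "closed_segment ?a ?b \<inter> frontier K \<noteq> {}"
  proof (rule connected_Int_frontier)
    have "?a \<in> closed_segment ?a ?b \<inter> K" using a interior_subset[of K] by auto
    then show "closed_segment ?a ?b \<inter> K \<noteq> {}" by blast
    have "?b \<in> closed_segment ?a ?b - K" using b by simp
    then show "closed_segment ?a ?b - K \<noteq> {}" by blast
  qed simp
  then obtain y where y: "y \<in> S" "y \<in> closed_segment ?a ?b" by blast
  then obtain u where u: "0 \<le> u" "u \<le> 1" "y = (1 - u) *\<^sub>R ?a + u *\<^sub>R ?b" by (auto simp: in_segment)
  have y': "y = pt w ((1 - u) * (- 2 * \<rho>) + u * (2 * \<sigma>))"
    unfolding u(3) pt_combine by (simp add: algebra_simps)
  have "u \<noteq> 0" using y(1) a u(3) by (auto simp: S_eq)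
  then have "0 < u * (2 * \<rho> + 2 * \<sigma>)" using u \<rho> \<sigma> by (intro mult_pos_pos) auto
  then have "- 2 * \<rho> < height y" unfolding y' by (simp add: algebra_simps)
  then show ?thesis using y(1) by (intro bexI[of _ y]) (simp_all add: y')
qed

end

section \<open>Numerical bounds and identities for the three directions\<close>

lemma sqrt3_bounds: "173 / 100 < sqrt 3" "sqrt 3 < 174 / 100"
  by (rule real_less_rsqrt, simp add: power2_eq_square, rule real_less_lsqrt, simp_all add: power2_eq_square)

lemma cos_half_lower: "54 / 100 \<le> cos (1 / 2 :: real)"
proof -
  have "cos (1 / 2 :: real) = 1 - 2 * (sin (1 / 4))\<^sup>2" using cos_double_sin[of "1 / 4 :: real"] by simp
  moreover have "(sin (1 / 4 :: real))\<^sup>2 \<le> (1 / 4)\<^sup>2"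
    using abs_sin_x_le_abs_x[of "1 / 4 :: real"] by (metis abs_le_square_iff)
  ultimately show ?thesis by (simp add: power2_eq_square)
qed

lemma dir_frame: "(dir 0 \<bullet> w) *\<^sub>R dir 0 + (dir 1 \<bullet> w) *\<^sub>R dir 1 + (dir 2 \<bullet> w) *\<^sub>R dir 2 = (3 / 2) *\<^sub>R w"
proof -
  have "sqrt 3 * (sqrt 3 * x) = 3 * x" for x :: real by (simp add: mult.assoc[symmetric])
  then show ?thesis
    by (simp add: dir_def inner_complex_def complex_eq_iff algebra_simps)
qed

lemma dir_perm:
  fixes f :: "nat \<Rightarrow> 'a::ab_group_add"
  assumes "j < 3" "k < 3" "l < 3" "j \<noteq> k" "j \<noteq> l" "k \<noteq> l"
  shows "f j + f k + f l = f 0 + f 1 + f 2"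
proof -
  have "f j + f k + f l = sum f {j, k, l}" using assms by (simp add: add.assoc)
  also have "{j, k, l} = {0, 1, 2}" using assms by (intro card_subset_eq) (auto simp: less_3_cases)
  also have "sum f {0, 1, 2} = f 0 + f 1 + f 2" by (simp add: add.assoc)
  finally show ?thesis .
qed

text \<open>Used for points of the symmetry plane through vertex \<open>j\<close>. The three
  directions form a tight frame, so \<open>w\<close> is recovered from its products with
  them.\<close>

lemma dir_decompose:
  assumes jkl: "j < 3" "k < 3" "l < 3" "j \<noteq> k" "j \<noteq> l" "k \<noteq> l" and w: "(dir k - dir l) \<bullet> w = 0"
  shows "w = (dir j \<bullet> w) *\<^sub>R dir j"
proof -
  define c where "c = dir k \<bullet> w"
  have l: "dir l \<bullet> w = c" using w by (simp add: c_def inner_diff_left)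
  have sum: "dir j + dir k + dir l = 0" using dir_perm[OF jkl, of dir] dir_sum by simp
  then have "dir j \<bullet> w + c + c = 0" using l by (metis c_def inner_add_left inner_zero_left)
  then have j: "dir j \<bullet> w = - 2 * c" by simp
  have "(dir j \<bullet> w) *\<^sub>R dir j + (dir k \<bullet> w) *\<^sub>R dir k + (dir l \<bullet> w) *\<^sub>R dir l = (3 / 2) *\<^sub>R w"
    using dir_perm[OF jkl, of "\<lambda>i. (dir i \<bullet> w) *\<^sub>R dir i"] dir_frame[of w] by simp
  then have "(- 2 * c) *\<^sub>R dir j + c *\<^sub>R (dir k + dir l) = (3 / 2) *\<^sub>R w"
    unfolding j l c_def[symmetric] by (simp only: scaleR_add_right add.assoc)
  moreover have "dir k + dir l = - dir j" using sum by (simp add: algebra_simps eq_neg_iff_add_eq_0)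
  ultimately have "(- 2 * c) *\<^sub>R dir j + c *\<^sub>R (- dir j) = (3 / 2) *\<^sub>R w" by (simp only:)
  moreover have "(- 2 * c) *\<^sub>R dir j + c *\<^sub>R (- dir j) = (- 3 * c) *\<^sub>R dir j"
    by (simp add: scaleR_left_distrib[symmetric] scaleR_minus_right flip: scaleR_minus_left)
  ultimately have "(- 3 * c) *\<^sub>R dir j = (3 / 2) *\<^sub>R w" by simp
  then have "(2 / 3) *\<^sub>R ((- 3 * c) *\<^sub>R dir j) = w" by simp
  then show ?thesis unfolding j by simp
qed

text \<open>\<open>s\<close> is the circumradius of the model triangle and \<open>\<zeta>\<close>
  the tolerance for its sides: a side is within sqrt(6 s \<open>\<sigma>\<close>) + 3
  \<open>\<sigma>\<close> of its segment, and comparing the two at equal arc length adds 6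
  \<open>\<sigma>\<close>.\<close>

locale near_tri = near_tip +
  fixes s \<zeta> :: real
  assumes s: "0 < s" "40 * s \<le> \<rho>" and \<zeta>: "sqrt (6 * s * \<sigma>) + 9 * \<sigma> \<le> \<zeta>" "100 * \<zeta> \<le> s"
begin

lemma \<sigma>_small: "900 * \<sigma> \<le> s" "9 * \<sigma> \<le> \<zeta>" "0 < \<zeta>"
proof -
  have "0 \<le> sqrt (6 * s * \<sigma>)" using s \<sigma> by simp
  then show "900 * \<sigma> \<le> s" "9 * \<sigma> \<le> \<zeta>" "0 < \<zeta>" using \<zeta> \<sigma> by linarith+
qed

definition corner :: "nat \<Rightarrow> real^3" where "corner j = pt (- s *\<^sub>R dir j) (- \<kappa> * s / 2)"
definition vert :: "nat \<Rightarrow> real^3" where "vert j = lift (- s *\<^sub>R dir j)"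

lemma vert_S: "vert j \<in> S" by (simp add: vert_def lift_S)

lemma corner_roof: "j < 3 \<Longrightarrow> corner j = pt (- s *\<^sub>R dir j) (roof \<kappa> (- s *\<^sub>R dir j))"
  using roof_vertex(1)[of j \<kappa> s] \<kappa> s by (simp add: corner_def)

lemma norm_corner: "norm (- s *\<^sub>R dir j) \<le> \<rho>"
  using s by simp

lemma vert_near: "j < 3 \<Longrightarrow> dist (vert j) (corner j) \<le> 3 * \<sigma>"
  unfolding corner_roof vert_def by (rule lift_near[OF norm_corner])

lemma corner_dist: "j < 3 \<Longrightarrow> k < 3 \<Longrightarrow> j \<noteq> k \<Longrightarrow> dist (corner j) (corner k) = sqrt 3 * s"
proof -
  assume jk: "j < 3" "k < 3" "j \<noteq> k"
  have "- s *\<^sub>R dir j - - s *\<^sub>R dir k = (- s) *\<^sub>R (dir j - dir k)" by (simp add: algebra_simps)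
  then show ?thesis unfolding corner_def dist_same_height using dist_dir[OF jk] s by simp
qed

text \<open>Both corners lie on the facet \<open>l\<close> of the roof, so the raised segment
  between them bounds the intrinsic distance.\<close>

lemma d_vert_le: "j < 3 \<Longrightarrow> k < 3 \<Longrightarrow> j \<noteq> k \<Longrightarrow> d (vert j) (vert k) \<le> sqrt 3 * s"
proof -
  assume jk: "j < 3" "k < 3" "j \<noteq> k"
  obtain l where l: "l < 3" "l \<noteq> j" "l \<noteq> k" using other_index[OF jk(1,2)] by blast
  have "d (vert j) (vert k) \<le> dist (corner j) (corner k)"
    unfolding vert_def corner_roof[OF jk(1)] corner_roof[OF jk(2)]
    using roof_vertex(2)[OF jk(1) \<kappa>(1) _ l(1,2), of s] roof_vertex(2)[OF jk(2) \<kappa>(1) _ l(1,3), of s] s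
    by (intro d_lift_le[OF l(1)]) auto
  then show ?thesis using corner_dist[OF jk] by simp
qed

lemma dist_vert_ge: "j < 3 \<Longrightarrow> k < 3 \<Longrightarrow> j \<noteq> k \<Longrightarrow> sqrt 3 * s - 6 * \<sigma> \<le> dist (vert j) (vert k)"
  using corner_dist[of j k] vert_near[of j] vert_near[of k]
    dist_triangle[of "corner j" "corner k" "vert j"] dist_triangle[of "vert j" "corner k" "vert k"]
  by (simp add: dist_commute)

lemma d_vert_ge: "j < 3 \<Longrightarrow> k < 3 \<Longrightarrow> j \<noteq> k \<Longrightarrow> sqrt 3 * s - 6 * \<sigma> \<le> d (vert j) (vert k)"
  using dist_vert_ge[of j k] d_ge_dist[OF vert_S vert_S, of j k] by simp

lemma side_lower: "17 / 10 * s \<le> sqrt 3 * s - 6 * \<sigma>"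
proof -
  have "173 / 100 * s \<le> sqrt 3 * s" using sqrt3_bounds s by (intro mult_right_mono) auto
  then show ?thesis using \<sigma>_small s by linarith
qed

lemma vert_neq: "j < 3 \<Longrightarrow> k < 3 \<Longrightarrow> j \<noteq> k \<Longrightarrow> vert j \<noteq> vert k"
  using dist_vert_ge[of j k] side_lower s by auto

definition seg :: "nat \<Rightarrow> nat \<Rightarrow> real \<Rightarrow> real^3" where
  "seg j k t = (1 - t) *\<^sub>R corner j + t *\<^sub>R corner k"

lemma seg_pt: "seg j k t = pt (- s *\<^sub>R ((1 - t) *\<^sub>R dir j + t *\<^sub>R dir k)) (- \<kappa> * s / 2)"
proof -
  have "(1 - t) * (- \<kappa> * s / 2) + t * (- \<kappa> * s / 2) = - \<kappa> * s / 2" by (simp add: field_simps)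
  moreover have "(1 - t) *\<^sub>R (- s *\<^sub>R dir j) + t *\<^sub>R (- s *\<^sub>R dir k) = - s *\<^sub>R ((1 - t) *\<^sub>R dir j + t *\<^sub>R dir k)"
    by (simp add: algebra_simps)
  ultimately show ?thesis unfolding seg_def corner_def pt_combine by (simp only:)
qed

text \<open>A shortest path between two vertices has Euclidean length close to the distance of its endpoints, hence
  stays close to the segment.\<close>
lemma side_near:
  assumes jk: "j < 3" "k < 3" "j \<noteq> k" and g: "geod \<gamma> L" "\<gamma> 0 = vert j" "\<gamma> L = vert k" and t: "0 \<le> t" "t \<le> 1"
  shows "dist (\<gamma> (L * t)) (seg j k t) \<le> sqrt (6 * s * \<sigma>) + 3 * \<sigma>"
proof -
  have L: "L = d (vert j) (vert k)" using geod_length[OF g(1)] g(2,3) by simp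
  have L0: "0 \<le> L" using geod_nonneg[OF g(1)] .
  define D where "D = dist (vert j) (vert k)"
  have b: "L \<le> sqrt 3 * s" "sqrt 3 * s - 6 * \<sigma> \<le> D" "0 \<le> sqrt 3 * s - 6 * \<sigma>"
    using d_vert_le[OF jk] dist_vert_ge[OF jk] side_lower s by (auto simp: L D_def)
  have "L\<^sup>2 \<le> (sqrt 3 * s)\<^sup>2" "(sqrt 3 * s - 6 * \<sigma>)\<^sup>2 \<le> D\<^sup>2" using b L0 by (auto intro: power_mono)
  then have "L\<^sup>2 - D\<^sup>2 \<le> (sqrt 3 * s)\<^sup>2 - (sqrt 3 * s - 6 * \<sigma>)\<^sup>2" by simp
  \<comment> \<open>The bounds for length and distance differ by 6 \<open>\<sigma>\<close>, whence
    12 sqrt 3 for the squares; rounding up to 24 and the factor t (1 - t) \<le> 1/4 of Stewart's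
    identity give the 6 under the root.\<close>
  also have "\<dots> \<le> 12 * sqrt 3 * (s * \<sigma>)" by (simp add: power2_eq_square algebra_simps)
  also have "\<dots> \<le> 24 * (s * \<sigma>)" using sqrt3_bounds s \<sigma> by (intro mult_right_mono) auto
  finally have LD: "L\<^sup>2 - D\<^sup>2 \<le> 24 * (s * \<sigma>)" .
  have tL: "0 \<le> L * t" "L * t \<le> L" using t L0 mult_left_mono[of t 1 L] by auto
  have d1: "dist (vert j) (\<gamma> (L * t)) \<le> L * t" using geod_dist[OF g(1), of 0 "L * t"] tL by (simp add: g(2))
  have d2: "dist (\<gamma> (L * t)) (vert k) \<le> (1 - t) * L"
    using geod_dist[OF g(1), of "L * t" L] tL by (simp add: g(3) algebra_simps)
  let ?m = "\<gamma> (L * t)"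
  have "(norm (?m - ((1 - t) *\<^sub>R vert j + t *\<^sub>R vert k)))\<^sup>2
      \<le> (1 - t) * (L * t)\<^sup>2 + t * ((1 - t) * L)\<^sup>2 - t * (1 - t) * D\<^sup>2"
    unfolding stewart D_def using t d1 d2 by (intro diff_right_mono add_mono mult_left_mono power_mono) auto
  also have "\<dots> = t * (1 - t) * (L\<^sup>2 - D\<^sup>2)" by (simp add: power2_eq_square algebra_simps)
  also have "\<dots> \<le> t * (1 - t) * (24 * (s * \<sigma>))" using LD t by (intro mult_left_mono) auto
  also have "\<dots> \<le> 1 / 4 * (24 * (s * \<sigma>))"
  proof (rule mult_right_mono)
    have "0 \<le> (t - 1 / 2)\<^sup>2" by simp
    then show "t * (1 - t) \<le> 1 / 4" by (simp add: power2_eq_square algebra_simps)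
  qed (use s \<sigma> in simp)
  finally have "norm (?m - ((1 - t) *\<^sub>R vert j + t *\<^sub>R vert k)) \<le> sqrt (6 * s * \<sigma>)"
    by (intro real_le_rsqrt) (simp add: mult.commute mult.left_commute)
  then have 1: "dist ?m ((1 - t) *\<^sub>R vert j + t *\<^sub>R vert k) \<le> sqrt (6 * s * \<sigma>)" by (simp add: dist_norm)
  have "(1 - t) *\<^sub>R vert j + t *\<^sub>R vert k - seg j k t = (1 - t) *\<^sub>R (vert j - corner j) + t *\<^sub>R (vert k - corner k)"
    by (simp add: seg_def algebra_simps)
  then have "dist ((1 - t) *\<^sub>R vert j + t *\<^sub>R vert k) (seg j k t)
      \<le> norm ((1 - t) *\<^sub>R (vert j - corner j)) + norm (t *\<^sub>R (vert k - corner k))"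
    unfolding dist_norm by (metis norm_triangle_ineq)
  also have "\<dots> = (1 - t) * dist (vert j) (corner j) + t * dist (vert k) (corner k)"
    using t by (simp add: dist_norm)
  also have "\<dots> \<le> (1 - t) * (3 * \<sigma>) + t * (3 * \<sigma>)"
    using t vert_near[OF jk(1)] vert_near[OF jk(2)] by (intro add_mono mult_left_mono) auto
  finally have 2: "dist ((1 - t) *\<^sub>R vert j + t *\<^sub>R vert k) (seg j k t) \<le> 3 * \<sigma>" by (simp add: algebra_simps)
  show ?thesis using dist_triangle[of ?m "seg j k t" "(1 - t) *\<^sub>R vert j + t *\<^sub>R vert k"] 1 2 by linarith
qed

lemma side_image:
  assumes jk: "j < 3" "k < 3" "j \<noteq> k" and g: "geod \<gamma> L" "\<gamma> 0 = vert j" "\<gamma> L = vert k" and \<tau>: "0 \<le> \<tau>" "\<tau> \<le> L"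
  shows "\<exists>t. 0 \<le> t \<and> t \<le> 1 \<and> dist (\<gamma> \<tau>) (seg j k t) \<le> \<zeta>"
proof -
  have "0 < L" using geod_length[OF g(1)] g(2,3) d_vert_ge[OF jk] side_lower s by simp
  then show ?thesis
    using side_near[OF jk g, of "\<tau> / L"] \<tau> \<zeta>(1) \<sigma> by (intro exI[of _ "\<tau> / L"]) auto
qed

lemma dir_proj_dist: "\<bar>dir l \<bullet> proj x - dir l \<bullet> proj y\<bar> \<le> dist x y"
  using inner_dir_bound[of l "proj x - proj y"] proj_dist_le[of x y] by (simp add: inner_diff_right)

text \<open>In direction \<open>dir l\<close> the side stays near s / 2, while vertex
  \<open>l\<close> is near - s.\<close>

lemma vert_not_in_side:
  assumes jk: "j < 3" "k < 3" "j \<noteq> k" and g: "geod \<gamma> L" "\<gamma> 0 = vert j" "\<gamma> L = vert k"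
    and \<tau>: "0 \<le> \<tau>" "\<tau> \<le> L" and l: "l < 3" "l \<noteq> j" "l \<noteq> k"
  shows "\<gamma> \<tau> \<noteq> vert l"
proof
  assume *: "\<gamma> \<tau> = vert l"
  obtain t where t: "0 \<le> t" "t \<le> 1" "dist (\<gamma> \<tau>) (seg j k t) \<le> \<zeta>" using side_image[OF jk g \<tau>] by blast
  have "dir l \<bullet> proj (seg j k t) = s / 2"
    unfolding seg_pt proj_pt using jk l by (simp add: inner_add_right inner_dir algebra_simps)
  moreover have "dir l \<bullet> proj (corner l) = - s" unfolding corner_def proj_pt using l by (simp add: inner_dir)
  ultimately show False
    using dir_proj_dist[of l "\<gamma> \<tau>" "seg j k t"] dir_proj_dist[of l "vert l" "corner l"] t(3) vert_near[OF l(1)]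
      \<sigma>_small \<zeta>(2) s unfolding * by linarith
qed

text \<open>If two sides from \<open>vert j\<close> met again, \<open>nonbranching\<close> would
  make them agree up to the end of the shorter one, and its end vertex would lie on the other side,
  against \<open>vert_not_in_side\<close>.\<close>

lemma sides_meet:
  assumes jkl: "j < 3" "k < 3" "l < 3" "j \<noteq> k" "j \<noteq> l" "k \<noteq> l"
    and g: "geod \<gamma> L" "\<gamma> 0 = vert j" "\<gamma> L = vert k" and h: "geod \<beta> M" "\<beta> 0 = vert j" "\<beta> M = vert l"
  shows "\<gamma> ` {0..L} \<inter> \<beta> ` {0..M} = {vert j}"
proof -
  have pos: "0 \<le> L" "0 \<le> M" using geod_nonneg g(1) h(1) by auto
  have "z = vert j" if zi: "z \<in> \<gamma> ` {0..L}" "z \<in> \<beta> ` {0..M}" for z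
  proof (rule ccontr)
    assume ne: "z \<noteq> vert j"
    obtain a b where ab: "0 \<le> a" "a \<le> L" "z = \<gamma> a" "0 \<le> b" "b \<le> M" "z = \<beta> b" using zi by auto
    have "d (vert j) z = a" using geod_d[OF g(1), of 0 a] ab g(2) pos by simp
    moreover have "d (vert j) z = b" using geod_d[OF h(1), of 0 b] ab h(2) pos by simp
    ultimately have "b = a" by simp
    have zS: "z \<in> S" using geod_S[OF g(1), of a] ab by simp
    have a: "0 < a" using d_pos[OF vert_S zS, of j] ne \<open>d (vert j) z = a\<close> by auto
    define r where "r = min L M - a"
    have r: "0 \<le> r" "a + r \<le> L" "a + r \<le> M" using ab \<open>b = a\<close> by (auto simp: r_def)
    have S: "\<gamma> (a + r) \<in> S" "\<beta> (a + r) \<in> S" using r a by (auto intro: geod_S[OF g(1)] geod_S[OF h(1)])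
    have "\<gamma> (a + r) = \<beta> (a + r)"
    proof (rule nonbranching[OF vert_S zS S a])
      show "d z (vert j) = a" using \<open>d (vert j) z = a\<close> by (simp add: d_commute)
      show "d (vert j) (\<gamma> (a + r)) = a + r" using geod_d[OF g(1), of 0 "a + r"] r a pos by (simp add: g(2))
      show "d (vert j) (\<beta> (a + r)) = a + r" using geod_d[OF h(1), of 0 "a + r"] r a pos by (simp add: h(2))
      show "d z (\<gamma> (a + r)) = r" using geod_d[OF g(1), of a "a + r"] r a ab by simp
      show "d z (\<beta> (a + r)) = r" using geod_d[OF h(1), of a "a + r"] r a ab \<open>b = a\<close> by simp
    qed
    moreover have "a + r = L \<or> a + r = M" by (auto simp: r_def min_def)
    ultimately show False
      using vert_not_in_side[OF jkl(1,2,4) g _ r(2) jkl(3)] vert_not_in_side[OF jkl(1,3,5) h _ r(3) jkl(2)]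
        g(3) h(3) jkl r a by auto
  qed
  moreover have "vert j \<in> \<gamma> ` {0..L}" "vert j \<in> \<beta> ` {0..M}" using g(2) h(2) pos by force+
  ultimately show ?thesis by blast
qed

text \<open>Side lengths between 17/10 s and sqrt 3 s give the comparison angle a cosine of at most
  311/578, which is below 54/100 and hence below cos (1/2).\<close>

lemma angle_ge_half:
  assumes jkl: "j < 3" "k < 3" "l < 3" "j \<noteq> k" "j \<noteq> l" "k \<noteq> l"
    and g: "shortest_path S g1 (vert j) (vert k)" and h: "shortest_path S g2 (vert j) (vert l)"
  shows "1 / 2 \<le> path_angle S g1 g2"
proof -
  define x y z where "x = d (vert j) (vert k)" and "y = d (vert j) (vert l)" and "z = d (vert k) (vert l)"
  have lo: "17 / 10 * s \<le> x" "17 / 10 * s \<le> y" "17 / 10 * s \<le> z"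
    using d_vert_ge[OF jkl(1,2,4)] d_vert_ge[OF jkl(1,3,5)] d_vert_ge[OF jkl(2,3,6)] side_lower
    unfolding x_def y_def z_def by linarith+
  have hi: "x \<le> sqrt 3 * s" "y \<le> sqrt 3 * s" using d_vert_le jkl by (auto simp: x_def y_def)
  have sq: "(sqrt 3 * s)\<^sup>2 = 3 * s\<^sup>2" by (simp add: power_mult_distrib)
  have "x\<^sup>2 \<le> 3 * s\<^sup>2" "y\<^sup>2 \<le> 3 * s\<^sup>2" unfolding sq[symmetric] using hi lo s by (auto intro!: power_mono)
  moreover have "(17 / 10 * s)\<^sup>2 \<le> z\<^sup>2" using lo s by (intro power_mono) auto
  ultimately have num: "x\<^sup>2 + y\<^sup>2 - z\<^sup>2 \<le> 311 / 100 * s\<^sup>2" by (simp add: power2_eq_square)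
  have "(17 / 10 * s) * (17 / 10 * s) \<le> x * y" using lo s by (intro mult_mono) auto
  then have den: "289 / 100 * s\<^sup>2 \<le> x * y" by (simp add: power2_eq_square)
  have "ccos (vert j) (vert k) (vert l) \<le> 54 / 100"
  proof -
    have "x\<^sup>2 + y\<^sup>2 - z\<^sup>2 \<le> 54 / 100 * (2 * (x * y))" using num den zero_le_power2[of s] by linarith
    then have "x\<^sup>2 + y\<^sup>2 - z\<^sup>2 \<le> 54 / 100 * (2 * x * y)" by (simp only: mult.assoc)
    moreover have "0 < 2 * x * y" using lo s by (simp add: zero_less_mult_iff)
    ultimately show ?thesis unfolding ccos_def x_def[symmetric] y_def[symmetric] z_def[symmetric]
      by (subst pos_divide_le_eq) auto
  qed
  then have "ccos (vert j) (vert k) (vert l) \<le> cos (1 / 2)" using cos_half_lower by simp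
  moreover have "- 1 \<le> ccos (vert j) (vert k) (vert l)" using vert_neq jkl by (intro ccos_bounds vert_S) auto
  ultimately have "arccos (cos (1 / 2)) \<le> arccos (ccos (vert j) (vert k) (vert l))" by (intro arccos_le_arccos) auto
  moreover have "arccos (cos (1 / 2 :: real)) = 1 / 2" using pi_gt3 by (intro arccos_cos) auto
  ultimately show ?thesis using shortest_path_angle_ge[OF g _ h] vert_neq jkl by fastforce
qed

text \<open>The third direction needed for the upper angle bound points away from the triangle.\<close>
lemma flat_angle_le:
  assumes jkl: "j < 3" "k < 3" "l < 3" "j \<noteq> k" "j \<noteq> l" "k \<noteq> l" and flat: "\<kappa> = 0"
    and g: "shortest_path S g1 (vert j) (vert k)" and h: "shortest_path S g2 (vert j) (vert l)"
  shows "path_angle S g1 g2 \<le> arccos (1 / 2 - 36 * (\<sigma> / s))"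
proof -
  \<comment> \<open>The third point continues the ray beyond vertex \<open>j\<close> to twice the
    distance from the centre. In the plane it has distance s from vertex \<open>j\<close> and sqrt 7
    s from the others, so the comparison cosines are (3 + 1 - 7) / (2 sqrt 3), for which
    \<open>shortest_path_angle_le\<close> gives the value 1/2, that is 60 degrees.\<close>
  define z where "z = lift (- (2 * s) *\<^sub>R dir j)"
  have roof0: "roof \<kappa> w = 0" for w by (simp add: roof_def flat)
  have up: "d (lift w) (lift w') \<le> norm (w - w')" for w w'
  proof -
    have "roof \<kappa> w = - \<kappa> * (dir 0 \<bullet> w)" for w unfolding roof0 by (simp add: flat)
    then have "d (lift w) (lift w') \<le> dist (pt w (roof \<kappa> w)) (pt w' (roof \<kappa> w'))" by (intro d_lift_le[of 0]) simp_all
    then show ?thesis unfolding roof0 dist_same_height .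
  qed
  have lo: "norm (w - w') - 6 * \<sigma> \<le> d (lift w) (lift w')" if "norm w \<le> \<rho>" "norm w' \<le> \<rho>" for w w'
    using d_lift_ge[OF that] unfolding roof0 dist_same_height .
  have n2: "norm (- (2 * s) *\<^sub>R dir j) \<le> \<rho>" using s by simp
  have "- s *\<^sub>R dir j - (- (2 * s) *\<^sub>R dir j) = (- s - (- (2 * s))) *\<^sub>R dir j" by (simp only: scaleR_diff_left)
  then have diff: "- s *\<^sub>R dir j - (- (2 * s) *\<^sub>R dir j) = s *\<^sub>R dir j" by simp
  have njz: "norm (- s *\<^sub>R dir j - (- (2 * s) *\<^sub>R dir j)) = s" unfolding diff using s by simp
  have dz: "s - 6 * \<sigma> \<le> d (vert j) z" "d (vert j) z \<le> s"
    unfolding vert_def z_def using lo[OF norm_corner n2, of j] up[of "- s *\<^sub>R dir j"] njz by metis+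
  have cos_bound: "ccos (vert j) (vert i) z \<le> (- 3 + 36 * (\<sigma> / s)) / (2 * sqrt 3)" if i: "i < 3" "i \<noteq> j" for i
  proof -
    define x y t where "x = d (vert j) (vert i)" and "y = d (vert j) z" and "t = d (vert i) z"
    have x: "17 / 10 * s \<le> x" "x \<le> sqrt 3 * s"
      using d_vert_ge[OF jkl(1) i(1)] d_vert_le[OF jkl(1) i(1)] i(2) side_lower by (auto simp: x_def)
    have y: "0 < y" "y \<le> s" using dz \<sigma>_small s by (auto simp: y_def)
    have "(norm (- s *\<^sub>R dir i - (- (2 * s) *\<^sub>R dir j)))\<^sup>2 = 7 * s\<^sup>2"
      unfolding power2_norm_eq_inner using i jkl
      by (simp add: inner_diff_left inner_diff_right inner_dir power2_eq_square algebra_simps)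
    moreover have "(sqrt 7 * s)\<^sup>2 = 7 * s\<^sup>2" by (simp add: power_mult_distrib)
    ultimately have "(norm (- s *\<^sub>R dir i - (- (2 * s) *\<^sub>R dir j)))\<^sup>2 = (sqrt 7 * s)\<^sup>2" by (simp only:)
    moreover have "0 \<le> sqrt 7 * s" using s by simp
    ultimately have "norm (- s *\<^sub>R dir i - (- (2 * s) *\<^sub>R dir j)) = sqrt 7 * s" by (rule power2_eq_imp_eq[OF _ norm_ge_zero])
    then have t: "sqrt 7 * s - 6 * \<sigma> \<le> t" using lo[OF norm_corner n2, of i] by (simp add: t_def vert_def z_def)
    have s7: "2 \<le> sqrt 7" "sqrt 7 \<le> 3" by (auto intro!: real_le_rsqrt real_le_lsqrt)
    have "2 * s \<le> sqrt 7 * s" using s7 s by (intro mult_right_mono) auto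
    then have "0 \<le> sqrt 7 * s - 6 * \<sigma>" using \<sigma>_small s by linarith
    then have "(sqrt 7 * s - 6 * \<sigma>)\<^sup>2 \<le> t\<^sup>2" using t by (intro power_mono) auto
    moreover have "(sqrt 7 * s - 6 * \<sigma>)\<^sup>2 = 7 * s\<^sup>2 - 12 * sqrt 7 * (s * \<sigma>) + 36 * \<sigma>\<^sup>2"
      by (simp add: power2_diff power_mult_distrib)
    moreover have "12 * sqrt 7 * (s * \<sigma>) \<le> 36 * (s * \<sigma>)" using s7 s \<sigma> by (intro mult_right_mono) auto
    moreover have "x\<^sup>2 \<le> (sqrt 3 * s)\<^sup>2" "y\<^sup>2 \<le> s\<^sup>2" using x y s by (auto intro!: power_mono)
    moreover have "(sqrt 3 * s)\<^sup>2 = 3 * s\<^sup>2" by (simp add: power_mult_distrib)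
    moreover have "0 \<le> 36 * \<sigma>\<^sup>2" by simp
    ultimately have num: "x\<^sup>2 + y\<^sup>2 - t\<^sup>2 \<le> - 3 * s\<^sup>2 + 36 * (s * \<sigma>)" by linarith
    have "36 * \<sigma> \<le> 3 * s" using \<sigma>_small s \<sigma> by linarith
    then have "s * (36 * \<sigma>) \<le> s * (3 * s)" using s by (intro mult_left_mono) auto
    then have neg: "- 3 * s\<^sup>2 + 36 * (s * \<sigma>) \<le> 0" by (simp add: power2_eq_square mult.left_commute)
    have xy: "0 < x * y" "x * y \<le> (sqrt 3 * s) * s" using x y s by (auto intro!: mult_mono mult_pos_pos)
    have "ccos (vert j) (vert i) z \<le> (- 3 * s\<^sup>2 + 36 * (s * \<sigma>)) / (2 * x * y)"
      unfolding ccos_def x_def[symmetric] y_def[symmetric] t_def[symmetric]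
      using num xy by (intro divide_right_mono) (auto simp: mult.assoc)
    also have "\<dots> \<le> (- 3 * s\<^sup>2 + 36 * (s * \<sigma>)) / (2 * ((sqrt 3 * s) * s))"
      using neg xy s x(1) y(1) by (intro divide_left_mono_neg) (auto simp: mult.assoc intro!: mult_pos_pos)
    also have "\<dots> = (- 3 + 36 * (\<sigma> / s)) / (2 * sqrt 3)"
      using s by (simp add: power2_eq_square field_simps)
    finally show ?thesis .
  qed
  have "- 5 / 2 - sqrt 3 * (ccos (vert j) (vert k) z + ccos (vert j) (vert l) z)
      \<ge> - 5 / 2 - sqrt 3 * ((- 3 + 36 * (\<sigma> / s)) / (2 * sqrt 3) + (- 3 + 36 * (\<sigma> / s)) / (2 * sqrt 3))"
    using cos_bound[of k] cos_bound[of l] jkl by (intro diff_left_mono mult_left_mono add_mono) auto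
  also have "- 5 / 2 - sqrt 3 * ((- 3 + 36 * (\<sigma> / s)) / (2 * sqrt 3) + (- 3 + 36 * (\<sigma> / s)) / (2 * sqrt 3))
      = 1 / 2 - 36 * (\<sigma> / s)"
    by (simp add: field_simps)
  finally have k: "1 / 2 - 36 * (\<sigma> / s) \<le> - 5 / 2 - sqrt 3 * (ccos (vert j) (vert k) z + ccos (vert j) (vert l) z)" .
  have "\<sigma> / s \<le> 1 / 900" using \<sigma>_small s by (simp add: pos_divide_le_eq)
  then have "- 1 \<le> 1 / 2 - 36 * (\<sigma> / s)" by simp
  moreover have "z \<in> S" "z \<noteq> vert j" using dz \<sigma>_small s d_refl[OF vert_S, of j] by (auto simp: z_def lift_S)
  ultimately show ?thesis
    using vert_neq jkl by (intro shortest_path_angle_le[OF g _ h _ _ _ _ k]) auto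
qed

text \<open>Sine of the angle between a side of the model triangle and the edge of the tip at its
  vertex: 1/2 for \<open>\<kappa> = 0\<close>, more for a proper tip.\<close>

definition sharp :: real where "sharp = sqrt ((1 + \<kappa>\<^sup>2) / (4 + \<kappa>\<^sup>2))"

lemma edge_dist:
  assumes jk: "j < 3" "k < 3" "j \<noteq> k" and r: "0 \<le> r"
  shows "r * sharp \<le> dist (pt (- s *\<^sub>R dir j - (r / sqrt 3) *\<^sub>R (dir k - dir j)) (- \<kappa> * s / 2)) (pt (x *\<^sub>R dir j) (\<kappa> * x / 2))"
proof (rule power2_le_imp_le)
  define y where "y = s + x"
  have eq: "- s *\<^sub>R dir j - (r / sqrt 3) *\<^sub>R (dir k - dir j) - x *\<^sub>R dir j = - (y *\<^sub>R dir j + (r / sqrt 3) *\<^sub>R (dir k - dir j))"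
    by (simp add: y_def algebra_simps)
  have c: "dir j \<bullet> (dir k - dir j) = - 3 / 2" "(dir k - dir j) \<bullet> (dir k - dir j) = 3"
    using jk by (simp_all add: inner_diff_left inner_diff_right inner_dir)
  have n: "(norm (y *\<^sub>R dir j + q *\<^sub>R (dir k - dir j)))\<^sup>2 = y\<^sup>2 - 3 * (y * q) + 3 * q\<^sup>2" for q
    unfolding power2_norm_eq_inner inner_add_left inner_add_right inner_scaleR_left inner_scaleR_right c
    using jk by (simp add: inner_dir inner_commute[of "dir k - dir j" "dir j"] c power2_eq_square algebra_simps)
  define q where "q = r / sqrt 3"
  have q2: "3 * q\<^sup>2 = r\<^sup>2" by (simp add: q_def power_divide)
  have "(dist (pt (- s *\<^sub>R dir j - (r / sqrt 3) *\<^sub>R (dir k - dir j)) (- \<kappa> * s / 2)) (pt (x *\<^sub>R dir j) (\<kappa> * x / 2)))\<^sup>2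
      = y\<^sup>2 - 3 * (y * q) + 3 * q\<^sup>2 + (\<kappa> * y / 2)\<^sup>2"
    unfolding dist_pt eq norm_minus_cancel n[of "r / sqrt 3"] q_def
    by (simp add: y_def power2_eq_square field_simps)
  moreover have "(r * sharp)\<^sup>2 = 3 * q\<^sup>2 * ((1 + \<kappa>\<^sup>2) / (4 + \<kappa>\<^sup>2))"
    unfolding q2 sharp_def power_mult_distrib by (subst real_sqrt_pow2) (auto intro: divide_nonneg_pos add_pos_nonneg)
  moreover have "3 * q\<^sup>2 * ((1 + \<kappa>\<^sup>2) / (4 + \<kappa>\<^sup>2)) \<le> y\<^sup>2 - 3 * (y * q) + 3 * q\<^sup>2 + (\<kappa> * y / 2)\<^sup>2"
  proof -
    define B where "B = y\<^sup>2 - 3 * (y * q) + 3 * q\<^sup>2 + (\<kappa> * y / 2)\<^sup>2"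
    define P where "P = 4 + \<kappa>\<^sup>2"
    have P: "0 < P" by (simp add: P_def add_pos_nonneg)
    \<comment> \<open>Completing the square in \<open>y\<close>; equality marks the foot of the
      perpendicular on the line of the edge.\<close>
    have "0 \<le> (P * y - 6 * q)\<^sup>2" by simp
    then have "3 * q\<^sup>2 * (1 + \<kappa>\<^sup>2) * 4 \<le> B * (4 * P)"
      by (simp add: P_def B_def power2_eq_square field_simps)
    then have "3 * q\<^sup>2 * (1 + \<kappa>\<^sup>2) \<le> B * P" by simp
    then show ?thesis using P unfolding P_def[symmetric] B_def[symmetric] by (simp add: pos_divide_le_eq)
  qed
  ultimately show "(r * sharp)\<^sup>2 \<le> (dist (pt (- s *\<^sub>R dir j - (r / sqrt 3) *\<^sub>R (dir k - dir j)) (- \<kappa> * s / 2)) (pt (x *\<^sub>R dir j) (\<kappa> * x / 2)))\<^sup>2"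
    by simp
qed simp

lemma sharp_bounds: "1 / 2 \<le> sharp" "sharp \<le> 1"
proof -
  have "(1 / 2)\<^sup>2 \<le> (1 + \<kappa>\<^sup>2) / (4 + \<kappa>\<^sup>2)" by (simp add: power2_eq_square pos_le_divide_eq add_pos_nonneg)
  then show "1 / 2 \<le> sharp" unfolding sharp_def by (rule real_le_rsqrt)
  show "sharp \<le> 1" unfolding sharp_def by (simp add: divide_le_eq_1 add_pos_nonneg)
qed

text \<open>The side has length \<open>L\<close> and its segment sqrt 3 s; at equal arc length
  \<open>r\<close> the two relative parameters differ, and this mismatch moves the point on the
  segment by at most 6 \<open>\<sigma>\<close>.\<close>

lemma near_side_point:
  assumes jk: "j < 3" "k < 3" "j \<noteq> k" and g: "geod \<gamma> L" "\<gamma> 0 = vert j" "\<gamma> L = vert k"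
    and r: "0 \<le> r" "r \<le> s"
  shows "dist (\<gamma> r) (pt (- s *\<^sub>R dir j - (r / sqrt 3) *\<^sub>R (dir k - dir j)) (- \<kappa> * s / 2)) \<le> \<zeta>"
proof -
  have L: "L = d (vert j) (vert k)" using geod_length[OF g(1)] g(2,3) by simp
  have Lb: "sqrt 3 * s - 6 * \<sigma> \<le> L" "L \<le> sqrt 3 * s" "s \<le> L" "0 < L"
    using d_vert_ge[OF jk] d_vert_le[OF jk] side_lower s by (auto simp: L)
  define t t' where "t = r / L" and "t' = r / (sqrt 3 * s)"
  have t: "0 \<le> t" "t \<le> 1" "L * t = r" using r Lb by (auto simp: t_def)
  have "dist (\<gamma> r) (seg j k t) \<le> sqrt (6 * s * \<sigma>) + 3 * \<sigma>" using side_near[OF jk g t(1,2)] t(3) by simp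
  moreover have "dist (seg j k t) (seg j k t') \<le> 6 * \<sigma>"
  proof -
    have "seg j k t - seg j k t' = (t - t') *\<^sub>R (corner k - corner j)" by (simp add: seg_def algebra_simps)
    then have "dist (seg j k t) (seg j k t') = \<bar>t - t'\<bar> * (sqrt 3 * s)"
      using corner_dist[OF jk] by (simp add: dist_norm norm_minus_commute)
    also have "\<bar>t - t'\<bar> = t - t'"
      using Lb r s by (simp add: t_def t'_def divide_left_mono)
    also have "(t - t') * (sqrt 3 * s) = r * (sqrt 3 * s - L) / L"
    proof -
      have "t' * (sqrt 3 * s) = r" using s by (simp add: t'_def)
      moreover have "r * (sqrt 3 * s - L) / L = t * (sqrt 3 * s) - r"
        using Lb by (simp add: t_def right_diff_distrib diff_divide_distrib)
      ultimately show ?thesis by (simp only: left_diff_distrib)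
    qed
    also have "\<dots> \<le> L * (6 * \<sigma>) / L" using Lb r \<sigma> by (intro divide_right_mono mult_mono) auto
    finally show ?thesis using Lb by simp
  qed
  moreover have "seg j k t' = pt (- s *\<^sub>R dir j - (r / sqrt 3) *\<^sub>R (dir k - dir j)) (- \<kappa> * s / 2)"
  proof -
    have "s * t' = r / sqrt 3" using s by (simp add: t'_def)
    have "- s *\<^sub>R ((1 - t') *\<^sub>R dir j + t' *\<^sub>R dir k) = - s *\<^sub>R dir j - (s * t') *\<^sub>R (dir k - dir j)"
      by (simp add: algebra_simps)
    then show ?thesis unfolding seg_pt \<open>s * t' = r / sqrt 3\<close> by simp
  qed
  ultimately show ?thesis using dist_triangle[of "\<gamma> r" "seg j k t'" "seg j k t"] \<zeta>(1) by simp
qed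

end

context near_tri
begin

text \<open>A path joining the two sides at a vertex must cross the symmetry plane close to the edge.\<close>
lemma tip_angle_ge:
  assumes jkl: "j < 3" "k < 3" "l < 3" "j \<noteq> k" "j \<noteq> l" "k \<noteq> l"
    and g: "shortest_path S g1 (vert j) (vert k)" and h: "shortest_path S g2 (vert j) (vert l)"
  shows "arccos (1 - 2 * (sharp - 20 * (\<zeta> / s))\<^sup>2) \<le> path_angle S g1 g2"
proof -
  define lk ll where "lk = d (vert j) (vert k)" and "ll = d (vert j) (vert l)"
  obtain \<gamma> where \<gamma>: "geod \<gamma> lk" "\<gamma> 0 = vert j" "\<gamma> lk = vert k" "\<gamma> ` {0..lk} = path_image g1"
    using shortest_path_geod(3)[OF g] by (auto simp: lk_def)
  obtain \<beta> where \<beta>: "geod \<beta> ll" "\<beta> 0 = vert j" "\<beta> ll = vert l" "\<beta> ` {0..ll} = path_image g2"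
    using shortest_path_geod(3)[OF h] by (auto simp: ll_def)
  have start: "pathstart g1 = vert j" using g by (simp add: shortest_path_def)
  \<comment> \<open>The distance from the vertex has to be large against \<open>\<zeta>\<close>, and
    so small against \<open>s\<close> that short crossings stay near this edge and away from the
    apex.\<close>
  define r where "r = s / 10"
  have r: "0 < r" "r \<le> s" "r \<le> lk" "r \<le> ll" "10 * r = s"
    using d_vert_ge[OF jkl(1,2,4)] d_vert_ge[OF jkl(1,3,5)] side_lower s unfolding r_def lk_def ll_def by linarith+
  define B C where "B = \<gamma> r" and "C = \<beta> r"
  define b where "b = pt (- s *\<^sub>R dir j - (r / sqrt 3) *\<^sub>R (dir k - dir j)) (- \<kappa> * s / 2)"
  define c where "c = pt (- s *\<^sub>R dir j - (r / sqrt 3) *\<^sub>R (dir l - dir j)) (- \<kappa> * s / 2)"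
  have Bb: "dist B b \<le> \<zeta>" unfolding B_def b_def using r by (intro near_side_point[OF jkl(1,2,4) \<gamma>(1-3)]) auto
  have Cc: "dist C c \<le> \<zeta>" unfolding C_def c_def using r by (intro near_side_point[OF jkl(1,3,5) \<beta>(1-3)]) auto
  have BS: "B \<in> S" "C \<in> S" using r by (auto simp: B_def C_def intro!: geod_S[OF \<gamma>(1)] geod_S[OF \<beta>(1)])
  define \<delta> where "\<delta> = dir k - dir l"
  have \<delta>b: "\<delta> \<bullet> proj b = - (3 / 2) * (r / sqrt 3)" "\<delta> \<bullet> proj c = 3 / 2 * (r / sqrt 3)"
    unfolding b_def c_def proj_pt \<delta>_def using jkl
    by (simp_all add: inner_diff_left inner_diff_right inner_dir algebra_simps)
  have n\<delta>: "norm \<delta> \<le> 2" using dist_dir[OF jkl(2,3,6)] sqrt3_bounds by (simp add: \<delta>_def)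
  have \<delta>_dist: "\<bar>\<delta> \<bullet> proj x - \<delta> \<bullet> proj y\<bar> \<le> 2 * dist x y" for x y
  proof -
    have "\<bar>\<delta> \<bullet> (proj x - proj y)\<bar> \<le> norm \<delta> * norm (proj x - proj y)" by (rule Cauchy_Schwarz_ineq2)
    also have "\<dots> \<le> 2 * dist x y" using n\<delta> proj_dist_le by (intro mult_mono) auto
    finally show ?thesis by (simp add: inner_diff_right)
  qed
  have r3: "r / 2 \<le> r / sqrt 3"
    using r sqrt3_bounds by (intro divide_left_mono) auto
  have \<zeta>r: "10 * \<zeta> \<le> r" using \<zeta>(2) r(5) by linarith
  have signs: "\<delta> \<bullet> proj B \<le> 0" "0 \<le> \<delta> \<bullet> proj C"
    using \<delta>_dist[of B b] \<delta>_dist[of C c] \<delta>b Bb Cc r3 \<zeta>r \<sigma>_small(3) by linarith+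
  define N where "N = Re \<delta> *\<^sub>R e1 + Im \<delta> *\<^sub>R e2"
  have N: "N \<bullet> y = \<delta> \<bullet> proj y + N \<bullet> v" for y
    by (simp add: N_def proj_def inner_complex_def inner_add_left inner_diff_left inner_commute algebra_simps)
  have through: "2 * (r * sharp) - 16 * \<sigma> \<le> dist c m + dist m b" if m: "m \<in> S" "\<delta> \<bullet> proj m = 0" for m
  \<comment> \<open>A crossing point far from \<open>b\<close> is harmless since
    \<open>sharp\<close> \<le> 1. Otherwise \<open>m\<close> lies on the upper sheet over the edge,
    within 8 \<open>\<sigma>\<close> of a point \<open>e\<close> of the edge, and each half is at
    least r \<open>sharp\<close> - 8 \<open>\<sigma>\<close> long.\<close>
  proof (cases "dist m b \<le> 2 * r")
    case False
    have "r * sharp \<le> r * 1" using r sharp_bounds by (intro mult_left_mono) auto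
    moreover have "0 \<le> dist c m" by simp
    ultimately show ?thesis using False \<sigma> by linarith
  next
    case True
    define x where "x = dir j \<bullet> proj m"
    have pm: "proj m = x *\<^sub>R dir j"
      unfolding x_def using m(2) unfolding \<delta>_def by (rule dir_decompose[OF jkl])
    define h where "h = r / sqrt 3"
    have "dir j \<bullet> proj b = - s + 3 / 2 * h"
      unfolding b_def proj_pt h_def using jkl by (simp add: inner_diff_right inner_dir algebra_simps)
    moreover have "r / sqrt 3 \<le> r / 1" using r sqrt3_bounds by (intro divide_left_mono) auto
    then have "h \<le> r" by (simp add: h_def)
    moreover have "r / 2 \<le> h" using r3 by (simp add: h_def)
    moreover have "\<bar>x - dir j \<bullet> proj b\<bar> \<le> 2 * r" unfolding x_def using dir_proj_dist[of j m b] True by linarith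
    ultimately have x: "- 3 * s \<le> x" "x \<le> - s / 2" using r by linarith+
    have "roof \<kappa> (- (- x) *\<^sub>R dir j) = - \<kappa> * (- x) / 2" using x s by (intro roof_vertex(1) jkl \<kappa>) auto
    then have rf: "roof \<kappa> (proj m) = \<kappa> * x / 2" by (simp add: pm)
    have np: "norm (proj m) \<le> \<rho> / 8" using x s by (simp add: pm)
    have "height b = - \<kappa> * s / 2" by (simp add: b_def)
    moreover have "\<kappa> * s \<le> 1 * s" using \<kappa> s by (intro mult_right_mono) auto
    moreover have "\<bar>height m - height b\<bar> \<le> 2 * r" using height_dist_le[of m b] True by linarith
    ultimately have "- 2 * \<rho> < height m" using r s by linarith
    then have "\<kappa> * x / 2 - 8 * \<sigma> \<le> height m" using sheet[OF m(1) np] by (simp add: rf)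
    moreover have "height m \<le> \<kappa> * x / 2 + \<sigma>" using height_le(1)[of m] m(1) S_subset_K by (auto simp: rf)
    ultimately have hm: "\<bar>height m - \<kappa> * x / 2\<bar> \<le> 8 * \<sigma>" using \<sigma> by linarith
    define e where "e = pt (x *\<^sub>R dir j) (\<kappa> * x / 2)"
    have "dist m e = \<bar>height m - \<kappa> * x / 2\<bar>" unfolding e_def by (subst (1) pt_proj[of m, symmetric]) (simp only: pm dist_same_proj)
    then have me: "dist m e \<le> 8 * \<sigma>" using hm by simp
    have "r * sharp \<le> dist b e" unfolding b_def e_def by (rule edge_dist[OF jkl(1,2,4) less_imp_le[OF r(1)]])
    moreover have "r * sharp \<le> dist c e" unfolding c_def e_def by (rule edge_dist[OF jkl(1,3,5) less_imp_le[OF r(1)]])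
    ultimately show ?thesis using dist_triangle[of b e m] dist_triangle[of c e m] me by (simp add: dist_commute)
  qed
  have "ereal (2 * (r * sharp) - 16 * \<sigma> - 2 * \<zeta>) \<le> pdist S C B"
  proof (rule pdist_crossing[where n=N and b="N \<bullet> v"])
    show "N \<bullet> v \<le> N \<bullet> C" "N \<bullet> B \<le> N \<bullet> v" using signs N[of B] N[of C] by simp_all
    fix m assume m: "m \<in> S" "N \<bullet> m = N \<bullet> v"
    have "2 * (r * sharp) - 16 * \<sigma> \<le> dist c m + dist m b" using m N[of m] by (intro through) auto
    also have "\<dots> \<le> (dist C m + \<zeta>) + (dist m B + \<zeta>)"
      using dist_triangle[of c m C] dist_triangle[of m b B] Bb Cc by (simp add: dist_commute)
    finally have "ereal (2 * (r * sharp) - 16 * \<sigma> - 2 * \<zeta>) \<le> ereal (dist C m) + ereal (dist m B)" by simp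
    also have "\<dots> \<le> pdist S C m + pdist S m B" by (intro add_mono pdist_ge_dist)
    finally show "ereal (2 * (r * sharp) - 16 * \<sigma> - 2 * \<zeta>) \<le> pdist S C m + pdist S m B" .
  qed
  then have "2 * (r * sharp) - 16 * \<sigma> - 2 * \<zeta> \<le> d C B" using BS by (simp flip: ereal_d)
  then have dBC: "2 * (r * sharp) - 4 * \<zeta> \<le> d B C" using \<sigma>_small(2) \<sigma> by (simp add: d_commute[of C B])
  have dr: "d (vert j) B = r" "d (vert j) C = r"
    using geod_d[OF \<gamma>(1), of 0 r] geod_d[OF \<beta>(1), of 0 r] r \<gamma>(2) \<beta>(2) by (simp_all add: B_def C_def)
  \<comment> \<open>The errors 16 \<open>\<sigma>\<close> + 2 \<open>\<zeta>\<close> \<le> 4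
    \<open>\<zeta>\<close> become 20 \<open>\<zeta>\<close> / s on division by 2 r = s / 5. The
    value 1 - 2 q^2 is the cosine of 2 arcsin q.\<close>
  define q where "q = sharp - 20 * (\<zeta> / s)"
  have "\<zeta> / s \<le> 1 / 100" using \<zeta>(2) s by (simp add: pos_divide_le_eq)
  then have q: "0 \<le> q" using sharp_bounds by (simp add: q_def)
  have rq: "2 * (r * q) = 2 * (r * sharp) - 4 * \<zeta>" using s by (simp add: q_def r_def algebra_simps)
  then have "2 * (r * q) \<le> d B C" using dBC by linarith
  moreover have "0 \<le> 2 * (r * q)" using q r by simp
  ultimately have "(2 * (r * q))\<^sup>2 \<le> (d B C)\<^sup>2" by (rule power_mono)
  then have "2 * r\<^sup>2 - (d B C)\<^sup>2 \<le> (1 - 2 * q\<^sup>2) * (2 * r\<^sup>2)" by (simp add: power_mult_distrib algebra_simps)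
  then have "ccos (vert j) B C \<le> 1 - 2 * q\<^sup>2"
    unfolding ccos_def dr using r by (simp add: pos_divide_le_eq power2_eq_square)
  moreover have "B \<noteq> vert j" "C \<noteq> vert j" using dr r d_refl[OF vert_S, of j] by auto
  then have "- 1 \<le> ccos (vert j) B C" using BS by (intro ccos_bounds vert_S) auto
  moreover have "0 \<le> \<zeta> / s" using \<sigma>_small(3) s by simp
  then have "q \<le> 1" using sharp_bounds unfolding q_def by linarith
  ultimately have "arccos (1 - 2 * q\<^sup>2) \<le> arccos (ccos (vert j) B C)"
    by (intro arccos_le_arccos) auto
  also have "\<dots> \<le> path_angle S g1 g2"
    unfolding B_def C_def using r
    by (intro path_angle_ge[OF \<gamma>(1) _ \<gamma>(2,4) \<beta>(1) _ \<beta>(2,4) start]) auto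
  finally show ?thesis by (simp add: q_def)
qed

text \<open>The triangle has circumradius \<open>s\<close>, so this is its incircle; its barycentric
  coordinates are affine in the products with the three directions.\<close>

lemma triangle_hull: "ball 0 (s / 2) \<subseteq> convex hull {- s *\<^sub>R dir 0, - s *\<^sub>R dir 1, - s *\<^sub>R dir 2}"
proof
  fix z :: complex assume z: "z \<in> ball 0 (s / 2)"
  define lam where "lam k = 1 / 3 - 2 / (3 * s) * (dir k \<bullet> z)" for k
  have "0 \<le> lam k" for k
  proof -
    have "dir k \<bullet> z \<le> s / 2" using inner_dir_bound[of k z] z by simp
    then have "2 / (3 * s) * (dir k \<bullet> z) \<le> 2 / (3 * s) * (s / 2)" using s by (intro mult_left_mono) auto
    then show ?thesis using s by (simp add: lam_def)
  qed
  moreover have "lam 0 + lam 1 + lam 2 = 1"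
  proof -
    have "lam 0 + lam 1 + lam 2 = 1 - 2 / (3 * s) * (dir 0 \<bullet> z + dir 1 \<bullet> z + dir 2 \<bullet> z)"
      by (simp add: lam_def algebra_simps)
    then show ?thesis unfolding inner_dir_sum by simp
  qed
  moreover have "z = lam 0 *\<^sub>R (- s *\<^sub>R dir 0) + lam 1 *\<^sub>R (- s *\<^sub>R dir 1) + lam 2 *\<^sub>R (- s *\<^sub>R dir 2)"
  proof -
    have "lam k *\<^sub>R (- s *\<^sub>R dir k) = - (s / 3) *\<^sub>R dir k + (2 / 3) *\<^sub>R ((dir k \<bullet> z) *\<^sub>R dir k)" for k
    proof -
      have "lam k * (- s) = - (s / 3) + 2 / 3 * (dir k \<bullet> z)" using s by (simp add: lam_def field_simps)
      then show ?thesis by (metis scaleR_add_left scaleR_scaleR)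
    qed
    then have "lam 0 *\<^sub>R (- s *\<^sub>R dir 0) + lam 1 *\<^sub>R (- s *\<^sub>R dir 1) + lam 2 *\<^sub>R (- s *\<^sub>R dir 2)
        = - (s / 3) *\<^sub>R (dir 0 + dir 1 + dir 2)
          + (2 / 3) *\<^sub>R ((dir 0 \<bullet> z) *\<^sub>R dir 0 + (dir 1 \<bullet> z) *\<^sub>R dir 1 + (dir 2 \<bullet> z) *\<^sub>R dir 2)"
      by (simp only: scaleR_add_right) (simp only: add.assoc add.left_commute)
    also have "\<dots> = z" unfolding dir_sum dir_frame by simp
    finally show ?thesis by simp
  qed
  ultimately show "z \<in> convex hull {- s *\<^sub>R dir 0, - s *\<^sub>R dir 1, - s *\<^sub>R dir 2}"
    unfolding convex_hull_3 by blast
qed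

text \<open>The points to be enclosed by the triangle. Half the radius of the incircle leaves room
  for the tolerance of the sides.\<close>

definition core :: "(real^3) set" where "core = {x \<in> S. norm (proj x) < s / 4 \<and> - \<rho> < height x}"

end

section \<open>The boundary curve of the triangle and its winding number\<close>

definition nxt :: "nat \<Rightarrow> nat" where "nxt j = (if j = 2 then 0 else Suc j)"

text \<open>The three sides are fixed once for all points of \<open>core\<close>.\<close>

locale near_tri_sides = near_tri +
  fixes \<gamma> :: "nat \<Rightarrow> real \<Rightarrow> real^3" and L :: "nat \<Rightarrow> real"
  assumes geod: "j < 3 \<Longrightarrow> geod (\<gamma> j) (L j)"
    and start: "j < 3 \<Longrightarrow> \<gamma> j 0 = vert j" and finish: "j < 3 \<Longrightarrow> \<gamma> j (L j) = vert (nxt j)"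
begin

lemma nxt: "j < 3 \<Longrightarrow> nxt j < 3" "j < 3 \<Longrightarrow> nxt j \<noteq> j" "nxt 0 = 1" "nxt 1 = 2" "nxt 2 = 0"
  "nxt (Suc 0) = 2" "j < 3 \<Longrightarrow> j \<noteq> nxt j"
  unfolding less_3_cases by (auto simp: nxt_def)

definition side :: "nat \<Rightarrow> real \<Rightarrow> real^3" where "side j = (\<lambda>t. \<gamma> j (L j * t))"
definition curve :: "real \<Rightarrow> real^3" where "curve = side 0 +++ side 1 +++ side 2"
definition bd :: "(real^3) set" where "bd = path_image (side 0) \<union> path_image (side 1) \<union> path_image (side 2)"

lemma side_shortest: "j < 3 \<Longrightarrow> shortest_path S (side j) (vert j) (vert (nxt j))"
  using geod_shortest_path[OF geod] start finish by (simp add: side_def)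

lemma L_pos: "j < 3 \<Longrightarrow> 0 < L j"
  using geod_length[OF geod, of j] d_vert_ge[of j "nxt j"] nxt side_lower s by (simp add: start finish)

lemma side_path_image: "j < 3 \<Longrightarrow> path_image (side j) = \<gamma> j ` {0..L j}"
proof -
  assume j: "j < 3"
  have "(\<lambda>t. L j * t) ` {0..1} = {0..L j}" using L_pos[OF j] image_mult_atLeastAtMost[of "L j" 0 1] by simp
  then show ?thesis unfolding path_image_def side_def image_image[of "\<gamma> j" "\<lambda>t. L j * t", symmetric] by simp
qed

lemma side_ends: "j < 3 \<Longrightarrow> pathstart (side j) = vert j" "j < 3 \<Longrightarrow> pathfinish (side j) = vert (nxt j)"
  using side_shortest by (auto simp: shortest_path_def)

lemma side_path: "j < 3 \<Longrightarrow> path (side j)" and side_S: "j < 3 \<Longrightarrow> path_image (side j) \<subseteq> S"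
  using side_shortest by (auto simp: shortest_path_def)

lemma side_arc: "j < 3 \<Longrightarrow> arc (side j)"
proof -
  assume j: "j < 3"
  have "inj_on (side j) {0..1}"
  proof (rule inj_onI)
    fix t u :: real assume tu: "t \<in> {0..1}" "u \<in> {0..1}" "side j t = side j u"
    have m: "0 \<le> L j * t" "L j * t \<le> L j" "0 \<le> L j * u" "L j * u \<le> L j"
      using L_pos[OF j] tu mult_left_mono[of t 1 "L j"] mult_left_mono[of u 1 "L j"] by auto
    have "\<bar>L j * t - L j * u\<bar> = 0"
      using geod_d[OF geod[OF j] m] tu(3) d_refl[OF geod_S[OF geod[OF j] m(1,2)]] by (simp add: side_def)
    then show "t = u" using L_pos[OF j] by simp
  qed
  then show ?thesis using side_path[OF j] by (simp add: arc_def)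
qed

text \<open>\<open>sides_meet\<close> is about two paths issuing from a common vertex, so the first
  side is reversed.\<close>

lemma sides_inter: "j < 3 \<Longrightarrow> path_image (side j) \<inter> path_image (side (nxt j)) = {vert (nxt j)}"
proof -
  assume j: "j < 3"
  note n = nxt(1)[OF j] nxt(1)[OF nxt(1)[OF j]]
  have ne: "nxt j \<noteq> j" "nxt j \<noteq> nxt (nxt j)" "j \<noteq> nxt (nxt j)" using j unfolding less_3_cases by (auto simp: nxt_def)
  have "(\<lambda>t. \<gamma> j (L j - t)) ` {0..L j} \<inter> \<gamma> (nxt j) ` {0..L (nxt j)} = {vert (nxt j)}"
    using geod_reverse[OF geod[OF j]] geod n start finish ne j
    by (intro sides_meet[of "nxt j" j "nxt (nxt j)"]) auto
  moreover have "(\<lambda>t. \<gamma> j (L j - t)) ` {0..L j} = \<gamma> j ` {0..L j}"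
    using image_image[of "\<gamma> j" "\<lambda>t. L j - t" "{0..L j}"] by simp
  ultimately show ?thesis unfolding side_path_image[OF j] side_path_image[OF n(1)] by simp
qed

lemma curve_simple: "simple_path curve"
  unfolding curve_def
proof (rule simple_path_join_loop)
  have i: "path_image (side 0) \<inter> path_image (side 1) = {vert 1}" "path_image (side 1) \<inter> path_image (side 2) = {vert 2}"
    "path_image (side 2) \<inter> path_image (side 0) = {vert 0}"
    using sides_inter[of 0] sides_inter[of 1] sides_inter[of 2] by (simp_all add: nxt)
  show "arc (side 0)" "arc (side 1 +++ side 2)"
    using i side_ends by (auto intro!: side_arc arc_join simp: nxt)
  show "path_image (side 0) \<inter> path_image (side 1 +++ side 2) \<subseteq> {pathstart (side 0), pathstart (side 1 +++ side 2)}"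
    using i side_ends by (auto simp: path_image_join nxt)
qed (use side_ends in \<open>auto simp: nxt\<close>)

lemma curve_path: "path curve" and curve_loop: "pathfinish curve = pathstart curve" and curve_image: "path_image curve = bd"
  using side_ends side_path by (auto simp: curve_def bd_def path_image_join nxt)

lemma bd_S: "bd \<subseteq> S" using side_S by (auto simp: bd_def)

definition ccurve :: "real \<Rightarrow> complex" where "ccurve = proj \<circ> curve"
definition tcurve :: "real \<Rightarrow> complex" where
  "tcurve = linepath (- s *\<^sub>R dir 0) (- s *\<^sub>R dir 1) +++ linepath (- s *\<^sub>R dir 1) (- s *\<^sub>R dir 2) +++
     linepath (- s *\<^sub>R dir 2) (- s *\<^sub>R dir 0)"

lemma side_seg: "j < 3 \<Longrightarrow> 0 \<le> t \<Longrightarrow> t \<le> 1 \<Longrightarrow> dist (side j t) (seg j (nxt j) t) \<le> \<zeta>"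
  using side_near[of j "nxt j" "\<gamma> j" "L j" t] geod start finish nxt \<zeta>(1) \<sigma> by (simp add: side_def)

lemma proj_seg: "proj (seg j k t) = linepath (- s *\<^sub>R dir j) (- s *\<^sub>R dir k) t"
  by (simp add: seg_pt linepath_def algebra_simps)

text \<open>Both curves carry the same nested parametrization and are compared time by time. The
  index \<open>l\<close> is that of the vertex opposite to the current side; the equation keeps the
  model curve at distance at least s / 2 from the centre.\<close>

lemma ccurve_near: "t \<in> {0..1} \<Longrightarrow> norm (ccurve t - tcurve t) \<le> \<zeta>
    \<and> (\<exists>l. dir l \<bullet> tcurve t = s / 2) \<and> norm (tcurve t) \<le> s"
proof -
  assume t: "t \<in> {0..1}"
  have tc: "\<exists>j u. j < 3 \<and> 0 \<le> u \<and> u \<le> 1 \<and> curve t = side j u \<and> tcurve t = linepath (- s *\<^sub>R dir j) (- s *\<^sub>R dir (nxt j)) u"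
  proof -
    consider "t \<le> 1/2" | "1/2 < t" "t \<le> 3/4" | "3/4 < t" by linarith
    then show ?thesis
    proof cases
      case 1
      then show ?thesis using t by (intro exI[of _ "0::nat"] exI[of _ "2 * t"]) (simp add: curve_def tcurve_def joinpaths_def nxt)
    next
      case 2
      then show ?thesis using t
        by (intro exI[of _ "1::nat"] exI[of _ "2 * (2 * t - 1)"]) (simp add: curve_def tcurve_def joinpaths_def nxt)
    next
      case 3
      then show ?thesis using t
        by (intro exI[of _ "2::nat"] exI[of _ "2 * (2 * t - 1) - 1"]) (simp add: curve_def tcurve_def joinpaths_def nxt)
    qed
  qed
  then obtain j u where ju: "j < 3" "0 \<le> u" "u \<le> 1" "curve t = side j u"
    "tcurve t = linepath (- s *\<^sub>R dir j) (- s *\<^sub>R dir (nxt j)) u" by blast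
  have "norm (ccurve t - tcurve t) \<le> dist (curve t) (seg j (nxt j) u)"
    unfolding ju(5) proj_seg[symmetric] ccurve_def comp_def by (rule proj_dist_le)
  then have 1: "norm (ccurve t - tcurve t) \<le> \<zeta>" using side_seg[OF ju(1-3)] ju(4) by simp
  obtain l where l: "l < 3" "l \<noteq> j" "l \<noteq> nxt j" using other_index[OF ju(1) nxt(1)[OF ju(1)]] by blast
  have 2: "dir l \<bullet> tcurve t = s / 2"
    unfolding ju(5) linepath_def using l ju(1) nxt(1)[OF ju(1)]
    by (simp add: inner_add_right inner_diff_right inner_dir algebra_simps)
  have "norm (tcurve t) \<le> norm ((1 - u) *\<^sub>R (- s *\<^sub>R dir j)) + norm (u *\<^sub>R (- s *\<^sub>R dir (nxt j)))"
    unfolding ju(5) linepath_def by (rule norm_triangle_ineq)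
  also have "\<dots> = s" by (simp only: norm_scaleR norm_dir) (use ju s in \<open>simp add: algebra_simps\<close>)
  finally show ?thesis using 1 2 by blast
qed

lemma ccurve_path: "path ccurve" and ccurve_loop: "pathfinish ccurve = pathstart ccurve"
  and ccurve_image: "path_image ccurve = proj ` bd"
  using curve_path curve_loop curve_image continuous_proj
  by (auto simp: ccurve_def path_continuous_image pathfinish_compose pathstart_compose path_image_compose)

text \<open>The straight homotopy to the model triangle misses \<open>w\<close>: the curves differ
  by at most \<open>\<zeta>\<close>, less than the distance s / 4 between the triangle and the
  disc.\<close>

lemma winding_inside:
  assumes w: "norm w \<le> s / 4"
  shows "w \<notin> path_image ccurve" "winding_number ccurve w \<noteq> 0"
proof -
  have far: "s / 4 \<le> norm (tcurve t - w)" if tt: "t \<in> {0..1}" for t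
  proof -
    obtain l where l: "dir l \<bullet> tcurve t = s / 2" using ccurve_near[OF tt] by blast
    have "dir l \<bullet> (tcurve t - w) \<le> norm (tcurve t - w)" using inner_dir_bound[of l "tcurve t - w"] by simp
    moreover have "dir l \<bullet> w \<le> s / 4" using inner_dir_bound[of l w] w by simp
    ultimately show ?thesis using l by (simp add: inner_diff_right)
  qed
  have tp: "path tcurve" "pathfinish tcurve = pathstart tcurve" by (simp_all add: tcurve_def)
  have near: "norm (ccurve t - tcurve t) < norm (tcurve t - w)" if "t \<in> {0..1}" for t
    using far[OF that] ccurve_near[OF that] \<zeta>(2) s by linarith
  have "homotopic_loops (- {w}) tcurve ccurve"
    by (rule homotopic_loops_nearby_explicit[OF tp(1) ccurve_path tp(2) ccurve_loop]) (use near in auto)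
  then have eq: "winding_number tcurve w = winding_number ccurve w" by (rule winding_number_homotopic_loops)
  show "w \<notin> path_image ccurve"
  proof
    assume "w \<in> path_image ccurve"
    then obtain t where t: "t \<in> {0..1}" "w = ccurve t" by (auto simp: path_image_def)
    then show False using near[OF t(1)] by (simp add: norm_minus_commute)
  qed
  have "w \<in> ball 0 (s / 2)" using w s by simp
  then have "w \<in> interior (convex hull {- s *\<^sub>R dir 0, - s *\<^sub>R dir 1, - s *\<^sub>R dir 2})"
    using triangle_hull interior_maximal[OF _ open_ball] by blast
  from winding_number_triangle[OF this] have "winding_number tcurve w \<noteq> 0"
    unfolding tcurve_def by (auto split: if_splits)
  then show "winding_number ccurve w \<noteq> 0" using eq by simp
qed

lemma winding_outside: "3 / 2 * s < norm w \<Longrightarrow> winding_number ccurve w = 0"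
proof (rule winding_number_zero_outside[OF ccurve_path convex_cball ccurve_loop])
  show "path_image ccurve \<subseteq> cball 0 (3 / 2 * s)"
  proof
    fix z assume "z \<in> path_image ccurve"
    then obtain t where t: "t \<in> {0..1}" "z = ccurve t" by (auto simp: path_image_def)
    have "norm z \<le> norm (ccurve t - tcurve t) + norm (tcurve t)" unfolding t(2) using norm_triangle_sub by (metis add.commute)
    then show "z \<in> cball 0 (3 / 2 * s)" using ccurve_near[OF t(1)] \<zeta>(2) s by simp
  qed
qed simp

lemma bd_bounds: "y \<in> bd \<Longrightarrow> norm (proj y) \<le> 3 / 2 * s \<and> s / 4 < norm (proj y) \<and> - \<rho> < height y"
proof -
  assume y: "y \<in> bd"
  then have "\<exists>j<3. y \<in> path_image (side j)" unfolding bd_def less_3_cases by auto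
  then obtain j where j: "j < 3" "y \<in> path_image (side j)" by blast
  then obtain t where t: "0 \<le> t" "t \<le> 1" "y = side j t" by (auto simp: path_image_def)
  have "\<bar>height y - height (seg j (nxt j) t)\<bar> \<le> \<zeta>"
    using side_seg[OF j(1) t(1,2)] height_dist_le[of y "seg j (nxt j) t"] t(3) by simp
  moreover have "height (seg j (nxt j) t) = - \<kappa> * s / 2" by (simp add: seg_pt)
  moreover have "\<kappa> * s \<le> 1 * s" using \<kappa> s by (intro mult_right_mono) auto
  ultimately have 1: "- \<rho> < height y" using \<zeta>(2) s by linarith
  have "proj y \<in> path_image ccurve" unfolding ccurve_image using y by blast
  then obtain u where u: "u \<in> {0..1}" "proj y = ccurve u" by (auto simp: path_image_def)
  obtain l where l: "dir l \<bullet> tcurve u = s / 2" using ccurve_near[OF u(1)] by blast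
  have "s / 2 \<le> norm (tcurve u)" using inner_dir_bound[of l "tcurve u"] l by simp
  moreover have "\<bar>norm (ccurve u) - norm (tcurve u)\<bar> \<le> \<zeta>"
    using norm_triangle_ineq3[of "ccurve u" "tcurve u"] ccurve_near[OF u(1)] by linarith
  ultimately show ?thesis using 1 ccurve_near[OF u(1)] u(2) \<zeta>(2) s by auto
qed

text \<open>Any point higher than - 2 \<open>\<rho>\<close> would be near the roof by
  \<open>sheet\<close>, but over this disc the roof is above - 2 s, far above -
  \<open>\<rho>\<close>. So the heights have a gap.\<close>

lemma low_sheet:
  assumes "y \<in> S" "norm (proj y) \<le> 2 * s" "height y \<le> - \<rho>" shows "height y \<le> - 2 * \<rho>"
proof (rule ccontr)
  assume "\<not> ?thesis"
  then have "roof \<kappa> (proj y) - 8 * \<sigma> \<le> height y" using assms s by (intro sheet) auto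
  moreover have "- (2 * s) \<le> roof \<kappa> (proj y)" using abs_roof_le[OF \<kappa>, of "proj y"] assms(2) by linarith
  ultimately show False using assms(3) \<sigma>_small s \<sigma> by linarith
qed

text \<open>The winding number of the projected boundary curve, extended by zero to the far part of the surface, is
  locally constant off the boundary curve.\<close>
lemma component_bound:
  assumes C: "connected C" "C \<subseteq> S - bd" and x: "x \<in> C" "x \<in> core" and y: "y \<in> C"
  shows "norm (proj y) \<le> 3 / 2 * s \<and> - \<rho> < height y"
proof -
  define U where "U = {y. norm (proj y) < 2 * s \<and> - \<rho> < height y}"
  define f where "f y = (if y \<in> U then winding_number ccurve (proj y) else 0)" for y
  have openU: "open U"
    unfolding U_def Collect_conj_eq
    by (intro open_Int open_Collect_less continuous_intros continuous_proj continuous_height)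
  have "f x = f y"
  proof (rule connected_local_const[OF C(1) x(1) y])
    show "\<forall>a\<in>C. eventually (\<lambda>b. f a = f b) (at a within C)"
    proof
      fix a assume a: "a \<in> C"
      have aS: "a \<in> S" "a \<notin> bd" using a C(2) by auto
      \<comment> \<open>Three kinds of points. In \<open>U\<close> injectivity of the projection
        keeps the image off the curve, and the winding number is locally constant there; below
        \<open>U\<close> the gap in the heights gives a neighbourhood with value 0; far from the
        axis the winding number itself vanishes.\<close>
      have "\<exists>V. open V \<and> a \<in> V \<and> (\<forall>b\<in>V. f a = f b)"
      proof (cases "a \<in> U")
        case True
        have notin: "proj a \<notin> path_image ccurve"
        proof
          assume "proj a \<in> path_image ccurve"
          then obtain z where z: "z \<in> bd" "proj a = proj z" unfolding ccurve_image by blast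
          have "a = z" using z bd_S bd_bounds[OF z(1)] aS True s \<rho> by (intro proj_inj) (auto simp: U_def)
          then show False using z(1) aS by simp
        qed
        define k where "k = winding_number ccurve (proj a)"
        define Z where "Z = {z. z \<notin> path_image ccurve \<and> winding_number ccurve z = k}"
        have "open Z" unfolding Z_def by (rule open_winding_number_levelsets[OF ccurve_path ccurve_loop])
        then have "open (proj -` Z)" using continuous_proj[of UNIV] by (simp add: open_vimage)
        then have "open (U \<inter> proj -` Z)" using openU by blast
        moreover have "a \<in> U \<inter> proj -` Z" using True notin by (simp add: Z_def k_def)
        moreover have "\<forall>b\<in>U \<inter> proj -` Z. f a = f b" using True by (simp add: f_def Z_def k_def)
        ultimately show ?thesis by blast
      next
        case False
        show ?thesis
        proof (cases "norm (proj a) < 2 * s")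
          case True
          then have "height a \<le> - 2 * \<rho>" using False aS by (intro low_sheet) (auto simp: U_def)
          moreover have "open {y. height y < - \<rho>}" by (intro open_Collect_less continuous_intros continuous_height)
          ultimately show ?thesis using False \<rho>
            by (intro exI[of _ "{y. height y < - \<rho>}"]) (auto simp: f_def U_def)
        next
          case far: False
          have "open {y. 3 / 2 * s < norm (proj y)}" by (intro open_Collect_less continuous_intros continuous_proj)
          then show ?thesis using False far s winding_outside
            by (intro exI[of _ "{y. 3 / 2 * s < norm (proj y)}"]) (auto simp: f_def)
        qed
      qed
      then show "eventually (\<lambda>b. f a = f b) (at a within C)" unfolding eventually_at_topological by blast
    qed
  qed
  moreover have "f x \<noteq> 0"
  proof -
    have "x \<in> U" using x(2) s by (simp add: core_def U_def)
    moreover have "winding_number ccurve (proj x) \<noteq> 0" using x(2) by (intro winding_inside) (simp add: core_def)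
    ultimately show ?thesis by (simp add: f_def)
  qed
  ultimately have "f y \<noteq> 0" by simp
  then have "y \<in> U" "winding_number ccurve (proj y) \<noteq> 0" unfolding f_def by (auto split: if_splits)
  then show ?thesis using winding_outside[of "proj y"] by (force simp: U_def)
qed

section \<open>The cap containing the triangle and its parametrization by a plane\<close>

definition cap :: "(real^3) set" where "cap = {y \<in> S. norm (proj y) \<le> 3 / 2 * s \<and> - \<rho> \<le> height y}"

lemma cap_closed: "closed cap"
proof -
  have "cap = S \<inter> ({y. norm (proj y) \<le> 3 / 2 * s} \<inter> {y. - \<rho> \<le> height y})" by (auto simp: cap_def)
  moreover have "closed {y. norm (proj y) \<le> 3 / 2 * s}" "closed {y. - \<rho> \<le> height y}"
    by (intro closed_Collect_le continuous_intros continuous_proj continuous_height)+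
  ultimately show ?thesis by (metis closed_Int closed_S)
qed

lemma cap_height: "y \<in> cap \<Longrightarrow> - 3 * s \<le> height y" "y \<in> cap \<Longrightarrow> height y \<le> \<sigma>"
proof -
  assume y: "y \<in> cap"
  have "roof \<kappa> (proj y) - 8 * \<sigma> \<le> height y" using y s \<rho> by (intro sheet) (auto simp: cap_def)
  moreover have "- (3 / 2 * s) \<le> roof \<kappa> (proj y)"
    using abs_roof_le[OF \<kappa>, of "proj y"] y unfolding cap_def by auto
  ultimately show "- 3 * s \<le> height y" using \<sigma>_small s \<sigma> by linarith
  show "height y \<le> \<sigma>" using y S_subset_K by (intro height_le(2)) (auto simp: cap_def)
qed

text \<open>The outer normal at a cap point has vertical part at least 1/8, because the body
  contains the deep ball. Following it up to height \<open>s\<close> gives a point whose nearest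
  point is the given one. So a disc at that height is mapped over the cap without increasing
  distances, which controls both diameter and area.\<close>

lemma cap_foot: "y \<in> cap \<Longrightarrow> \<exists>w. norm w \<le> 34 * s \<and> closest_point K (pt w s) = y"
proof -
  assume y: "y \<in> cap"
  have yS: "y \<in> S" "norm (proj y) \<le> 3 / 2 * s" using y by (auto simp: cap_def)
  have yK: "y \<in> K" using yS(1) S_subset_K by blast
  obtain n where n: "norm n = 1" "\<And>z. z \<in> K \<Longrightarrow> n \<bullet> z \<le> n \<bullet> y" using S_support[OF yS(1)] by blast
  define q where "q = n \<bullet> \<nu>"
  \<comment> \<open>The support inequality at the point of the deep ball farthest in direction
    \<open>n\<close> gives \<open>\<rho>\<close> / 2 \<le> 9/2 s + 2 \<open>\<rho>\<close> q, and 40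
    s \<le> \<open>\<rho>\<close>.\<close>
  have "1 / 8 \<le> q"
  proof -
    have "pt 0 (- 2 * \<rho>) + (\<rho> / 2) *\<^sub>R n \<in> K" using n(1) \<rho> deep by (auto simp: dist_norm)
    from n(2)[OF this] have "\<rho> / 2 \<le> n \<bullet> (y - pt 0 (- 2 * \<rho>))"
      using n(1) by (simp add: inner_add_right inner_diff_right norm_eq_1)
    also have "y - pt 0 (- 2 * \<rho>) = (y - pt 0 0) + (2 * \<rho>) *\<^sub>R \<nu>" by (simp add: pt_def)
    also have "n \<bullet> \<dots> = n \<bullet> (y - pt 0 0) + 2 * \<rho> * q" by (simp add: inner_add_right q_def)
    also have "n \<bullet> (y - pt 0 0) \<le> norm n * norm (y - pt 0 0)" by (rule norm_cauchy_schwarz)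
    also have "norm (y - pt 0 0) \<le> norm (proj y) + \<bar>height y\<bar>"
    proof (rule power2_le_imp_le)
      have "(norm (y - pt 0 0))\<^sup>2 = (norm (proj y))\<^sup>2 + (height y)\<^sup>2" using dist_split[of y "pt 0 0"] by (simp add: dist_norm)
      also have "\<dots> \<le> (norm (proj y) + \<bar>height y\<bar>)\<^sup>2" by (simp add: power2_sum)
      finally show "(norm (y - pt 0 0))\<^sup>2 \<le> (norm (proj y) + \<bar>height y\<bar>)\<^sup>2" .
    qed simp
    also have "norm (proj y) + \<bar>height y\<bar> \<le> 9 / 2 * s" using yS(2) cap_height[OF y] \<sigma>_small s by linarith
    finally have "\<rho> / 2 \<le> 9 / 2 * s + 2 * \<rho> * q" using n(1) by simp
    then have "\<rho> * (1 / 8) \<le> \<rho> * q" using s by linarith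
    then show ?thesis using \<rho> by (rule mult_left_le_imp_le)
  qed
  then have q: "0 < q" "1 / 8 \<le> q" by simp_all
  define \<tau> where "\<tau> = (s - height y) / q"
  have top: "0 \<le> s - height y" "s - height y \<le> 4 * s" using cap_height[OF y] \<sigma>_small s \<sigma> by linarith+
  have \<tau>: "0 \<le> \<tau>" using top q by (simp add: \<tau>_def)
  have "\<tau> \<le> 4 * s / (1 / 8)" unfolding \<tau>_def using top q s by (intro frac_le) auto
  then have \<tau>32: "\<tau> \<le> 32 * s" by simp
  define p where "p = y + \<tau> *\<^sub>R n"
  have "height p = height y + \<tau> * q" by (simp add: p_def height_def inner_add_left inner_diff_left q_def)
  then have hp: "height p = s" using q by (simp add: \<tau>_def)
  have "norm (proj p - proj y) \<le> \<tau>" using proj_dist_le[of p y] n(1) \<tau> by (simp add: p_def dist_norm)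
  then have "norm (proj p) \<le> 34 * s" using norm_triangle_sub[of "proj p" "proj y"] yS(2) \<tau>32 s by linarith
  moreover have "closest_point K p = y"
  proof (rule closest_point_unique[symmetric, OF convex_K closed_K yK], intro ballI)
    fix z assume z: "z \<in> K"
    have "(norm (p - z))\<^sup>2 = (norm (p - y))\<^sup>2 + 2 * (\<tau> * (n \<bullet> (y - z))) + (norm (y - z))\<^sup>2"
    proof -
      have "(norm (p - z))\<^sup>2 = (norm ((p - y) + (y - z)))\<^sup>2" by simp
      also have "\<dots> = (norm (p - y))\<^sup>2 + 2 * ((p - y) \<bullet> (y - z)) + (norm (y - z))\<^sup>2"
        unfolding power2_norm_eq_inner inner_add_left inner_add_right inner_commute[of "y - z" "p - y"] by linarith
      finally have "(norm (p - z))\<^sup>2 = (norm (p - y))\<^sup>2 + 2 * ((p - y) \<bullet> (y - z)) + (norm (y - z))\<^sup>2" .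
      moreover have "p - y = \<tau> *\<^sub>R n" by (simp add: p_def)
      ultimately show ?thesis by simp
    qed
    moreover have "0 \<le> \<tau> * (n \<bullet> (y - z))" using \<tau> n(2)[OF z] by (simp add: inner_diff_right)
    ultimately have "(norm (p - y))\<^sup>2 \<le> (norm (p - z))\<^sup>2" using zero_le_power2[of "norm (y - z)"] by linarith
    then have "norm (p - y) \<le> norm (p - z)" by (rule power2_le_imp_le) simp
    then show "dist p y \<le> dist p z" by (simp add: dist_norm)
  qed
  moreover have "p = pt (proj p) s" using pt_proj[of p] hp by simp
  ultimately show ?thesis by (intro exI[of _ "proj p"]) auto
qed

lemma foot_S: "closest_point K (pt w s) \<in> S"
  using high_segment_W[of "pt w s" "pt w s"] \<sigma>_small s \<sigma> by (intro closest_point_frontier) auto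

lemma foot_d: "d (closest_point K (pt w s)) (closest_point K (pt z s)) \<le> norm (w - z)"
proof -
  have "pdist W (pt w s) (pt z s) \<le> ereal (dist (pt w s) (pt z s))"
    using \<sigma>_small s \<sigma> by (intro pdist_segment high_segment_W) auto
  from order_trans[OF pdist_closest_point this]
  have "ereal (d (closest_point K (pt w s)) (closest_point K (pt z s))) \<le> ereal (norm (w - z))"
    unfolding dist_same_height ereal_d[OF foot_S foot_S] .
  then show ?thesis by simp
qed

lemma cap_d: "y \<in> cap \<Longrightarrow> z \<in> cap \<Longrightarrow> d y z \<le> 68 * s"
proof -
  assume "y \<in> cap" "z \<in> cap"
  then obtain w w' where w: "norm w \<le> 34 * s" "closest_point K (pt w s) = y" "norm w' \<le> 34 * s" "closest_point K (pt w' s) = z"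
    using cap_foot by metis
  then show ?thesis using foot_d[of w w'] norm_triangle_ineq4[of w w'] by simp
qed

end

section \<open>Area of the Euclidean comparison triangle\<close>

lemma euclidean_triangle_exists:
  fixes l1 l2 l3 :: real
  assumes l: "0 < l1" "0 \<le> l2" "0 \<le> l3" and tri: "\<bar>l1\<^sup>2 + l3\<^sup>2 - l2\<^sup>2\<bar> \<le> 2 * l1 * l3"
  shows "\<exists>p q r :: real^2. dist p q = l1 \<and> dist q r = l2 \<and> dist r p = l3"
proof -
  define x where "x = (l1\<^sup>2 + l3\<^sup>2 - l2\<^sup>2) / (2 * l1)"
  have x: "2 * l1 * x = l1\<^sup>2 + l3\<^sup>2 - l2\<^sup>2" using l by (simp add: x_def)
  have "\<bar>x\<bar> = \<bar>l1\<^sup>2 + l3\<^sup>2 - l2\<^sup>2\<bar> / (2 * l1)" using l by (simp add: x_def abs_divide)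
  also have "\<dots> \<le> l3" using tri l by (simp add: pos_divide_le_eq mult.commute mult.left_commute)
  finally have "x\<^sup>2 \<le> l3\<^sup>2" using l by (simp add: abs_le_square_iff[symmetric])
  then have y: "(sqrt (l3\<^sup>2 - x\<^sup>2))\<^sup>2 = l3\<^sup>2 - x\<^sup>2" by simp
  define p q r :: "real^2" where "p = vector [0, 0]" and "q = vector [l1, 0]" and "r = vector [x, sqrt (l3\<^sup>2 - x\<^sup>2)]"
  have dist2: "dist a b = sqrt ((a $ 1 - b $ 1)\<^sup>2 + (a $ 2 - b $ 2)\<^sup>2)" for a b :: "real^2"
    by (simp add: dist_vec_def L2_set_def sum_2 dist_real_def)
  have "dist p q = l1" using l by (simp add: dist2 p_def q_def)
  moreover have "dist r p = l3" using l y by (simp add: dist2 p_def r_def)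
  moreover have "(l1 - x)\<^sup>2 + (sqrt (l3\<^sup>2 - x\<^sup>2))\<^sup>2 = l2\<^sup>2" unfolding y using x by (simp add: power2_diff)
  then have "dist q r = l2" using l by (simp add: dist2 q_def r_def)
  ultimately show ?thesis by blast
qed

text \<open>Existence makes the choice in \<open>eucl_tri_area\<close> meaningful, and Heron's
  formula gives the area of whichever triangle is chosen from its side lengths.\<close>

lemma eucl_tri_area_bounds:
  fixes l1 l2 l3 s :: real
  assumes s: "0 < s" and l: "17 / 10 * s \<le> l1" "17 / 10 * s \<le> l2" "17 / 10 * s \<le> l3"
    "l1 \<le> 174 / 100 * s" "l2 \<le> 174 / 100 * s" "l3 \<le> 174 / 100 * s"
  shows "s\<^sup>2 \<le> eucl_tri_area l1 l2 l3" "eucl_tri_area l1 l2 l3 \<le> 2 * s\<^sup>2"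
proof -
  have sq: "289 / 100 * s\<^sup>2 \<le> x\<^sup>2 \<and> x\<^sup>2 \<le> 304 / 100 * s\<^sup>2" if "17 / 10 * s \<le> x" "x \<le> 174 / 100 * s" for x
  proof -
    have "(17 / 10 * s)\<^sup>2 \<le> x\<^sup>2" "x\<^sup>2 \<le> (174 / 100 * s)\<^sup>2" using that s by (auto intro!: power_mono)
    then show ?thesis using zero_le_power2[of s] by (simp add: power_mult_distrib power2_eq_square)
  qed
  have "(17 / 10 * s) * (17 / 10 * s) \<le> l1 * l3" using l s by (intro mult_mono) auto
  then have "289 / 100 * s\<^sup>2 \<le> l1 * l3" by (simp add: power2_eq_square)
  then have "\<bar>l1\<^sup>2 + l3\<^sup>2 - l2\<^sup>2\<bar> \<le> 2 * (l1 * l3)"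
    using sq[OF l(1,4)] sq[OF l(2,5)] sq[OF l(3,6)] zero_le_power2[of s] by linarith
  then have "\<exists>p q r :: real^2. dist p q = l1 \<and> dist q r = l2 \<and> dist r p = l3"
    using l s by (intro euclidean_triangle_exists) auto
  then have "\<exists>A. \<exists>p q r :: real^2. dist p q = l1 \<and> dist q r = l2 \<and> dist r p = l3 \<and> A = measure lborel (convex hull {p, q, r})"
    by blast
  then have "\<exists>p q r :: real^2. dist p q = l1 \<and> dist q r = l2 \<and> dist r p = l3
      \<and> eucl_tri_area l1 l2 l3 = measure lborel (convex hull {p, q, r})"
    unfolding eucl_tri_area_def by (rule someI_ex)
  then obtain p q r :: "real^2" where pqr: "dist p q = l1" "dist q r = l2" "dist r p = l3"
    "eucl_tri_area l1 l2 l3 = measure lborel (convex hull {p, q, r})" by blast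
  define h where "h = (l2 + l3 + l1) / 2"
  then have h2: "2 * h = l2 + l3 + l1" by simp
  have "dist p r = l3" using pqr(3) by (simp add: dist_commute)
  then have area: "eucl_tri_area l1 l2 l3 = sqrt (h * (h - l2) * (h - l3) * (h - l1))"
    using heron[of p q r] pqr by (simp add: h_def)
  have side: "4 / 5 * s \<le> h - c \<and> 2 * s \<le> h"
    if "17 / 10 * s \<le> a" "17 / 10 * s \<le> b" "17 / 10 * s \<le> c" "c \<le> 174 / 100 * s" "2 * h = a + b + c" for a b c
  proof
    show "4 / 5 * s \<le> h - c" using that(1,2,4,5) s by linarith
    show "2 * s \<le> h" using that(1,2,3,5) s by linarith
  qed
  have lo: "2 * s \<le> h" "4 / 5 * s \<le> h - l2" "4 / 5 * s \<le> h - l3" "4 / 5 * s \<le> h - l1"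
    using side[of l1 l3 l2] side[of l1 l2 l3] side[of l2 l3 l1] l s h2 by auto
  have hi: "h \<le> 3 * s" "h - l2 \<le> s" "h - l3 \<le> s" "h - l1 \<le> s"
    using l s h2 by linarith+
  have "(2 * s) * (4 / 5 * s) * (4 / 5 * s) * (4 / 5 * s) \<le> h * (h - l2) * (h - l3) * (h - l1)"
    using lo s by (intro mult_mono mult_nonneg_nonneg) auto
  moreover have "(2 * s) * (4 / 5 * s) * (4 / 5 * s) * (4 / 5 * s) = 128 / 125 * (s\<^sup>2)\<^sup>2" by (simp add: power2_eq_square)
  moreover have "0 \<le> (s\<^sup>2)\<^sup>2" by simp
  ultimately have "(s\<^sup>2)\<^sup>2 \<le> h * (h - l2) * (h - l3) * (h - l1)" by linarith
  then show "s\<^sup>2 \<le> eucl_tri_area l1 l2 l3" unfolding area by (intro real_le_rsqrt)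
  have "h * (h - l2) * (h - l3) * (h - l1) \<le> (3 * s) * s * s * s"
    using lo hi s by (intro mult_mono mult_nonneg_nonneg) auto
  also have "(3 * s) * s * s * s = 3 * (s\<^sup>2)\<^sup>2" by (simp add: power2_eq_square)
  also have "3 * (s\<^sup>2)\<^sup>2 \<le> (2 * s\<^sup>2)\<^sup>2" by (simp add: power_mult_distrib)
  finally show "eucl_tri_area l1 l2 l3 \<le> 2 * s\<^sup>2" unfolding area by (intro real_le_lsqrt) auto
qed

section \<open>The geodesic triangle: excess, areas and curvature ratios\<close>

context near_tri_sides
begin

text \<open>Only the region depends on \<open>x\<close>: taking the component of \<open>x\<close>
  selects the right side of the common boundary curve.\<close>

definition tri :: "real^3 \<Rightarrow> gtri" where
  "tri x = \<lparr>va = vert 0, vb = vert 1, vc = vert 2, sab = side 0, sbc = side 1, sca = side 2,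
    reg = closure (connected_component_set (S - bd) x)\<rparr>"

lemma core_off_bd: "x \<in> core \<Longrightarrow> x \<in> S - bd"
  using bd_bounds[of x] by (auto simp: core_def)

lemma tri_sides: "sides (tri x) = bd"
  by (simp add: sides_def tri_def bd_def)

lemma tri_geo: "x \<in> core \<Longrightarrow> geo_triangle S (tri x)"
  unfolding geo_triangle_def tri_sides
  using side_shortest[of 0] side_shortest[of 1] side_shortest[of 2] curve_simple core_off_bd[of x]
  by (auto simp: tri_def nxt curve_def intro!: bexI[of _ "connected_component_set (S - bd) x"] componentsI)

lemma tri_reg: "x \<in> core \<Longrightarrow> reg (tri x) \<subseteq> cap"
proof -
  assume x: "x \<in> core"
  have "connected_component_set (S - bd) x \<subseteq> cap"
  proof
    fix y assume y: "y \<in> connected_component_set (S - bd) x"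
    have "norm (proj y) \<le> 3 / 2 * s \<and> - \<rho> < height y"
      using core_off_bd[OF x] y x
      by (intro component_bound[OF connected_connected_component[of "S - bd" x] connected_component_subset])
        (auto simp: connected_component_refl)
    moreover have "y \<in> S" using y connected_component_subset[of "S - bd" x] by blast
    ultimately show "y \<in> cap" by (simp add: cap_def)
  qed
  then show ?thesis unfolding tri_def by (simp add: closure_minimal cap_closed)
qed

lemma tri_mem: "x \<in> core \<Longrightarrow> x \<in> reg (tri x) - sides (tri x)"
proof -
  assume x: "x \<in> core"
  have "x \<in> connected_component_set (S - bd) x" using core_off_bd[OF x] by (simp add: connected_component_refl)
  then have "x \<in> closure (connected_component_set (S - bd) x)" by (rule subsetD[OF closure_subset])
  then show ?thesis using core_off_bd[OF x] unfolding tri_sides by (simp add: tri_def)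
qed

lemma tri_idiam: "x \<in> core \<Longrightarrow> idiam S (reg (tri x)) \<le> 68 * s"
proof -
  assume x: "x \<in> core"
  have "reg (tri x) \<noteq> {}" using tri_mem[OF x] by blast
  then show ?thesis unfolding idiam_def using tri_reg[OF x] cap_d by (intro cSUP_least) auto
qed

text \<open>Each angle is a path angle at a vertex after reversing one side. The predicate
  \<open>P\<close> lets the upper and the lower bounds share this bookkeeping.\<close>

lemma tri_angles:
  assumes "\<forall>j k l g1 g2. j < 3 \<longrightarrow> k < 3 \<longrightarrow> l < 3 \<longrightarrow> j \<noteq> k \<longrightarrow> j \<noteq> l \<longrightarrow> k \<noteq> l \<longrightarrow>
    shortest_path S g1 (vert j) (vert k) \<longrightarrow> shortest_path S g2 (vert j) (vert l) \<longrightarrow> P (path_angle S g1 g2)"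
  shows "P (ang_a S (tri x))" "P (ang_b S (tri x))" "P (ang_c S (tri x))"
proof -
  have f: "shortest_path S (side 0) (vert 0) (vert 1)" "shortest_path S (side 1) (vert 1) (vert 2)"
    "shortest_path S (side 2) (vert 2) (vert 0)"
    using side_shortest[of 0] side_shortest[of 1] side_shortest[of 2] by (simp_all add: nxt)
  note r = f[THEN shortest_path_reversepath] and P = assms[rule_format]
  show "P (ang_a S (tri x))" using P[OF _ _ _ _ _ _ f(1) r(3)] by (simp add: ang_a_def tri_def)
  show "P (ang_b S (tri x))" using P[OF _ _ _ _ _ _ r(1) f(2)] by (simp add: ang_b_def tri_def)
  show "P (ang_c S (tri x))" using P[OF _ _ _ _ _ _ r(2) f(3)] by (simp add: ang_c_def tri_def)
qed

lemma tri_Etri: "x \<in> core \<Longrightarrow> 68 * s < \<delta> \<Longrightarrow> a \<le> 1 / 2 \<Longrightarrow> tri x \<in> Etri S x \<delta> a"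
  using tri_geo[of x] tri_mem[of x] tri_idiam[of x] tri_angles[where P = "\<lambda>t. 1 / 2 \<le> t" and x = x] angle_ge_half
  by (fastforce simp: Etri_def)

lemma excess_flat:
  assumes "\<kappa> = 0" shows "excess S (tri x) \<le> 3 * arccos (1 / 2 - 36 * (\<sigma> / s)) - pi"
proof -
  define P where "P t \<longleftrightarrow> t \<le> arccos (1 / 2 - 36 * (\<sigma> / s))" for t
  have "\<forall>j k l g1 g2. j < 3 \<longrightarrow> k < 3 \<longrightarrow> l < 3 \<longrightarrow> j \<noteq> k \<longrightarrow> j \<noteq> l \<longrightarrow> k \<noteq> l \<longrightarrow>
    shortest_path S g1 (vert j) (vert k) \<longrightarrow> shortest_path S g2 (vert j) (vert l) \<longrightarrow> P (path_angle S g1 g2)"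
    unfolding P_def using flat_angle_le assms by blast
  from tri_angles[of P x, OF this] show ?thesis unfolding excess_def P_def by linarith
qed

lemma excess_tip: "3 * arccos (1 - 2 * (sharp - 20 * (\<zeta> / s))\<^sup>2) - pi \<le> excess S (tri x)"
proof -
  define P where "P t \<longleftrightarrow> arccos (1 - 2 * (sharp - 20 * (\<zeta> / s))\<^sup>2) \<le> t" for t
  have "\<forall>j k l g1 g2. j < 3 \<longrightarrow> k < 3 \<longrightarrow> l < 3 \<longrightarrow> j \<noteq> k \<longrightarrow> j \<noteq> l \<longrightarrow> k \<noteq> l \<longrightarrow>
    shortest_path S g1 (vert j) (vert k) \<longrightarrow> shortest_path S g2 (vert j) (vert l) \<longrightarrow> P (path_angle S g1 g2)"
    unfolding P_def using tip_angle_ge by blast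
  from tri_angles[of P x, OF this] show ?thesis unfolding excess_def P_def by linarith
qed

lemma sigma0_bounds: "s\<^sup>2 \<le> sigma0 S (tri x)" "sigma0 S (tri x) \<le> 2 * s\<^sup>2"
proof -
  have b: "17 / 10 * s \<le> d (vert j) (vert k)" "d (vert j) (vert k) \<le> 174 / 100 * s" if "j < 3" "k < 3" "j \<noteq> k" for j k
  proof -
    show "17 / 10 * s \<le> d (vert j) (vert k)" using d_vert_ge[OF that] side_lower by linarith
    have "sqrt 3 * s \<le> 174 / 100 * s" using sqrt3_bounds s by (intro mult_right_mono) auto
    then show "d (vert j) (vert k) \<le> 174 / 100 * s" using d_vert_le[OF that] by linarith
  qed
  show "s\<^sup>2 \<le> sigma0 S (tri x)" "sigma0 S (tri x) \<le> 2 * s\<^sup>2"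
    unfolding sigma0_def tri_def gtri.simps using b s(1) by (intro eucl_tri_area_bounds; simp)+
qed

text \<open>The covering sets are images of grid squares at height \<open>s\<close> under the
  nonexpanding foot map, so a square of side \<open>h\<close> yields diameter at most 2 h.\<close>

lemma mu_upper:
  assumes x: "x \<in> core" shows "mu S (tri x) \<le> ennreal (80000 * s\<^sup>2)"
  unfolding mu_def hausdorff2_def
proof (rule SUP_least)
  fix \<delta> :: real assume "\<delta> \<in> {0<..}"
  then have \<delta>: "0 < \<delta>" by simp
  obtain N :: nat where N: "136 * s / \<delta> < real N" using reals_Archimedean2 by blast
  have Npos: "0 < real N" using N \<delta> s by (smt (verit) divide_nonneg_pos)
  define h where "h = 68 * s / real N"
  have h: "0 < h" "real N * h = 68 * s" using Npos s by (auto simp: h_def)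
  have "136 * s < \<delta> * real N" using N \<delta> by (simp add: pos_divide_less_eq mult.commute)
  then have h\<delta>: "2 * h \<le> \<delta>" using Npos by (simp add: h_def pos_divide_le_eq)
  \<comment> \<open>One square more per row than \<open>N\<close>, so that the right end of the
    interval lies in a square as well.\<close>
  define m where "m = Suc N"
  define Q where "Q i j = {w. h * real i \<le> Re w + 34 * s \<and> Re w + 34 * s \<le> h * real i + h \<and>
    h * real j \<le> Im w + 34 * s \<and> Im w + 34 * s \<le> h * real j + h}" for i j :: nat
  define U where "U n = (if n < m * m then (\<lambda>w. closest_point K (pt w s)) ` Q (n div m) (n mod m) else {})" for n
  have diam: "ddiam d (U n) \<le> ennreal (2 * h)" for n
    unfolding ddiam_def
  proof (intro SUP_least ennreal_leI)
    fix p q assume "p \<in> U n" "q \<in> U n"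
    then obtain w z i j where wz: "w \<in> Q i j" "z \<in> Q i j" "p = closest_point K (pt w s)" "q = closest_point K (pt z s)"
      unfolding U_def by (auto split: if_splits)
    have "norm (w - z) \<le> \<bar>Re (w - z)\<bar> + \<bar>Im (w - z)\<bar>" by (rule cmod_le)
    moreover have "\<bar>Re (w - z)\<bar> \<le> h" "\<bar>Im (w - z)\<bar> \<le> h" using wz(1,2) by (auto simp: Q_def abs_le_iff)
    ultimately show "d p q \<le> 2 * h" unfolding wz using foot_d[of w z] by linarith
  qed
  have sub: "U n \<subseteq> S" for n using foot_S by (auto simp: U_def)
  have cover: "reg (tri x) \<subseteq> (\<Union>n. U n)"
  proof
    fix y assume "y \<in> reg (tri x)"
    then obtain w where w: "norm w \<le> 34 * s" "closest_point K (pt w s) = y" using tri_reg[OF x] cap_foot by blast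
    have idx: "\<exists>i<m. h * real i \<le> u + 34 * s \<and> u + 34 * s \<le> h * real i + h" if "\<bar>u\<bar> \<le> 34 * s" for u
    proof -
      have u: "0 \<le> (u + 34 * s) / h" using that h by simp
      define i where "i = nat \<lfloor>(u + 34 * s) / h\<rfloor>"
      have i: "real i \<le> (u + 34 * s) / h" "(u + 34 * s) / h < real i + 1"
        using u unfolding i_def by (simp_all add: of_nat_nat)
      then have b: "h * real i \<le> u + 34 * s" "u + 34 * s \<le> h * real i + h"
        using h by (simp_all add: pos_le_divide_eq pos_divide_less_eq algebra_simps)
      have "h * real i \<le> h * real N" using b(1) that h(2) by (simp add: mult.commute)
      then have "i < m" using h(1) by (simp add: m_def)
      then show ?thesis using b by blast
    qed
    obtain i where i: "i < m" "h * real i \<le> Re w + 34 * s \<and> Re w + 34 * s \<le> h * real i + h"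
      using idx[of "Re w"] abs_Re_le_cmod[of w] w(1) by auto
    obtain j where j: "j < m" "h * real j \<le> Im w + 34 * s \<and> Im w + 34 * s \<le> h * real j + h"
      using idx[of "Im w"] abs_Im_le_cmod[of w] w(1) by auto
    define n where "n = j + i * m"
    have "n div m = i" "n mod m = j" using j(1) by (simp_all add: n_def)
    moreover have "n < m * m"
    proof -
      have "n < m + i * m" using j(1) by (simp add: n_def)
      also have "\<dots> = Suc i * m" by simp
      also have "\<dots> \<le> m * m" using i(1) by (intro mult_le_mono1) simp
      finally show ?thesis .
    qed
    moreover have "w \<in> Q i j" using i j by (simp add: Q_def)
    ultimately have "y \<in> U n" using w(2) by (auto simp: U_def)
    then show "y \<in> (\<Union>n. U n)" by blast
  qed
  have "ennreal (pi / 4) * ddiam d (U n) ^ 2 = 0" if "n \<notin> {..<m * m}" for n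
    using that by (simp add: U_def ddiam_def bot_ennreal)
  then have "(\<Sum>n. ennreal (pi / 4) * ddiam d (U n) ^ 2) = (\<Sum>n<m * m. ennreal (pi / 4) * ddiam d (U n) ^ 2)"
    by (intro suminf_finite) auto
  also have "\<dots> \<le> of_nat (card {..<m * m}) * (ennreal (pi / 4) * ennreal (2 * h) ^ 2)"
    by (intro sum_bounded_above mult_left_mono power_mono diam) auto
  also have "\<dots> = ennreal (real (m * m) * (pi / 4 * (2 * h) ^ 2))"
  proof -
    have "ennreal (real (m * m) * (pi / 4 * (2 * h) ^ 2)) = ennreal (real (m * m)) * ennreal (pi / 4 * (2 * h) ^ 2)"
      by (rule ennreal_mult) auto
    also have "ennreal (pi / 4 * (2 * h) ^ 2) = ennreal (pi / 4) * ennreal ((2 * h) ^ 2)" by (rule ennreal_mult) auto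
    also have "ennreal ((2 * h) ^ 2) = ennreal (2 * h) ^ 2" using h by (intro ennreal_power[symmetric]) simp
    finally show ?thesis by (simp only: card_lessThan ennreal_of_nat_eq_real_of_nat)
  qed
  also have "\<dots> \<le> ennreal (80000 * s\<^sup>2)"
  proof (rule ennreal_leI)
    \<comment> \<open>N + 1 \<le> 2 N doubles the total width 68 s; with pi \<le> 4 the sum is at
      most 4 * 136^2 s^2.\<close>
    have "real m * h \<le> 136 * s" using h Npos mult_right_mono[of 1 "real N" h] by (simp add: m_def algebra_simps)
    then have "(real m * h)\<^sup>2 \<le> (136 * s)\<^sup>2" using h by (intro power_mono) auto
    then have "pi * (real m * h)\<^sup>2 \<le> 4 * (136 * s)\<^sup>2" using pi_less_4 by (intro mult_mono) auto
    moreover have "real (m * m) * (pi / 4 * (2 * h) ^ 2) = pi * (real m * h)\<^sup>2" by (simp add: power2_eq_square)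
    moreover have "4 * (136 * s)\<^sup>2 = 73984 * s\<^sup>2" by (simp add: power_mult_distrib)
    ultimately show "real (m * m) * (pi / 4 * (2 * h) ^ 2) \<le> 80000 * s\<^sup>2" using zero_le_power2[of s] by linarith
  qed
  finally have bound: "(\<Sum>n. ennreal (pi / 4) * ddiam d (U n) ^ 2) \<le> ennreal (80000 * s\<^sup>2)" .
  have small: "ddiam d (U n) \<le> ennreal \<delta>" for n using diam[of n] ennreal_leI[OF h\<delta>] by (rule order_trans)
  show "(INF U\<in>{U :: nat \<Rightarrow> _. (\<forall>n. U n \<subseteq> S \<and> ddiam d (U n) \<le> ennreal \<delta>) \<and> reg (tri x) \<subseteq> (\<Union>n. U n)}.
      \<Sum>n. ennreal (pi / 4) * ddiam d (U n) ^ 2) \<le> ennreal (80000 * s\<^sup>2)"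
    by (rule INF_lower2[where i = U]) (use sub cover bound small in auto)
qed

text \<open>Over the closed disc the projection is a homeomorphism from a compact piece of the upper
  sheet. This piece is therefore connected; it avoids the sides and contains \<open>x\<close>, so it
  belongs to the region.\<close>

lemma disc_in_reg:
  assumes x: "x \<in> core" shows "cball 0 (s / 4) \<subseteq> proj ` reg (tri x)"
proof -
  define U where "U = {y \<in> S. norm (proj y) \<le> s / 4 \<and> - \<rho> \<le> height y}"
  have "U = S \<inter> ({y. norm (proj y) \<le> s / 4} \<inter> {y. - \<rho> \<le> height y})" by (auto simp: U_def)
  moreover have "closed ({y. norm (proj y) \<le> s / 4} \<inter> {y. - \<rho> \<le> height y})"
    by (intro closed_Int closed_Collect_le continuous_intros continuous_proj continuous_height)
  ultimately have "compact U" using compact_S by (metis compact_Int_closed)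
  have inj: "inj_on proj U"
    using s \<rho> by (intro inj_onI proj_inj) (auto simp: U_def)
  have img: "cball 0 (s / 4) \<subseteq> proj ` U"
  proof
    fix w :: complex assume w: "w \<in> cball 0 (s / 4)"
    then have "norm w \<le> \<rho> / 8" using s by simp
    then obtain y where y: "y \<in> S" "proj y = w" "- 2 * \<rho> < height y" using sheet_exists by blast
    have "- \<rho> < height y" using low_sheet[OF y(1)] y w s by (cases "height y \<le> - \<rho>") auto
    then show "w \<in> proj ` U" using y w by (auto simp: U_def)
  qed
  moreover have "proj ` U \<subseteq> cball 0 (s / 4)" by (auto simp: U_def)
  ultimately have im: "proj ` U = cball 0 (s / 4)" by blast
  have "continuous_on (proj ` U) (the_inv_into U proj)"
    using \<open>compact U\<close> inj by (intro continuous_on_inv continuous_proj) (auto simp: the_inv_into_f_f)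
  then have "connected (the_inv_into U proj ` (proj ` U))"
    unfolding im by (rule connected_continuous_image) (rule convex_connected[OF convex_cball])
  moreover have "the_inv_into U proj ` (proj ` U) = U" using inj by (force simp: image_image the_inv_into_f_f)
  ultimately have "connected U" by simp
  moreover have "U \<subseteq> S - bd" using bd_bounds by (force simp: U_def)
  moreover have "x \<in> U" using x by (auto simp: core_def U_def)
  ultimately have "U \<subseteq> connected_component_set (S - bd) x" by (intro connected_component_maximal)
  then have "U \<subseteq> reg (tri x)" unfolding tri_def using closure_subset by fastforce
  then show ?thesis using img by blast
qed

text \<open>The orthogonal projection does not increase intrinsic distances, so a covering of the triangle induces a covering
  of a planar square by squares.\<close>
lemma mu_lower:
  assumes x: "x \<in> core" shows "ennreal (s\<^sup>2 / 256) \<le> mu S (tri x)"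
proof -
  define J where "J = cbox (Complex (- s / 8) (- s / 8)) (Complex (s / 8) (s / 8))"
  have emJ: "emeasure lborel (cbox (Complex (a - r) (b - r)) (Complex (a + r) (b + r))) = ennreal (4 * r\<^sup>2)"
    if "0 \<le> r" for a b r
    using that by (subst emeasure_lborel_cbox) (auto simp: Basis_complex_def power2_eq_square)
  have J: "emeasure lborel J = ennreal (s\<^sup>2 / 16)"
    using emJ[of "s / 8" 0 0] s by (simp add: J_def power2_eq_square)
  have "J \<subseteq> cball 0 (s / 4)"
  proof
    fix w assume "w \<in> J"
    then have "\<bar>Re w\<bar> \<le> s / 8" "\<bar>Im w\<bar> \<le> s / 8" by (auto simp: J_def in_cbox_complex_iff)
    then show "w \<in> cball 0 (s / 4)" using cmod_le[of w] by simp
  qed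
  then have JU: "J \<subseteq> proj ` reg (tri x)" using disc_in_reg[OF x] by blast
  \<comment> \<open>The single scale 1 is enough, since the measure is a supremum over scales, and
    it makes all diameters finite. A set of diameter \<open>r\<close> projects into a square of area
    4 r^2, which accounts for pi / 16 against the weight pi / 4.\<close>
  have "ennreal (s\<^sup>2 / 256) \<le> (\<Sum>n. ennreal (pi / 4) * ddiam d (U n) ^ 2)"
    if U: "\<And>n. U n \<subseteq> S" "\<And>n. ddiam d (U n) \<le> ennreal 1" "reg (tri x) \<subseteq> (\<Union>n. U n)" for U :: "nat \<Rightarrow> (real^3) set"
  proof -
    have "\<forall>n. \<exists>B. B \<in> sets lborel \<and> proj ` U n \<subseteq> B \<and> emeasure lborel B \<le> 4 * ddiam d (U n) ^ 2"
    proof (rule allI)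
     fix n show "\<exists>B. B \<in> sets lborel \<and> proj ` U n \<subseteq> B \<and> emeasure lborel B \<le> 4 * ddiam d (U n) ^ 2"
     proof (cases "U n = {}")
      case True
      then show ?thesis by (intro exI[of _ "{}"]) auto
    next
      case False
      then obtain y where y: "y \<in> U n" by blast
      define r where "r = enn2real (ddiam d (U n))"
      have r: "ddiam d (U n) = ennreal r" "0 \<le> r"
        using U(2)[of n] by (auto simp: r_def intro!: ennreal_enn2real[symmetric] intro: order_le_less_trans)
      define a b where "a = Re (proj y)" and "b = Im (proj y)"
      have "proj ` U n \<subseteq> cbox (Complex (a - r) (b - r)) (Complex (a + r) (b + r))"
      proof
        fix w assume "w \<in> proj ` U n"
        then obtain z where z: "z \<in> U n" "w = proj z" by blast
        have "ennreal (d z y) \<le> ddiam d (U n)" unfolding ddiam_def using z(1) y by (meson SUP_upper SUP_upper2)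
        then have "d z y \<le> r" using r by (simp add: ennreal_le_iff)
        then have "norm (w - proj y) \<le> r"
          using proj_dist_le[of z y] d_ge_dist[of z y] z y U(1)[of n] by (auto intro: order_trans)
        then have "\<bar>Re w - a\<bar> \<le> r" "\<bar>Im w - b\<bar> \<le> r"
          using abs_Re_le_cmod[of "w - proj y"] abs_Im_le_cmod[of "w - proj y"] by (auto simp: a_def b_def)
        then show "w \<in> cbox (Complex (a - r) (b - r)) (Complex (a + r) (b + r))"
          by (auto simp: in_cbox_complex_iff abs_le_iff)
      qed
      moreover have "4 * ddiam d (U n) ^ 2 = ennreal (4 * r\<^sup>2)"
        unfolding r(1) using r(2) by (simp add: ennreal_power ennreal_mult)
      ultimately show ?thesis using emJ[OF r(2), of a b]
        by (intro exI[of _ "cbox (Complex (a - r) (b - r)) (Complex (a + r) (b + r))"]) auto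
     qed
    qed
    from choice[OF this] obtain B where B0: "\<forall>n. B n \<in> sets lborel \<and> proj ` U n \<subseteq> B n
      \<and> emeasure lborel (B n) \<le> 4 * ddiam d (U n) ^ 2" ..
    then have B: "B n \<in> sets lborel" "proj ` U n \<subseteq> B n" "emeasure lborel (B n) \<le> 4 * ddiam d (U n) ^ 2" for n
      by simp_all
    have "J \<subseteq> (\<Union>n. B n)"
    proof
      fix w assume "w \<in> J"
      then obtain y where y: "y \<in> reg (tri x)" "w = proj y" using JU by blast
      then obtain n where "y \<in> U n" using U(3) by blast
      then show "w \<in> (\<Union>n. B n)" using B(2)[of n] y(2) by blast
    qed
    then have "emeasure lborel J \<le> emeasure lborel (\<Union>n. B n)" using B(1) by (intro emeasure_mono) auto
    also have "\<dots> \<le> (\<Sum>n. emeasure lborel (B n))" using B(1) by (intro emeasure_subadditive_countably) auto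
    also have "\<dots> \<le> (\<Sum>n. 4 * ddiam d (U n) ^ 2)" using B(3) by (intro suminf_le) auto
    finally have "ennreal (s\<^sup>2 / 16) \<le> (\<Sum>n. 4 * ddiam d (U n) ^ 2)" unfolding J .
    then have "ennreal (pi / 16) * ennreal (s\<^sup>2 / 16) \<le> ennreal (pi / 16) * (\<Sum>n. 4 * ddiam d (U n) ^ 2)"
      by (rule mult_left_mono) simp
    also have "\<dots> = (\<Sum>n. ennreal (pi / 16) * (4 * ddiam d (U n) ^ 2))" by simp
    also have "\<dots> = (\<Sum>n. ennreal (pi / 4) * ddiam d (U n) ^ 2)"
    proof -
      have "ennreal (pi / 16) * 4 = ennreal (pi / 4)"
      proof -
        have "ennreal (pi / 16) * 4 = ennreal (pi / 16) * ennreal 4" by simp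
        also have "\<dots> = ennreal (pi / 16 * 4)" by (rule ennreal_mult[symmetric]) auto
        also have "\<dots> = ennreal (pi / 4)" by simp
        finally show ?thesis .
      qed
      then show ?thesis by (simp only: mult.assoc[symmetric])
    qed
    finally have "ennreal (pi / 16) * ennreal (s\<^sup>2 / 16) \<le> (\<Sum>n. ennreal (pi / 4) * ddiam d (U n) ^ 2)" .
    moreover have "ennreal (pi / 16 * (s\<^sup>2 / 16)) = ennreal (pi / 16) * ennreal (s\<^sup>2 / 16)" by (rule ennreal_mult) auto
    moreover have "s\<^sup>2 / 256 \<le> pi / 16 * (s\<^sup>2 / 16)" using pi_ge_two mult_right_mono[of 1 pi "s\<^sup>2"] by simp
    then have "ennreal (s\<^sup>2 / 256) \<le> ennreal (pi / 16 * (s\<^sup>2 / 16))" by (rule ennreal_leI)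
    ultimately show ?thesis by order
  qed
  then have "ennreal (s\<^sup>2 / 256) \<le> (INF U\<in>{U :: nat \<Rightarrow> _. (\<forall>n. U n \<subseteq> S \<and> ddiam d (U n) \<le> ennreal 1)
      \<and> reg (tri x) \<subseteq> (\<Union>n. U n)}. \<Sum>n. ennreal (pi / 4) * ddiam d (U n) ^ 2)"
    by (intro INF_greatest) auto
  also have "\<dots> \<le> mu S (tri x)" unfolding mu_def hausdorff2_def by (intro SUP_upper) auto
  finally show ?thesis .
qed

text \<open>Both denominators are comparable with s^2, so one estimate of the excess decides both
  ratios.\<close>

lemma ratio_real:
  assumes x: "x \<in> core"
  shows "\<exists>a b. 0 < a \<and> 0 < b \<and> s\<^sup>2 / 256 \<le> a \<and> a \<le> 80000 * s\<^sup>2 \<and> s\<^sup>2 / 256 \<le> b \<and> b \<le> 80000 * s\<^sup>2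
    \<and> ratioK S (tri x) = ereal (excess S (tri x) / a) \<and> ratioG S (tri x) = ereal (excess S (tri x) / b)"
proof -
  have s2: "0 < s\<^sup>2" using s by simp
  define b where "b = enn2real (mu S (tri x))"
  have b: "mu S (tri x) = ennreal b"
    using mu_upper[OF x] unfolding b_def
    by (intro ennreal_enn2real[symmetric]) (auto intro: order_le_less_trans)
  have b0: "0 \<le> b" by (simp add: b_def)
  have bb: "s\<^sup>2 / 256 \<le> b" "b \<le> 80000 * s\<^sup>2"
    using mu_lower[OF x] mu_upper[OF x] b0 s2 unfolding b by (simp_all add: ennreal_le_iff)
  then have bpos: "0 < b" using s2 by linarith
  have "ratioG S (tri x) = ereal (excess S (tri x) / b)"
    unfolding ratioG_def b using bpos by (simp add: enn2ereal_ennreal)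
  moreover have "s\<^sup>2 / 256 \<le> sigma0 S (tri x)" "sigma0 S (tri x) \<le> 80000 * s\<^sup>2" "0 < sigma0 S (tri x)"
    using sigma0_bounds[of x] s2 by linarith+
  then have "ratioK S (tri x) = ereal (excess S (tri x) / sigma0 S (tri x))"
    unfolding ratioK_def by simp
  ultimately show ?thesis
    using bb bpos \<open>s\<^sup>2 / 256 \<le> sigma0 S (tri x)\<close> \<open>sigma0 S (tri x) \<le> 80000 * s\<^sup>2\<close> \<open>0 < sigma0 S (tri x)\<close> by blast
qed

lemma ratio_flat:
  assumes x: "x \<in> core" and flat: "\<kappa> = 0" and e: "256 * (3 * arccos (1 / 2 - 36 * (\<sigma> / s)) - pi) < e * s\<^sup>2"
  shows "ratioK S (tri x) < ereal e" "ratioG S (tri x) < ereal e"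
proof -
  have s2: "0 < s\<^sup>2" using s by simp
  have ex: "0 \<le> excess S (tri x)" "256 * excess S (tri x) < e * s\<^sup>2"
    using excess_nonneg[OF tri_geo[OF x]] order_le_less_trans[OF mult_left_mono[OF excess_flat[OF flat, of x], of 256] e]
    by simp_all
  have "0 < e * s\<^sup>2" using ex by linarith
  then have "0 < e" using s2 by (simp add: zero_less_mult_iff)
  then have "excess S (tri x) / a < e" if "0 < a" "s\<^sup>2 / 256 \<le> a" for a
  proof -
    have "e * (s\<^sup>2 / 256) \<le> e * a" using that \<open>0 < e\<close> by (intro mult_left_mono) auto
    then have "excess S (tri x) < e * a" using ex by simp
    then show ?thesis using that(1) by (simp add: pos_divide_less_eq)
  qed
  then show "ratioK S (tri x) < ereal e" "ratioG S (tri x) < ereal e" using ratio_real[OF x] by auto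
qed

lemma ratio_tip:
  assumes x: "x \<in> core" and e: "0 \<le> e" "e * (80000 * s\<^sup>2) < 3 * arccos (1 - 2 * (sharp - 20 * (\<zeta> / s))\<^sup>2) - pi"
  shows "ereal e < ratioK S (tri x)" "ereal e < ratioG S (tri x)"
proof -
  have ex: "e * (80000 * s\<^sup>2) < excess S (tri x)" using excess_tip[of x] e by linarith
  then have "e < excess S (tri x) / a" if "0 < a" "a \<le> 80000 * s\<^sup>2" for a
    using that e(1) mult_left_mono[of a "80000 * s\<^sup>2" e] by (simp add: pos_less_divide_eq)
  then show "ereal e < ratioK S (tri x)" "ereal e < ratioG S (tri x)" using ratio_real[OF x] by auto
qed

end

section \<open>Triangles around every point of the core\<close>

context near_tri
begin

lemma sides_exist: "\<exists>\<gamma> L. near_tri_sides K v e1 e2 \<nu> \<kappa> \<rho> \<sigma> s \<zeta> \<gamma> L"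
proof -
  have "\<exists>g. geod g (d (vert j) (vert (nxt j))) \<and> g 0 = vert j \<and> g (d (vert j) (vert (nxt j))) = vert (nxt j)" for j
    by (intro geodesic_exists vert_S)
  then obtain \<gamma> :: "nat \<Rightarrow> real \<Rightarrow> real^3" where
    "\<forall>j. geod (\<gamma> j) (d (vert j) (vert (nxt j))) \<and> \<gamma> j 0 = vert j \<and> \<gamma> j (d (vert j) (vert (nxt j))) = vert (nxt j)"
    by metis
  then have "near_tri_sides K v e1 e2 \<nu> \<kappa> \<rho> \<sigma> s \<zeta> \<gamma> (\<lambda>j. d (vert j) (vert (nxt j)))"
    by unfold_locales auto
  then show ?thesis by blast
qed

lemma core_flat:
  assumes "x \<in> core" "\<kappa> = 0" "256 * (3 * arccos (1 / 2 - 36 * (\<sigma> / s)) - pi) < e * s\<^sup>2" "68 * s < \<delta>" "a \<le> 1 / 2"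
  shows "\<exists>T\<in>Etri S x \<delta> a. ratioK S T < ereal e \<and> ratioG S T < ereal e"
proof -
  obtain \<gamma> L where "near_tri_sides K v e1 e2 \<nu> \<kappa> \<rho> \<sigma> s \<zeta> \<gamma> L" using sides_exist by blast
  then interpret near_tri_sides K v e1 e2 \<nu> \<kappa> \<rho> \<sigma> s \<zeta> \<gamma> L .
  show ?thesis using assms(1) ratio_flat[of x e] tri_Etri[of x \<delta> a] assms(2-5) by blast
qed

lemma core_tip:
  assumes "x \<in> core" "0 \<le> e" "e * (80000 * s\<^sup>2) < 3 * arccos (1 - 2 * (sharp - 20 * (\<zeta> / s))\<^sup>2) - pi" "68 * s < \<delta>" "a \<le> 1 / 2"
  shows "\<exists>T\<in>Etri S x \<delta> a. ereal e < ratioK S T \<and> ereal e < ratioG S T"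
proof -
  obtain \<gamma> L where "near_tri_sides K v e1 e2 \<nu> \<kappa> \<rho> \<sigma> s \<zeta> \<gamma> L" using sides_exist by blast
  then interpret near_tri_sides K v e1 e2 \<nu> \<kappa> \<rho> \<sigma> s \<zeta> \<gamma> L .
  show ?thesis using assms(1) ratio_tip[of x e] tri_Etri[of x \<delta> a] assms(2-5) by blast
qed

end

section \<open>The hyperspace of convex surfaces\<close>

text \<open>The suprema are taken over bounded sets and distances to compact sets are attained, so a
  bound on \<open>hausdist\<close> provides actual nearby points.\<close>

lemma hausdist_less:
  assumes A: "compact A" "A \<noteq> {}" and B: "compact B" "B \<noteq> {}" and h: "hausdist A B < e"
  shows "\<forall>a\<in>A. \<exists>b\<in>B. dist a b < e" "\<forall>b\<in>B. \<exists>a\<in>A. dist b a < e"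
proof -
  have *: "\<exists>y\<in>Y. dist x y < e" if X: "compact X" "x \<in> X" and Y: "compact Y" "Y \<noteq> {}" and h: "(SUP x\<in>X. setdist {x} Y) < e" for X Y :: "(real^3) set" and x
  proof -
    obtain y0 where y0: "y0 \<in> Y" using Y(2) by blast
    obtain D where D: "\<And>x. x \<in> X \<Longrightarrow> dist y0 x \<le> D" using compact_imp_bounded[OF X(1)] by (auto simp: bounded_any_center[of X y0])
    have "bdd_above ((\<lambda>x. setdist {x} Y) ` X)"
    proof (rule bdd_aboveI2)
      fix x assume "x \<in> X"
      then show "setdist {x} Y \<le> D" using setdist_le_dist[of x "{x}" y0 Y] y0 D[of x] by (simp add: dist_commute)
    qed
    then have "setdist {x} Y < e" using h X(2) cSUP_upper[of x X "\<lambda>x. setdist {x} Y"] by linarith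
    moreover obtain y where "y \<in> Y" "dist x y = setdist {x} Y"
      using setdist_compact_closed[of "{x}" Y] compact_imp_closed[OF Y(1)] Y(2) by auto
    ultimately show ?thesis by (intro bexI[of _ y]) simp_all
  qed
  have "(SUP a\<in>A. setdist {a} B) < e" "(SUP b\<in>B. setdist {b} A) < e" using h by (simp_all add: hausdist_def)
  then show "\<forall>a\<in>A. \<exists>b\<in>B. dist a b < e" "\<forall>b\<in>B. \<exists>a\<in>A. dist b a < e" using *[OF A(1) _ B] *[OF B(1) _ A] by blast+
qed

lemma hausdist_le:
  assumes "A \<noteq> {}" "B \<noteq> {}" and AB: "\<forall>a\<in>A. \<exists>b\<in>B. dist a b \<le> e" and BA: "\<forall>b\<in>B. \<exists>a\<in>A. dist b a \<le> e"
  shows "hausdist A B \<le> e"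
proof -
  have *: "(SUP x\<in>X. setdist {x} Y) \<le> e" if ne: "X \<noteq> {}" and near: "\<forall>x\<in>X. \<exists>y\<in>Y. dist x y \<le> e" for X Y :: "(real^3) set"
  proof (rule cSUP_least[OF ne])
    fix x assume "x \<in> X"
    then obtain y where "y \<in> Y" "dist x y \<le> e" using near by blast
    then show "setdist {x} Y \<le> e" using setdist_le_dist[of x "{x}" y Y] by simp
  qed
  show ?thesis unfolding hausdist_def using *[OF assms(1) AB] *[OF assms(2) BA] by simp
qed

lemma hausdist_triangle_less:
  assumes A: "compact A" "A \<noteq> {}" and B: "compact B" "B \<noteq> {}" and C: "compact C" "C \<noteq> {}"
    and AB: "hausdist A B < e" and BC: "hausdist B C < f"
  shows "hausdist A C \<le> e + f"
proof (rule hausdist_le[OF A(2) C(2)])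
  note ab = hausdist_less[OF A B AB] and bc = hausdist_less[OF B C BC]
  show "\<forall>a\<in>A. \<exists>c\<in>C. dist a c \<le> e + f"
  proof
    fix a assume "a \<in> A"
    then obtain b where b: "b \<in> B" "dist a b < e" using ab(1) by blast
    then obtain c where "c \<in> C" "dist b c < f" using bc(1) by blast
    then show "\<exists>c\<in>C. dist a c \<le> e + f" using b dist_triangle[of a c b] by (intro bexI[of _ c]) auto
  qed
  show "\<forall>c\<in>C. \<exists>a\<in>A. dist c a \<le> e + f"
  proof
    fix c assume "c \<in> C"
    then obtain b where b: "b \<in> B" "dist c b < f" using bc(2) by blast
    then obtain a where "a \<in> A" "dist b a < e" using ab(2) by blast
    then show "\<exists>a\<in>A. dist c a \<le> e + f" using b dist_triangle[of c a b] by (intro bexI[of _ a]) auto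
  qed
qed

lemma convex_surfaces_body: "A \<in> convex_surfaces \<longleftrightarrow> (\<exists>K. convex_body K \<and> A = frontier K)"
  unfolding convex_surfaces_def convex_body_def by blast

lemma convex_surface_compact: "A \<in> convex_surfaces \<Longrightarrow> compact A" "A \<in> convex_surfaces \<Longrightarrow> A \<noteq> {}"
proof -
  assume "A \<in> convex_surfaces"
  then obtain K where K: "convex_body K" "A = frontier K" unfolding convex_surfaces_body by blast
  interpret convex_body K by (rule K(1))
  show "compact A" using compact_S K(2) by simp
  have "K \<noteq> UNIV" using compact_K not_compact_UNIV by metis
  then show "A \<noteq> {}" using frontier_not_empty[of K] K_nonempty K(2) by simp
qed

lemma openin_surface_space:
  "openin surface_space U \<longleftrightarrow> U \<subseteq> convex_surfaces \<and> (\<forall>A\<in>U. \<exists>e>0. \<forall>B\<in>convex_surfaces. hausdist A B < e \<longrightarrow> B \<in> U)"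
proof -
  have "istopology (\<lambda>U. U \<subseteq> convex_surfaces \<and> (\<forall>A\<in>U. \<exists>e>0. \<forall>B\<in>convex_surfaces. hausdist A B < e \<longrightarrow> B \<in> U))"
    unfolding istopology_def
  proof (intro conjI allI impI ballI)
    fix U V A
    assume U: "U \<subseteq> convex_surfaces \<and> (\<forall>A\<in>U. \<exists>e>0. \<forall>B\<in>convex_surfaces. hausdist A B < e \<longrightarrow> B \<in> U)"
      and V: "V \<subseteq> convex_surfaces \<and> (\<forall>A\<in>V. \<exists>e>0. \<forall>B\<in>convex_surfaces. hausdist A B < e \<longrightarrow> B \<in> V)" and A: "A \<in> U \<inter> V"
    obtain e where e: "0 < e" "\<forall>B\<in>convex_surfaces. hausdist A B < e \<longrightarrow> B \<in> U" using U A by blast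
    obtain f where f: "0 < f" "\<forall>B\<in>convex_surfaces. hausdist A B < f \<longrightarrow> B \<in> V" using V A by blast
    show "\<exists>e>0. \<forall>B\<in>convex_surfaces. hausdist A B < e \<longrightarrow> B \<in> U \<inter> V"
      using e f by (intro exI[of _ "min e f"]) auto
  next
    fix \<U> A
    assume *: "\<forall>U\<in>\<U>. U \<subseteq> convex_surfaces \<and> (\<forall>A\<in>U. \<exists>e>0. \<forall>B\<in>convex_surfaces. hausdist A B < e \<longrightarrow> B \<in> U)" and "A \<in> \<Union>\<U>"
    then obtain U where U: "U \<in> \<U>" "A \<in> U" by blast
    then obtain e where "0 < e" "\<forall>B\<in>convex_surfaces. hausdist A B < e \<longrightarrow> B \<in> U" using * by blast
    then show "\<exists>e>0. \<forall>B\<in>convex_surfaces. hausdist A B < e \<longrightarrow> B \<in> \<Union>\<U>" using U(1) by blast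
  qed blast+
  then show ?thesis unfolding surface_space_def by (simp add: topology_inverse')
qed

lemma topspace_surface_space: "topspace surface_space = convex_surfaces"
proof -
  have "openin surface_space convex_surfaces" unfolding openin_surface_space
    by (intro conjI subset_refl ballI exI[of _ "1 :: real"] impI) simp_all
  then have "convex_surfaces \<subseteq> topspace surface_space" by (rule openin_subset)
  moreover have "topspace surface_space \<subseteq> convex_surfaces"
    using openin_topspace[of surface_space] by (simp only: openin_surface_space)
  ultimately show ?thesis by (rule subset_antisym[rotated])
qed

lemma openin_hausdist_ball:
  assumes S: "S \<in> convex_surfaces" shows "openin surface_space {B \<in> convex_surfaces. hausdist S B < e}"
  unfolding openin_surface_space
proof (intro conjI ballI)
  fix A assume "A \<in> {B \<in> convex_surfaces. hausdist S B < e}"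
  then have A: "A \<in> convex_surfaces" "hausdist S A < e" by auto
  define f where "f = (e - hausdist S A) / 3"
  have "3 * f = e - hausdist S A" by (simp add: f_def)
  then have f: "0 < f" "hausdist S A + 3 * f = e" using A(2) by linarith+
  have "hausdist S B < e" if B: "B \<in> convex_surfaces" "hausdist A B < f" for B
  proof -
    have "hausdist S B \<le> (hausdist S A + f) + f"
      using f(1) B(2) by (intro hausdist_triangle_less[of S A B] convex_surface_compact S A(1) B(1)) auto
    then show ?thesis using f by linarith
  qed
  then show "\<exists>f>0. \<forall>B\<in>convex_surfaces. hausdist A B < f \<longrightarrow> B \<in> {B \<in> convex_surfaces. hausdist S B < e}"
    using f(1) by blast
qed blast

section \<open>Nowhere dense sets, first category and forcible properties\<close>

lemma nowhere_denseI:
  assumes "A \<subseteq> topspace X" and "\<And>T. openin X T \<Longrightarrow> T \<noteq> {} \<Longrightarrow> \<exists>N. openin X N \<and> N \<noteq> {} \<and> N \<subseteq> T \<and> N \<inter> A = {}"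
  shows "nowhere_dense X A"
proof -
  have "X interior_of (X closure_of A) = {}"
  proof (rule ccontr)
    assume "X interior_of (X closure_of A) \<noteq> {}"
    then have "\<exists>T. openin X T \<and> T \<noteq> {} \<and> T \<subseteq> X closure_of A"
      using openin_interior_of interior_of_subset by metis
    then obtain T where T: "openin X T" "T \<noteq> {}" "T \<subseteq> X closure_of A" by blast
    obtain N where N: "openin X N" "N \<noteq> {}" "N \<subseteq> T" "N \<inter> A = {}" using assms(2)[OF T(1,2)] by blast
    obtain x where x: "x \<in> N" using N(2) by blast
    then have "x \<in> X closure_of A" using N(3) T(3) by blast
    then have "\<exists>y. y \<in> A \<and> y \<in> N" using x N(1) unfolding in_closure_of by simp
    then show False using N(4) by blast
  qed
  then show ?thesis using assms(1) by (simp add: nowhere_dense_def)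
qed

lemma nowhere_dense_imp_first_category: "nowhere_dense X A \<Longrightarrow> first_category X A"
  unfolding first_category_def by (intro exI[of _ "\<lambda>_. A"]) auto

lemma first_category_UN:
  assumes "\<forall>n::nat. first_category X (A n)" shows "first_category X (\<Union>n. A n)"
proof -
  have "\<forall>n. \<exists>F :: nat \<Rightarrow> _. (\<forall>i. nowhere_dense X (F i)) \<and> A n \<subseteq> (\<Union>i. F i)" using assms unfolding first_category_def .
  from choice[OF this] obtain F where F: "\<forall>n. (\<forall>i :: nat. nowhere_dense X (F n i)) \<and> A n \<subseteq> (\<Union>i. F n i)" ..
  have "A n \<subseteq> (\<Union>m. case_prod F (prod_decode m))" for n
  proof
    fix x assume "x \<in> A n"
    then obtain i where "x \<in> F n i" using F[rule_format, of n] by blast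
    then have "x \<in> case_prod F (prod_decode (prod_encode (n, i)))" by simp
    then show "x \<in> (\<Union>m. case_prod F (prod_decode m))" by (rule UN_I[OF UNIV_I])
  qed
  then have "(\<Union>n. A n) \<subseteq> (\<Union>m. case_prod F (prod_decode m))" by (rule UN_least)
  moreover have "nowhere_dense X (case_prod F (prod_decode m))" for m using F by (simp split: prod.split)
  ultimately show ?thesis unfolding first_category_def by (intro exI[of _ "\<lambda>m. case_prod F (prod_decode m)"] conjI allI)
qed

lemma first_category_mono: "first_category X B \<Longrightarrow> A \<subseteq> B \<Longrightarrow> first_category X A"
  unfolding first_category_def by (meson subset_trans)

definition forcible :: "((real^3) set \<Rightarrow> real^3 \<Rightarrow> bool) \<Rightarrow> bool" where
  "forcible P \<longleftrightarrow> (\<forall>K x \<epsilon>. convex_body K \<longrightarrow> x \<in> frontier K \<longrightarrow> 0 < \<epsilon> \<longrightarrow>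
    (\<exists>K'. convex_body K' \<and> hausdist (frontier K) (frontier K') < \<epsilon> \<and>
      (\<exists>\<eta>>0. \<forall>K''. convex_body K'' \<longrightarrow> hausdist (frontier K') (frontier K'') < \<eta> \<longrightarrow>
        (\<exists>G. openin (top_of_set (frontier K'')) G \<and> G \<noteq> {} \<and> G \<subseteq> ball x \<epsilon> \<and> (\<forall>y\<in>G. P (frontier K'') y)))))"

lemma forcible_generic:
  assumes P: "forcible P"
  shows "first_category surface_space {S \<in> convex_surfaces. \<not> nowhere_dense (top_of_set S) {x \<in> S. \<not> P S x}}"
proof -
  obtain \<B> :: "(real^3) set set" where B: "countable \<B>" "topological_basis \<B>" using ex_countable_basis by blast
  have "\<B> \<noteq> {}" using topological_basisE[OF B(2) open_UNIV, of 0] by blast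
  \<comment> \<open>The bad surfaces for \<open>U\<close>: they meet \<open>U\<close>, but the
    property holds on no nonempty open piece inside \<open>U\<close>. Forcing near a point of
    \<open>U\<close> moves a whole neighbourhood of surfaces out of \<open>E U\<close>. A surface
    that avoids \<open>E U\<close> for all \<open>U\<close> in the base has a nowhere dense set of
    bad points.\<close>
  define E where "E U = {S \<in> convex_surfaces. S \<inter> U \<noteq> {} \<and>
    \<not> (\<exists>G. openin (top_of_set S) G \<and> G \<noteq> {} \<and> G \<subseteq> U \<and> (\<forall>y\<in>G. P S y))}" for U
  have nd: "nowhere_dense surface_space (E U)" if U: "open U" for U
  proof (rule nowhere_denseI)
    show "E U \<subseteq> topspace surface_space" by (auto simp: E_def topspace_surface_space)
    fix T assume T: "openin surface_space T" "T \<noteq> {}"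
    show "\<exists>N. openin surface_space N \<and> N \<noteq> {} \<and> N \<subseteq> T \<and> N \<inter> E U = {}"
    proof (cases "T \<inter> E U = {}")
      case True
      then show ?thesis using T by blast
    next
      case False
      then obtain S where S: "S \<in> T" "S \<in> convex_surfaces" "S \<inter> U \<noteq> {}" unfolding E_def by blast
      then obtain K x where K: "convex_body K" "S = frontier K" "x \<in> S" "x \<in> U" unfolding convex_surfaces_body by blast
      obtain r where r: "0 < r" "ball x r \<subseteq> U" using U K(4) by (meson open_contains_ball)
      obtain e where e: "0 < e" "\<forall>B\<in>convex_surfaces. hausdist S B < e \<longrightarrow> B \<in> T"
        using T(1) S(1) unfolding openin_surface_space by blast
      \<comment> \<open>The modified surface has to stay in the open set \<open>T\<close>, and the
        good piece has to stay in \<open>U\<close>.\<close>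
      have "0 < min r e" using r e by simp
      note mod = P[unfolded forcible_def, rule_format, OF K(1) K(3)[unfolded K(2)] this]
      from mod obtain K' where K'0: "convex_body K' \<and> hausdist (frontier K) (frontier K') < min r e \<and>
        (\<exists>\<eta>>0. \<forall>K''. convex_body K'' \<longrightarrow> hausdist (frontier K') (frontier K'') < \<eta> \<longrightarrow>
          (\<exists>G. openin (top_of_set (frontier K'')) G \<and> G \<noteq> {} \<and> G \<subseteq> ball x (min r e) \<and> (\<forall>y\<in>G. P (frontier K'') y)))" ..
      note K'1 = K'0[THEN conjunct1] K'0[THEN conjunct2, THEN conjunct1] K'0[THEN conjunct2, THEN conjunct2]
      from K'1(3) obtain \<eta> where \<eta>: "0 < \<eta> \<and> (\<forall>K''. convex_body K'' \<longrightarrow> hausdist (frontier K') (frontier K'') < \<eta> \<longrightarrow>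
          (\<exists>G. openin (top_of_set (frontier K'')) G \<and> G \<noteq> {} \<and> G \<subseteq> ball x (min r e) \<and> (\<forall>y\<in>G. P (frontier K'') y)))" ..
      have K': "convex_body K'" "hausdist S (frontier K') < min r e" "0 < \<eta>"
        "\<forall>K''. convex_body K'' \<longrightarrow> hausdist (frontier K') (frontier K'') < \<eta> \<longrightarrow>
          (\<exists>G. openin (top_of_set (frontier K'')) G \<and> G \<noteq> {} \<and> G \<subseteq> ball x (min r e) \<and> (\<forall>y\<in>G. P (frontier K'') y))"
        unfolding K(2) by (fact K'1(1), fact K'1(2), rule \<eta>[THEN conjunct1], rule \<eta>[THEN conjunct2])
      define S' where "S' = frontier K'"
      have S': "S' \<in> convex_surfaces" using K'(1) by (auto simp: S'_def convex_surfaces_body)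
      define N where "N = T \<inter> {B \<in> convex_surfaces. hausdist S' B < \<eta>}"
      have "openin surface_space N" unfolding N_def by (intro openin_Int T(1) openin_hausdist_ball S')
      moreover have "S' \<in> N"
      proof -
        have "S' \<in> T" using e(2) S' K'(2) by (simp add: S'_def)
        moreover have "hausdist S' S' \<le> 0" using convex_surface_compact(2)[OF S'] by (intro hausdist_le) (auto intro: bexI)
        ultimately show ?thesis using K'(3) S' by (simp add: N_def)
      qed
      moreover have "N \<inter> E U = {}"
      proof -
        have "A \<notin> E U" if "A \<in> N" for A
        proof -
          have A: "A \<in> convex_surfaces" "hausdist S' A < \<eta>" using that by (auto simp: N_def)
          then obtain K'' where K'': "convex_body K''" "A = frontier K''" unfolding convex_surfaces_body by blast
          then have "\<exists>G. openin (top_of_set A) G \<and> G \<noteq> {} \<and> G \<subseteq> ball x (min r e) \<and> (\<forall>y\<in>G. P A y)"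
            using K'(4)[rule_format, OF K''(1)] A(2) unfolding S'_def by simp
          moreover have "ball x (min r e) \<subseteq> U" using r(2) by auto
          ultimately have "\<exists>G. openin (top_of_set A) G \<and> G \<noteq> {} \<and> G \<subseteq> U \<and> (\<forall>y\<in>G. P A y)"
            by (metis subset_trans)
          then show ?thesis unfolding E_def mem_Collect_eq by blast
        qed
        then show ?thesis by blast
      qed
      ultimately show ?thesis by (intro exI[of _ N]) (auto simp: N_def)
    qed
  qed
  have good: "nowhere_dense (top_of_set S) {x \<in> S. \<not> P S x}" if S: "S \<in> convex_surfaces" "\<forall>U\<in>\<B>. S \<notin> E U" for S
  proof (rule nowhere_denseI)
    fix T assume T: "openin (top_of_set S) T" "T \<noteq> {}"
    then obtain V x where V: "open V" "T = S \<inter> V" "x \<in> T" unfolding openin_open by blast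
    obtain U where U: "U \<in> \<B>" "x \<in> U" "U \<subseteq> V" using topological_basisE[OF B(2) V(1)] V(2,3) by blast
    have "S \<inter> U \<noteq> {}" using U(2) V(2,3) by blast
    then have "\<exists>G. openin (top_of_set S) G \<and> G \<noteq> {} \<and> G \<subseteq> U \<and> (\<forall>y\<in>G. P S y)"
      using S(1) S(2)[rule_format, OF U(1)] unfolding E_def mem_Collect_eq by blast
    then obtain G where G: "openin (top_of_set S) G" "G \<noteq> {}" "G \<subseteq> U" "\<forall>y\<in>G. P S y" by blast
    moreover have "G \<subseteq> S" using G(1) openin_imp_subset by blast
    ultimately show "\<exists>N. openin (top_of_set S) N \<and> N \<noteq> {} \<and> N \<subseteq> T \<and> N \<inter> {x \<in> S. \<not> P S x} = {}"
      using U(3) V(2) by (intro exI[of _ G]) auto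
  qed auto
  define F where "F n = E (from_nat_into \<B> n)" for n
  have "nowhere_dense surface_space (F n)" for n
    unfolding F_def using from_nat_into[OF \<open>\<B> \<noteq> {}\<close>] topological_basis_open[OF B(2)] by (intro nd) blast
  moreover have "{S \<in> convex_surfaces. \<not> nowhere_dense (top_of_set S) {x \<in> S. \<not> P S x}} \<subseteq> (\<Union>n. F n)"
  proof
    fix S assume "S \<in> {S \<in> convex_surfaces. \<not> nowhere_dense (top_of_set S) {x \<in> S. \<not> P S x}}"
    then obtain U where U: "U \<in> \<B>" "S \<in> E U" using good by blast
    then obtain n where "from_nat_into \<B> n = U" using from_nat_into_surj[OF B(1)] by blast
    then show "S \<in> (\<Union>n. F n)" using U(2) by (auto simp: F_def)
  qed
  ultimately show ?thesis unfolding first_category_def by blast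
qed

section \<open>The lower and upper curvatures\<close>

text \<open>The fixed angle bound 1/2 serves every smaller \<open>a\<close>, so countably many
  conditions are enough for the double limits of G as well as for K.\<close>

definition flat_at :: "nat \<Rightarrow> (real^3) set \<Rightarrow> real^3 \<Rightarrow> bool" where
  "flat_at n S x \<longleftrightarrow> (\<exists>T\<in>Etri S x (1 / real (Suc n)) (1 / 2).
    ratioK S T < ereal (1 / real (Suc n)) \<and> ratioG S T < ereal (1 / real (Suc n)))"

definition sharp_at :: "nat \<Rightarrow> (real^3) set \<Rightarrow> real^3 \<Rightarrow> bool" where
  "sharp_at n S x \<longleftrightarrow> (\<exists>T\<in>Etri S x (1 / real (Suc n)) (1 / 2). ereal (real n) < ratioK S T \<and> ereal (real n) < ratioG S T)"

lemma Etri_mono: "\<delta>' \<le> \<delta> \<Longrightarrow> a \<le> a' \<Longrightarrow> Etri S x \<delta>' a' \<subseteq> Etri S x \<delta> a"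
  by (auto simp: Etri_def)

text \<open>The functions to which this is applied are constant near 0.\<close>

lemma Lim_at_right_eq:
  fixes f :: "real \<Rightarrow> ereal"
  assumes "0 < c" "\<And>t. 0 < t \<Longrightarrow> t < c \<Longrightarrow> f t = l" shows "Lim (at_right 0) f = l"
proof (rule tendsto_Lim)
  have "eventually (\<lambda>t. f t = l) (at_right 0)" using assms by (auto simp: eventually_at_right_field)
  then show "(f \<longlongrightarrow> l) (at_right 0)" by (rule tendsto_eventually)
qed (rule trivial_limit_at_right_real)

text \<open>A comparison triangle exists by the triangle inequality; only this ties the
  \<open>SOME\<close> in \<open>eucl_tri_area\<close> to a measure.\<close>

lemma (in convex_body) sigma0_nonneg:
  assumes T: "geo_triangle S T" shows "0 \<le> sigma0 S T"
proof -
  note ne = geo_triangle_distinct[OF T]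
  define l1 l2 l3 where "l1 = d (va T) (vb T)" and "l2 = d (vb T) (vc T)" and "l3 = d (vc T) (va T)"
  have pos: "0 < l1" "0 < l2" "0 < l3" unfolding l1_def l2_def l3_def using ne by (auto intro!: d_pos)
  have tri: "l1 \<le> l2 + l3" "l2 \<le> l1 + l3" "l3 \<le> l1 + l2"
    using d_triangle[of "va T" "vc T" "vb T"] d_triangle[of "vb T" "va T" "vc T"] d_triangle[of "vc T" "vb T" "va T"] ne
    unfolding l1_def l2_def l3_def d_commute[of "vb T" "va T"] d_commute[of "vc T" "vb T"] d_commute[of "va T" "vc T"]
    by simp_all
  have "l2\<^sup>2 \<le> (l1 + l3)\<^sup>2" using tri pos by (intro power_mono) auto
  moreover have "\<bar>l1 - l3\<bar>\<^sup>2 \<le> l2\<^sup>2" using tri pos by (intro power_mono) auto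
  ultimately have "\<bar>l1\<^sup>2 + l3\<^sup>2 - l2\<^sup>2\<bar> \<le> 2 * l1 * l3" by (simp add: power2_sum power2_diff abs_le_iff)
  then have "\<exists>p q r :: real^2. dist p q = l1 \<and> dist q r = l2 \<and> dist r p = l3"
    using pos by (intro euclidean_triangle_exists) auto
  then have "\<exists>A. \<exists>p q r :: real^2. dist p q = l1 \<and> dist q r = l2 \<and> dist r p = l3 \<and> A = measure lborel (convex hull {p, q, r})"
    by blast
  then have "\<exists>p q r :: real^2. dist p q = l1 \<and> dist q r = l2 \<and> dist r p = l3
      \<and> eucl_tri_area l1 l2 l3 = measure lborel (convex hull {p, q, r})"
    unfolding eucl_tri_area_def by (rule someI_ex)
  then show ?thesis unfolding sigma0_def l1_def[symmetric] l2_def[symmetric] l3_def[symmetric] by auto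
qed

text \<open>\<open>Etri\<close> also contains all smaller triangles, and ratios are nonnegative;
  hence the infima are 0 and the suprema infinite already for every positive \<open>\<delta>\<close>
  and every \<open>a \<le> 1 / 2\<close>, before any limit is taken.\<close>

lemma (in convex_body) curvatures:
  assumes flat: "\<And>n. flat_at n S x" and sharp: "\<And>n. sharp_at n S x"
  shows "K_low S x = 0 \<and> G_low S x = 0 \<and> K_up S x = \<infinity> \<and> G_up S x = \<infinity>"
proof -
  have nonneg: "0 \<le> ratioK S T" "0 \<le> ratioG S T" if "T \<in> Etri S x \<delta> a" for T \<delta> a
  proof -
    have T: "geo_triangle S T" using that by (simp add: Etri_def)
    have *: "0 \<le> ereal (excess S T)" "0 \<le> ereal (sigma0 S T)" using excess_nonneg[OF T] sigma0_nonneg[OF T] by simp_all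
    show "0 \<le> ratioK S T" unfolding ratioK_def by (rule zero_le_divide_ereal[OF *])
    show "0 \<le> ratioG S T" unfolding ratioG_def by (rule zero_le_divide_ereal[OF *(1) enn2ereal_nonneg])
  qed
  have small: "(INF T\<in>Etri S x \<delta> a. ratioK S T) = 0 \<and> (INF T\<in>Etri S x \<delta> a. ratioG S T) = 0"
    if "0 < \<delta>" "a \<le> 1 / 2" for \<delta> a
  proof -
    have "(INF T\<in>Etri S x \<delta> a. ratioK S T) \<le> ereal e \<and> (INF T\<in>Etri S x \<delta> a. ratioG S T) \<le> ereal e" if "0 < e" for e
    proof -
      have "0 < min \<delta> e" using \<open>0 < \<delta>\<close> \<open>0 < e\<close> by simp
      then obtain n where n: "1 / real (Suc n) < min \<delta> e" by (rule nat_approx_posE)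
      obtain T where T: "T \<in> Etri S x (1 / real (Suc n)) (1 / 2)"
        "ratioK S T < ereal (1 / real (Suc n))" "ratioG S T < ereal (1 / real (Suc n))"
        using flat[of n] unfolding flat_at_def by blast
      have "T \<in> Etri S x \<delta> a" by (rule subsetD[OF Etri_mono T(1)]) (use n \<open>a \<le> 1 / 2\<close> in auto)
      moreover have e: "ereal (1 / real (Suc n)) \<le> ereal e" using n by simp
      have "ratioK S T \<le> ereal e" by (rule order_trans[OF less_imp_le[OF T(2)] e])
      moreover have "ratioG S T \<le> ereal e" by (rule order_trans[OF less_imp_le[OF T(3)] e])
      ultimately show ?thesis using INF_lower2[of T "Etri S x \<delta> a" "ratioK S"] INF_lower2[of T "Etri S x \<delta> a" "ratioG S"] by simp
    qed
    note le = this
    have "(INF T\<in>Etri S x \<delta> a. ratioK S T) \<le> 0" by (rule ereal_le_epsilon2) (use le in simp)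
    moreover have "(INF T\<in>Etri S x \<delta> a. ratioG S T) \<le> 0" by (rule ereal_le_epsilon2) (use le in simp)
    moreover have "0 \<le> (INF T\<in>Etri S x \<delta> a. ratioK S T)" "0 \<le> (INF T\<in>Etri S x \<delta> a. ratioG S T)"
      using nonneg by (auto intro!: INF_greatest)
    ultimately show ?thesis by (simp add: order_antisym)
  qed
  have large: "(SUP T\<in>Etri S x \<delta> a. ratioK S T) = \<infinity> \<and> (SUP T\<in>Etri S x \<delta> a. ratioG S T) = \<infinity>"
    if "0 < \<delta>" "a \<le> 1 / 2" for \<delta> a
  proof -
    have "ereal (real m) \<le> (SUP T\<in>Etri S x \<delta> a. ratioK S T) \<and> ereal (real m) \<le> (SUP T\<in>Etri S x \<delta> a. ratioG S T)" for m :: nat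
    proof -
      obtain n0 where n0: "1 / real (Suc n0) < \<delta>" using \<open>0 < \<delta>\<close> by (rule nat_approx_posE)
      define n where "n = max n0 m"
      have "1 / real (Suc n) \<le> 1 / real (Suc n0)" by (intro divide_left_mono) (auto simp: n_def)
      then have n: "1 / real (Suc n) \<le> \<delta>" "ereal (real m) \<le> ereal (real n)" using n0 by (auto simp: n_def)
      obtain T where T: "T \<in> Etri S x (1 / real (Suc n)) (1 / 2)" "ereal (real n) < ratioK S T" "ereal (real n) < ratioG S T"
        using sharp[of n] unfolding sharp_at_def by blast
      have "T \<in> Etri S x \<delta> a" by (rule subsetD[OF Etri_mono[OF n(1)] T(1)]) (use \<open>a \<le> 1 / 2\<close> in auto)
      moreover have "ereal (real m) \<le> ratioK S T" by (rule order_trans[OF n(2) less_imp_le[OF T(2)]])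
      moreover have "ereal (real m) \<le> ratioG S T" by (rule order_trans[OF n(2) less_imp_le[OF T(3)]])
      ultimately show ?thesis using SUP_upper2[of T "Etri S x \<delta> a" _ "ratioK S"] SUP_upper2[of T "Etri S x \<delta> a" _ "ratioG S"] by simp
    qed
    note m = this
    have "ereal B \<le> (SUP T\<in>Etri S x \<delta> a. ratioK S T) \<and> ereal B \<le> (SUP T\<in>Etri S x \<delta> a. ratioG S T)" for B
    proof -
      obtain k :: nat where "B \<le> real k" using real_arch_simple by blast
      then have k: "ereal B \<le> ereal (real k)" by simp
      show ?thesis by (rule conjI[OF order_trans[OF k conjunct1[OF m]] order_trans[OF k conjunct2[OF m]]])
    qed
    then show ?thesis by (simp add: ereal_top)
  qed
  have G: "Lim (at_right 0) (\<lambda>\<delta>. INF T\<in>Etri S x \<delta> a. ratioG S T) = 0"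
    "Lim (at_right 0) (\<lambda>\<delta>. SUP T\<in>Etri S x \<delta> a. ratioG S T) = \<infinity>" if "a < 1 / 2" for a
    by (rule Lim_at_right_eq[of 1]; use small large that in simp)+
  show ?thesis unfolding K_low_def K_up_def G_low_def G_up_def
    by (intro conjI; rule Lim_at_right_eq[of "1 / 2"]; use small large G in simp)
qed

lemma theorem_from_forcible:
  assumes flat: "\<And>n. forcible (flat_at n)" and sharp: "\<And>n. forcible (sharp_at n)"
  shows "first_category surface_space
    {S \<in> convex_surfaces. \<not> first_category (top_of_set S)
        {x \<in> S. \<not> (K_low S x = 0 \<and> G_low S x = 0 \<and> K_up S x = \<infinity> \<and> G_up S x = \<infinity>)}}"
proof -
  \<comment> \<open>Interleaving the two sequences leaves a single countable union of exceptional
    sets.\<close>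
  define P where "P n = (if even n then flat_at (n div 2) else sharp_at (n div 2))" for n
  define A where "A n = {S \<in> convex_surfaces. \<not> nowhere_dense (top_of_set S) {x \<in> S. \<not> P n S x}}" for n
  have "first_category surface_space (A n)" for n
    unfolding A_def using flat sharp by (intro forcible_generic) (simp add: P_def)
  then have "first_category surface_space (\<Union>n. A n)" by (intro first_category_UN) simp
  moreover have "first_category (top_of_set S)
      {x \<in> S. \<not> (K_low S x = 0 \<and> G_low S x = 0 \<and> K_up S x = \<infinity> \<and> G_up S x = \<infinity>)}"
    if S: "S \<in> convex_surfaces" "S \<notin> (\<Union>n. A n)" for S
  proof (rule first_category_mono)
    have "nowhere_dense (top_of_set S) {x \<in> S. \<not> P n S x}" for n using S by (auto simp: A_def)
    then show "first_category (top_of_set S) (\<Union>n. {x \<in> S. \<not> P n S x})"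
      by (intro first_category_UN) (simp add: nowhere_dense_imp_first_category)
    obtain K where K: "convex_body K" "S = frontier K" using S(1) unfolding convex_surfaces_body by blast
    interpret convex_body K by (rule K(1))
    show "{x \<in> S. \<not> (K_low S x = 0 \<and> G_low S x = 0 \<and> K_up S x = \<infinity> \<and> G_up S x = \<infinity>)} \<subseteq> (\<Union>n. {x \<in> S. \<not> P n S x})"
    proof (rule subsetI, rule ccontr)
      fix x assume x: "x \<in> {x \<in> S. \<not> (K_low S x = 0 \<and> G_low S x = 0 \<and> K_up S x = \<infinity> \<and> G_up S x = \<infinity>)}"
        "x \<notin> (\<Union>n. {x \<in> S. \<not> P n S x})"
      then have P: "P n S x" for n by blast
      have "flat_at n S x" for n using P[of "2 * n"] by (simp add: P_def)
      moreover have "sharp_at n S x" for n using P[of "2 * n + 1"] by (simp add: P_def)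
      ultimately show False using curvatures[of x] x(1) unfolding K(2) by blast
    qed
  qed
  ultimately show ?thesis by (elim first_category_mono) blast
qed

section \<open>Open pieces of the surface with the required triangles\<close>

context near_tri
begin

lemma core_open: "openin (top_of_set S) core"
proof -
  have "core = S \<inter> ({x. norm (proj x) < s / 4} \<inter> {x. - \<rho> < height x})" by (auto simp: core_def)
  moreover have "open ({x. norm (proj x) < s / 4} \<inter> {x. - \<rho> < height x})"
    by (intro open_Int open_Collect_less continuous_intros continuous_proj continuous_height)
  ultimately show ?thesis unfolding openin_open by blast
qed

lemma core_nonempty: "core \<noteq> {}"
proof -
  obtain \<gamma> L where "near_tri_sides K v e1 e2 \<nu> \<kappa> \<rho> \<sigma> s \<zeta> \<gamma> L" using sides_exist by blast
  then interpret near_tri_sides K v e1 e2 \<nu> \<kappa> \<rho> \<sigma> s \<zeta> \<gamma> L .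
  obtain y where y: "y \<in> S" "proj y = 0" "- 2 * \<rho> < height y" using sheet_exists[of 0] \<rho> by auto
  then have "\<not> height y \<le> - \<rho>" using low_sheet[of y] s by auto
  then have "y \<in> core" using y s by (simp add: core_def)
  then show ?thesis by blast
qed

text \<open>The centre will be the boundary point at which the body was modified.\<close>

lemma core_ball: "core \<subseteq> ball (v + (- (2 * \<rho>)) *\<^sub>R \<nu>) (4 * \<rho>)"
proof
  fix x assume x: "x \<in> core"
  have eq: "v + (- (2 * \<rho>)) *\<^sub>R \<nu> = pt 0 (- (2 * \<rho>))" by (simp add: pt_def)
  have "height x \<le> \<sigma>" using x S_subset_K by (intro height_le(2)) (auto simp: core_def)
  then have h: "0 \<le> height x + 2 * \<rho>" "height x + 2 * \<rho> \<le> 3 * \<rho>" using x \<sigma>_small s \<rho> by (auto simp: core_def)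
  have p: "norm (proj x) \<le> \<rho>" using x s by (simp add: core_def)
  have "(dist (pt 0 (- (2 * \<rho>))) x)\<^sup>2 = (norm (proj x))\<^sup>2 + (height x + 2 * \<rho>)\<^sup>2"
    using dist_split[of x "pt 0 (- (2 * \<rho>))"] by (simp add: dist_commute)
  moreover have "(norm (proj x))\<^sup>2 \<le> \<rho>\<^sup>2" using p by (intro power_mono) auto
  moreover have "(height x + 2 * \<rho>)\<^sup>2 \<le> (3 * \<rho>)\<^sup>2" using h by (intro power_mono) auto
  moreover have "(3 * \<rho>)\<^sup>2 = 9 * \<rho>\<^sup>2" "(4 * \<rho>)\<^sup>2 = 16 * \<rho>\<^sup>2" "0 < \<rho>\<^sup>2" using \<rho> by (simp_all add: power_mult_distrib)
  ultimately have "(dist (pt 0 (- (2 * \<rho>))) x)\<^sup>2 < (4 * \<rho>)\<^sup>2" by linarith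
  then have "dist (pt 0 (- (2 * \<rho>))) x < 4 * \<rho>" by (rule power2_less_imp_less) (use \<rho> in simp)
  then show "x \<in> ball (v + (- (2 * \<rho>)) *\<^sub>R \<nu>) (4 * \<rho>)" unfolding eq by simp
qed

lemma flat_region:
  assumes "\<kappa> = 0" "256 * (3 * arccos (1 / 2 - 36 * (\<sigma> / s)) - pi) < 1 / real (Suc n) * s\<^sup>2" "68 * s < 1 / real (Suc n)"
  shows "\<exists>G. openin (top_of_set S) G \<and> G \<noteq> {} \<and> G \<subseteq> ball (v + (- (2 * \<rho>)) *\<^sub>R \<nu>) (4 * \<rho>) \<and> (\<forall>y\<in>G. flat_at n S y)"
  using core_open core_nonempty core_ball core_flat[OF _ assms order_refl] unfolding flat_at_def by blast

lemma sharp_region: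
  assumes "real n * (80000 * s\<^sup>2) < 3 * arccos (1 - 2 * (sqrt ((1 + \<kappa>\<^sup>2) / (4 + \<kappa>\<^sup>2)) - 20 * (\<zeta> / s))\<^sup>2) - pi"
    "68 * s < 1 / real (Suc n)"
  shows "\<exists>G. openin (top_of_set S) G \<and> G \<noteq> {} \<and> G \<subseteq> ball (v + (- (2 * \<rho>)) *\<^sub>R \<nu>) (4 * \<rho>) \<and> (\<forall>y\<in>G. sharp_at n S y)"
  using core_open core_nonempty core_ball core_tip[OF _ of_nat_0_le_iff assms(1)[folded sharp_def] assms(2) order_refl]
  unfolding sharp_at_def by blast

end

lemma frame_exists:
  fixes \<nu> :: "real^3"
  assumes "norm \<nu> = 1" shows "\<exists>e1 e2. frame e1 e2 \<nu>"
proof -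
  obtain y where y: "y \<noteq> 0" "orthogonal \<nu> y" using orthogonal_to_vector_exists[of \<nu>] by auto
  define e1 where "e1 = sgn y"
  define e2 where "e2 = cross3 \<nu> e1"
  have e1: "norm e1 = 1" "\<nu> \<bullet> e1 = 0" using y by (simp_all add: e1_def norm_sgn orthogonal_def sgn_div_norm)
  have "(norm e2)\<^sup>2 = 1" using e1 assms norm_cross[of \<nu> e1] by (simp add: e2_def)
  then have "e2 \<bullet> e2 = 1" by (simp add: power2_norm_eq_inner)
  moreover have "e1 \<bullet> e1 = 1" "\<nu> \<bullet> \<nu> = 1" using e1(1) assms by (simp_all add: norm_eq_1)
  moreover have "e1 \<bullet> e2 = 0" "e2 \<bullet> \<nu> = 0" by (simp_all add: e2_def dot_cross_self)
  ultimately have "frame e1 e2 \<nu>" using e1(2) by (simp add: frame_def inner_commute)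
  then show ?thesis by blast
qed

section \<open>Thickened bodies and the Hausdorff distance of frontiers\<close>

definition thickening :: "(real^3) set \<Rightarrow> real \<Rightarrow> (real^3) set" where
  "thickening K \<epsilon> = {y. \<exists>k\<in>K. dist y k \<le> \<epsilon>}"

lemma thickening_sums: "thickening K \<epsilon> = (\<Union>x\<in>K. \<Union>y\<in>cball 0 \<epsilon>. {x + y})"
proof
  show "thickening K \<epsilon> \<subseteq> (\<Union>x\<in>K. \<Union>y\<in>cball 0 \<epsilon>. {x + y})"
  proof
    fix y assume "y \<in> thickening K \<epsilon>"
    then obtain k where "k \<in> K" and "dist y k \<le> \<epsilon>" by (auto simp: thickening_def)
    from this(2) have "y \<in> (\<Union>z\<in>cball 0 \<epsilon>. {k + z})" by (intro UN_I[of "y - k"]) (simp_all add: dist_norm norm_minus_commute)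
    then show "y \<in> (\<Union>x\<in>K. \<Union>y\<in>cball 0 \<epsilon>. {x + y})" by (rule UN_I[OF \<open>k \<in> K\<close>])
  qed
next
  show "(\<Union>x\<in>K. \<Union>y\<in>cball 0 \<epsilon>. {x + y}) \<subseteq> thickening K \<epsilon>"
  proof
    fix z assume "z \<in> (\<Union>x\<in>K. \<Union>y\<in>cball 0 \<epsilon>. {x + y})"
    then obtain x y where "x \<in> K" "norm y \<le> \<epsilon>" "z = x + y" by auto
    then show "z \<in> thickening K \<epsilon>" unfolding thickening_def mem_Collect_eq by (intro bexI[of _ x]) (simp_all add: dist_norm)
  qed
qed

lemma compact_thickening: "compact K \<Longrightarrow> compact (thickening K \<epsilon>)"
  unfolding thickening_sums by (rule compact_sums'[OF _ compact_cball])

lemma convex_thickening: "convex K \<Longrightarrow> convex (thickening K \<epsilon>)"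
  unfolding thickening_sums by (rule convex_sums[OF _ convex_cball])

text \<open>A compact convex set is the hull of its frontier and the thickening of a convex set is
  convex, so closeness of frontiers passes to the bodies.\<close>

lemma body_near:
  assumes K: "convex_body K" and L: "convex_body L" and h: "hausdist (frontier K) (frontier L) < \<eta>"
  shows "K \<subseteq> thickening L \<eta>"
proof -
  have F: "frontier A \<in> convex_surfaces" if "convex_body A" for A using that convex_surfaces_body by blast
  note c = convex_surface_compact[OF F]
  interpret K: convex_body K by (rule K)
  interpret L: convex_body L by (rule L)
  have "frontier K \<subseteq> thickening L \<eta>"
  proof
    fix y assume "y \<in> frontier K"
    then obtain z where "z \<in> frontier L" "dist y z < \<eta>"
      using hausdist_less(1)[OF c(1)[OF K] c(2)[OF K] c(1)[OF L] c(2)[OF L] h] by blast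
    then show "y \<in> thickening L \<eta>" using L.S_subset_K by (force simp: thickening_def)
  qed
  then have "convex hull (frontier K) \<subseteq> thickening L \<eta>" by (rule hull_minimal) (rule convex_thickening[OF L.convex_K])
  then show ?thesis using Krein_Milman_frontier[OF K.convex_K K.compact_K] by simp
qed

text \<open>From the inner frontier an outer normal is followed until it leaves \<open>L\<close>,
  which happens within distance \<open>\<epsilon>\<close>; from the outer frontier the nearest point
  of \<open>K\<close> is taken.\<close>

lemma hausdist_bodies_le:
  assumes K: "convex_body K" and L: "convex_body L" and sub: "K \<subseteq> L" "L \<subseteq> thickening K \<epsilon>" and \<epsilon>: "0 < \<epsilon>"
  shows "hausdist (frontier K) (frontier L) \<le> \<epsilon>"
proof -
  have F: "frontier A \<in> convex_surfaces" if "convex_body A" for A using that convex_surfaces_body by blast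
  interpret K: convex_body K by (rule K)
  interpret L: convex_body L by (rule L)
  show ?thesis
  proof (rule hausdist_le[OF convex_surface_compact(2)[OF F[OF K]] convex_surface_compact(2)[OF F[OF L]]])
    show "\<forall>a\<in>frontier K. \<exists>b\<in>frontier L. dist a b \<le> \<epsilon>"
    proof
      fix y assume y: "y \<in> frontier K"
      obtain n where n: "norm n = 1" "\<And>z. z \<in> K \<Longrightarrow> n \<bullet> z \<le> n \<bullet> y" using K.S_support[OF y] by blast
      have n1: "n \<bullet> n = 1" using n(1) by (simp add: norm_eq_1)
      have up: "n \<bullet> z \<le> n \<bullet> y + \<epsilon>" if z: "z \<in> L" for z
      proof -
        obtain k where k: "k \<in> K" "dist z k \<le> \<epsilon>" using sub(2) z by (auto simp: thickening_def)
        have "n \<bullet> (z - k) \<le> norm n * norm (z - k)" by (rule norm_cauchy_schwarz)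
        then show ?thesis using n(2)[OF k(1)] k(2) n(1) by (simp add: inner_diff_right dist_norm)
      qed
      define q where "q = y + (2 * \<epsilon>) *\<^sub>R n"
      have "n \<bullet> q = n \<bullet> y + 2 * \<epsilon>" by (simp add: q_def inner_add_right n1)
      then have "q \<notin> L" using up[of q] \<epsilon> by auto
      moreover have "y \<in> L" using y K.S_subset_K sub(1) by blast
      ultimately have "closed_segment y q \<inter> frontier L \<noteq> {}" by (intro connected_Int_frontier) auto
      then obtain z t where z: "z \<in> frontier L" "0 \<le> t" "z = (1 - t) *\<^sub>R y + t *\<^sub>R q" by (auto simp: closed_segment_def)
      have zy: "z = y + (t * (2 * \<epsilon>)) *\<^sub>R n" unfolding z(3) q_def by (simp add: algebra_simps)
      have "n \<bullet> z = n \<bullet> y + t * (2 * \<epsilon>)" unfolding zy by (simp add: inner_add_right n1)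
      then have "t * (2 * \<epsilon>) \<le> \<epsilon>" using up[of z] z(1) L.S_subset_K by auto
      moreover have "dist y z = t * (2 * \<epsilon>)" unfolding zy using n(1) z(2) \<epsilon> by (simp add: dist_norm)
      ultimately have "dist y z \<le> \<epsilon>" by linarith
      then show "\<exists>b\<in>frontier L. dist y b \<le> \<epsilon>" using z(1) by (rule bexI)
    qed
    show "\<forall>b\<in>frontier L. \<exists>a\<in>frontier K. dist b a \<le> \<epsilon>"
    proof
      fix z assume z: "z \<in> frontier L"
      have "z \<in> L" using z L.S_subset_K by blast
      then obtain k where k: "k \<in> K" "dist z k \<le> \<epsilon>" using sub(2) by (auto simp: thickening_def)
      have "interior K \<subseteq> interior L" by (rule interior_mono[OF sub(1)])
      then have "z \<in> - interior K" using z by (auto simp: L.S_eq)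
      then have "closest_point K z \<in> frontier K" by (rule K.closest_point_frontier)
      moreover have "dist z (closest_point K z) \<le> \<epsilon>"
        using closest_point_le[OF K.closed_K k(1), of z] k(2) by linarith
      ultimately show "\<exists>a\<in>frontier K. dist z a \<le> \<epsilon>" by blast
    qed
  qed
qed

text \<open>A point of the small ball missing from \<open>L\<close> is separated from
  \<open>L\<close> by a plane. Moved away from that plane by \<open>r - \<delta>\<close>, it stays
  in the large ball but is farther than \<open>\<eta>\<close> from \<open>L\<close>.\<close>

lemma cball_subset_body:
  assumes L: "convex_body L" and ball: "cball x r \<subseteq> thickening L \<eta>" and le: "0 \<le> \<eta>" "\<delta> + \<eta> \<le> r"
  shows "cball x \<delta> \<subseteq> L"
proof (rule subsetI, rule ccontr)
  interpret convex_body L by (rule L)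
  fix p assume p: "p \<in> cball x \<delta>" "p \<notin> L"
  obtain n b where nb: "n \<bullet> p < b" "\<And>z. z \<in> L \<Longrightarrow> b < n \<bullet> z"
    using separating_hyperplane_closed_point[OF convex_K closed_K p(2)] by blast
  have "n \<noteq> 0" using nb(1) nb(2) K_nonempty by fastforce
  define u where "u = - sgn n"
  have u: "norm u = 1" using \<open>n \<noteq> 0\<close> by (simp add: u_def norm_sgn)
  have "n \<bullet> u = - ((norm n)\<^sup>2 / norm n)" unfolding power2_norm_eq_inner by (simp add: u_def sgn_div_norm divide_inverse)
  then have un: "n \<bullet> u = - norm n" by (simp add: power2_eq_square)
  have e: "0 \<le> r - \<delta>" "\<eta> \<le> r - \<delta>" using le by linarith+
  have "dist x (p + (r - \<delta>) *\<^sub>R u) \<le> dist x p + dist p (p + (r - \<delta>) *\<^sub>R u)" by (rule dist_triangle)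
  also have "\<dots> \<le> r" using p(1) e u by (simp add: dist_norm)
  finally have "p + (r - \<delta>) *\<^sub>R u \<in> thickening L \<eta>" using ball by auto
  then obtain z where z: "z \<in> L" "dist (p + (r - \<delta>) *\<^sub>R u) z \<le> \<eta>" by (auto simp: thickening_def)
  have "n \<bullet> (z - (p + (r - \<delta>) *\<^sub>R u)) \<le> norm n * norm (z - (p + (r - \<delta>) *\<^sub>R u))" by (rule norm_cauchy_schwarz)
  also have "\<dots> \<le> norm n * (r - \<delta>)" using z(2) e by (intro mult_left_mono) (auto simp: dist_norm norm_minus_commute)
  finally have "n \<bullet> z \<le> n \<bullet> p" by (simp add: inner_diff_right inner_add_right un algebra_simps)
  then show False using nb(1) nb(2)[OF z(1)] by linarith
qed

text \<open>The apex \<open>v\<close> lies 2 \<open>\<rho>\<close> above a boundary point.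
  Thickening by 4 \<open>\<rho>\<close> covers the roof over the disc of radius
  \<open>\<rho>\<close>, so only the planes are seen there. By \<open>sup\<close> and
  \<open>narrow\<close> the planes cut nothing off \<open>K\<close>, which keeps the new body close
  to the old one.\<close>

lemma (in frame) modification:
  assumes K: "convex_body K" and x: "pt 0 (- (2 * \<rho>)) \<in> K" and \<rho>: "0 < \<rho>" and \<kappa>: "0 \<le> \<kappa>" "\<kappa> \<le> 1"
    and sup: "\<forall>y\<in>K. height y \<le> - (2 * \<rho>)" and narrow: "\<forall>y\<in>K. \<kappa> * norm (proj y) \<le> 2 * \<rho>"
  shows "\<exists>K'. convex_body K' \<and> hausdist (frontier K) (frontier K') \<le> 4 * \<rho> \<and>
    (\<forall>\<eta> L. 0 < \<eta> \<longrightarrow> \<eta> \<le> \<rho> / 2 \<longrightarrow> convex_body L \<longrightarrow> hausdist (frontier K') (frontier L) < \<eta> \<longrightarrow>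
      near_tip L v e1 e2 \<nu> \<kappa> \<rho> (2 * \<eta>))"
proof -
  interpret K: convex_body K by (rule K)
  define H where "H = (\<Inter>k\<in>{..<3}. {y. nrm \<kappa> k \<bullet> y \<le> nrm \<kappa> k \<bullet> v})"
  have H: "y \<in> H \<longleftrightarrow> (\<forall>k<3. height y + \<kappa> * (dir k \<bullet> proj y) \<le> 0)" for y
  proof -
    have "nrm \<kappa> k \<bullet> y \<le> nrm \<kappa> k \<bullet> v \<longleftrightarrow> height y + \<kappa> * (dir k \<bullet> proj y) \<le> 0" for k
      using nrm_inner[of \<kappa> k y] by (auto simp: inner_diff_right)
    then show ?thesis by (auto simp: H_def)
  qed
  define K' where "K' = thickening K (4 * \<rho>) \<inter> H"
  have slope: "\<kappa> * (dir k \<bullet> w) \<le> \<kappa> * norm w" for k w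
    using inner_dir_bound[of k w] \<kappa>(1) by (intro mult_left_mono) auto
  have slope1: "\<kappa> * norm w \<le> norm w" for w :: complex using \<kappa> mult_right_mono[of \<kappa> 1 "norm w"] by simp
  have KK': "K \<subseteq> K'"
  proof
    fix y assume y: "y \<in> K"
    have "height y + \<kappa> * (dir k \<bullet> proj y) \<le> 0" for k
      using sup[rule_format, OF y] narrow[rule_format, OF y] slope[of k "proj y"] by linarith
    moreover have "y \<in> thickening K (4 * \<rho>)" using y \<rho> by (auto simp: thickening_def intro!: bexI[of _ y])
    ultimately show "y \<in> K'" by (simp add: K'_def H)
  qed
  have inside: "y \<in> K'" if "dist y (pt 0 (- (2 * \<rho>))) \<le> 4 * \<rho>" "\<forall>k<3. height y + \<kappa> * (dir k \<bullet> proj y) \<le> 0" for y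
    using that x by (auto simp: K'_def H thickening_def)
  have cball_K': "cball (pt 0 (- (2 * \<rho>))) \<rho> \<subseteq> K'"
  proof
    fix y assume y: "y \<in> cball (pt 0 (- (2 * \<rho>))) \<rho>"
    have h: "height y \<le> - \<rho>" using height_dist_le[of "pt 0 (- (2 * \<rho>))" y] y by auto
    have "norm (proj y) \<le> \<rho>" using proj_dist_le[of "pt 0 (- (2 * \<rho>))" y] y by simp
    then have "height y + \<kappa> * (dir k \<bullet> proj y) \<le> 0" for k using h slope[of k "proj y"] slope1[of "proj y"] by linarith
    then show "y \<in> K'" using y \<rho> by (intro inside) (auto simp: dist_commute)
  qed
  have "closed H" unfolding H_def by (intro closed_INT ballI closed_halfspace_le)
  moreover have "convex H" unfolding H_def by (intro convex_INT convex_halfspace_le)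
  ultimately have "compact K'" "convex K'"
    unfolding K'_def by (auto intro: compact_Int_closed compact_thickening convex_Int convex_thickening K.compact_K K.convex_K)
  moreover have "ball (pt 0 (- (2 * \<rho>))) \<rho> \<subseteq> interior K'"
    using cball_K' ball_subset_cball by (intro interior_maximal) auto
  then have "interior K' \<noteq> {}" using \<rho> by (metis ball_eq_empty not_le subset_empty)
  ultimately have body: "convex_body K'" by unfold_locales
  have close: "hausdist (frontier K) (frontier K') \<le> 4 * \<rho>"
    using \<rho> by (intro hausdist_bodies_le[OF K body KK']) (auto simp: K'_def)
  have tip: "near_tip L v e1 e2 \<nu> \<kappa> \<rho> (2 * \<eta>)"
    if \<eta>: "0 < \<eta>" "\<eta> \<le> \<rho> / 2" and L: "convex_body L" and h: "hausdist (frontier K') (frontier L) < \<eta>" for \<eta> L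
  proof -
    have K'L: "K' \<subseteq> thickening L \<eta>" by (rule body_near[OF body L h])
    have "hausdist (frontier L) (frontier K') < \<eta>" using h by (simp add: hausdist_def max.commute)
    then have LK': "L \<subseteq> thickening K' \<eta>" by (rule body_near[OF L body])
    show ?thesis
    proof (rule near_tip.intro[OF L frame_axioms near_tip_axioms.intro])
      show "0 < 2 * \<eta>" using \<eta> by simp
      fix y k assume y: "y \<in> L" "k < (3 :: nat)"
      then obtain z where z: "z \<in> K'" "dist y z \<le> \<eta>" using LK' by (auto simp: thickening_def)
      have 1: "\<bar>height y - height z\<bar> \<le> \<eta>" using height_dist_le[of y z] z(2) by linarith
      have "norm (proj y - proj z) \<le> \<eta>" using proj_dist_le[of y z] z(2) by linarith
      then have "\<kappa> * (dir k \<bullet> proj y) - \<kappa> * (dir k \<bullet> proj z) \<le> \<eta>"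
        using slope[of k "proj y - proj z"] slope1[of "proj y - proj z"] by (simp add: inner_diff_right right_diff_distrib)
      moreover have "height z + \<kappa> * (dir k \<bullet> proj z) \<le> 0" using z(1) y(2) by (simp add: K'_def H)
      ultimately show "height y + \<kappa> * (dir k \<bullet> proj y) \<le> 2 * \<eta>" using 1 by linarith
    next
      fix w :: complex assume w: "norm w \<le> \<rho>"
      have r: "\<bar>roof \<kappa> w\<bar> \<le> norm w" by (rule abs_roof_le[OF \<kappa>])
      have "(dist (pt w (roof \<kappa> w)) (pt 0 (- (2 * \<rho>))))\<^sup>2 = (norm w)\<^sup>2 + (roof \<kappa> w + 2 * \<rho>)\<^sup>2" by (simp add: dist_pt)
      moreover have "(norm w)\<^sup>2 \<le> \<rho>\<^sup>2" using w by (intro power_mono) auto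
      moreover have "(roof \<kappa> w + 2 * \<rho>)\<^sup>2 \<le> (2 * \<rho>)\<^sup>2" using r w roof_le_0[of \<kappa> w] \<rho> by (intro power_mono) auto
      moreover have "(2 * \<rho>)\<^sup>2 = 4 * \<rho>\<^sup>2" "(4 * \<rho>)\<^sup>2 = 16 * \<rho>\<^sup>2" "0 \<le> \<rho>\<^sup>2" by (simp_all add: power_mult_distrib)
      ultimately have "(dist (pt w (roof \<kappa> w)) (pt 0 (- (2 * \<rho>))))\<^sup>2 \<le> (4 * \<rho>)\<^sup>2" by linarith
      then have "dist (pt w (roof \<kappa> w)) (pt 0 (- (2 * \<rho>))) \<le> 4 * \<rho>" by (rule power2_le_imp_le) (use \<rho> in simp)
      moreover have "roof \<kappa> w + \<kappa> * (dir k \<bullet> w) \<le> 0" if "k < 3" for k using roof_le[OF that, of \<kappa> w] by simp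
      ultimately have "pt w (roof \<kappa> w) \<in> K'" by (intro inside) auto
      then obtain z where "z \<in> L" "dist (pt w (roof \<kappa> w)) z \<le> \<eta>" using K'L by (auto simp: thickening_def)
      then show "\<exists>z\<in>L. dist (pt w (roof \<kappa> w)) z \<le> 2 * \<eta>" using \<eta> by (intro bexI[of _ z]) auto
    next
      have "cball (pt 0 (- (2 * \<rho>))) (\<rho> / 2) \<subseteq> L"
        using subset_trans[OF cball_K' K'L] \<eta> \<rho> by (intro cball_subset_body[OF L]) auto
      then show "cball (pt 0 (- 2 * \<rho>)) (\<rho> / 2) \<subseteq> L" by simp
    qed (fact \<kappa>(1) \<kappa>(2) \<rho>)+
  qed
  have "\<forall>\<eta> L. 0 < \<eta> \<longrightarrow> \<eta> \<le> \<rho> / 2 \<longrightarrow> convex_body L \<longrightarrow> hausdist (frontier K') (frontier L) < \<eta> \<longrightarrow>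
      near_tip L v e1 e2 \<nu> \<kappa> \<rho> (2 * \<eta>)" using tip by simp
  then show ?thesis using body close by (intro exI[of _ K'] conjI)
qed

text \<open>The slope \<open>\<kappa>\<close> and the tolerance \<open>b\<close> depend only on
  \<open>\<rho>\<close> and on a bound \<open>R\<close> for the width of the body; they are uniform
  in the competing body and in the frame.\<close>

lemma forcible_from_regions:
  assumes P: "\<And>\<rho> R. 0 < \<rho> \<Longrightarrow> 0 < R \<Longrightarrow> \<exists>\<kappa> b. 0 \<le> \<kappa> \<and> \<kappa> \<le> 1 \<and> \<kappa> * R \<le> 2 * \<rho> \<and> 0 < b \<and>
    (\<forall>L v e1 e2 \<nu> \<sigma>. 0 < \<sigma> \<longrightarrow> \<sigma> < b \<longrightarrow> near_tip L v e1 e2 \<nu> \<kappa> \<rho> \<sigma> \<longrightarrow>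
      (\<exists>G. openin (top_of_set (frontier L)) G \<and> G \<noteq> {} \<and> G \<subseteq> ball (v + (- (2 * \<rho>)) *\<^sub>R \<nu>) (4 * \<rho>) \<and> (\<forall>y\<in>G. P (frontier L) y)))"
  shows "forcible P"
  unfolding forcible_def
proof (intro allI impI)
  fix K x and \<epsilon> :: real assume K: "convex_body K" and x: "x \<in> frontier K" and \<epsilon>: "0 < \<epsilon>"
  interpret K: convex_body K by (rule K)
  \<comment> \<open>4 \<open>\<rho>\<close> bounds both the change of the body and the radius of the
    ball around \<open>x\<close> that contains the good piece; it has to be below
    \<open>\<epsilon>\<close>.\<close>
  define \<rho> where "\<rho> = \<epsilon> / 8"
  have \<rho>: "0 < \<rho>" "4 * \<rho> < \<epsilon>" using \<epsilon> by (simp_all add: \<rho>_def)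
  obtain \<nu> where \<nu>: "norm \<nu> = 1" "\<And>y. y \<in> K \<Longrightarrow> \<nu> \<bullet> y \<le> \<nu> \<bullet> x" using K.S_support[OF x] by blast
  define v where "v = x + (2 * \<rho>) *\<^sub>R \<nu>"
  obtain e1 e2 where "frame e1 e2 \<nu>" using frame_exists[OF \<nu>(1)] by blast
  then interpret frame v e1 e2 \<nu> .
  have xv: "v + (- (2 * \<rho>)) *\<^sub>R \<nu> = x" by (simp add: v_def)
  have x_pt: "pt 0 (- (2 * \<rho>)) = x" using xv by (simp add: pt_def)
  obtain R0 where R0: "\<And>y. y \<in> K \<Longrightarrow> dist v y \<le> R0" using compact_imp_bounded[OF K.compact_K] by (auto simp: bounded_any_center[of K v])
  define R where "R = max R0 1"
  have R: "norm (proj y) \<le> R" if "y \<in> K" for y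
  proof -
    have "proj v = 0" by (simp add: proj_def zero_complex.code)
    then have "norm (proj y) \<le> dist v y" using proj_dist_le[of v y] by simp
    then show ?thesis using R0[OF that] by (simp add: R_def)
  qed
  have "0 < R" by (simp add: R_def)
  from P[OF \<rho>(1) this] obtain \<kappa> b where \<kappa>: "0 \<le> \<kappa>" "\<kappa> \<le> 1" "\<kappa> * R \<le> 2 * \<rho>" "0 < b" and
    b: "\<forall>L v e1 e2 \<nu> \<sigma>. 0 < \<sigma> \<longrightarrow> \<sigma> < b \<longrightarrow> near_tip L v e1 e2 \<nu> \<kappa> \<rho> \<sigma> \<longrightarrow>
      (\<exists>G. openin (top_of_set (frontier L)) G \<and> G \<noteq> {} \<and> G \<subseteq> ball (v + (- (2 * \<rho>)) *\<^sub>R \<nu>) (4 * \<rho>) \<and> (\<forall>y\<in>G. P (frontier L) y))"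
    by (elim exE conjE) (rule that; assumption)
  have m1: "pt 0 (- (2 * \<rho>)) \<in> K" unfolding x_pt using x K.S_subset_K by blast
  have m2: "\<forall>y\<in>K. height y \<le> - (2 * \<rho>)"
  proof
    fix y assume y: "y \<in> K"
    have "(y - (x + (2 * \<rho>) *\<^sub>R \<nu>)) \<bullet> \<nu> = \<nu> \<bullet> y - \<nu> \<bullet> x - 2 * \<rho>"
      unfolding inner_diff_left inner_add_left inner_scaleR_left unit(3) by (simp add: inner_commute)
    then have "height y = \<nu> \<bullet> y - \<nu> \<bullet> x - 2 * \<rho>" unfolding height_def unfolding v_def .
    then show "height y \<le> - (2 * \<rho>)" using \<nu>(2)[OF y] by simp
  qed
  have m3: "\<forall>y\<in>K. \<kappa> * norm (proj y) \<le> 2 * \<rho>"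
  proof
    fix y assume "y \<in> K"
    then show "\<kappa> * norm (proj y) \<le> 2 * \<rho>" using mult_left_mono[OF R[of y] \<kappa>(1)] \<kappa>(3) by linarith
  qed
  from modification[OF K m1 \<rho>(1) \<kappa>(1,2) m2 m3]
  obtain K' where K': "convex_body K'" "hausdist (frontier K) (frontier K') \<le> 4 * \<rho>"
    "\<forall>\<eta> L. 0 < \<eta> \<longrightarrow> \<eta> \<le> \<rho> / 2 \<longrightarrow> convex_body L \<longrightarrow> hausdist (frontier K') (frontier L) < \<eta> \<longrightarrow>
      near_tip L v e1 e2 \<nu> \<kappa> \<rho> (2 * \<eta>)"
    by (elim exE conjE) (rule that)
  define \<eta> where "\<eta> = min (\<rho> / 2) (b / 4)"
  have \<eta>: "0 < \<eta>" "\<eta> \<le> \<rho> / 2" "0 < 2 * \<eta>" "2 * \<eta> < b" using \<rho>(1) \<kappa>(4) by (auto simp: \<eta>_def)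
  have "\<exists>G. openin (top_of_set (frontier L)) G \<and> G \<noteq> {} \<and> G \<subseteq> ball x \<epsilon> \<and> (\<forall>y\<in>G. P (frontier L) y)"
    if L: "convex_body L" "hausdist (frontier K') (frontier L) < \<eta>" for L
  proof -
    have "near_tip L v e1 e2 \<nu> \<kappa> \<rho> (2 * \<eta>)" using K'(3) \<eta>(1,2) L by simp
    from b[rule_format, OF \<eta>(3,4) this, unfolded xv]
    obtain G where G: "openin (top_of_set (frontier L)) G" "G \<noteq> {}" "G \<subseteq> ball x (4 * \<rho>)" "\<forall>y\<in>G. P (frontier L) y"
      by blast
    moreover have "ball x (4 * \<rho>) \<subseteq> ball x \<epsilon>" using \<rho>(2) by (intro subset_ball) simp
    ultimately show ?thesis by (intro exI[of _ G]) auto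
  qed
  moreover have "hausdist (frontier K) (frontier K') < \<epsilon>" using K'(2) \<rho>(2) by linarith
  ultimately show "\<exists>K'. convex_body K' \<and> hausdist (frontier K) (frontier K') < \<epsilon> \<and>
      (\<exists>\<eta>>0. \<forall>K''. convex_body K'' \<longrightarrow> hausdist (frontier K') (frontier K'') < \<eta> \<longrightarrow>
        (\<exists>G. openin (top_of_set (frontier K'')) G \<and> G \<noteq> {} \<and> G \<subseteq> ball x \<epsilon> \<and> (\<forall>y\<in>G. P (frontier K'') y)))"
    using K'(1) \<eta>(1) by (intro exI[of _ K'] conjI exI[of _ \<eta>]) auto
qed

lemma arccos_half: "arccos (1 / 2 :: real) = pi / 3"
  using arccos_cos[of "pi / 3"] pi_gt_zero by (simp add: cos_60)

lemma eventually_scale: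
  assumes "0 < s"
  shows "eventually (\<lambda>\<sigma>. 100 * (sqrt (6 * s * \<sigma>) + 9 * \<sigma>) \<le> s) (at_right 0)"
proof -
  have "((\<lambda>\<sigma>. 100 * (sqrt (6 * s * \<sigma>) + 9 * \<sigma>)) \<longlongrightarrow> 100 * (sqrt (6 * s * 0) + 9 * 0)) (at_right 0)"
    by (intro tendsto_intros)
  then have "eventually (\<lambda>\<sigma>. 100 * (sqrt (6 * s * \<sigma>) + 9 * \<sigma>) < s) (at_right 0)"
    using assms by (intro order_tendstoD(2)) auto
  then show ?thesis by eventually_elim simp
qed

lemma eventually_size:
  assumes "0 < c" "0 < (w :: real)" "0 < \<rho>"
  shows "\<exists>s. 0 < s \<and> 40 * s \<le> \<rho> \<and> 68 * s < c \<and> M * s\<^sup>2 < w"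
proof -
  have "((\<lambda>s. 40 * s) \<longlongrightarrow> 40 * 0) (at_right (0 :: real))" "((\<lambda>s. 68 * s) \<longlongrightarrow> 68 * 0) (at_right (0 :: real))"
    "((\<lambda>s. M * s\<^sup>2) \<longlongrightarrow> M * 0\<^sup>2) (at_right (0 :: real))" by (intro tendsto_intros)+
  then have "eventually (\<lambda>s. 40 * s < \<rho>) (at_right 0)" "eventually (\<lambda>s. 68 * s < c) (at_right 0)"
    "eventually (\<lambda>s. M * s\<^sup>2 < w) (at_right 0)" using assms by (auto dest: order_tendstoD(2))
  moreover have "eventually (\<lambda>s. 0 < s) (at_right (0 :: real))" by (rule eventually_at_right_less)
  ultimately have "eventually (\<lambda>s. 0 < s \<and> 40 * s \<le> \<rho> \<and> 68 * s < c \<and> M * s\<^sup>2 < w) (at_right 0)"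
    by eventually_elim simp
  from eventually_happens[OF this] show ?thesis using trivial_limit_at_right_real[of "0 :: real"] by blast
qed

text \<open>With \<open>\<kappa> = 0\<close> and \<open>s\<close> fixed, the upper bound for each
  angle tends to pi / 3 as \<open>\<sigma>\<close> tends to 0, so the excess falls below any
  prescribed multiple of s^2.\<close>

lemma flat_forcible: "forcible (flat_at n)"
proof (rule forcible_from_regions)
  fix \<rho> R :: real assume \<rho>: "0 < \<rho>" and "0 < R"
  obtain s where s: "0 < s" "40 * s \<le> \<rho>" "68 * s < 1 / real (Suc n)"
    using eventually_size[of "1 / real (Suc n)" 1 \<rho> 0] \<rho> by auto
  have "((\<lambda>\<sigma>. 1 / 2 - 36 * (\<sigma> / s)) \<longlongrightarrow> 1 / 2 - 36 * (0 / s)) (at_right 0)"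
    using s(1) by (intro tendsto_intros) auto
  then have "((\<lambda>\<sigma>. 1 / 2 - 36 * (\<sigma> / s)) \<longlongrightarrow> 1 / 2) (at_right 0)" by simp
  from isCont_tendsto_compose[OF isCont_arccos this]
  have "((\<lambda>\<sigma>. arccos (1 / 2 - 36 * (\<sigma> / s))) \<longlongrightarrow> pi / 3) (at_right 0)" by (simp add: arccos_half)
  then have "((\<lambda>\<sigma>. 256 * (3 * arccos (1 / 2 - 36 * (\<sigma> / s)) - pi)) \<longlongrightarrow> 256 * (3 * (pi / 3) - pi)) (at_right 0)"
    by (intro tendsto_intros)
  then have "eventually (\<lambda>\<sigma>. 256 * (3 * arccos (1 / 2 - 36 * (\<sigma> / s)) - pi) < 1 / real (Suc n) * s\<^sup>2) (at_right 0)"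
    using s(1) by (intro order_tendstoD(2)) auto
  then have "eventually (\<lambda>\<sigma>. 256 * (3 * arccos (1 / 2 - 36 * (\<sigma> / s)) - pi) < 1 / real (Suc n) * s\<^sup>2
      \<and> 100 * (sqrt (6 * s * \<sigma>) + 9 * \<sigma>) \<le> s) (at_right 0)"
    using eventually_scale[OF s(1)] by (rule eventually_conj)
  then obtain b where b: "0 < b" "\<forall>\<sigma>>0. \<sigma> < b \<longrightarrow> 256 * (3 * arccos (1 / 2 - 36 * (\<sigma> / s)) - pi) < 1 / real (Suc n) * s\<^sup>2
      \<and> 100 * (sqrt (6 * s * \<sigma>) + 9 * \<sigma>) \<le> s"
    unfolding eventually_at_right_field by blast
  show "\<exists>\<kappa> b. 0 \<le> \<kappa> \<and> \<kappa> \<le> 1 \<and> \<kappa> * R \<le> 2 * \<rho> \<and> 0 < b \<and>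
    (\<forall>L v e1 e2 \<nu> \<sigma>. 0 < \<sigma> \<longrightarrow> \<sigma> < b \<longrightarrow> near_tip L v e1 e2 \<nu> \<kappa> \<rho> \<sigma> \<longrightarrow>
      (\<exists>G. openin (top_of_set (frontier L)) G \<and> G \<noteq> {} \<and> G \<subseteq> ball (v + (- (2 * \<rho>)) *\<^sub>R \<nu>) (4 * \<rho>)
        \<and> (\<forall>y\<in>G. flat_at n (frontier L) y)))"
  proof (rule exI[of _ "0 :: real"], rule exI[of _ b], intro conjI allI impI)
    fix L v e1 e2 \<nu> \<sigma> assume small: "0 < \<sigma>" "\<sigma> < b" and "near_tip L v e1 e2 \<nu> 0 \<rho> \<sigma>"
    then interpret near_tip L v e1 e2 \<nu> 0 \<rho> \<sigma> by simp
    note s3 = s(3)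
    have b': "256 * (3 * arccos (1 / 2 - 36 * (\<sigma> / s)) - pi) < 1 / real (Suc n) * s\<^sup>2 \<and> 100 * (sqrt (6 * s * \<sigma>) + 9 * \<sigma>) \<le> s"
      using b(2) small by blast
    interpret near_tri L v e1 e2 \<nu> 0 \<rho> \<sigma> s "sqrt (6 * s * \<sigma>) + 9 * \<sigma>"
      using s conjunct2[OF b'] by unfold_locales auto
    show "\<exists>G. openin (top_of_set (frontier L)) G \<and> G \<noteq> {} \<and> G \<subseteq> ball (v + (- (2 * \<rho>)) *\<^sub>R \<nu>) (4 * \<rho>)
        \<and> (\<forall>y\<in>G. flat_at n (frontier L) y)"
      by (rule flat_region[OF refl conjunct1[OF b'] s3])
  qed (use \<rho> b(1) in auto)
qed

text \<open>However small the slope forced by the width \<open>R\<close>, it is positive, so q^2 >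
  1/4 and the limiting excess \<open>w\<close> is positive and free of \<open>s\<close>. Therefore
  \<open>s\<close> can be taken so small that w / s^2 exceeds any bound, and \<open>\<sigma>\<close>
  is adapted to \<open>s\<close> afterwards.\<close>

lemma sharp_forcible: "forcible (sharp_at n)"
proof (rule forcible_from_regions)
  fix \<rho> R :: real assume \<rho>: "0 < \<rho>" and R: "0 < R"
  define \<kappa> where "\<kappa> = min 1 (2 * \<rho> / R)"
  have "\<kappa> \<le> 2 * \<rho> / R" by (simp add: \<kappa>_def)
  then have "\<kappa> * R \<le> 2 * \<rho>" using R by (simp add: pos_le_divide_eq)
  moreover have "0 < \<kappa>" "\<kappa> \<le> 1" using \<rho> R by (simp_all add: \<kappa>_def)
  ultimately have \<kappa>: "0 < \<kappa>" "\<kappa> \<le> 1" "\<kappa> * R \<le> 2 * \<rho>" by simp_all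
  define q where "q = sqrt ((1 + \<kappa>\<^sup>2) / (4 + \<kappa>\<^sup>2))"
  have k2: "0 < \<kappa>\<^sup>2" using \<kappa>(1) by simp
  have q2: "q\<^sup>2 = (1 + \<kappa>\<^sup>2) / (4 + \<kappa>\<^sup>2)" using k2 by (simp add: q_def)
  have "0 < 4 + \<kappa>\<^sup>2" using k2 by linarith
  note d = this
  have "1 / 4 * (4 + \<kappa>\<^sup>2) < 1 + \<kappa>\<^sup>2" unfolding distrib_left using k2 by linarith
  then have q: "1 / 4 < q\<^sup>2" "q\<^sup>2 < 1" unfolding q2 by (simp_all only: pos_less_divide_eq[OF d] pos_divide_less_eq[OF d]) simp
  define w where "w = 3 * arccos (1 - 2 * q\<^sup>2) - pi"
  have "arccos (1 / 2) < arccos (1 - 2 * q\<^sup>2)" using q by (intro arccos_less_arccos) auto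
  then have w: "0 < w" by (simp add: w_def arccos_half)
  obtain s where s: "0 < s" "40 * s \<le> \<rho>" "68 * s < 1 / real (Suc n)" "real n * 80000 * s\<^sup>2 < w"
    using eventually_size[of "1 / real (Suc n)" w \<rho> "real n * 80000"] \<rho> w by auto
  have "((\<lambda>\<sigma>. 1 - 2 * (q - 20 * ((sqrt (6 * s * \<sigma>) + 9 * \<sigma>) / s))\<^sup>2) \<longlongrightarrow> 1 - 2 * (q - 20 * ((sqrt (6 * s * 0) + 9 * 0) / s))\<^sup>2) (at_right 0)"
    using s(1) by (intro tendsto_intros) auto
  then have "((\<lambda>\<sigma>. 1 - 2 * (q - 20 * ((sqrt (6 * s * \<sigma>) + 9 * \<sigma>) / s))\<^sup>2) \<longlongrightarrow> 1 - 2 * q\<^sup>2) (at_right 0)" by simp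
  moreover have "isCont arccos (1 - 2 * q\<^sup>2)" using q by (intro isCont_arccos) auto
  ultimately have "((\<lambda>\<sigma>. arccos (1 - 2 * (q - 20 * ((sqrt (6 * s * \<sigma>) + 9 * \<sigma>) / s))\<^sup>2)) \<longlongrightarrow> arccos (1 - 2 * q\<^sup>2)) (at_right 0)"
    by (rule isCont_tendsto_compose[rotated])
  then have "((\<lambda>\<sigma>. 3 * arccos (1 - 2 * (q - 20 * ((sqrt (6 * s * \<sigma>) + 9 * \<sigma>) / s))\<^sup>2) - pi) \<longlongrightarrow> w) (at_right 0)"
    unfolding w_def by (intro tendsto_intros)
  from order_tendstoD(1)[OF this s(4)]
  have "eventually (\<lambda>\<sigma>. real n * 80000 * s\<^sup>2 < 3 * arccos (1 - 2 * (q - 20 * ((sqrt (6 * s * \<sigma>) + 9 * \<sigma>) / s))\<^sup>2) - pi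
      \<and> 100 * (sqrt (6 * s * \<sigma>) + 9 * \<sigma>) \<le> s) (at_right 0)"
    using eventually_scale[OF s(1)] by (rule eventually_conj)
  then obtain b where b: "0 < b" "\<forall>\<sigma>>0. \<sigma> < b \<longrightarrow>
      real n * 80000 * s\<^sup>2 < 3 * arccos (1 - 2 * (q - 20 * ((sqrt (6 * s * \<sigma>) + 9 * \<sigma>) / s))\<^sup>2) - pi
      \<and> 100 * (sqrt (6 * s * \<sigma>) + 9 * \<sigma>) \<le> s"
    unfolding eventually_at_right_field by blast
  show "\<exists>\<kappa> b. 0 \<le> \<kappa> \<and> \<kappa> \<le> 1 \<and> \<kappa> * R \<le> 2 * \<rho> \<and> 0 < b \<and>
    (\<forall>L v e1 e2 \<nu> \<sigma>. 0 < \<sigma> \<longrightarrow> \<sigma> < b \<longrightarrow> near_tip L v e1 e2 \<nu> \<kappa> \<rho> \<sigma> \<longrightarrow>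
      (\<exists>G. openin (top_of_set (frontier L)) G \<and> G \<noteq> {} \<and> G \<subseteq> ball (v + (- (2 * \<rho>)) *\<^sub>R \<nu>) (4 * \<rho>)
        \<and> (\<forall>y\<in>G. sharp_at n (frontier L) y)))"
  proof (rule exI[of _ \<kappa>], rule exI[of _ b], intro conjI allI impI)
    fix L v e1 e2 \<nu> \<sigma> assume small: "0 < \<sigma>" "\<sigma> < b" and "near_tip L v e1 e2 \<nu> \<kappa> \<rho> \<sigma>"
    then interpret near_tip L v e1 e2 \<nu> \<kappa> \<rho> \<sigma> by simp
    note s3 = s(3)
    have b': "real n * 80000 * s\<^sup>2 < 3 * arccos (1 - 2 * (q - 20 * ((sqrt (6 * s * \<sigma>) + 9 * \<sigma>) / s))\<^sup>2) - pi \<and> 100 * (sqrt (6 * s * \<sigma>) + 9 * \<sigma>) \<le> s"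
      using b(2) small by blast
    interpret near_tri L v e1 e2 \<nu> \<kappa> \<rho> \<sigma> s "sqrt (6 * s * \<sigma>) + 9 * \<sigma>"
      using s conjunct2[OF b'] by unfold_locales auto
    have "real n * (80000 * s\<^sup>2) < 3 * arccos (1 - 2 * (q - 20 * ((sqrt (6 * s * \<sigma>) + 9 * \<sigma>) / s))\<^sup>2) - pi"
      using conjunct1[OF b'] by (simp only: mult.assoc)
    from sharp_region[OF this[unfolded q_def] s3]
    show "\<exists>G. openin (top_of_set (frontier L)) G \<and> G \<noteq> {} \<and> G \<subseteq> ball (v + (- (2 * \<rho>)) *\<^sub>R \<nu>) (4 * \<rho>)
        \<and> (\<forall>y\<in>G. sharp_at n (frontier L) y)" .
  qed (use \<kappa> b(1) in auto)
qed

theorem theorem11: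
  shows "first_category surface_space
    {S \<in> convex_surfaces. \<not> first_category (top_of_set S)
        {x \<in> S. \<not> (K_low S x = 0 \<and> G_low S x = 0 \<and> K_up S x = \<infinity> \<and> G_up S x = \<infinity>)}}"
  by (rule theorem_from_forcible[OF flat_forcible sharp_forcible])

end
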